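(* Fix $l\in\mathbb{N}$, $l\ge1$. Sending a Hecke character $\psi$ of an imaginary quadratic field $K$ to the field $K$ induces a well-defined bijection from the set of Hecke characters (of imaginary quadratic fields) with $\infty$-type $l$ and rational coefficients, considered up to twisting, onto the set of imaginary quadratic fields $K$ whose exponent $e_K$ divides $l$.
   Context: Let $K\subset\mathbb{C}$ be an imaginary quadratic field with ring of integers $\mathcal O_K$ and norm $\mathcal N$ of $K/\mathbb{Q}$. A Hecke character of $K$ modulo an ideal $\mathfrak m$ with $\infty$-type $l$ is a homomorphism $\psi$ from the group of fractional ideals of $K$ prime to $\mathfrak m$ to $\mathbb{C}^*$ with $\psi(\alpha\mathcal O_K)=\alpha^l$ for all $\alpha\in K^*$ with $\alpha\equiv1\bmod\mathfrak m$ (multiplicative congruence); it is extended by $0$ to the other fractional ideals. Its conductor is the minimal $\mathfrak m$ modulo which it is defined, and Hecke characters are identified with the corresponding character modulo its conductor. $\psi$ has rational coefficients if $f_\psi=\sum_{\mathfrak a\subset\mathcal O_K}\psi(\mathfrak a)q^{\mathcal N(\mathfrak a)}=\sum_n a_nq^n$ has all $a_n\in\mathbb{Q}$. Twisting: $\psi$ is replaced by $\psi\otimes\Xi$ with $(\psi\otimes\Xi)(\mathfrak a)=\psi(\mathfrak a)\Xi(\mathfrak a)$ (extended to the group of ideals prime to its conductor), where $\Xi=\phi\circ\mathcal N$ for a quadratic Dirichlet character $\phi$; if $K=\mathbb{Q}(\sqrt{-1})$ (resp. $K=\mathbb{Q}(\sqrt{-3})$), $\Xi$ may also be any finite-order Hecke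 character of $K$ of order dividing $4$ (resp. $6$). Two Hecke characters of the same field are equivalent if one is a twist of the other. The exponent $e_K$ is the exponent of the class group $Cl(\mathcal O_K)$. *)

theory Defs
  imports
    "HOL-Computational_Algebra.Computational_Algebra"
    "HOL-Algebra.Algebra"
    "HOL-Algebra.Algebraic_Closure_Type"
begin

abbreviation complex_ring :: "complex ring"
  where "complex_ring \<equiv> ring_of_type_algebra"

definition imag_quad_field :: "complex set \<Rightarrow> bool"
  where "imag_quad_field K \<longleftrightarrow>
    subfield K complex_ring \<and> ring.dimension complex_ring 2 \<rat> K \<and> \<not> K \<subseteq> \<real>"

definition int_ring :: "complex set \<Rightarrow> complex ring"
  where "int_ring K = complex_ring\<lparr>carrier := {x \<in> K. algebraic_int x}\<rparr>"

abbreviation ints_of :: "complex set \<Rightarrow> complex set"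
  where "ints_of K \<equiv> carrier (int_ring K)"

definition integral_ideal :: "complex set \<Rightarrow> complex set \<Rightarrow> bool"
  where "integral_ideal K I \<longleftrightarrow> ideal I (int_ring K) \<and> I \<noteq> {0}"

definition ideal_norm :: "complex set \<Rightarrow> complex set \<Rightarrow> nat"
  where "ideal_norm K I = card (carrier (int_ring K Quot I))"

definition fractional_ideal :: "complex set \<Rightarrow> complex set \<Rightarrow> bool"
  where "fractional_ideal K I \<longleftrightarrow>
    (\<exists>A c. integral_ideal K A \<and> c \<in> ints_of K \<and> c \<noteq> 0 \<and> I = (\<lambda>x. x / c) ` A)"

definition principal_ideal :: "complex set \<Rightarrow> complex \<Rightarrow> complex set"
  where "principal_ideal K \<alpha> = (\<lambda>x. \<alpha> * x) ` ints_of K"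

definition frac_ideal_group :: "complex set \<Rightarrow> complex set monoid"
  where "frac_ideal_group K =
    \<lparr>carrier = {I. fractional_ideal K I}, monoid.mult = ideal_prod complex_ring, one = ints_of K\<rparr>"

definition class_group :: "complex set \<Rightarrow> complex set set monoid"
  where "class_group K = frac_ideal_group K Mod (principal_ideal K ` (K - {0}))"

text \<open>The exponent of a group is the least common multiple of the orders of its elements.
  Both \<^const>\<open>group.ord\<close> and \<^const>\<open>Lcm\<close> use 0 for ``infinite''.\<close>

definition group_exponent :: "('a, 'b) monoid_scheme \<Rightarrow> nat"
  where "group_exponent G = Lcm (group.ord G ` carrier G)"


definition coprime_ideals :: "complex set \<Rightarrow> complex set \<Rightarrow> complex set \<Rightarrow> bool"
  where "coprime_ideals K A B \<longleftrightarrow> A <+>\<^bsub>int_ring K\<^esub> B = ints_of K"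

text \<open>A fractional ideal is prime to \<open>\<mm>\<close> if it is a quotient of two integral ideals
  coprime to \<open>\<mm>\<close>.\<close>

definition ideals_prime_to :: "complex set \<Rightarrow> complex set \<Rightarrow> complex set monoid"
  where "ideals_prime_to K \<mm> = (frac_ideal_group K)\<lparr>carrier :=
    {I. fractional_ideal K I \<and>
        (\<exists>A B. integral_ideal K A \<and> integral_ideal K B \<and>
               coprime_ideals K A \<mm> \<and> coprime_ideals K B \<mm> \<and>
               I \<otimes>\<^bsub>frac_ideal_group K\<^esub> B = A)}\<rparr>"

text \<open>The multiplicative congruence \<open>\<alpha> \<equiv> 1\<close> modulo \<open>\<mm>\<close>: \<open>\<alpha>\<close> is a
  quotient of two integers of \<open>K\<close> that are prime to \<open>\<mm>\<close> and congruent modulo \<open>\<mm>\<close>.\<close>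

definition cong_one :: "complex set \<Rightarrow> complex set \<Rightarrow> complex \<Rightarrow> bool"
  where "cong_one K \<mm> \<alpha> \<longleftrightarrow>
    (\<exists>a b. a \<in> ints_of K \<and> b \<in> ints_of K \<and> b \<noteq> 0 \<and>
           coprime_ideals K (principal_ideal K a) \<mm> \<and>
           coprime_ideals K (principal_ideal K b) \<mm> \<and>
           a - b \<in> \<mm> \<and> \<alpha> = a / b)"

text \<open>Characters are functions on all sets of complex numbers, so the extension by zero is
  imposed everywhere outside the ideals prime to the modulus; thus equal characters are
  equal functions.\<close>

definition hecke_character ::
    "complex set \<Rightarrow> nat \<Rightarrow> complex set \<Rightarrow> (complex set \<Rightarrow> complex) \<Rightarrow> bool"
  where "hecke_character K l \<mm> \<psi> \<longleftrightarrow>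
    integral_ideal K \<mm> \<and>
    \<psi> \<in> hom (ideals_prime_to K \<mm>) (units_of complex_ring) \<and>
    (\<forall>\<alpha>\<in>K - {0}. cong_one K \<mm> \<alpha> \<longrightarrow> \<psi> (principal_ideal K \<alpha>) = \<alpha> ^ l) \<and>
    (\<forall>I. I \<notin> carrier (ideals_prime_to K \<mm>) \<longrightarrow> \<psi> I = 0)"

text \<open>\<open>\<psi>'\<close> restricts to \<open>\<psi>\<close> on the group on which \<open>\<psi>\<close> is nonzero, i.e. on the
  ideals prime to the modulus of \<open>\<psi>\<close>.\<close>

definition extends_character ::
    "(complex set \<Rightarrow> complex) \<Rightarrow> (complex set \<Rightarrow> complex) \<Rightarrow> bool"
  where "extends_character \<psi>' \<psi> \<longleftrightarrow> (\<forall>I. \<psi> I \<noteq> 0 \<longrightarrow> \<psi>' I = \<psi> I)"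

text \<open>Moduli are ordered by divisibility, that is, by reverse inclusion: the modulus \<open>\<mm>\<close> is the
  conductor if \<open>\<psi>\<close> does not extend to a Hecke character modulo a proper divisor of \<open>\<mm>\<close>.\<close>

definition is_conductor ::
    "complex set \<Rightarrow> nat \<Rightarrow> complex set \<Rightarrow> (complex set \<Rightarrow> complex) \<Rightarrow> bool"
  where "is_conductor K l \<mm> \<psi> \<longleftrightarrow>
    hecke_character K l \<mm> \<psi> \<and>
    \<not> (\<exists>\<nn> \<psi>'. \<mm> \<subset> \<nn> \<and> hecke_character K l \<nn> \<psi>' \<and> extends_character \<psi>' \<psi>)"

text \<open>Each Hecke character is represented by the one modulo its conductor.\<close>

definition primitive_hecke_character ::
    "complex set \<Rightarrow> nat \<Rightarrow> (complex set \<Rightarrow> complex) \<Rightarrow> bool"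
  where "primitive_hecke_character K l \<psi> \<longleftrightarrow> (\<exists>\<mm>. is_conductor K l \<mm> \<psi>)"

definition hecke_series :: "complex set \<Rightarrow> (complex set \<Rightarrow> complex) \<Rightarrow> complex fps"
  where "hecke_series K \<psi> =
    Abs_fps (\<lambda>n. \<Sum>\<aa> | integral_ideal K \<aa> \<and> ideal_norm K \<aa> = n. \<psi> \<aa>)"

definition rational_coeffs :: "complex set \<Rightarrow> (complex set \<Rightarrow> complex) \<Rightarrow> bool"
  where "rational_coeffs K \<psi> \<longleftrightarrow> (\<forall>n. fps_nth (hecke_series K \<psi>) n \<in> \<rat>)"


definition dirichlet_character :: "nat \<Rightarrow> (nat \<Rightarrow> complex) \<Rightarrow> bool"
  where "dirichlet_character N \<phi> \<longleftrightarrow>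
    N > 0 \<and> \<phi> 1 = 1 \<and> (\<forall>a b. \<phi> (a * b) = \<phi> a * \<phi> b) \<and>
    (\<forall>a. \<phi> (a + N) = \<phi> a) \<and> (\<forall>a. \<phi> a = 0 \<longleftrightarrow> \<not> coprime a N)"

text \<open>The principal character is counted as quadratic; it gives the trivial twist.\<close>

definition quadratic_dirichlet_character :: "nat \<Rightarrow> (nat \<Rightarrow> complex) \<Rightarrow> bool"
  where "quadratic_dirichlet_character N \<phi> \<longleftrightarrow>
    dirichlet_character N \<phi> \<and> (\<forall>a. coprime a N \<longrightarrow> \<phi> a ^ 2 = 1)"

definition order_divides :: "(complex set \<Rightarrow> complex) \<Rightarrow> nat \<Rightarrow> bool"
  where "order_divides \<Xi> n \<longleftrightarrow> (\<forall>I. \<Xi> I \<noteq> 0 \<longrightarrow> \<Xi> I ^ n = 1)"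

text \<open>A homomorphism on the ideals prime to a modulus is determined by its values on the integral
  ones, so \<open>\<Xi> = \<phi> \<circ> \<N>\<close> is stated for integral ideals only, where \<open>\<N>\<close> is a natural number.
  The infinity type \<open>k\<close> of a character of finite order is necessarily 0.\<close>

definition twisting_character :: "complex set \<Rightarrow> (complex set \<Rightarrow> complex) \<Rightarrow> bool"
  where "twisting_character K \<Xi> \<longleftrightarrow>
    (\<exists>k \<mm>. hecke_character K k \<mm> \<Xi>) \<and>
    ((\<exists>N \<phi>. quadratic_dirichlet_character N \<phi> \<and>
            (\<forall>I. integral_ideal K I \<longrightarrow> \<Xi> I = \<phi> (ideal_norm K I))) \<or>
     K = generate_field complex_ring {csqrt (-1)} \<and> order_divides \<Xi> 4 \<or>
     K = generate_field complex_ring {csqrt (-3)} \<and> order_divides \<Xi> 6)"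

text \<open>To be applied to a primitive character \<open>\<psi>'\<close>.\<close>

definition is_twist ::
    "complex set \<Rightarrow> (complex set \<Rightarrow> complex) \<Rightarrow> (complex set \<Rightarrow> complex) \<Rightarrow> bool"
  where "is_twist K \<psi> \<psi>' \<longleftrightarrow>
    (\<exists>\<Xi>. twisting_character K \<Xi> \<and> extends_character \<psi>' (\<lambda>I. \<psi> I * \<Xi> I))"

definition rational_hecke_characters ::
    "nat \<Rightarrow> (complex set \<times> (complex set \<Rightarrow> complex)) set"
  where "rational_hecke_characters l =
    {(K, \<psi>). imag_quad_field K \<and> primitive_hecke_character K l \<psi> \<and> rational_coeffs K \<psi>}"

definition twist_equivalence ::
    "nat \<Rightarrow> ((complex set \<times> (complex set \<Rightarrow> complex)) \<times>
             (complex set \<times> (complex set \<Rightarrow> complex))) set"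
  where "twist_equivalence l =
    {((K, \<psi>), (K', \<psi>')). (K, \<psi>) \<in> rational_hecke_characters l \<and>
       (K', \<psi>') \<in> rational_hecke_characters l \<and> K = K' \<and> is_twist K \<psi> \<psi>'}"

end

theory Submission
  imports Defs "HOL-Analysis.Elementary_Normed_Spaces" "HOL-Analysis.Infinite_Sum" "HOL-Number_Theory.Cong" "HOL-Number_Theory.Quadratic_Reciprocity"
begin

text \<open>
  Let \<open>K = \<rat>(\<surd>-D)\<close>. If \<open>\<psi>\<close> has rational coefficients, then on ideals \<open>A\<close> prime to a
  suitable modulus \<open>\<psi>(A)\<close> is an integer of \<open>K\<close> that generates \<open>A\<^sup>l\<close>, and \<open>\<psi>\<close> commutes with conjugation; hence \<open>e\<^sub>K\<close> divides \<open>l\<close>.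
  Conversely, a multiplicative choice of generators of the ideals \<open>A\<^sup>l\<close> that is stable under
  conjugation is a rational character. Such choices, with their conductors, are written
  down explicitly: for even \<open>l\<close>, for odd \<open>l\<close> with a prime \<open>p \<equiv> 3\<close> modulo 4 dividing \<open>D\<close>, for
  \<open>\<rat>(\<surd>-2)\<close>, and for the two fields with extra units. For the remaining fields and odd \<open>l\<close> the
  ideal above 2 would be principal of norm 2, so \<open>x\<^sup>2 + D y\<^sup>2 = 2\<close> would have a solution.

  The quotient \<open>\<Xi>\<close> of two rational characters of the same field has values in the units, which
  settles \<open>\<rat>(\<surd>-1)\<close> and \<open>\<rat>(\<surd>-3)\<close>. Otherwise \<open>\<Xi>\<close> is quadratic and invariant under conjugation. On
  rational integers \<open>\<Xi>\<close> is an even Dirichlet character that is 1 at all split primes, so it is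
  trivial: otherwise its convolution with its twist by the Kronecker symbol of \<open>-D\<close> would
  be nonnegative, and the Lambert series of this convolution would diverge near 1, although
  both factors have mean value zero. Hence \<open>\<Xi>(A)\<close> depends only on the norm of \<open>A\<close>, and
  Legendre's equation \<open>x\<^sup>2 + D y\<^sup>2 = n z\<^sup>2\<close> shows that it is 1 if the norm is a square modulo \<open>M\<^sup>4\<close>.
  Therefore \<open>\<Xi>\<close> is the composition of a quadratic Dirichlet character with the norm.
\<close>

section \<open>Integers of imaginary quadratic fields\<close>

text \<open>Ideal arithmetic is elementary: an ideal times its conjugate is the principal ideal of
  its norm, as a lattice basis shows. This yields multiplicative norms, cancellation, division from
  containment and unique roots of ideals, which take the place of prime factorisation. Rationality
  controls \<psi> only through sums over ideals of equal norm. For a split prime P the coefficients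
  at p and p^2 make the sum and the product of \<psi>(P) and \<psi>(cnj P) rational. Some power of
  \<psi>(P) is a non-real \<alpha>^l, which forces the two values to be conjugate. The fourth power
  in \<open>M ^ 4\<close> pays for denominators: the element built from a solution of Legendre's
  equation is divided by a divisor of M^3, and a factor M must survive to make it congruent to a
  rational integer modulo M. Characters have to be primitive, so existence needs exact conductors:
  the unit ideal for even l, a prime above p, 4 sqrt(-2), and, in the two fields with extra units,
  an ideal that depends on l.\<close>

lemma complex_ring_simps [simp]:
  "carrier complex_ring = UNIV" "monoid.mult complex_ring x y = x * y" "one complex_ring = 1"
  "ring.zero complex_ring = 0" "add complex_ring x y = x + y"
  by (simp_all add: ring_of_type_algebra_def)

interpretation CR: cring complex_ring
  by (rule cring_from_type_algebra)

lemma complex_ring_a_inv [simp]: "\<ominus>\<^bsub>complex_ring\<^esub> x = - x"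
  by (rule CR.minus_equality) simp_all

lemma complex_ring_m_inv: "x \<noteq> 0 \<Longrightarrow> inv\<^bsub>complex_ring\<^esub> x = inverse x"
  by (rule CR.comm_inv_char) simp_all

lemma Rats_imp_Reals: "x \<in> \<rat> \<Longrightarrow> x \<in> (\<real> :: complex set)"
  by (erule Rats_cases') (simp add: Reals_divide)

lemma poly_of_int_add:
  "poly (map_poly of_int (p + q)) (x :: complex) = poly (map_poly of_int p) x + poly (map_poly of_int q) x"
  by (induct p q rule: poly_induct2) (simp_all add: map_poly_pCons algebra_simps)

lemma poly_of_int_smult:
  "poly (map_poly of_int (smult k p)) (x :: complex) = of_int k * poly (map_poly of_int p) x"
  by (induct p) (simp_all add: map_poly_pCons algebra_simps)

lemma poly_of_int_mult:
  "poly (map_poly of_int (p * q)) (x :: complex) = poly (map_poly of_int p) x * poly (map_poly of_int q) x"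
  by (induct p) (simp_all add: map_poly_pCons poly_of_int_add poly_of_int_smult algebra_simps)

section \<open>The square root that generates an imaginary quadratic field\<close>

lemma dimension_2_rats:
  assumes "ring.dimension complex_ring 2 \<rat> K"
  obtains v w where "K = {p * v + q * w | p q. p \<in> \<rat> \<and> q \<in> \<rat>}"
proof -
  have "CR.dimension (Suc (Suc 0)) \<rat> K" using assms by (simp add: numeral_2_eq_2)
  then obtain v E where E: "K = CR.line_extension \<rat> v E" "CR.dimension (Suc 0) \<rat> E"
    by (cases rule: CR.dimension.cases) auto
  from E(2) obtain w F where F: "E = CR.line_extension \<rat> w F" "CR.dimension 0 \<rat> F"
    by (cases rule: CR.dimension.cases) auto
  from F(2) have "F = {0}" by (cases rule: CR.dimension.cases) auto
  have "x \<in> K \<longleftrightarrow> (\<exists>p q. x = p * v + q * w \<and> p \<in> \<rat> \<and> q \<in> \<rat>)" for x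
    unfolding E(1) F(1) \<open>F = {0}\<close> CR.line_extension_mem_iff Bex_def by simp blast
  then have "K = {p * v + q * w | p q. p \<in> \<rat> \<and> q \<in> \<rat>}" by blast
  then show ?thesis by (rule that)
qed

text \<open>Otherwise z = q / p would be real. Comparisons of coordinates in the field rest on
  this.\<close>

lemma nonreal_rational_independent:
  fixes z p q :: complex
  assumes "z \<notin> \<real>" "p \<in> \<rat>" "q \<in> \<rat>" "p * z = q"
  shows "p = 0" "q = 0"
proof -
  show "p = 0"
  proof (rule ccontr)
    assume "p \<noteq> 0"
    then have "z = q / p" using assms(4) by (simp add: field_simps)
    moreover have "q / p \<in> \<real>" using assms(2,3) by (intro Rats_imp_Reals Rats_divide)
    ultimately show False using assms(1) by simp
  qed
  then show "q = 0" using assms(4) by simp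
qed

text \<open>If y^2 = a / b and - a b = D e^2, then b y / e has square - D. The sign of r is left
  open because the target is the root in the upper half-plane.\<close>

lemma negative_rat_square:
  fixes y :: complex
  assumes "y \<notin> \<real>" "y ^ 2 \<in> \<rat>"
  obtains D :: nat and r :: complex where "D > 0" "squarefree D" "r \<in> \<rat>" "r \<noteq> 0"
    "\<i> * of_real (sqrt (real D)) = r * y"
proof -
  obtain c where c: "y ^ 2 = of_rat c" using assms(2) by (auto elim: Rats_cases)
  have cr: "y ^ 2 = of_real (of_rat c)" using c by (cases c) (simp add: of_rat_rat)
  have "c < 0"
  proof (rule ccontr)
    assume "\<not> c < 0"
    then have "(of_rat c :: real) \<ge> 0" by simp
    then have "y ^ 2 = (of_real (sqrt (of_rat c))) ^ 2"
      unfolding cr by (simp flip: of_real_power)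
    then have "y = of_real (sqrt (of_rat c)) \<or> y = - of_real (sqrt (of_rat c))"
      by (simp add: power2_eq_iff)
    then show False using assms(1) by auto
  qed
  obtain a b where ab: "b > 0" "c = Rat.Fract a b" by (cases c) auto
  have a: "a < 0" using ab \<open>c < 0\<close> by (simp add: Rat.Fract_less_zero_iff)
  define M where "M = nat (- a * b)"
  have M: "M > 0" using ab a by (simp add: M_def mult_neg_pos)
  define D where "D = squarefree_part M"
  define e where "e = square_part M"
  have Me: "M = D * e ^ 2" unfolding D_def e_def by (rule squarefree_decompose)
  have e0: "e > 0" "D > 0" using Me M by auto
  have sqD: "squarefree D" unfolding D_def using M by (simp add: squarefree_squarefree_part)
  have "(of_rat c :: complex) = of_int a / of_int b"
    using ab by (simp add: of_rat_rat)
  also have "\<dots> = - (of_nat M) / of_int b ^ 2"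
    using ab a by (simp add: M_def power2_eq_square mult_neg_pos of_nat_nat less_imp_le)
  finally have y2: "y ^ 2 = - (of_nat M) / of_int b ^ 2" using c by simp
  have "(of_int b / of_nat e * y) ^ 2 = - of_nat D"
    using y2 e0 ab by (simp add: power_mult_distrib power_divide Me)
  also have "\<dots> = (\<i> * of_real (sqrt (real D))) ^ 2"
    by (simp add: power_mult_distrib flip: of_real_power)
  finally have "\<i> * of_real (sqrt (real D)) = of_int b / of_nat e * y \<or>
    \<i> * of_real (sqrt (real D)) = (- of_int b / of_nat e) * y"
    by (auto simp: power2_eq_iff)
  then show ?thesis
    using that[of D "of_int b / of_nat e"] that[of D "- of_int b / of_nat e"] e0 sqD ab by auto
qed

lemma imag_quad_field_cases:
  assumes "imag_quad_field K"
  obtains D :: nat where "D > 0" "squarefree D"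
    "K = {p + q * (\<i> * of_real (sqrt (real D))) | p q. p \<in> \<rat> \<and> q \<in> \<rat>}"
proof -
  have sub: "subfield K complex_ring" and nr: "\<not> K \<subseteq> \<real>"
    using assms by (auto simp: imag_quad_field_def)
  obtain v w where K: "K = {p * v + q * w | p q. p \<in> \<rat> \<and> q \<in> \<rat>}"
    using dimension_2_rats assms by (auto simp: imag_quad_field_def)
  interpret S: subfield K complex_ring by (rule sub)
  have one: "1 \<in> K" using S.one_closed by simp
  have mult: "x * y \<in> K" if "x \<in> K" "y \<in> K" for x y using S.m_closed[OF that] by simp
  have lin: "p * x + q * y \<in> K" if xy: "x \<in> K" "y \<in> K" "p \<in> \<rat>" "q \<in> \<rat>" for x y p q
  proof -
    obtain a b where 1: "x = a * v + b * w" "a \<in> \<rat>" "b \<in> \<rat>" using xy K by auto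
    obtain c d where 2: "y = c * v + d * w" "c \<in> \<rat>" "d \<in> \<rat>" using xy K by auto
    have "p * x + q * y = (p * a + q * c) * v + (p * b + q * d) * w"
      unfolding 1(1) 2(1) by (simp add: algebra_simps)
    then show ?thesis using xy 1 2 by (subst K) (intro CollectI exI conjI, assumption, auto)
  qed
  obtain z where z: "z \<in> K" "z \<notin> \<real>" using nr by auto
  obtain p q where pq: "1 = p * v + q * w" "p \<in> \<rat>" "q \<in> \<rat>" using one K by auto
  obtain r t where rt: "z = r * v + t * w" "r \<in> \<rat>" "t \<in> \<rat>" using z K by auto
  have vw: "t - q * z = (p * t - q * r) * v" "p * z - r = (p * t - q * r) * w"
  proof -
    have "t * 1 - q * z = (p * t - q * r) * v" unfolding pq(1) rt(1) by (simp add: algebra_simps)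
    then show "t - q * z = (p * t - q * r) * v" by simp
    have "p * z - r * 1 = (p * t - q * r) * w" unfolding pq(1) rt(1) by (simp add: algebra_simps)
    then show "p * z - r = (p * t - q * r) * w" by simp
  qed
  \<comment> \<open>The determinant of the passage from v, w to 1, z. If it vanished, p z = r and q
    z = t would force p = q = 0.\<close>
  have det: "p * t - q * r \<noteq> 0"
  proof
    assume 0: "p * t - q * r = 0"
    have "p * z = r" "q * z = t" using vw(1)[unfolded 0] vw(2)[unfolded 0] by simp_all
    then have "p = 0" "q = 0" using nonreal_rational_independent z pq rt by blast+
    then show False using pq by simp
  qed
  have span: "\<exists>a b. a \<in> \<rat> \<and> b \<in> \<rat> \<and> x = a + b * z" if x: "x \<in> K" for x
  proof -
    obtain e f where ef: "x = e * v + f * w" "e \<in> \<rat>" "f \<in> \<rat>" using x by (subst (asm) K) auto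
    define d where "d = p * t - q * r"
    have d0: "d \<noteq> 0" using det by (simp add: d_def)
    have "d * x = e * (d * v) + f * (d * w)" unfolding ef(1) by (simp add: algebra_simps)
    also have "\<dots> = (e * t - f * r) + (f * p - e * q) * z"
      unfolding d_def vw[symmetric] by (simp add: algebra_simps)
    finally have "x = ((e * t - f * r) + (f * p - e * q) * z) / d" using d0 by (simp add: field_simps)
    then have "x = (e * t - f * r) / d + ((f * p - e * q) / d) * z" by (simp add: add_divide_distrib)
    moreover have "d \<in> \<rat>" using pq(2,3) rt(2,3) unfolding d_def by (intro Rats_diff Rats_mult)
    then have "(e * t - f * r) / d \<in> \<rat> \<and> (f * p - e * q) / d \<in> \<rat>"
      using pq(2,3) rt(2,3) ef(2,3) by (intro conjI Rats_divide Rats_diff Rats_mult)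
    ultimately show ?thesis by blast
  qed
  obtain a b where ab: "a \<in> \<rat>" "b \<in> \<rat>" "z * z = a + b * z" using span[OF mult[OF z(1) z(1)]] by blast
  \<comment> \<open>Completing the square removes the linear term of the equation of z.\<close>
  define y where "y = z - b / 2"
  have yy: "y ^ 2 = a + b ^ 2 / 4" using ab(3)
    by (simp add: y_def power2_eq_square algebra_simps)
  have b2: "b / 2 \<in> \<real>" using ab(2) by (intro Rats_imp_Reals Rats_divide) auto
  have y: "y \<notin> \<real>"
  proof
    assume "y \<in> \<real>"
    then have "y + b / 2 \<in> \<real>" using b2 by (rule Reals_add)
    then show False using z by (simp add: y_def)
  qed
  have "y ^ 2 \<in> \<rat>" unfolding yy using ab by auto
  then obtain D r where D: "D > 0" "squarefree D" "r \<in> \<rat>" "r \<noteq> 0"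
    "\<i> * of_real (sqrt (real D)) = r * y"
    using negative_rat_square[OF y] by metis
  let ?s = "\<i> * of_real (sqrt (real D))"
  have sz: "?s = r * z + (- r * b / 2) * 1" unfolding D(5) y_def by (simp add: algebra_simps)
  have sK: "?s \<in> K" unfolding sz by (rule lin) (use D ab z one in auto)
  have "K = {p + q * ?s | p q. p \<in> \<rat> \<and> q \<in> \<rat>}"
  proof (intro equalityI subsetI)
    fix x assume "x \<in> K"
    then obtain e f where ef: "e \<in> \<rat>" "f \<in> \<rat>" "x = e + f * z" using span by blast
    have "z = ?s / r + b / 2" unfolding sz using D(4) by (simp add: field_simps)
    then have x: "x = (e + f * b / 2) + (f / r) * ?s" unfolding ef(3) by (simp add: algebra_simps)
    have "e + f * b / 2 \<in> \<rat> \<and> f / r \<in> \<rat>" using ef(1,2) ab(1,2) D(3) by simp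
    then show "x \<in> {p + q * ?s | p q. p \<in> \<rat> \<and> q \<in> \<rat>}" using x by blast
  next
    fix x assume "x \<in> {p + q * ?s | p q. p \<in> \<rat> \<and> q \<in> \<rat>}"
    then obtain p q where "x = p * 1 + q * ?s" "p \<in> \<rat>" "q \<in> \<rat>" by auto
    then show "x \<in> K" using lin one sK by blast
  qed
  then show ?thesis using D that by blast
qed

section \<open>Gauss's lemma and quadratic integers\<close>

text \<open>Contents are multiplicative and p, being monic, has content 1, so q has content a up to
  sign. After cancelling a, the leading coefficient of g divides that of p.\<close>

lemma monic_dvd_leading_coeff:
  fixes p g q :: "int poly"
  assumes "lead_coeff p = 1" "content g = 1" "a \<noteq> 0" "smult a p = g * q"
  shows "lead_coeff g dvd 1"
proof -
  have "content p dvd 1" using content_dvd_coeff[of p "degree p"] assms(1) by simp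
  then have cp: "content p = 1" by (metis is_unit_normalize normalize_content)
  have "normalize a = content q"
    using arg_cong[OF assms(4), of content] assms(2) cp by (simp add: content_mult)
  then have "smult (normalize a) (g * primitive_part q) = g * q"
    by (simp only: mult_smult_right[symmetric] content_times_primitive_part)
  then have "smult a p = smult (normalize a) (g * primitive_part q)" using assms(4) by simp
  then have "a * lead_coeff p = normalize a * (lead_coeff g * lead_coeff (primitive_part q))"
    by (simp only: lead_coeff_mult lead_coeff_smult flip: lead_coeff_smult[of a])
  then have "a = normalize a * (lead_coeff g * lead_coeff (primitive_part q))" using assms(1) by simp
  then have "normalize a * (lead_coeff g * lead_coeff (primitive_part q)) dvd normalize a * 1"
    by (metis dvd_refl dvd_normalize_iff mult.right_neutral)
  then have "lead_coeff g * lead_coeff (primitive_part q) dvd 1"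
    using assms(3) by (simp only: dvd_mult_cancel_left normalize_eq_0_iff) simp
  then show ?thesis by (rule dvd_mult_left)
qed

text \<open>Let g be the primitive integer quadratic with root x. Pseudo-division of a monic integer
  polynomial of x by g leaves a remainder of degree at most 1 with the non-real root x, hence zero.
  So g divides a multiple of a monic polynomial, and Gauss's lemma makes its leading coefficient a
  unit.\<close>

lemma algebraic_int_quadratic:
  fixes x :: complex
  assumes "algebraic_int x" "x \<notin> \<real>" "x + cnj x \<in> \<rat>" "x * cnj x \<in> \<rat>"
  shows "x + cnj x \<in> \<int> \<and> x * cnj x \<in> \<int>"
proof -
  obtain p :: "int poly" where p: "poly (map_poly of_int p) x = 0" "lead_coeff p = 1"
    using assms(1) by (auto simp: algebraic_int_altdef_ipoly)
  obtain a b where ab: "x + cnj x = of_int a / of_int b" "b > 0" using assms(3) by (auto elim: Rats_cases')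
  obtain c d where cd: "x * cnj x = of_int c / of_int d" "d > 0" using assms(4) by (auto elim: Rats_cases')
  have quad: "x ^ 2 = (x + cnj x) * x - x * cnj x" by (simp add: power2_eq_square algebra_simps)
  define f where "f = [:c * b, - a * d, b * d:]"
  define g where "g = primitive_part f"
  have f0: "f \<noteq> 0" "degree f = 2" using ab cd by (auto simp: f_def)
  have cg: "content g = 1" "g \<noteq> 0" "degree g = 2" using f0 by (auto simp: g_def)
  have fx: "poly (map_poly of_int f) x = 0"
  proof -
    have "poly (map_poly of_int f) x = of_int (b * d) * (x ^ 2 - of_int a / of_int b * x + of_int c / of_int d)"
      using ab cd by (simp add: f_def map_poly_pCons field_simps power2_eq_square)
    also have "\<dots> = 0" unfolding quad ab(1)[symmetric] cd(1)[symmetric] by simp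
    finally show ?thesis .
  qed
  note of_int_smult = poly_of_int_smult[of _ _ x]
  have "f = smult (content f) g" by (simp add: g_def)
  then have "of_int (content f) * poly (map_poly of_int g) x = 0" using fx of_int_smult by metis
  then have gx: "poly (map_poly of_int g) x = 0" using f0 by simp
  obtain k q where kq: "k \<noteq> 0" "smult k p = g * q + pseudo_mod p g" using pseudo_mod(1)[OF cg(2)] by blast
  have "poly (map_poly of_int (smult k p)) x = 0" using p of_int_smult by simp
  then have "poly (map_poly of_int (g * q + pseudo_mod p g)) x = 0" using kq by simp
  then have rx: "poly (map_poly of_int (pseudo_mod p g)) x = 0" using gx
    by (simp add: poly_of_int_add poly_of_int_mult)
  have "pseudo_mod p g = 0 \<or> degree (pseudo_mod p g) < 2" using pseudo_mod(2)[OF cg(2)] cg by metis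
  then have "degree (pseudo_mod p g) \<le> 1" by auto
  then obtain r0 r1 where r: "pseudo_mod p g = [:r0, r1:]"
    by (auto intro!: that[of "coeff (pseudo_mod p g) 0" "coeff (pseudo_mod p g) 1"] poly_eqI
      simp: coeff_pCons coeff_eq_0 split: nat.splits)
  have "of_int r1 * x = of_int (- r0)" using rx by (simp add: r map_poly_pCons algebra_simps add_eq_0_iff)
  then have "r1 = 0" "r0 = 0"
    using nonreal_rational_independent[OF assms(2), of "of_int r1" "of_int (- r0)"] by auto
  then have "smult k p = g * q" using kq r by simp
  then have unit: "lead_coeff g dvd 1" using monic_dvd_leading_coeff p(2) cg(1) kq(1) by blast
  define u where "u = coeff g 2"
  have u: "u * u = 1" using unit cg(3) by (auto simp: u_def zdvd1_eq abs_if split: if_splits)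
  have g: "g = [:coeff g 0, coeff g 1, u:]"
    using cg(3) by (intro poly_eqI) (auto simp: u_def coeff_pCons numeral_2_eq_2 coeff_eq_0 split: nat.splits)
  have "poly (map_poly of_int [:coeff g 0, coeff g 1, u:]) x = 0" using gx g by simp
  then have e: "of_int (coeff g 0) + x * (of_int (coeff g 1) + x * of_int u) = 0"
    by (simp add: map_poly_pCons)
  have uu: "(of_int u :: complex) * of_int u = 1" using u by (metis of_int_1 of_int_mult)
  have "x * x = - of_int (u * coeff g 0) - of_int (u * coeff g 1) * x"
  proof -
    have "of_int u * (of_int (coeff g 0) + x * (of_int (coeff g 1) + x * of_int u)) = 0" using e by simp
    then have "of_int (u * coeff g 0) + of_int (u * coeff g 1) * x + (of_int u * of_int u) * (x * x) = 0"
      by (simp add: algebra_simps)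
    moreover have "C = - A - B" if "A + B + 1 * C = 0" for A B C :: complex
    proof -
      have "C = (A + B + 1 * C) - A - B" by simp
      then show ?thesis unfolding that by simp
    qed
    ultimately show ?thesis unfolding uu by blast
  qed
  moreover have "(x + cnj x + of_int (u * coeff g 1)) * x = x * x + of_int (u * coeff g 1) * x + x * cnj x"
    by (simp add: algebra_simps)
  ultimately have "(x + cnj x + of_int (u * coeff g 1)) * x = x * cnj x - of_int (u * coeff g 0)" by simp
  then have "x + cnj x + of_int (u * coeff g 1) = 0" "x * cnj x - of_int (u * coeff g 0) = 0"
    using nonreal_rational_independent[OF assms(2), of "x + cnj x + of_int (u * coeff g 1)"
      "x * cnj x - of_int (u * coeff g 0)"] assms(3,4) by auto
  then have "x + cnj x = of_int (- (u * coeff g 1))" "x * cnj x = of_int (u * coeff g 0)"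
    by (simp_all only: eq_neg_iff_add_eq_0 of_int_minus right_minus_eq)
  then show ?thesis by (metis Ints_of_int)
qed

text \<open>The square of the denominator v divides D, so v = 1.\<close>

lemma squarefree_mult_square_int:
  fixes r :: complex
  assumes "squarefree D" "r \<in> \<rat>" "r ^ 2 * of_nat D \<in> \<int>"
  shows "r \<in> \<int>"
proof -
  obtain u v where uv: "r = of_int u / of_int v" "v > 0" "coprime u v" using assms(2) by (auto elim: Rats_cases')
  obtain k where k: "r ^ 2 * of_nat D = of_int k" using assms(3) by (auto elim: Ints_cases)
  have "of_int u = r * of_int v" using uv(1,2) by simp
  then have "of_int (u ^ 2 * int D) = (r ^ 2 * of_nat D) * of_int v ^ 2" by (simp add: power_mult_distrib)
  also have "\<dots> = (of_int (k * v ^ 2) :: complex)" unfolding k by simp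
  finally have "of_int (u ^ 2 * int D) = (of_int (k * v ^ 2) :: complex)" .
  then have "u ^ 2 * int D = k * v ^ 2" by (simp only: of_int_eq_iff)
  then have "v ^ 2 dvd u ^ 2 * int D" by simp
  moreover have "coprime (v ^ 2) (u ^ 2)" using uv by (simp add: ac_simps)
  ultimately have "v ^ 2 dvd int D" by (simp add: coprime_dvd_mult_right_iff)
  then have "nat v ^ 2 dvd D" using uv(2) by (metis int_dvd_int_iff of_nat_power int_nat_eq less_imp_le)
  then have "nat v dvd 1" using squarefreeD[OF assms(1)] by blast
  then have "v = 1" using uv(2) by simp
  then show ?thesis using uv by simp
qed

section \<open>The ring of integers for a fixed squarefree D\<close>

locale iqf =
  fixes K :: "complex set" and D :: nat
  assumes D_pos: "D > 0" and D_sqf: "squarefree D"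
    and K_eq: "K = {p + q * (\<i> * of_real (sqrt (real D))) | p q. p \<in> \<rat> \<and> q \<in> \<rat>}"
begin

definition s :: complex where "s = \<i> * of_real (sqrt (real D))"

lemma s_sq: "s * s = - of_nat D"
proof -
  have "s * s = (\<i> * \<i>) * of_real (sqrt (real D) * sqrt (real D))"
    unfolding s_def of_real_mult by (simp only: ac_simps)
  then show ?thesis by simp
qed

lemma cnj_s [simp]: "cnj s = - s"
  by (simp add: s_def)

lemma Re_s [simp]: "Re s = 0" and Im_s: "Im s = sqrt (real D)"
  by (simp_all add: s_def)

lemma s_nonreal: "s \<notin> \<real>"
  using D_pos by (auto simp: complex_is_Real_iff Im_s)

lemma s_nonzero [simp]: "s \<noteq> 0"
  using s_nonreal by auto

lemma K_iff: "x \<in> K \<longleftrightarrow> (\<exists>p\<in>\<rat>. \<exists>q\<in>\<rat>. x = p + q * s)"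
  by (auto simp: K_eq s_def)

lemma K_I: "p \<in> \<rat> \<Longrightarrow> q \<in> \<rat> \<Longrightarrow> p + q * s \<in> K"
  by (auto simp: K_iff)

lemma K_Rats: "x \<in> \<rat> \<Longrightarrow> x \<in> K"
  using K_I[of x 0] by simp

lemma K_0 [simp]: "0 \<in> K" and K_1 [simp]: "1 \<in> K" and K_s [simp]: "s \<in> K"
  using K_I[of 0 1] by (auto intro: K_Rats)

lemma K_of_nat [simp]: "of_nat n \<in> K" and K_of_int [simp]: "of_int i \<in> K"
  by (auto intro: K_Rats)

lemma K_add [intro]: assumes "x \<in> K" "y \<in> K" shows "x + y \<in> K"
proof -
  obtain a b where 1: "a \<in> \<rat>" "b \<in> \<rat>" "x = a + b * s" using assms by (auto simp: K_iff)
  obtain c d where 2: "c \<in> \<rat>" "d \<in> \<rat>" "y = c + d * s" using assms by (auto simp: K_iff)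
  have "x + y = (a + c) + (b + d) * s" by (simp add: 1 2 algebra_simps)
  moreover have "(a + c) + (b + d) * s \<in> K" using 1(1,2) 2(1,2) by (intro K_I Rats_add)
  ultimately show ?thesis by simp
qed

lemma K_mult [intro]: assumes "x \<in> K" "y \<in> K" shows "x * y \<in> K"
proof -
  obtain a b where 1: "a \<in> \<rat>" "b \<in> \<rat>" "x = a + b * s" using assms by (auto simp: K_iff)
  obtain c d where 2: "c \<in> \<rat>" "d \<in> \<rat>" "y = c + d * s" using assms by (auto simp: K_iff)
  have "x * y = (a * c + b * d * (s * s)) + (a * d + b * c) * s"
    by (simp add: 1 2 algebra_simps)
  then have "x * y = (a * c - b * d * of_nat D) + (a * d + b * c) * s" by (simp add: s_sq)
  moreover have "(a * c - b * d * of_nat D) + (a * d + b * c) * s \<in> K"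
    using 1(1,2) 2(1,2) by (intro K_I Rats_add Rats_diff Rats_mult Rats_of_nat)
  ultimately show ?thesis by simp
qed

lemma K_uminus [intro]: "x \<in> K \<Longrightarrow> - x \<in> K"
  using K_mult[of "-1" x] by (simp add: K_Rats)

lemma K_diff [intro]: "x \<in> K \<Longrightarrow> y \<in> K \<Longrightarrow> x - y \<in> K"
  using K_add[of x "-y"] K_uminus by simp

lemma K_power [intro]: "x \<in> K \<Longrightarrow> x ^ n \<in> K"
  by (induct n) auto

lemma K_cnj [intro]: assumes "x \<in> K" shows "cnj x \<in> K"
proof -
  obtain a b where 1: "a \<in> \<rat>" "b \<in> \<rat>" "x = a + b * s" using assms by (auto simp: K_iff)
  have "cnj a = a" "cnj b = b" using 1(1,2) by (auto dest!: Rats_imp_Reals simp: Reals_cnj_iff)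
  then have "cnj x = a + (- b) * s" unfolding 1(3) by simp
  moreover have "a + (- b) * s \<in> K" using 1(1,2) by (intro K_I) auto
  ultimately show ?thesis by simp
qed

lemma K_trace_norm:
  assumes "p \<in> \<rat>" "q \<in> \<rat>" "x = p + q * s"
  shows "x + cnj x = 2 * p" "x * cnj x = p ^ 2 + of_nat D * q ^ 2"
proof -
  have "cnj p = p" "cnj q = q" using assms(1,2) by (auto dest!: Rats_imp_Reals simp: Reals_cnj_iff)
  then have c: "cnj x = p - q * s" unfolding assms(3) by simp
  show "x + cnj x = 2 * p" unfolding c by (simp add: assms(3))
  have "x * cnj x = p ^ 2 - q ^ 2 * (s * s)" unfolding c by (simp add: assms(3) algebra_simps power2_eq_square)
  then show "x * cnj x = p ^ 2 + of_nat D * q ^ 2" by (simp add: s_sq)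
qed

lemma K_trace_norm_Rats: assumes "x \<in> K" shows K_trace: "x + cnj x \<in> \<rat>" and K_norm: "x * cnj x \<in> \<rat>"
proof -
  obtain p q where pq: "p \<in> \<rat>" "q \<in> \<rat>" "x = p + q * s" using assms by (auto simp: K_iff)
  show "x + cnj x \<in> \<rat>" "x * cnj x \<in> \<rat>"
    unfolding K_trace_norm[OF pq] using pq(1,2) by auto
qed

lemma K_real: assumes "x \<in> K" "x \<in> \<real>" shows "x \<in> \<rat>"
proof -
  have "x = (x + cnj x) / 2" using assms(2) by (simp add: Reals_cnj_iff)
  then show ?thesis using K_trace[OF assms(1)] by (metis Rats_divide Rats_number_of)
qed

lemma K_inverse [intro]: assumes "x \<in> K" shows "inverse x \<in> K"
proof (cases "x = 0")
  case False
  have "inverse x = inverse (x * cnj x) * cnj x" using False by simp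
  moreover have "inverse (x * cnj x) \<in> \<rat>" using K_norm[OF assms] by (rule Rats_inverse)
  ultimately show ?thesis using assms by (metis K_Rats K_cnj K_mult)
qed simp

lemma K_divide [intro]: "x \<in> K \<Longrightarrow> y \<in> K \<Longrightarrow> x / y \<in> K"
  unfolding divide_inverse by auto

abbreviation R :: "complex set" where "R \<equiv> ints_of K"

lemma R_eq: "R = {x \<in> K. algebraic_int x}"
  by (simp add: int_ring_def)

lemma R_K: "x \<in> R \<Longrightarrow> x \<in> K"
  by (simp add: R_eq)

text \<open>A real element of the field is rational, so integrality makes it a rational integer; the
  non-real case is \<open>algebraic_int_quadratic\<close>. Conversely, trace and norm are the
  coefficients of a monic equation.\<close>

lemma R_iff: "x \<in> R \<longleftrightarrow> x \<in> K \<and> x + cnj x \<in> \<int> \<and> x * cnj x \<in> \<int>"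
proof
  assume x: "x \<in> R"
  then have xK: "x \<in> K" and xi: "algebraic_int x" by (auto simp: R_eq)
  show "x \<in> K \<and> x + cnj x \<in> \<int> \<and> x * cnj x \<in> \<int>"
  proof (cases "x \<in> \<real>")
    case True
    then have "x \<in> \<int>" using K_real[OF xK True] xi rational_algebraic_int_is_int by blast
    moreover have "cnj x = x" using True by (simp add: Reals_cnj_iff)
    ultimately show ?thesis using xK by simp
  next
    case False
    then show ?thesis using algebraic_int_quadratic[OF xi False K_trace[OF xK] K_norm[OF xK]] xK by simp
  qed
next
  assume x: "x \<in> K \<and> x + cnj x \<in> \<int> \<and> x * cnj x \<in> \<int>"
  let ?p = "[:x * cnj x, - (x + cnj x), 1:]"
  have "algebraic_int x"
  proof (rule algebraic_int.intros)
    show "lead_coeff ?p = 1" by simp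
    show "\<forall>i. coeff ?p i \<in> \<int>" using x Ints_minus[of "x + cnj x"]
      by (auto simp: coeff_pCons split: nat.splits simp del: complex_add_cnj)
    show "poly ?p x = 0" by (simp add: algebra_simps)
  qed
  then show "x \<in> R" using x by (simp add: R_eq)
qed

text \<open>The second member of the integral basis 1, \<open>w\<close>; its trace and norm are
  \<open>tw\<close> and \<open>nw\<close>. The case 3 modulo 4 is that of - D being 1 modulo
  4.\<close>

definition w :: complex where "w = (if D mod 4 = 3 then (1 + s) / 2 else s)"
definition tw :: int where "tw = (if D mod 4 = 3 then 1 else 0)"
definition nw :: int where "nw = (if D mod 4 = 3 then (int D + 1) div 4 else int D)"

lemma w_trace: "w + cnj w = of_int tw"
  by (simp add: w_def tw_def flip: add_divide_distrib del: complex_add_cnj)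

lemma w_norm: "w * cnj w = of_int nw"
proof (cases "D mod 4 = 3")
  case True
  then have "(int D + 1) = 4 * ((int D + 1) div 4)" by presburger
  then have e: "(of_nat D + 1 :: complex) = 4 * of_int ((int D + 1) div 4)"
    by (metis of_int_1 of_int_add of_int_mult of_int_numeral of_int_of_nat_eq)
  have "w * cnj w = (1 - s * s) / 4" using True by (simp add: w_def algebra_simps)
  also have "\<dots> = (of_nat D + 1) / 4" by (simp add: s_sq)
  also have "\<dots> = of_int nw" unfolding e using True by (simp add: nw_def)
  finally show ?thesis .
qed (simp add: w_def nw_def s_sq)

lemma w_sq: "w * w = of_int tw * w - of_int nw"
  unfolding w_trace[symmetric] w_norm[symmetric] by (simp add: algebra_simps)

lemma cnj_w: "cnj w = of_int tw - w"
  unfolding w_trace[symmetric] by simp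

lemma w_nonreal: "w \<notin> \<real>"
  using D_pos by (auto simp: w_def complex_is_Real_iff Im_s)

lemma w_K: "w \<in> K"
proof -
  have "(1 + s) / 2 \<in> K" by (intro K_divide K_add) (auto intro: K_Rats)
  then show ?thesis by (simp add: w_def)
qed

lemma basis_unique:
  assumes "of_int i + of_int j * w = of_int i' + of_int j' * w"
  shows "i = i' \<and> j = j'"
proof -
  have "of_int (j - j') * w = of_int (i' - i)" using assms by (simp add: algebra_simps)
  then have "(of_int (j - j') :: complex) = 0" "(of_int (i' - i) :: complex) = 0"
    using nonreal_rational_independent[OF w_nonreal] by (metis Rats_of_int)+
  then show ?thesis by simp
qed

text \<open>The doubled coordinates of an integer are integers a, b with a^2 + D b^2 divisible by 4.
  Modulo 4 this means equal parity if D is 3 modulo 4, and a, b both even if D is 1 or 2 modulo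
  4.\<close>

lemma R_basis: "x \<in> R \<longleftrightarrow> (\<exists>i j. x = of_int i + of_int j * w)"
proof
  assume "x \<in> R"
  then have x: "x \<in> K" "x + cnj x \<in> \<int>" "x * cnj x \<in> \<int>" by (auto simp: R_iff)
  obtain p q where pq: "p \<in> \<rat>" "q \<in> \<rat>" "x = p + q * s" using x by (auto simp: K_iff)
  note tn = K_trace_norm[OF pq]
  obtain a where a: "2 * p = of_int a" using x(2) tn by (metis Ints_cases)
  obtain n where n: "p ^ 2 + of_nat D * q ^ 2 = of_int n" using x(3) tn by (metis Ints_cases)
  have "(2 * q) ^ 2 * of_nat D = 4 * (p ^ 2 + of_nat D * q ^ 2) - (2 * p) ^ 2"
    by (simp add: power2_eq_square algebra_simps)
  also have "\<dots> = of_int (4 * n - a ^ 2)" unfolding n a by simp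
  finally have e: "(2 * q) ^ 2 * of_nat D = of_int (4 * n - a ^ 2)" .
  have "2 * q \<in> \<int>"
    by (rule squarefree_mult_square_int[OF D_sqf]) (use pq(2) in simp, simp only: e Ints_of_int)
  then obtain b where b: "2 * q = of_int b" by (auto elim: Ints_cases)
  have "of_int (b ^ 2 * int D) = (of_int (4 * n - a ^ 2) :: complex)" using e unfolding b by simp
  then have ab: "b ^ 2 * int D = 4 * n - a ^ 2" by (simp only: of_int_eq_iff)
  have D4: "D mod 4 \<noteq> 0"
  proof
    assume "D mod 4 = 0"
    then have "2 ^ 2 dvd D" by (simp add: dvd_eq_mod_eq_0)
    from squarefreeD[OF D_sqf this] show False by simp
  qed
  have xab: "x = (of_int a + of_int b * s) / 2" unfolding pq(3) a[symmetric] b[symmetric] by simp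
  show "\<exists>i j. x = of_int i + of_int j * w"
  proof (cases "D mod 4 = 3")
    case True
    then have oD: "odd D" by presburger
    have "even (b ^ 2 * int D + a ^ 2)" using ab by simp
    then have "even (a - b)" using oD by auto
    then obtain c where "a - b = 2 * c" by (rule evenE)
    then have "a = b + 2 * c" by simp
    then have "x = of_int c + of_int b * w" using True unfolding xab w_def by (simp add: field_simps)
    then show ?thesis by blast
  next
    case False
    have sq: "z ^ 2 mod 4 = (if even z then 0 else 1)" for z :: int
    proof (cases "even z")
      case True then show ?thesis by (auto elim!: evenE simp: power_mult_distrib)
    next
      case False
      then obtain c where "z = 2 * c + 1" by (auto elim!: oddE)
      then have "z ^ 2 = 4 * (c ^ 2 + c) + 1" by (simp add: power2_eq_square algebra_simps)
      then show ?thesis using False by presburger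
    qed
    have "D mod 4 = 1 \<or> D mod 4 = 2" using D4 False by presburger
    then have D12: "int D mod 4 = 1 \<or> int D mod 4 = 2" by presburger
    have "(b ^ 2 * int D + a ^ 2) mod 4 = 0" using ab by simp
    then have "((b ^ 2 mod 4) * (int D mod 4) + a ^ 2 mod 4) mod 4 = 0" by (metis mod_add_eq mod_mult_eq mod_add_left_eq)
    then have "even a \<and> even b" using D12 unfolding sq by (auto split: if_splits)
    then obtain c d where "a = 2 * c" "b = 2 * d" by (auto elim!: evenE)
    then have "x = of_int c + of_int d * w" using False unfolding xab w_def by (simp add: field_simps)
    then show ?thesis by blast
  qed
next
  assume "\<exists>i j. x = of_int i + of_int j * w"
  then obtain i j where x: "x = of_int i + of_int j * w" by blast
  have "x + cnj x = of_int (2 * i) + of_int j * (w + cnj w)" unfolding x by (simp add: algebra_simps)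
  then have 1: "x + cnj x = of_int (2 * i + j * tw)" by (simp add: w_trace)
  have "x * cnj x = of_int (i ^ 2) + of_int (i * j) * (w + cnj w) + of_int (j ^ 2) * (w * cnj w)"
    unfolding x by (simp add: algebra_simps power2_eq_square)
  then have 2: "x * cnj x = of_int (i ^ 2 + i * j * tw + j ^ 2 * nw)" by (simp add: w_trace w_norm)
  have "x \<in> K" unfolding x by (intro K_add K_mult K_of_int w_K)
  then show "x \<in> R" unfolding R_iff 1 2 by (metis Ints_of_int)
qed

lemma R_I [intro]: "of_int i + of_int j * w \<in> R"
  by (auto simp: R_basis)

lemma R_of_int [simp, intro]: "of_int i \<in> R"
  using R_I[of i 0] by simp

lemma R_of_nat [simp, intro]: "of_nat i \<in> R"
  using R_of_int[of "int i"] by simp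

lemma R_0 [simp, intro]: "0 \<in> R" and R_1 [simp, intro]: "1 \<in> R"
  using R_of_int[of 0] R_of_int[of 1] by simp_all

lemma R_numeral [simp, intro]: "numeral n \<in> R"
  using R_of_nat[of "numeral n"] by simp

lemma R_w [simp, intro]: "w \<in> R"
  using R_I[of 0 1] by simp

lemma R_s [simp, intro]: "s \<in> R"
  using R_I[of "-1" 2] R_I[of 0 1] by (simp add: w_def split: if_splits)

lemma R_add [intro]: assumes "x \<in> R" "y \<in> R" shows "x + y \<in> R"
proof -
  obtain a b where 1: "x = of_int a + of_int b * w" using assms by (auto simp: R_basis)
  obtain c d where 2: "y = of_int c + of_int d * w" using assms by (auto simp: R_basis)
  have "x + y = of_int (a + c) + of_int (b + d) * w" by (simp add: 1 2 algebra_simps)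
  then show ?thesis using R_I by metis
qed

lemma R_mult [intro]: assumes "x \<in> R" "y \<in> R" shows "x * y \<in> R"
proof -
  obtain a b where 1: "x = of_int a + of_int b * w" using assms by (auto simp: R_basis)
  obtain c d where 2: "y = of_int c + of_int d * w" using assms by (auto simp: R_basis)
  have "x * y = of_int (a * c) + of_int (a * d + b * c) * w + of_int (b * d) * (w * w)"
    by (simp add: 1 2 algebra_simps)
  also have "\<dots> = of_int (a * c - b * d * nw) + of_int (a * d + b * c + b * d * tw) * w"
    unfolding w_sq by (simp add: algebra_simps)
  finally show ?thesis using R_I by metis
qed

lemma R_uminus [intro]: "x \<in> R \<Longrightarrow> - x \<in> R"
  using R_mult[of "-1" x] R_of_int[of "-1"] by simp

lemma R_diff [intro]: "x \<in> R \<Longrightarrow> y \<in> R \<Longrightarrow> x - y \<in> R"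
  using R_add[of x "-y"] R_uminus by simp

lemma R_power [intro]: "x \<in> R \<Longrightarrow> x ^ n \<in> R"
  by (induct n) auto

lemma R_cnj [intro]: "x \<in> R \<Longrightarrow> cnj x \<in> R"
  by (auto simp: R_iff add.commute mult.commute)

lemma R_cnj_iff [simp]: "cnj x \<in> R \<longleftrightarrow> x \<in> R"
  using R_cnj[of x] R_cnj[of "cnj x"] by auto

text \<open>On integers of the field the floor is exact; it serves to give norm and trace the types
  of natural numbers and integers.\<close>

definition nm :: "complex \<Rightarrow> nat" where "nm x = nat \<lfloor>Re (x * cnj x)\<rfloor>"
definition tr :: "complex \<Rightarrow> int" where "tr x = \<lfloor>Re (x + cnj x)\<rfloor>"

lemma nm: assumes "x \<in> R" shows "of_nat (nm x) = x * cnj x"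
proof -
  obtain k where k: "x * cnj x = of_int k" using assms by (auto simp: R_iff elim: Ints_cases)
  have "Re (x * cnj x) \<ge> 0" by (simp add: complex_mult_cnj)
  then have "k \<ge> 0" using k by simp
  moreover have "nm x = nat k" using k by (simp add: nm_def)
  ultimately show ?thesis using k by simp
qed

lemma tr: assumes "x \<in> R" shows "of_int (tr x) = x + cnj x"
proof -
  obtain k where k: "x + cnj x = of_int k" using assms by (auto simp: R_iff elim: Ints_cases)
  then show ?thesis by (simp add: tr_def del: complex_add_cnj)
qed

lemma nm_eqI: "x \<in> R \<Longrightarrow> x * cnj x = of_nat n \<Longrightarrow> nm x = n"
  using nm by (metis of_nat_eq_iff)

lemma tr_eqI: "x \<in> R \<Longrightarrow> x + cnj x = of_int n \<Longrightarrow> tr x = n"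
  using tr by (metis of_int_eq_iff)

lemma nm_mult: "x \<in> R \<Longrightarrow> y \<in> R \<Longrightarrow> nm (x * y) = nm x * nm y"
  by (rule nm_eqI) (auto simp: nm)

lemma nm_power: "x \<in> R \<Longrightarrow> nm (x ^ n) = nm x ^ n"
  by (rule nm_eqI) (auto simp: nm power_mult_distrib)

lemma nm_cnj [simp]: "nm (cnj x) = nm x"
  by (simp add: nm_def mult.commute)

lemma nm_eq_0: "x \<in> R \<Longrightarrow> nm x = 0 \<longleftrightarrow> x = 0"
  using nm[of x] by (metis complex_cnj_zero_iff mult_eq_0_iff of_nat_eq_0_iff)

lemma nm_of_nat: "nm (of_nat n) = n ^ 2"
  by (rule nm_eqI) (auto simp: power2_eq_square)

lemma nm_of_int: "nm (of_int n) = nat (n ^ 2)"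
  by (rule nm_eqI) (auto simp: power2_eq_square)

lemma nm_basis: "int (nm (of_int i + of_int j * w)) = i ^ 2 + i * j * tw + j ^ 2 * nw"
proof -
  let ?x = "of_int i + of_int j * w"
  have "?x * cnj ?x = of_int (i ^ 2) + of_int (i * j) * (w + cnj w) + of_int (j ^ 2) * (w * cnj w)"
    by (simp add: algebra_simps power2_eq_square)
  then have "?x * cnj ?x = of_int (i ^ 2 + i * j * tw + j ^ 2 * nw)" by (simp add: w_trace w_norm)
  then have "of_int (int (nm ?x)) = (of_int (i ^ 2 + i * j * tw + j ^ 2 * nw) :: complex)"
    using nm[OF R_I[of i j]] by simp
  then show ?thesis by (simp only: of_int_eq_iff)
qed

lemma nm_s: "nm (of_int u + of_int v * s) = nat (u ^ 2 + int D * v ^ 2)"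
proof -
  have R: "of_int u + of_int v * s \<in> R" by (intro R_add R_mult) auto
  have "(of_int u + of_int v * s) * cnj (of_int u + of_int v * s) = of_int (u ^ 2) - of_int (v ^ 2) * (s * s)"
    by (simp add: algebra_simps power2_eq_square)
  also have "\<dots> = of_int (u ^ 2 + int D * v ^ 2)" by (simp add: s_sq)
  also have "\<dots> = of_nat (nat (u ^ 2 + int D * v ^ 2))" by (simp add: of_nat_nat)
  finally show ?thesis by (rule nm_eqI[OF R])
qed

lemma R_divide_of_nat:
  assumes "x \<in> K" obtains a n where "a \<in> R" "n > 0" "x = a / of_nat n"
proof -
  obtain p q where pq: "p \<in> \<rat>" "q \<in> \<rat>" "x = p + q * s" using assms by (auto simp: K_iff)
  obtain a b where 1: "p = of_int a / of_int b" "b > 0" using pq by (auto elim: Rats_cases')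
  obtain c d where 2: "q = of_int c / of_int d" "d > 0" using pq by (auto elim: Rats_cases')
  have bd: "(of_int b :: complex) \<noteq> 0" "(of_int d :: complex) \<noteq> 0" using 1(2) 2(2) by auto
  have "x = (of_int (a * d) + of_int (c * b) * s) / of_int (b * d)"
    unfolding pq(3) 1(1) 2(1) using bd by (simp add: add_divide_distrib)
  also have "(of_int (b * d) :: complex) = of_nat (nat (b * d))" using 1(2) 2(2) by (simp add: of_nat_nat)
  finally have "x = (of_int (a * d) + of_int (c * b) * s) / of_nat (nat (b * d))" .
  moreover have "of_int (a * d) + of_int (c * b) * s \<in> R" by (intro R_add R_mult R_of_int R_s)
  moreover have "nat (b * d) > 0" using 1(2) 2(2) by simp
  ultimately show ?thesis using that by blast
qed

end

lemma imag_quad_field_iqf: assumes "imag_quad_field K" shows "\<exists>D. iqf K D"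
proof -
  obtain D :: nat where D: "D > 0" "squarefree D"
    "K = {p + q * (\<i> * of_real (sqrt (real D))) | p q. p \<in> \<rat> \<and> q \<in> \<rat>}"
    by (rule imag_quad_field_cases[OF assms])
  then have "iqf K D" by (rule iqf.intro)
  then show ?thesis ..
qed

section \<open>Ideals and their norms\<close>

abbreviation imul :: "complex set \<Rightarrow> complex set \<Rightarrow> complex set" (infixl "\<odot>" 70)
  where "A \<odot> B \<equiv> ideal_prod complex_ring A B"

lemma imul_prod: "a \<in> A \<Longrightarrow> b \<in> B \<Longrightarrow> a * b \<in> A \<odot> B"
  using ideal_prod.prod[of a A b B complex_ring] by simp

lemma imul_sum: "x \<in> A \<odot> B \<Longrightarrow> y \<in> A \<odot> B \<Longrightarrow> x + y \<in> A \<odot> B"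
  using ideal_prod.sum[of x complex_ring A B y] by simp

lemma imul_induct [consumes 1, case_names prod sum]:
  assumes "x \<in> A \<odot> B" "\<And>a b. a \<in> A \<Longrightarrow> b \<in> B \<Longrightarrow> P (a * b)"
    "\<And>x y. x \<in> A \<odot> B \<Longrightarrow> P x \<Longrightarrow> y \<in> A \<odot> B \<Longrightarrow> P y \<Longrightarrow> P (x + y)"
  shows "P x"
  using assms(1)
proof (induct rule: ideal_prod.induct)
  case (prod i j)
  then show ?case using assms(2) by simp
next
  case (sum s1 s2)
  then show ?case using assms(3) by simp
qed

lemma imul_subsetI:
  assumes "\<And>a b. a \<in> A \<Longrightarrow> b \<in> B \<Longrightarrow> a * b \<in> C" "\<And>x y. x \<in> C \<Longrightarrow> y \<in> C \<Longrightarrow> x + y \<in> C"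
  shows "A \<odot> B \<subseteq> C"
proof
  fix x assume "x \<in> A \<odot> B"
  then show "x \<in> C" by (induct rule: imul_induct) (auto intro: assms)
qed

lemma imul_mono: "A \<subseteq> A' \<Longrightarrow> B \<subseteq> B' \<Longrightarrow> A \<odot> B \<subseteq> A' \<odot> B'"
  by (rule imul_subsetI) (auto intro: imul_prod imul_sum)

lemma imul_comm: "A \<odot> B = B \<odot> A"
proof -
  have "A \<odot> B \<subseteq> B \<odot> A" for A B
  proof (rule imul_subsetI)
    show "a * b \<in> B \<odot> A" if "a \<in> A" "b \<in> B" for a b
      using imul_prod[OF that(2,1)] by (simp add: mult.commute)
  qed (rule imul_sum)
  then show ?thesis by blast
qed

lemma imul_assoc: "A \<odot> B \<odot> C = A \<odot> (B \<odot> C)"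
proof -
  have le: "A \<odot> B \<odot> C \<subseteq> A \<odot> (B \<odot> C)" for A B C
  proof (rule imul_subsetI)
    fix x c assume "x \<in> A \<odot> B" and c: "c \<in> C"
    then show "x * c \<in> A \<odot> (B \<odot> C)"
    proof (induct rule: imul_induct)
      case (prod a b)
      then show ?case using imul_prod[OF prod(1) imul_prod[OF prod(2) c]] by (simp add: mult.assoc)
    next
      case (sum x y)
      then show ?case using imul_sum by (simp add: distrib_right)
    qed
  qed (rule imul_sum)
  have "A \<odot> (B \<odot> C) = C \<odot> B \<odot> A" by (simp add: imul_comm)
  also have "\<dots> \<subseteq> C \<odot> (B \<odot> A)" by (rule le)
  also have "\<dots> = A \<odot> B \<odot> C" by (simp add: imul_comm)
  finally show ?thesis using le[of A B C] by blast
qed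

lemma imul_left_comm: "A \<odot> (B \<odot> C) = B \<odot> (A \<odot> C)"
  by (metis imul_assoc imul_comm)

lemmas imul_ac = imul_assoc imul_comm imul_left_comm

lemma imul_scale: "((*) c ` A) \<odot> B = (*) c ` (A \<odot> B)"
proof
  show "((*) c ` A) \<odot> B \<subseteq> (*) c ` (A \<odot> B)"
  proof (rule imul_subsetI)
    show "a * b \<in> (*) c ` (A \<odot> B)" if "a \<in> (*) c ` A" "b \<in> B" for a b
      using that imul_prod by (auto simp: mult.assoc)
    show "x + y \<in> (*) c ` (A \<odot> B)" if "x \<in> (*) c ` (A \<odot> B)" "y \<in> (*) c ` (A \<odot> B)" for x y
      using that imul_sum by (auto simp flip: distrib_left)
  qed
  show "(*) c ` (A \<odot> B) \<subseteq> ((*) c ` A) \<odot> B"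
  proof
    fix z assume "z \<in> (*) c ` (A \<odot> B)"
    then obtain x where z: "z = c * x" and "x \<in> A \<odot> B" by auto
    from this(2) have "c * x \<in> ((*) c ` A) \<odot> B"
    proof (induct rule: imul_induct)
      case (prod a b)
      then have "c * a * b \<in> ((*) c ` A) \<odot> B" by (intro imul_prod) auto
      then show ?case by (simp add: mult.assoc)
    next
      case (sum x y)
      then show ?case using imul_sum by (simp add: distrib_left)
    qed
    then show "z \<in> ((*) c ` A) \<odot> B" by (simp add: z)
  qed
qed

lemma imul_cnj: "cnj ` (A \<odot> B) = cnj ` A \<odot> cnj ` B"
proof -
  have le: "cnj ` (A \<odot> B) \<subseteq> cnj ` A \<odot> cnj ` B" for A B
  proof
    fix z assume "z \<in> cnj ` (A \<odot> B)"
    then obtain x where z: "z = cnj x" and "x \<in> A \<odot> B" by auto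
    from this(2) have "cnj x \<in> cnj ` A \<odot> cnj ` B"
      by (induct rule: imul_induct) (auto intro: imul_prod imul_sum)
    then show "z \<in> cnj ` A \<odot> cnj ` B" by (simp add: z)
  qed
  have "cnj ` (cnj ` A \<odot> cnj ` B) \<subseteq> cnj ` cnj ` A \<odot> cnj ` cnj ` B" by (rule le)
  then have "cnj ` (cnj ` A \<odot> cnj ` B) \<subseteq> A \<odot> B" by (simp add: image_image)
  then have "cnj ` cnj ` (cnj ` A \<odot> cnj ` B) \<subseteq> cnj ` (A \<odot> B)" by (rule image_mono)
  then show ?thesis using le[of A B] by (simp add: image_image subset_antisym)
qed

lemma cnj_cnj_image [simp]: "cnj ` cnj ` A = A"
  by (simp add: image_image)

context iqf
begin

abbreviation "idl \<equiv> integral_ideal K"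

abbreviation "pid \<equiv> principal_ideal K"

lemma int_ring_simps [simp]:
  "monoid.mult (int_ring K) x y = x * y" "one (int_ring K) = 1"
  "ring.zero (int_ring K) = 0" "add (int_ring K) x y = x + y"
  by (simp_all add: int_ring_def)

lemma ring_int_ring: "ring (int_ring K)"
proof -
  have "subring R complex_ring" by (rule CR.subringI) auto
  moreover have "int_ring K = complex_ring\<lparr>carrier := R\<rparr>" by (simp add: int_ring_def)
  ultimately show ?thesis using CR.subring_is_ring by metis
qed

lemma idl_iff: "idl I \<longleftrightarrow> I \<subseteq> R \<and> (\<exists>x\<in>I. x \<noteq> 0) \<and>
    (\<forall>x\<in>I. \<forall>y\<in>I. x + y \<in> I) \<and> (\<forall>r\<in>R. \<forall>x\<in>I. r * x \<in> I)" (is "_ = ?rhs")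
proof
  interpret O: ring "int_ring K" by (rule ring_int_ring)
  have minus: "\<ominus>\<^bsub>int_ring K\<^esub> x = - x" if "x \<in> R" for x
    by (rule O.minus_equality) (use that in auto)
  show ?rhs if "idl I"
  proof -
    interpret ideal I "int_ring K" using that by (simp add: integral_ideal_def)
    have "I \<subseteq> R" by (rule a_subset)
    moreover have "\<exists>x\<in>I. x \<noteq> 0" using that zero_closed by (force simp: integral_ideal_def)
    ultimately show ?thesis using a_closed I_l_closed by simp
  qed
  show "idl I" if I: ?rhs
  proof -
    have m1: "- x \<in> I" if "x \<in> I" for x
      using I that R_of_int[of "-1"] by (metis mult_minus1 of_int_1 of_int_minus)
    have "ideal I (int_ring K)"
    proof (rule idealI[OF ring_int_ring])
      show "subgroup I (add_monoid (int_ring K))"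
      proof
        show "I \<subseteq> carrier (add_monoid (int_ring K))" using I by simp
        show "x \<otimes>\<^bsub>add_monoid (int_ring K)\<^esub> y \<in> I" if "x \<in> I" "y \<in> I" for x y
          using I that by simp
        show "\<one>\<^bsub>add_monoid (int_ring K)\<^esub> \<in> I" using I R_0 by (simp, metis mult_zero_left)
        show "inv\<^bsub>add_monoid (int_ring K)\<^esub> x \<in> I" if "x \<in> I" for x
        proof -
          have "x \<in> R" using I that by auto
          then show ?thesis using minus[of x] m1[OF that] unfolding a_inv_def by simp
        qed
      qed
      show "x \<otimes>\<^bsub>int_ring K\<^esub> a \<in> I" if "a \<in> I" "x \<in> R" for a x
        using I that by simp
      show "a \<otimes>\<^bsub>int_ring K\<^esub> x \<in> I" if "a \<in> I" "x \<in> R" for a x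
        using I that by (metis int_ring_simps(1) mult.commute)
    qed
    then show ?thesis using I by (auto simp: integral_ideal_def)
  qed
qed

lemma idlI:
  assumes "I \<subseteq> R" "x \<in> I" "x \<noteq> 0" "\<And>x y. x \<in> I \<Longrightarrow> y \<in> I \<Longrightarrow> x + y \<in> I"
    "\<And>r x. r \<in> R \<Longrightarrow> x \<in> I \<Longrightarrow> r * x \<in> I"
  shows "idl I"
  using assms unfolding idl_iff by blast

lemma idl_R: "idl I \<Longrightarrow> x \<in> I \<Longrightarrow> x \<in> R"
  by (auto simp: idl_iff)

lemma idl_sub: "idl I \<Longrightarrow> I \<subseteq> R"
  by (simp add: idl_iff)

lemma idl_add: "idl I \<Longrightarrow> x \<in> I \<Longrightarrow> y \<in> I \<Longrightarrow> x + y \<in> I"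
  by (simp add: idl_iff)

lemma idl_mult: "idl I \<Longrightarrow> r \<in> R \<Longrightarrow> x \<in> I \<Longrightarrow> r * x \<in> I"
  by (simp add: idl_iff)

lemma idl_mult_right: "idl I \<Longrightarrow> r \<in> R \<Longrightarrow> x \<in> I \<Longrightarrow> x * r \<in> I"
  by (simp add: idl_iff mult.commute)

lemma idl_uminus: "idl I \<Longrightarrow> x \<in> I \<Longrightarrow> - x \<in> I"
  using idl_mult[of I "-1" x] R_of_int[of "-1"] by simp

lemma idl_diff: "idl I \<Longrightarrow> x \<in> I \<Longrightarrow> y \<in> I \<Longrightarrow> x - y \<in> I"
  using idl_add[of I x "-y"] idl_uminus by simp

lemma idl_0: "idl I \<Longrightarrow> 0 \<in> I"
  by (metis R_0 idl_iff mult_zero_left)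

lemma idl_nonzero: assumes "idl I" obtains x where "x \<in> I" "x \<noteq> 0" "x \<in> R"
  using assms unfolding idl_iff by blast

lemma idl_one: assumes "idl I" "1 \<in> I" shows "I = R"
proof
  show "R \<subseteq> I" using idl_mult[OF assms(1) _ assms(2)] by auto
qed (rule idl_sub[OF assms(1)])

lemma idl_unit: "idl R"
  by (rule idlI[of _ 1]) auto

lemma pid_iff: "x \<in> pid a \<longleftrightarrow> (\<exists>r\<in>R. x = a * r)"
  by (auto simp: principal_ideal_def)

lemma pid_mem [simp]: "a \<in> pid a"
  unfolding pid_iff by (rule bexI[of _ 1]) auto

lemma pid_1 [simp]: "pid 1 = R"
  by (auto simp: pid_iff)

lemma pid_memI: "r \<in> R \<Longrightarrow> a * r \<in> pid a"
  by (auto simp: pid_iff)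

lemma pid_add: "x \<in> pid a \<Longrightarrow> y \<in> pid a \<Longrightarrow> x + y \<in> pid a"
  unfolding pid_iff by (metis R_add distrib_left)

lemma idl_pid: assumes "a \<in> R" "a \<noteq> 0" shows "idl (pid a)"
proof (rule idlI[of _ a])
  show "r * x \<in> pid a" if r: "r \<in> R" and x: "x \<in> pid a" for r x
  proof -
    obtain t where t: "t \<in> R" "x = a * t" using x by (auto simp: pid_iff)
    have e: "r * x = a * (r * t)" unfolding t by (simp only: ac_simps)
    show ?thesis unfolding e by (rule pid_memI[OF R_mult[OF r t(1)]])
  qed
qed (use assms pid_add in \<open>auto simp: pid_iff\<close>)

lemma pid_mult: "pid a \<odot> pid b = pid (a * b)"
proof
  show "pid a \<odot> pid b \<subseteq> pid (a * b)"
  proof (rule imul_subsetI)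
    show "x * y \<in> pid (a * b)"
      if xy: "x \<in> pid a" "y \<in> pid b" for x y
    proof -
      obtain t u where t: "t \<in> R" "x = a * t" "u \<in> R" "y = b * u" using xy by (auto simp: pid_iff)
      have e: "x * y = a * b * (t * u)" unfolding t by (simp only: ac_simps)
      show ?thesis unfolding e by (rule pid_memI[OF R_mult[OF t(1,3)]])
    qed
  qed (rule pid_add)
  show "pid (a * b) \<subseteq> pid a \<odot> pid b"
  proof
    fix x assume "x \<in> pid (a * b)"
    then obtain r where "r \<in> R" "x = a * (b * r)" by (auto simp: pid_iff mult.assoc)
    then show "x \<in> pid a \<odot> pid b"
      using imul_prod[OF pid_mem pid_memI] by metis
  qed
qed

lemma imul_pid: assumes "idl I" shows "pid a \<odot> I = (*) a ` I"
proof -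
  have "R \<odot> I = I"
  proof
    show "R \<odot> I \<subseteq> I" by (rule imul_subsetI) (auto intro: idl_mult idl_add assms)
    show "I \<subseteq> R \<odot> I" using imul_prod[OF R_1] by fastforce
  qed
  then show ?thesis using imul_scale[of a R I] by (simp add: principal_ideal_def)
qed

lemma imul_R [simp]: "idl I \<Longrightarrow> R \<odot> I = I"
  using imul_pid[of I 1] by simp

lemma imul_R' [simp]: "idl I \<Longrightarrow> I \<odot> R = I"
  using imul_comm imul_R by metis

lemma idl_imul: assumes A: "idl A" and B: "idl B" shows "idl (A \<odot> B)"
proof -
  obtain a b where ab: "a \<in> A" "a \<noteq> 0" "b \<in> B" "b \<noteq> 0" using idl_nonzero[OF A] idl_nonzero[OF B] by metis
  show ?thesis
  proof (rule idlI[of _ "a * b"])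
    show "A \<odot> B \<subseteq> R" by (rule imul_subsetI) (use A B in \<open>auto dest: idl_R\<close>)
    show "a * b \<in> A \<odot> B" using ab by (auto intro: imul_prod)
    show "a * b \<noteq> 0" using ab by simp
    show "r * x \<in> A \<odot> B" if r: "r \<in> R" and "x \<in> A \<odot> B" for r x
      using that(2)
    proof (induct rule: imul_induct)
      case (prod a b)
      then show ?case using imul_prod[OF idl_mult[OF A r prod(1)] prod(2)] by (simp add: mult.assoc)
    next
      case (sum x y)
      then show ?case using imul_sum by (simp add: distrib_left)
    qed
  qed (rule imul_sum)
qed

lemma imul_subset_left: "idl A \<Longrightarrow> idl B \<Longrightarrow> A \<odot> B \<subseteq> A"
  by (rule imul_subsetI) (auto intro: idl_mult_right idl_add idl_R)

lemma imul_subset_right: "idl A \<Longrightarrow> idl B \<Longrightarrow> A \<odot> B \<subseteq> B"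
  using imul_subset_left imul_comm by metis

lemma R_cnj_image [simp]: "cnj ` R = R"
proof
  show "R \<subseteq> cnj ` R"
  proof
    fix x assume "x \<in> R"
    then show "x \<in> cnj ` R" by (intro image_eqI[of _ _ "cnj x"]) auto
  qed
qed auto

lemma idl_cnj: assumes "idl I" shows "idl (cnj ` I)"
proof -
  obtain x where x: "x \<in> I" "x \<noteq> 0" using idl_nonzero[OF assms] by metis
  show ?thesis
  proof (rule idlI[of _ "cnj x"])
    show "r * y \<in> cnj ` I" if r: "r \<in> R" and y: "y \<in> cnj ` I" for r y
    proof -
      obtain z where z: "z \<in> I" "y = cnj z" using y by auto
      then have "cnj r * z \<in> I" using r assms idl_mult by auto
      then show ?thesis using z by (intro image_eqI[of _ _ "cnj r * z"]) auto
    qed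
    show "cnj ` I \<subseteq> R" using idl_sub[OF assms] by auto
    show "cnj x \<in> cnj ` I" using x(1) by (rule imageI)
    show "cnj x \<noteq> 0" using x(2) by simp
    show "u + v \<in> cnj ` I" if "u \<in> cnj ` I" "v \<in> cnj ` I" for u v
      using that idl_add[OF assms] by (metis (no_types, lifting) complex_cnj_add image_iff)
  qed
qed

lemma pid_cnj: "cnj ` pid a = pid (cnj a)"
proof -
  have "cnj ` (*) a ` R = (*) (cnj a) ` cnj ` R" by (simp only: image_image complex_cnj_mult)
  then show ?thesis by (simp add: principal_ideal_def)
qed

lemma coprime_ideals_iff:
  assumes "idl A" "idl B"
  shows "coprime_ideals K A B \<longleftrightarrow> (\<exists>a\<in>A. \<exists>b\<in>B. a + b = 1)"
proof -
  have *: "A <+>\<^bsub>int_ring K\<^esub> B = {a + b | a b. a \<in> A \<and> b \<in> B}"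
    unfolding set_add_def' by auto
  show ?thesis
  proof
    assume "coprime_ideals K A B"
    then have "1 \<in> {a + b | a b. a \<in> A \<and> b \<in> B}" unfolding coprime_ideals_def * by auto
    then show "\<exists>a\<in>A. \<exists>b\<in>B. a + b = 1" by force
  next
    assume "\<exists>a\<in>A. \<exists>b\<in>B. a + b = 1"
    then obtain a b where ab: "a \<in> A" "b \<in> B" "a + b = 1" by blast
    have "r = a * r + b * r" for r using ab(3) by (metis distrib_right mult_1)
    then have "R \<subseteq> {a + b | a b. a \<in> A \<and> b \<in> B}"
      using ab idl_mult_right assms by blast
    moreover have "{a + b | a b. a \<in> A \<and> b \<in> B} \<subseteq> R" using assms idl_R by blast
    ultimately show "coprime_ideals K A B" unfolding coprime_ideals_def * by blast
  qed
qed

end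

hide_const (open) Divisibility.prime

section \<open>Lattice bases and ideal norms\<close>

context iqf
begin

abbreviation "N \<equiv> ideal_norm K"

definition rclass :: "complex set \<Rightarrow> complex \<Rightarrow> complex set" where "rclass I r = {h + r | h. h \<in> I}"

lemma rclass_eq_iff: assumes "idl I" shows "rclass I u = rclass I v \<longleftrightarrow> u - v \<in> I"
proof
  assume e: "rclass I u = rclass I v"
  have "0 + u \<in> rclass I u" using idl_0[OF assms] unfolding rclass_def by blast
  then obtain h where "h \<in> I" "u = h + v" unfolding e unfolding rclass_def by auto
  then show "u - v \<in> I" by simp
next
  assume uv: "u - v \<in> I"
  have sub: "rclass I u \<subseteq> rclass I v" if uv: "u - v \<in> I" for u v
  proof
    fix z assume "z \<in> rclass I u"
    then obtain h where "h \<in> I" "z = h + u" unfolding rclass_def by auto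
    then have "z = (h + (u - v)) + v" "h + (u - v) \<in> I" using idl_add[OF assms _ uv] by auto
    then show "z \<in> rclass I v" unfolding rclass_def by blast
  qed
  have "v - u \<in> I" using idl_uminus[OF assms uv] by simp
  then show "rclass I u = rclass I v" using sub uv by blast
qed

lemma N_rclass: "N I = card (rclass I ` R)"
proof -
  have "carrier (int_ring K Quot I) = rclass I ` R"
    unfolding FactRing_def A_RCOSETS_def' a_r_coset_def' rclass_def by auto
  then show ?thesis by (simp add: ideal_norm_def)
qed

lemma card_cosets:
  assumes "S \<subseteq> R" "\<And>r. r \<in> R \<Longrightarrow> \<exists>u\<in>S. r - u \<in> I"
    "\<And>u v. u \<in> S \<Longrightarrow> v \<in> S \<Longrightarrow> u - v \<in> I \<Longrightarrow> u = v" "idl I"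
  shows "ideal_norm K I = card S"
proof -
  have "rclass I ` R = rclass I ` S"
  proof
    show "rclass I ` R \<subseteq> rclass I ` S"
    proof
      fix z assume "z \<in> rclass I ` R"
      then obtain r where r: "r \<in> R" "z = rclass I r" by auto
      obtain u where "u \<in> S" "r - u \<in> I" using assms(2)[OF r(1)] by auto
      then show "z \<in> rclass I ` S" using r rclass_eq_iff[OF assms(4)] by auto
    qed
  qed (use assms(1) in auto)
  moreover have "card (rclass I ` S) = card S"
    by (rule card_image) (use assms(3) rclass_eq_iff[OF assms(4)] in \<open>auto intro!: inj_onI\<close>)
  ultimately show ?thesis unfolding N_rclass by simp
qed

text \<open>Hermite normal form: I is y times the lattice spanned by a and x + w. The numbers a, 2 x
  + tw, c are the coefficients of the binary quadratic form attached to I, and the condition on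
  primes says that this form is primitive.\<close>

definition lattice_basis :: "complex set \<Rightarrow> int \<Rightarrow> int \<Rightarrow> int \<Rightarrow> int \<Rightarrow> bool" where
  "lattice_basis I y a x c \<longleftrightarrow> y > 0 \<and> a > 0 \<and> int (nm (of_int x + w)) = a * c \<and>
    (\<forall>p. prime p \<longrightarrow> \<not> (p dvd a \<and> p dvd 2 * x + tw \<and> p dvd c)) \<and>
    I = {of_int y * (of_int (i * a + j * x) + of_int j * w) | i j. True}"

text \<open>A is the least positive rational integer in I and Y the least positive coordinate at w.
  Minimality makes them divide all other candidates; in particular Y divides A, because A w is in I,
  and Y divides X0, because I is stable under multiplication by w.\<close>

lemma idl_basis:
  assumes I: "idl I"
  shows "\<exists>y a x c. lattice_basis I y a x c"
proof -
  obtain z where z: "z \<in> I" "z \<noteq> 0" "z \<in> R" using idl_nonzero[OF I] .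
  have zI: "of_nat (nm z) \<in> I" unfolding nm[OF z(3)]
    using idl_mult_right[OF I R_cnj[OF z(3)] z(1)] .
  have nmz: "nm z > 0" using nm_eq_0[OF z(3)] z(2) by simp
  define A where "A = (LEAST n. n > 0 \<and> of_nat n \<in> I)"
  have A: "A > 0" "of_nat A \<in> I" using LeastI[of "\<lambda>n. n > 0 \<and> of_nat n \<in> I" "nm z"] zI nmz
    unfolding A_def by auto
  have A_min: "A \<le> n" if "n > 0" "of_nat n \<in> I" for n
    unfolding A_def using that by (intro Least_le) simp
  have int_mult: "of_int k * u \<in> I" if "u \<in> I" for k u
    using idl_mult[OF I R_of_int that] .
  have A_dvd: "int A dvd n" if n: "of_int n \<in> I" for n
  proof -
    have "of_int (n mod int A) = (of_int n - of_int (n div int A) * of_nat A :: complex)"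
      by (metis minus_div_mult_eq_mod of_int_diff of_int_mult of_int_of_nat_eq)
    moreover have "of_int n - of_int (n div int A) * of_nat A \<in> I"
      by (intro idl_diff[OF I] n int_mult A)
    ultimately have mI: "of_int (n mod int A) \<in> I" by simp
    have "n mod int A = 0"
    proof (rule ccontr)
      assume "n mod int A \<noteq> 0"
      then have pos: "n mod int A > 0" "n mod int A < int A"
        using A(1) pos_mod_sign[of "int A" n] pos_mod_bound[of "int A" n] by linarith+
      have "of_nat (nat (n mod int A)) \<in> I" using mI pos by (simp add: of_nat_nat)
      then have "A \<le> nat (n mod int A)" using pos by (intro A_min) auto
      then show False using pos by linarith
    qed
    then show ?thesis by auto
  qed
  define Y where "Y = (LEAST n. n > 0 \<and> (\<exists>i. of_int i + of_nat n * w \<in> I))"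
  have ex: "\<exists>i. of_int i + of_nat A * w \<in> I"
    using idl_mult_right[OF I R_w A(2)] by (intro exI[of _ 0]) simp
  have "Y > 0 \<and> (\<exists>i. of_int i + of_nat Y * w \<in> I)" unfolding Y_def
    by (rule LeastI[of "\<lambda>n. n > 0 \<and> (\<exists>i. of_int i + of_nat n * w \<in> I)" A]) (use ex A(1) in simp)
  then obtain X0 where Y: "Y > 0" "of_int X0 + of_nat Y * w \<in> I" by auto
  have Y_min: "Y \<le> n" if "n > 0" "of_int i + of_nat n * w \<in> I" for n i
    unfolding Y_def using that by (intro Least_le) auto
  have Y_dvd: "int Y dvd j" if ij: "of_int i + of_int j * w \<in> I" for i j
  proof -
    have "of_int (i - j div int Y * X0) + of_int (j mod int Y) * w
        = (of_int i + of_int j * w) - of_int (j div int Y) * (of_int X0 + of_nat Y * w)"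
      by (simp add: algebra_simps flip: minus_div_mult_eq_mod)
    moreover have "(of_int i + of_int j * w) - of_int (j div int Y) * (of_int X0 + of_nat Y * w) \<in> I"
      by (intro idl_diff[OF I] ij int_mult Y)
    ultimately have mI: "of_int (i - j div int Y * X0) + of_int (j mod int Y) * w \<in> I" by (simp only:)
    have "j mod int Y = 0"
    proof (rule ccontr)
      assume "j mod int Y \<noteq> 0"
      then have pos: "j mod int Y > 0" "j mod int Y < int Y"
        using Y(1) pos_mod_sign[of "int Y" j] pos_mod_bound[of "int Y" j] by linarith+
      have e: "of_nat (nat (j mod int Y)) = (of_int (j mod int Y) :: complex)" using pos by (simp add: of_nat_nat)
      have "of_int (i - j div int Y * X0) + of_nat (nat (j mod int Y)) * w \<in> I"
        unfolding e by (rule mI)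
      then have "Y \<le> nat (j mod int Y)" by (rule Y_min[rotated]) (use pos in simp)
      then show False using pos by linarith
    qed
    then show ?thesis by auto
  qed
  have "int Y dvd int A" using Y_dvd[of 0 "int A"] idl_mult_right[OF I R_w A(2)] by simp
  then obtain a where a: "int A = int Y * a" by blast
  have a0: "a > 0" using a A(1) Y(1) by (metis of_nat_0_less_iff zero_less_mult_pos)
  have "(of_int X0 + of_nat Y * w) * w = of_int X0 * w + of_nat Y * (w * w)" by (simp add: algebra_simps)
  also have "\<dots> = of_int (- int Y * nw) + of_int (X0 + int Y * tw) * w"
    unfolding w_sq by (simp add: algebra_simps)
  finally have "of_int (- int Y * nw) + of_int (X0 + int Y * tw) * w \<in> I"
    using idl_mult_right[OF I R_w Y(2)] by simp
  then have "int Y dvd X0 + int Y * tw" by (rule Y_dvd)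
  then have "int Y dvd X0" by (simp add: dvd_add_left_iff)
  then obtain x where x: "X0 = int Y * x" by blast
  have gen: "of_int X0 + of_nat Y * w = of_int (int Y) * (of_int x + w)"
    unfolding x by (simp add: algebra_simps)
  have xwR: "of_int x + w \<in> R" by (intro R_add) auto
  have "of_int (int Y * int (nm (of_int x + w))) = of_int (int Y) * ((of_int x + w) * cnj (of_int x + w))"
    using nm[OF xwR] by simp
  also have "\<dots> = (of_int X0 + of_nat Y * w) * cnj (of_int x + w)" unfolding gen by (simp only: mult.assoc)
  also have "\<dots> \<in> I" by (rule idl_mult_right[OF I R_cnj[OF xwR] Y(2)])
  finally have "int A dvd int Y * int (nm (of_int x + w))" by (rule A_dvd)
  then have "a dvd int (nm (of_int x + w))" using Y(1) unfolding a by simp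
  then obtain c where c: "int (nm (of_int x + w)) = a * c" by blast
  \<comment> \<open>Such a p would give (x + w) / p an integral trace and norm, although its
    coordinate at w is 1 / p.\<close>
  have prim: "\<not> (p dvd a \<and> p dvd 2 * x + tw \<and> p dvd c)" if p: "prime p" for p
  proof
    assume d: "p dvd a \<and> p dvd 2 * x + tw \<and> p dvd c"
    have p0: "(of_int p :: complex) \<noteq> 0" using p by auto
    let ?z = "(of_int x + w) / of_int p"
    obtain t where t: "2 * x + tw = p * t" using d by blast
    obtain a' c' where ac: "a = p * a'" "c = p * c'" using d by blast
    have "?z + cnj ?z = of_int (2 * x) / of_int p + (w + cnj w) / of_int p"
      by (simp add: add_divide_distrib del: complex_add_cnj)
    also have "\<dots> = of_int (2 * x + tw) / of_int p" by (simp add: w_trace add_divide_distrib)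
    also have "\<dots> = of_int t" unfolding t using p0 by simp
    finally have 1: "?z + cnj ?z = of_int t" .
    have "?z * cnj ?z = ((of_int x + w) * cnj (of_int x + w)) / of_int (p * p)" by simp
    also have "(of_int x + w) * cnj (of_int x + w) = of_int (a * c)"
      using nm[OF xwR] c by (metis of_int_of_nat_eq)
    also have "a * c = (p * p) * (a' * c')" unfolding ac by simp
    also have "of_int (p * p * (a' * c')) / of_int (p * p) = (of_int (a' * c') :: complex)" using p0 by simp
    finally have 2: "?z * cnj ?z = of_int (a' * c')" .
    have "?z \<in> K" using xwR by (intro K_divide R_K) auto
    then have "?z \<in> R" unfolding R_iff 1 2 by simp
    then obtain i j where "?z = of_int i + of_int j * w" by (auto simp: R_basis)
    then have "of_int x + of_int 1 * w = of_int (p * i) + of_int (p * j) * w"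
      using p0 by (simp add: field_simps)
    then have "1 = p * j" using basis_unique by blast
    then show False using p by (metis dvd_triv_left not_prime_unit)
  qed
  have "I = {of_int (int Y) * (of_int (i * a + j * x) + of_int j * w) | i j. True}" (is "_ = ?B")
  proof
    show "?B \<subseteq> I"
    proof
      fix u assume "u \<in> ?B"
      then obtain i j where "u = of_int (int Y) * (of_int (i * a + j * x) + of_int j * w)" by auto
      also have "\<dots> = of_int i * of_int (int A) + of_int j * (of_int X0 + of_nat Y * w)"
        unfolding a gen by (simp add: algebra_simps)
      also have "\<dots> \<in> I" by (intro idl_add[OF I] int_mult Y(2)) (use A(2) in simp)
      finally show "u \<in> I" .
    qed
    show "I \<subseteq> ?B"
    proof
      fix u assume u: "u \<in> I"
      then obtain i j where ij: "u = of_int i + of_int j * w" using idl_R[OF I u] by (auto simp: R_basis)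
      obtain j' where j': "j = int Y * j'" using Y_dvd u ij by blast
      have "of_int (i - j' * X0) = u - of_int j' * (of_int X0 + of_nat Y * w)"
        unfolding ij j' by (simp add: algebra_simps)
      also have "\<dots> \<in> I" by (intro idl_diff[OF I] u int_mult Y)
      finally have "int A dvd i - j' * X0" by (rule A_dvd)
      then obtain i' where i': "i - j' * X0 = int Y * a * i'" using a by (metis dvdE)
      have "i = int Y * (i' * a + j' * x)" using i' unfolding x by (simp add: algebra_simps)
      then have "u = of_int (int Y) * (of_int (i' * a + j' * x) + of_int j' * w)"
        unfolding ij j' by (simp add: algebra_simps)
      then show "u \<in> ?B" by blast
    qed
  qed
  then have "lattice_basis I (int Y) a x c" unfolding lattice_basis_def using Y(1) a0 c prim by simp
  then show ?thesis by blast
qed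

lemma bezout3:
  fixes a b c :: int
  assumes "\<And>p. prime p \<Longrightarrow> \<not> (p dvd a \<and> p dvd b \<and> p dvd c)"
  obtains u v t where "u * a + v * b + t * c = 1"
proof -
  have "gcd a (gcd b c) = 1"
  proof (rule ccontr)
    assume "gcd a (gcd b c) \<noteq> 1"
    then have "\<not> is_unit (gcd a (gcd b c))" by simp
    then obtain p where "prime p" "p dvd gcd a (gcd b c)" using prime_divisor_exists[of "gcd a (gcd b c)"]
      by (metis gcd_eq_0_iff assms dvd_0_right two_is_prime_nat prime_nat_int_transfer)
    then show False using assms[of p] by auto
  qed
  then obtain u v where 1: "u * a + v * gcd b c = 1" using bezout_int by metis
  obtain x y where 2: "x * b + y * c = gcd b c" using bezout_int by metis
  have "u * a + (v * x) * b + (v * y) * c = u * a + v * (x * b + y * c)" by (simp add: algebra_simps)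
  then show ?thesis using that 1 2 by metis
qed

text \<open>The cosets are represented by i + j w with i below y a and j below y. The product with
  the conjugate is generated by y^2 times a^2, a (x + w), a (x + cnj w) and a c; primitivity of the
  form turns this into y^2 a times the whole ring.\<close>

lemma idl_basis_norm:
  assumes I: "idl I" and basis: "lattice_basis I y a x c"
  shows "int (N I) = a * y\<^sup>2" "I \<odot> cnj ` I = pid (of_nat (N I))"
proof -
  have y: "y > 0" and a: "a > 0" and c: "int (nm (of_int x + w)) = a * c"
    and prim: "\<And>p. prime p \<Longrightarrow> \<not> (p dvd a \<and> p dvd 2 * x + tw \<and> p dvd c)"
    and I_eq: "I = {of_int y * (of_int (i * a + j * x) + of_int j * w) | i j. True}"
    using basis unfolding lattice_basis_def by blast+
  define S :: "complex set" where "S = (\<lambda>(i, j). of_int i + of_int j * w) ` ({0..<y * a} \<times> {0..<y})"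
  have inj: "inj_on (\<lambda>(i, j). of_int i + of_int j * w) ({0..<y * a} \<times> {0..<y})"
    using basis_unique by (auto intro!: inj_onI)
  have "N I = card S"
  proof (rule card_cosets[OF _ _ _ I])
    show "S \<subseteq> R" by (auto simp: S_def)
    show "\<exists>u\<in>S. r - u \<in> I" if r: "r \<in> R" for r
    proof -
      obtain i j where ij: "r = of_int i + of_int j * w" using r by (auto simp: R_basis)
      define j' where "j' = j div y"
      define i1 where "i1 = i - j' * y * x"
      define i' where "i' = i1 div (y * a)"
      define u where "u = of_int (i1 mod (y * a)) + of_int (j mod y) * w"
      have "y * a > 0" using y a by simp
      then have "u \<in> S" unfolding u_def S_def using y
        by (intro image_eqI[of _ _ "(i1 mod (y * a), j mod y)"]) auto
      have 1: "j = y * j' + j mod y" unfolding j'_def by simp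
      have 2: "i = y * a * i' + i1 mod (y * a) + y * j' * x" unfolding i'_def by (simp add: i1_def)
      have "of_int j = of_int y * of_int j' + (of_int (j mod y) :: complex)"
        by (subst 1) (simp only: of_int_add of_int_mult)
      moreover have "of_int i = of_int y * of_int a * of_int i' + of_int (i1 mod (y * a)) + (of_int y * of_int j' * of_int x :: complex)"
        by (subst 2) (simp only: of_int_add of_int_mult)
      ultimately have "r - u = of_int y * (of_int (i' * a + j' * x) + of_int j' * w)"
        unfolding ij u_def by (simp add: algebra_simps)
      then have "r - u \<in> I" unfolding I_eq by blast
      with \<open>u \<in> S\<close> show ?thesis by blast
    qed
    show "u = v" if u: "u \<in> S" and v: "v \<in> S" and uv: "u - v \<in> I" for u v
    proof -
      obtain i j where i: "u = of_int i + of_int j * w" "0 \<le> i" "i < y * a" "0 \<le> j" "j < y"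
        using u by (auto simp: S_def)
      obtain i' j' where i': "v = of_int i' + of_int j' * w" "0 \<le> i'" "i' < y * a" "0 \<le> j'" "j' < y"
        using v by (auto simp: S_def)
      obtain k l where kl: "u - v = of_int y * (of_int (k * a + l * x) + of_int l * w)"
        using uv unfolding I_eq by auto
      have "of_int (i - i') + of_int (j - j') * w = of_int (y * (k * a + l * x)) + of_int (y * l) * w"
        using kl unfolding i(1) i'(1) by (simp add: algebra_simps)
      then have e: "i - i' = y * (k * a + l * x)" "j - j' = y * l" using basis_unique by blast+
      have "y dvd j - j'" using e by simp
      moreover have "\<bar>j - j'\<bar> < y" using i i' by linarith
      ultimately have j0: "j - j' = 0" using y by (meson dvd_imp_le_int leD zero_less_abs_iff not_le dvd_abs_iff zdvd_imp_le abs_of_pos)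
      then have "l = 0" using e y by simp
      then have "y * a dvd i - i'" using e by simp
      moreover have "\<bar>i - i'\<bar> < y * a" using i i' by linarith
      ultimately have "i - i' = 0" using zdvd_imp_le[of "y * a" "\<bar>i - i'\<bar>"] by (cases "i = i'") auto
      then show ?thesis using j0 i(1) i'(1) by simp
    qed
  qed
  also have "card S = card ({0..<y * a} \<times> {0..<y})" unfolding S_def by (rule card_image[OF inj])
  also have "\<dots> = nat (y * a) * nat y" by simp
  finally show n: "int (N I) = a * y\<^sup>2" using y a by (simp add: power2_eq_square)
  have nn: "of_nat (N I) = (of_int (a * y\<^sup>2) :: complex)" using n by (metis of_int_of_nat_eq)
  have xw: "(of_int x + w) * (of_int x + cnj w) = of_int (a * c)"
  proof -
    have "of_int x + w \<in> R" by (intro R_add) auto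
    from nm[OF this] show ?thesis using c by (metis complex_cnj_add complex_cnj_of_int of_int_of_nat_eq)
  qed
  show "I \<odot> cnj ` I = pid (of_nat (N I))"
  proof
    show "I \<odot> cnj ` I \<subseteq> pid (of_nat (N I))"
    proof (rule imul_subsetI)
      fix u v assume u: "u \<in> I" and v: "v \<in> cnj ` I"
      obtain i j where i: "u = of_int y * (of_int (i * a + j * x) + of_int j * w)" using u unfolding I_eq by auto
      obtain v' where v': "v' \<in> I" "v = cnj v'" using v by auto
      obtain k l where "v' = of_int y * (of_int (k * a + l * x) + of_int l * w)" using v'(1) unfolding I_eq by auto
      then have k: "v = cnj (of_int y * (of_int (k * a + l * x) + of_int l * w))" using v'(2) by simp
      let ?r = "of_int (i * k * a + j * l * c) + of_int (i * l) * (of_int x + cnj w) + of_int (j * k) * (of_int x + w)"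
      have "u * v = of_int y ^ 2 * (of_int (i * a) + of_int j * (of_int x + w)) *
          (of_int (k * a) + of_int l * (of_int x + cnj w))"
        unfolding i k by (simp add: algebra_simps power2_eq_square)
      also have "\<dots> = of_int y ^ 2 * (of_int (i * a * k * a) + of_int (i * l * a) * (of_int x + cnj w)
          + of_int (j * k * a) * (of_int x + w) + of_int (j * l) * ((of_int x + w) * (of_int x + cnj w)))"
        by (simp add: algebra_simps)
      also have "\<dots> = of_nat (N I) * ?r" unfolding xw nn by (simp add: algebra_simps)
      finally have e: "u * v = of_nat (N I) * ?r" .
      show "u * v \<in> pid (of_nat (N I))" unfolding e by (intro pid_memI R_add R_mult) auto
    qed (rule pid_add)
    have J: "idl (I \<odot> cnj ` I)" by (intro idl_imul idl_cnj I)
    have g1: "of_int (y * a) \<in> I" unfolding I_eq by (intro CollectI exI[of _ 1] exI[of _ 0]) simp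
    have g2: "of_int y * (of_int x + w) \<in> I" unfolding I_eq by (intro CollectI exI[of _ 0] exI[of _ 1]) simp
    obtain u v t where uvt: "u * a + v * (2 * x + tw) + t * c = 1" using bezout3 prim by metis
    have c1: "of_int (y * a) \<in> cnj ` I" using g1 by (metis complex_cnj_of_int imageI)
    have c2: "of_int y * (of_int x + cnj w) \<in> cnj ` I" using imageI[OF g2, of cnj] by simp
    \<comment> \<open>The Bezout relation between the coefficients of the form, carried over to the
      generators: a^2, the sum of the two mixed products and the norm a c of x + w have the weights
      u, v, t.\<close>
    have "of_int u * (of_int (y * a) * of_int (y * a)) + of_int v * (of_int (y * a) * (of_int y * (of_int x + cnj w))
        + of_int y * (of_int x + w) * of_int (y * a)) + of_int t * (of_int y * (of_int x + w) * (of_int y * (of_int x + cnj w))) \<in> I \<odot> cnj ` I"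
      (is "?e \<in> _")
      by (intro idl_add[OF J] idl_mult[OF J] imul_prod g1 g2 c1 c2 R_of_int)
    moreover have "?e = of_nat (N I)"
    proof -
      have "?e = of_int (y ^ 2) * (of_int (u * a * a) + of_int (v * a) * (2 * of_int x + (w + cnj w)) + of_int t * ((of_int x + w) * (of_int x + cnj w)))"
        by (simp add: algebra_simps power2_eq_square)
      also have "\<dots> = of_int (y ^ 2 * a * (u * a + v * (2 * x + tw) + t * c))"
        unfolding w_trace xw by (simp add: algebra_simps)
      finally show ?thesis unfolding uvt nn by (simp add: mult.commute)
    qed
    ultimately have nI: "of_nat (N I) \<in> I \<odot> cnj ` I" by simp
    show "pid (of_nat (N I)) \<subseteq> I \<odot> cnj ` I"
      using idl_mult_right[OF J _ nI] by (auto simp: pid_iff)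
  qed
qed

lemma N_pos: assumes "idl I" shows "N I > 0"
proof -
  obtain y a x c where b: "lattice_basis I y a x c" using idl_basis[OF assms] by blast
  then have "y > 0" "a > 0" by (auto simp: lattice_basis_def)
  then show ?thesis using idl_basis_norm(1)[OF assms b]
    by (metis of_nat_0_less_iff mult_pos_pos zero_less_power)
qed

lemma imul_cnj_N: assumes "idl I" shows "I \<odot> cnj ` I = pid (of_nat (N I))"
  using idl_basis[OF assms] idl_basis_norm(2)[OF assms] by blast

end

text \<open>Modulo a prime the values a, c and a + b + c at (1, 0), (0, 1) and (1, 1) cannot all
  vanish. The Chinese remainder theorem glues good arguments for the primes dividing M.\<close>

lemma primitive_form_coprime:
  fixes a b c :: int and M :: nat
  assumes prim: "\<And>p. prime p \<Longrightarrow> \<not> (p dvd a \<and> p dvd b \<and> p dvd c)" and M: "M > 0"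
  obtains i j :: nat where "coprime (a * int i ^ 2 + b * int i * int j + c * int j ^ 2) (int M)"
proof -
  define Q where "Q = (\<lambda>i j :: nat. a * int i ^ 2 + b * int i * int j + c * int j ^ 2)"
  have "\<exists>i j. \<not> int p dvd Q i j" if p: "prime p" for p
  proof (rule ccontr)
    assume "\<not> ?thesis"
    then have "int p dvd Q 1 0" "int p dvd Q 0 1" "int p dvd Q 1 1" by auto
    then have 1: "int p dvd a" "int p dvd c" "int p dvd a + b + c" by (auto simp: Q_def)
    have "int p dvd (a + b + c) - (a + c)" by (rule dvd_diff[OF 1(3) dvd_add[OF 1(1,2)]])
    then have "int p dvd b" by (simp add: algebra_simps)
    then show False using prim[of "int p"] 1 p by simp
  qed
  then obtain f g where fg: "\<And>p. prime p \<Longrightarrow> \<not> int p dvd Q (f p) (g p)" by metis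
  let ?P = "prime_factors M"
  have cop: "\<forall>i\<in>?P. \<forall>j\<in>?P. i \<noteq> j \<longrightarrow> coprime i j" by (auto intro: primes_coprime)
  obtain i where i: "\<forall>p\<in>?P. [i = f p] (mod p)" using chinese_remainder_nat[of ?P "\<lambda>p. p" f] cop by auto
  obtain j where j: "\<forall>p\<in>?P. [j = g p] (mod p)" using chinese_remainder_nat[of ?P "\<lambda>p. p" g] cop by auto
  have "coprime (Q i j) (int M)"
  proof (rule ccontr)
    assume "\<not> coprime (Q i j) (int M)"
    then have "\<not> is_unit (gcd (Q i j) (int M))" by (simp add: coprime_iff_gcd_eq_1)
    then obtain q where q: "prime q" "q dvd gcd (Q i j) (int M)"
      using prime_divisor_exists[of "gcd (Q i j) (int M)"] M by auto
    define p where "p = nat q"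
    have qp: "q = int p" using prime_ge_0_int[OF q(1)] by (simp add: p_def)
    have p: "q = int p" "prime p" using q(1) unfolding qp by simp_all
    then have "p \<in> ?P" using q M by (simp add: in_prime_factors_iff)
    then have "[int i = int (f p)] (mod int p)" "[int j = int (g p)] (mod int p)"
      using i j by (auto simp: cong_int_iff)
    then have "[Q i j = Q (f p) (g p)] (mod int p)" unfolding Q_def
      by (intro cong_add cong_mult cong_pow cong_refl)
    then have "int p dvd Q (f p) (g p)" using q(2) p(1) by (simp add: cong_dvd_iff)
    then show False using fg[OF p(2)] by simp
  qed
  then show ?thesis using that unfolding Q_def by blast
qed

section \<open>Cancellation, division and finiteness of ideal classes\<close>

context iqf
begin

lemma pid_subset: "idl I \<Longrightarrow> a \<in> I \<Longrightarrow> pid a \<subseteq> I"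
  by (auto simp: pid_iff intro: idl_mult_right)

lemma N_mem: assumes "idl I" shows "of_nat (N I) \<in> I"
proof -
  have "of_nat (N I) \<in> I \<odot> cnj ` I" unfolding imul_cnj_N[OF assms] by simp
  then show ?thesis using imul_subset_left[OF assms idl_cnj[OF assms]] by blast
qed

lemma pid_nat_inj: assumes e: "pid (of_nat m) = pid (of_nat n)" shows "m = n"
proof -
  have dvd: "n dvd m" if e: "pid (of_nat m) = pid (of_nat n)" for m n
  proof -
    have "of_nat m \<in> pid (of_nat n)" unfolding e[symmetric] by simp
    then obtain r where r: "r \<in> R" "of_nat m = of_nat n * r" by (auto simp: pid_iff)
    have "nm (of_nat m) = nm (of_nat n) * nm r" unfolding r(2) by (rule nm_mult) (use r in auto)
    then have "n ^ 2 dvd m ^ 2" by (simp add: nm_of_nat)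
    then show ?thesis by simp
  qed
  show ?thesis by (rule dvd_antisym[OF dvd[OF e[symmetric]] dvd[OF e]])
qed

lemma N_eqI: "idl I \<Longrightarrow> I \<odot> cnj ` I = pid (of_nat n) \<Longrightarrow> N I = n"
  using imul_cnj_N pid_nat_inj by metis

lemma N_R [simp]: "N R = 1"
  by (rule N_eqI) (simp_all add: idl_unit)

text \<open>By \<open>N_eqI\<close> the norm is determined by the product of an ideal with its
  conjugate, and this product is multiplicative.\<close>

lemma N_mult: assumes A: "idl A" and B: "idl B" shows "N (A \<odot> B) = N A * N B"
proof (rule N_eqI[OF idl_imul[OF A B]])
  have "A \<odot> B \<odot> cnj ` (A \<odot> B) = (A \<odot> cnj ` A) \<odot> (B \<odot> cnj ` B)"
    unfolding imul_cnj by (simp only: imul_ac)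
  then show "A \<odot> B \<odot> cnj ` (A \<odot> B) = pid (of_nat (N A * N B))"
    unfolding imul_cnj_N[OF A] imul_cnj_N[OF B] pid_mult by simp
qed

lemma N_pid: assumes "a \<in> R" "a \<noteq> 0" shows "N (pid a) = nm a"
  by (rule N_eqI[OF idl_pid[OF assms]]) (simp add: pid_cnj pid_mult nm[OF assms(1)])

lemma N_cnj: assumes "idl I" shows "N (cnj ` I) = N I"
  by (rule N_eqI[OF idl_cnj[OF assms]]) (simp add: imul_comm[of _ I] imul_cnj_N[OF assms])

lemma N_1: "idl I \<Longrightarrow> N I = 1 \<Longrightarrow> I = R"
  using N_mem idl_one by (metis of_nat_1)

text \<open>Multiplication by the conjugate of A turns A into the nonzero scalar N A.\<close>

lemma imul_cancel:
  assumes A: "idl A" and B: "idl B" and C: "idl C"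
    and e: "A \<odot> B = A \<odot> C"
  shows "B = C"
proof -
  have "(*) (of_nat (N A)) ` Z = cnj ` A \<odot> (A \<odot> Z)" if "idl Z" for Z
    using imul_pid[OF that, of "of_nat (N A)"] unfolding imul_cnj_N[OF A, symmetric] by (simp only: imul_ac)
  then have "(*) (of_nat (N A) :: complex) ` B = (*) (of_nat (N A)) ` C" using B C e by metis
  moreover have "inj ((*) (of_nat (N A) :: complex))" using N_pos[OF A] by (auto intro!: injI)
  ultimately show ?thesis by (simp add: inj_image_eq_iff)
qed

text \<open>The cofactor is A times the conjugate of B, divided by N B. The division is exact
  because A lies in B and B times its conjugate is generated by N B.\<close>

lemma idl_dvd:
  assumes A: "idl A" and B: "idl B" and AB: "A \<subseteq> B"
  obtains C where "idl C" "A = B \<odot> C"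
proof -
  define n :: complex where "n = of_nat (N B)"
  have n0: "n \<noteq> 0" using N_pos[OF B] by (simp add: n_def)
  define J where "J = A \<odot> cnj ` B"
  have J: "idl J" unfolding J_def by (intro idl_imul A idl_cnj B)
  have Jn: "J \<subseteq> pid n"
    unfolding J_def n_def imul_cnj_N[OF B, symmetric] by (rule imul_mono[OF AB subset_refl])
  define C where "C = {x \<in> R. n * x \<in> J}"
  have nC: "(*) n ` C = J" using Jn unfolding C_def by (force simp: pid_iff)
  obtain z where z: "z \<in> J" "z \<noteq> 0" using idl_nonzero[OF J] by metis
  then obtain z' where z': "z' \<in> C" "z = n * z'" using nC by auto
  have C: "idl C"
  proof (rule idlI[of _ z'])
    show "x + y \<in> C" if "x \<in> C" "y \<in> C" for x y
      using that idl_add[OF J] by (auto simp: C_def distrib_left)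
    show "r * x \<in> C" if "r \<in> R" "x \<in> C" for r x
      using that idl_mult[OF J, of r "n * x"] by (auto simp: C_def mult.left_commute)
  qed (use z z' in \<open>auto simp: C_def\<close>)
  have "(*) n ` (B \<odot> C) = J \<odot> B" using imul_scale[of n C B] nC by (simp add: imul_comm)
  also have "\<dots> = (B \<odot> cnj ` B) \<odot> A" unfolding J_def by (simp only: imul_ac)
  also have "\<dots> = (*) n ` A" unfolding imul_cnj_N[OF B] using imul_pid[OF A] by (simp add: n_def)
  finally have "(*) n ` (B \<odot> C) = (*) n ` A" .
  moreover have "inj ((*) n)" using n0 by (auto intro!: injI)
  ultimately have "B \<odot> C = A" by (simp add: inj_image_eq_iff)
  then show ?thesis using that C by blast
qed

lemma N_dvd: assumes "idl A" "idl B" "A \<subseteq> B" shows "N B dvd N A"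
proof -
  obtain C where C: "idl C" "A = B \<odot> C" by (rule idl_dvd[OF assms])
  have "N A = N B * N C" unfolding C(2) by (rule N_mult[OF assms(2) C(1)])
  then show ?thesis by simp
qed

lemma N_dvd_nm: assumes "idl I" "a \<in> I" shows "N I dvd nm a"
proof (cases "a = 0")
  case True
  then show ?thesis by (simp add: nm_def)
next
  case False
  have a: "a \<in> R" using assms idl_R by blast
  show ?thesis using N_dvd[OF idl_pid[OF a False] assms(1) pid_subset[OF assms]] N_pid[OF a False] by simp
qed

lemma pid_eqD:
  assumes "pid a = pid b" "b \<noteq> 0" "b \<in> R"
  obtains u where "u \<in> R" "nm u = 1" "a = b * u"
proof -
  have "a \<in> pid b" "b \<in> pid a" 
    using pid_mem[of a] pid_mem[of b] unfolding assms(1) by simp_all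
  then obtain u v where u: "u \<in> R" "a = b * u" and v: "v \<in> R" "b = a * v" unfolding pid_iff by blast
  have "b * (u * v) = b * 1" unfolding mult.assoc[symmetric] u(2)[symmetric] v(2)[symmetric] by simp
  then have "u * v = 1" using assms(2) by simp
  then have "nm u * nm v = nm 1" using nm_mult u(1) v(1) by metis
  then have "nm u * nm v = 1" using nm_of_nat[of 1] by simp
  then show ?thesis using that u by simp
qed

lemma unit_cnj: "u \<in> R \<Longrightarrow> nm u = 1 \<Longrightarrow> u * cnj u = 1"
  using nm[of u] by simp

lemma pid_unit: assumes "u \<in> R" "nm u = 1" shows "pid u = R"
proof (rule idl_one)
  show "idl (pid u)"
    by (rule idl_pid[OF assms(1)]) (use assms(2) nm_eq_0[OF assms(1)] in simp)
  show "1 \<in> pid u" using pid_memI[OF R_cnj[OF assms(1)], of u] unit_cnj[OF assms] by simp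
qed

definition ipow :: "complex set \<Rightarrow> nat \<Rightarrow> complex set" where "ipow A k = ((\<odot>) A ^^ k) R"

lemma ipow_0 [simp]: "ipow A 0 = R" and ipow_Suc: "ipow A (Suc k) = A \<odot> ipow A k"
  by (simp_all add: ipow_def)

lemma idl_ipow: "idl A \<Longrightarrow> idl (ipow A k)"
  by (induct k) (simp_all add: idl_unit ipow_Suc idl_imul)

lemma ipow_add: "idl A \<Longrightarrow> ipow A (m + n) = ipow A m \<odot> ipow A n"
  by (induct m) (simp_all add: idl_ipow ipow_Suc imul_assoc)

lemma ipow_1: "idl A \<Longrightarrow> ipow A 1 = A"
  by (simp add: ipow_Suc)

lemma ipow_imul: "idl A \<Longrightarrow> idl B \<Longrightarrow> ipow (A \<odot> B) n = ipow A n \<odot> ipow B n"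
  by (induct n) (simp_all add: idl_unit ipow_Suc imul_ac)

lemma ipow_mult: "idl A \<Longrightarrow> ipow A (m * n) = ipow (ipow A m) n"
  by (induct n) (simp_all add: ipow_Suc ipow_add)

lemma N_ipow: "idl A \<Longrightarrow> N (ipow A n) = N A ^ n"
  by (induct n) (simp_all add: ipow_Suc N_mult idl_ipow)

lemma ipow_pid: "ipow (pid a) n = pid (a ^ n)"
  by (induct n) (simp_all add: ipow_Suc pid_mult)

lemma ipow_cnj: "cnj ` ipow A n = ipow (cnj ` A) n"
  by (induct n) (simp_all add: ipow_Suc imul_cnj)

lemma coprime_idealsI:
  "idl A \<Longrightarrow> idl B \<Longrightarrow> a \<in> A \<Longrightarrow> b \<in> B \<Longrightarrow> a + b = 1 \<Longrightarrow> coprime_ideals K A B"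
  using coprime_ideals_iff by blast

lemma coprime_idealsE:
  assumes "coprime_ideals K A B" "idl A" "idl B"
  obtains a b where "a \<in> A" "b \<in> B" "a + b = 1"
  using assms(1) unfolding coprime_ideals_iff[OF assms(2,3)] using that by blast

lemma coprime_R: "idl \<mm> \<Longrightarrow> coprime_ideals K R \<mm>"
  by (rule coprime_idealsI[OF idl_unit _ R_1 idl_0]) auto

lemma coprime_imul:
  assumes "coprime_ideals K A \<mm>" "coprime_ideals K B \<mm>"
    and A: "idl A" and B: "idl B" and m: "idl \<mm>"
  shows "coprime_ideals K (A \<odot> B) \<mm>"
proof -
  obtain a c where ac: "a \<in> A" "c \<in> \<mm>" "a + c = 1" by (rule coprime_idealsE[OF assms(1) A m])
  obtain b d where bd: "b \<in> B" "d \<in> \<mm>" "b + d = 1" by (rule coprime_idealsE[OF assms(2) B m])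
  have "a * b + (a * d + c) = a * (b + d) + c" by (simp add: algebra_simps)
  then have 1: "a * b + (a * d + c) = 1" using ac bd by simp
  have "a * d + c \<in> \<mm>" using idl_add[OF m] idl_mult[OF m] ac bd idl_R[OF A] by blast
  then show ?thesis using coprime_idealsI[OF idl_imul[OF A B] m imul_prod[OF ac(1) bd(1)] _ 1] by blast
qed

lemma coprime_mono:
  assumes "coprime_ideals K A \<mm>" "idl A" "idl \<mm>" "idl \<nn>" "\<mm> \<subseteq> \<nn>"
  shows "coprime_ideals K A \<nn>"
  using assms(1,5) unfolding coprime_ideals_iff[OF assms(2,3)] coprime_ideals_iff[OF assms(2,4)] by blast

lemma coprime_mono_left:
  assumes "coprime_ideals K A \<mm>" "idl A" "idl \<mm>" "idl B" "A \<subseteq> B"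
  shows "coprime_ideals K B \<mm>"
  using assms(1,5) unfolding coprime_ideals_iff[OF assms(2,3)] coprime_ideals_iff[OF assms(4,3)] by blast

lemma coprime_cnj:
  assumes "coprime_ideals K A \<mm>" and A: "idl A" and m: "idl \<mm>"
  shows "coprime_ideals K (cnj ` A) (cnj ` \<mm>)"
proof -
  obtain a c where ac: "a \<in> A" "c \<in> \<mm>" "a + c = 1" by (rule coprime_idealsE[OF assms(1) A m])
  have "cnj a + cnj c = 1" using ac(3) by (metis complex_cnj_add complex_cnj_one)
  then show ?thesis
    using coprime_idealsI[OF idl_cnj[OF A] idl_cnj[OF m] imageI[OF ac(1)] imageI[OF ac(2)]] by blast
qed

lemma coprime_ipow:
  "coprime_ideals K A \<mm> \<Longrightarrow> idl A \<Longrightarrow> idl \<mm> \<Longrightarrow> coprime_ideals K (ipow A n) \<mm>"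
  by (induct n) (simp_all add: coprime_R ipow_Suc coprime_imul idl_ipow)

text \<open>One direction is Bezout, as N A lies in A. For the other, an element of A congruent to 1
  modulo M has norm congruent to 1 modulo M, and N A divides that norm.\<close>

lemma coprime_nat_iff:
  assumes A: "idl A" and M: "M > 0"
  shows "coprime_ideals K A (pid (of_nat M)) \<longleftrightarrow> coprime (N A) M"
proof
  have m: "idl (pid (of_nat M))" using M by (intro idl_pid) auto
  show "coprime_ideals K A (pid (of_nat M))" if cop: "coprime (N A) M"
  proof -
    have "coprime (int (N A)) (int M)" using cop by simp
    then obtain u v where "u * int (N A) + v * int M = 1" using bezout_int[of "int (N A)" "int M"] by auto
    then have "of_int (u * int (N A) + v * int M) = (1 :: complex)" by simp
    then have e: "of_int u * of_nat (N A) + of_nat M * of_int v = (1 :: complex)" by (simp add: mult.commute)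
    show ?thesis
      by (rule coprime_idealsI[OF A m _ _ e]) (auto intro: idl_mult[OF A] N_mem[OF A] pid_memI)
  qed
  show "coprime (N A) M" if cop: "coprime_ideals K A (pid (of_nat M))"
  proof -
    obtain a b where ab: "a \<in> A" "b \<in> pid (of_nat M)" "a + b = 1"
      by (rule coprime_idealsE[OF cop A m])
    then obtain r where r: "r \<in> R" "b = of_nat M * r" by (auto simp: pid_iff)
    have a: "a = 1 - of_nat M * r" using ab(3) unfolding r(2) by (simp add: algebra_simps)
    have aR: "a \<in> R" using A ab(1) by (rule idl_R)
    have "of_nat (nm a) = a * cnj a" using nm[OF aR] .
    also have "\<dots> = 1 - of_nat M * (r + cnj r) + of_nat M ^ 2 * (r * cnj r)"
      unfolding a by (simp add: algebra_simps power2_eq_square)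
    also have "\<dots> = of_int (1 - int M * tr r + int M ^ 2 * int (nm r))"
      unfolding tr[OF r(1), symmetric] nm[OF r(1), symmetric] by simp
    finally have "of_int (int (nm a)) = (of_int (1 - int M * tr r + int M ^ 2 * int (nm r)) :: complex)" by simp
    then have "int (nm a) = 1 - int M * tr r + int M ^ 2 * int (nm r)" by (simp only: of_int_eq_iff)
    then have e: "int (nm a) = 1 - int M * (tr r - int M * int (nm r))" by (simp add: algebra_simps power2_eq_square)
    have "coprime (int (nm a)) (int M)"
    proof (rule coprimeI)
      fix c assume c: "c dvd int (nm a)" "c dvd int M"
      then have "c dvd int (nm a) + int M * (tr r - int M * int (nm r))" by simp
      then show "is_unit c" unfolding e by simp
    qed
    then have "coprime (nm a) M" by simp
    then show ?thesis using N_dvd_nm[OF A ab(1)] coprime_divisors[of "N A" "nm a" M M] by auto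
  qed
qed

text \<open>For \<xi> in I the quotient nm \<xi> / N I is a value of the primitive form attached to
  I, and such a form takes values prime to M. Thus I can be moved, within inverse classes, to an
  ideal C of norm prime to M.\<close>

lemma coprime_N_representative:
  assumes I: "idl I" and M: "M > 0"
  obtains \<xi> C where "\<xi> \<in> R" "\<xi> \<noteq> 0" "idl C" "pid \<xi> = I \<odot> C" "coprime (N C) M"
proof -
  obtain y a x c where b: "lattice_basis I y a x c" using idl_basis[OF I] by blast
  then have y: "y > 0" and a: "a > 0" and c: "int (nm (of_int x + w)) = a * c"
    and prim: "\<And>p. prime p \<Longrightarrow> \<not> (p dvd a \<and> p dvd 2 * x + tw \<and> p dvd c)"
    and I_eq: "I = {of_int y * (of_int (i * a + j * x) + of_int j * w) | i j. True}"
    unfolding lattice_basis_def by blast+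
  obtain i j :: nat where ij: "coprime (a * int i ^ 2 + (2 * x + tw) * int i * int j + c * int j ^ 2) (int M)"
    (is "coprime ?Q _") using primitive_form_coprime[OF prim M] by blast
  define z where "z = of_int (int i * a + int j * x) + of_int (int j) * w"
  define \<xi> where "\<xi> = of_int y * z"
  have z: "z \<in> R" unfolding z_def by auto
  have \<xi>R: "\<xi> \<in> R" unfolding \<xi>_def using z by auto
  have \<xi>I: "\<xi> \<in> I" unfolding \<xi>_def z_def I_eq by blast
  have "x ^ 2 + x * tw + nw = a * c" using nm_basis[of x 1] c by simp
  then have nwe: "nw = a * c - x ^ 2 - x * tw" by simp
  have "int (nm z) = a * ?Q" unfolding z_def nm_basis unfolding nwe
    by (simp add: algebra_simps power2_eq_square)
  moreover have "int (nm (of_int y)) = y ^ 2" by (simp add: nm_of_int)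
  moreover have "nm \<xi> = nm (of_int y) * nm z" unfolding \<xi>_def by (rule nm_mult) (use z in auto)
  ultimately have "int (nm \<xi>) = (a * y ^ 2) * ?Q" by simp
  then have nmQ: "int (nm \<xi>) = int (N I) * ?Q" using idl_basis_norm(1)[OF I b] by simp
  show ?thesis
  proof (cases "\<xi> = 0")
    \<comment> \<open>The form is positive definite, but the arguments found may be (0, 0). Then 0
      is prime to M, so M = 1 and any nonzero element of I will do.\<close>
    case True
    then have "int (N I) * ?Q = 0" using nmQ by (simp add: nm_def)
    then have "?Q = 0" using N_pos[OF I] by simp
    then have "M = 1" using ij by simp
    moreover obtain t where t: "t \<in> I" "t \<noteq> 0" "t \<in> R" using idl_nonzero[OF I] .
    obtain C where "idl C" "pid t = I \<odot> C"
      by (rule idl_dvd[OF idl_pid[OF t(3,2)] I pid_subset[OF I t(1)]])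
    ultimately show ?thesis using that t by simp
  next
    case False
    obtain C where C: "idl C" "pid \<xi> = I \<odot> C"
      by (rule idl_dvd[OF idl_pid[OF \<xi>R False] I pid_subset[OF I \<xi>I]])
    have "nm \<xi> = N I * N C" using N_pid[OF \<xi>R False] N_mult[OF I C(1)] C(2) by simp
    then have "int (N I) * int (N C) = int (N I) * ?Q" using nmQ by simp
    then have "int (N C) = ?Q" using N_pos[OF I] by simp
    then have "coprime (int (N C)) (int M)" using ij by simp
    then show ?thesis using that \<xi>R False C by simp
  qed
qed


text \<open>Pigeonhole: more than N I integers i + j w have coordinates between 0 and the square
  root of N I, so two of them differ by an element of I. Its norm is bounded by 2 + nw times N I,
  the constant coming from the norm form.\<close>

lemma small_element:
  obtains B where "\<And>I. idl I \<Longrightarrow> \<exists>a\<in>I. a \<noteq> 0 \<and> nm a \<le> B * N I"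
proof
  fix I assume I: "idl I"
  define n where "n = N I"
  define M where "M = nat \<lfloor>sqrt (real n)\<rfloor>"
  have M1: "real M \<le> sqrt (real n)" and M2: "sqrt (real n) < real M + 1"
    unfolding M_def by (simp_all add: of_nat_nat)
  have "real M ^ 2 \<le> real n" using power_mono[OF M1, of 2] by simp
  then have Mle: "M ^ 2 \<le> n" by (metis of_nat_le_iff of_nat_power)
  have "real n < (real M + 1) ^ 2" using power_strict_mono[OF M2, of 2] by simp
  then have Mgt: "n < (M + 1) ^ 2" by (metis of_nat_1 of_nat_add of_nat_less_iff of_nat_power)
  define f where "f = (\<lambda>(i :: int, j :: int). of_int i + of_int j * w)"
  let ?S = "{0..int M} \<times> {0..int M}"
  have "\<not> inj_on (rclass I \<circ> f) ?S"
  proof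
    assume inj: "inj_on (rclass I \<circ> f) ?S"
    have "card ?S \<le> card (rclass I ` R)"
    proof (rule card_inj_on_le[OF inj])
      show "(rclass I \<circ> f) ` ?S \<subseteq> rclass I ` R" by (auto simp: f_def)
      show "finite (rclass I ` R)" using N_pos[OF I] unfolding N_rclass by (rule card_ge_0_finite)
    qed
    moreover have "card ?S = (M + 1) ^ 2" by (simp add: power2_eq_square nat_add_distrib)
    ultimately show False using Mgt unfolding N_rclass[symmetric] n_def by simp
  qed
  then obtain p q where pq: "p \<in> ?S" "q \<in> ?S" "p \<noteq> q" "rclass I (f p) = rclass I (f q)"
    unfolding inj_on_def by auto
  obtain i j i' j' where p: "p = (i, j)" and q: "q = (i', j')" by (cases p, cases q)
  note ij = pq[unfolded p q]
  define a where "a = of_int (i - i') + of_int (j - j') * w"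
  have "f (i, j) - f (i', j') \<in> I" using ij(4) rclass_eq_iff[OF I] by simp
  then have aI: "a \<in> I" by (simp add: f_def a_def algebra_simps)
  have a0: "a \<noteq> 0"
  proof
    assume "a = 0"
    then have "of_int (i - i') + of_int (j - j') * w = of_int 0 + of_int 0 * w" by (simp add: a_def)
    then have "i - i' = 0" "j - j' = 0" using basis_unique by blast+
    then show False using ij(3) by simp
  qed
  let ?u = "i - i'" and ?v = "j - j'"
  have uv: "\<bar>?u\<bar> \<le> int M" "\<bar>?v\<bar> \<le> int M" using ij(1,2) by auto
  have le: "\<bar>x * y\<bar> \<le> int n" if "\<bar>x\<bar> \<le> int M" "\<bar>y\<bar> \<le> int M" for x y
  proof -
    have "\<bar>x * y\<bar> \<le> int M * int M" unfolding abs_mult using that by (intro mult_mono) auto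
    moreover have "int M * int M \<le> int n" using Mle by (metis of_nat_le_iff of_nat_mult power2_eq_square)
    ultimately show ?thesis by linarith
  qed
  have t: "tw = 0 \<or> tw = 1" and nw: "nw \<ge> 0" by (auto simp: tw_def nw_def)
  have "int (nm a) = ?u * ?u + ?u * ?v * tw + nw * (?v * ?v)"
    unfolding a_def nm_basis by (simp add: power2_eq_square)
  also have "\<dots> \<le> int n + int n + nw * int n"
  proof (intro add_mono mult_left_mono)
    show "?u * ?u \<le> int n" using le[OF uv(1) uv(1)] by linarith
    show "?u * ?v * tw \<le> int n" using le[OF uv(1) uv(2)] t by auto
    show "?v * ?v \<le> int n" using le[OF uv(2) uv(2)] by linarith
  qed (use nw in auto)
  also have "\<dots> = int ((2 + nat nw) * n)" using nw by (simp add: algebra_simps)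
  finally have "nm a \<le> (2 + nat nw) * n" by linarith
  then show "\<exists>a\<in>I. a \<noteq> 0 \<and> nm a \<le> (2 + nat nw) * N I" using aI a0 unfolding n_def by blast
qed

lemma N_mult_mem: assumes "idl I" "N I dvd n" "r \<in> R" shows "of_nat n * r \<in> I"
proof -
  obtain k where k: "n = N I * k" using assms(2) by blast
  have e: "of_nat n * r = of_nat (N I) * (of_nat k * r)" unfolding k by simp
  show ?thesis unfolding e using assms(3) by (intro idl_mult_right[OF assms(1)] N_mem[OF assms(1)] R_mult) auto
qed

lemma finite_residues: fixes n :: nat assumes "n > 0"
  obtains S where "finite S" "S \<subseteq> R" "\<forall>r\<in>R. \<exists>u\<in>S. \<exists>t\<in>R. r = u + of_nat n * t"
proof -
  let ?S = "(\<lambda>(i :: int, j :: int). of_int i + of_int j * w) ` ({0..<int n} \<times> {0..<int n})"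
  show ?thesis
  proof (rule that[of ?S], goal_cases)
    case 3
    show ?case
    proof
    fix r assume "r \<in> R"
    then obtain i j where ij: "r = of_int i + of_int j * w" by (auto simp: R_basis)
    let ?u = "of_int (i mod int n) + of_int (j mod int n) * w"
    let ?t = "of_int (i div int n) + of_int (j div int n) * w"
    have "i = i mod int n + int n * (i div int n)" "j = j mod int n + int n * (j div int n)" by simp_all
    then have "of_int i = (of_int (i mod int n) + of_nat n * of_int (i div int n) :: complex)"
      "of_int j = (of_int (j mod int n) + of_nat n * of_int (j div int n) :: complex)"
      by (metis of_int_add of_int_mult of_int_of_nat_eq)+
    then have "r = ?u + of_nat n * ?t" unfolding ij by (simp add: algebra_simps)
    moreover have "?u \<in> ?S" using assms by (intro image_eqI[of _ _ "(i mod int n, j mod int n)"]) auto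
    moreover have "?t \<in> R" by auto
    ultimately show "\<exists>u\<in>?S. \<exists>t\<in>R. r = u + of_nat n * t" by blast
    qed
  qed auto
qed

text \<open>All these ideals contain n R for n = B!, so each is determined by its members in a
  finite residue system modulo n.\<close>

lemma finite_bounded_norm: "finite {I. idl I \<and> N I \<le> B}"
proof -
  define n where "n = (fact B :: nat)"
  have n: "n > 0" by (simp add: n_def)
  obtain S where S: "finite S" "S \<subseteq> R" "\<forall>r\<in>R. \<exists>u\<in>S. \<exists>t\<in>R. r = u + of_nat n * t"
    by (rule finite_residues[OF n])
  let ?J = "{I. idl I \<and> N I \<le> B}"
  have "inj_on (\<lambda>I. I \<inter> S) ?J"
  proof (rule inj_onI)
    have sub: "I \<subseteq> J" if I: "idl I" "N I \<le> B" and J: "idl J" "N J \<le> B"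
      and e: "I \<inter> S = J \<inter> S" for I J
    proof
      fix x assume x: "x \<in> I"
      obtain u t where ut: "u \<in> S" "t \<in> R" "x = u + of_nat n * t" using S(3) idl_R[OF I(1) x] by blast
      have "N I dvd n" "N J dvd n" unfolding n_def using I J N_pos by (auto intro!: dvd_fact simp: Suc_le_eq)
      then have m: "of_nat n * t \<in> I" "of_nat n * t \<in> J" using N_mult_mem I(1) J(1) ut(2) by auto
      have "u = x - of_nat n * t" using ut(3) by simp
      then have "u \<in> I" using idl_diff[OF I(1) x m(1)] by simp
      then have "u \<in> J" using e ut(1) by blast
      then show "x \<in> J" unfolding ut(3) by (rule idl_add[OF J(1) _ m(2)])
    qed
    show "I = J" if "I \<in> ?J" "J \<in> ?J" "I \<inter> S = J \<inter> S" for I J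
      using that sub[of I J] sub[of J I] by auto
  qed
  moreover have "finite ((\<lambda>I. I \<inter> S) ` ?J)" by (rule finite_subset[of _ "Pow S"]) (use S(1) in auto)
  ultimately show ?thesis by (rule finite_imageD[rotated])
qed

text \<open>Each power of I has a complement J of bounded norm making the product principal. Two
  powers share the same J, and cancelling it makes the power with the difference of the exponents
  principal.\<close>

lemma finite_class_order:
  assumes I: "idl I"
  obtains k \<alpha> where "k > 0" "\<alpha> \<in> R" "\<alpha> \<noteq> 0" "ipow I k = pid \<alpha>"
proof -
  obtain B where B: "\<And>I. idl I \<Longrightarrow> \<exists>a\<in>I. a \<noteq> 0 \<and> nm a \<le> B * N I"
    using small_element by blast
  have "\<exists>a J. a \<in> R \<and> a \<noteq> 0 \<and> idl J \<and> N J \<le> B \<and> pid a = ipow I n \<odot> J" for n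
  proof -
    have In: "idl (ipow I n)" by (rule idl_ipow[OF I])
    obtain a where a: "a \<in> ipow I n" "a \<noteq> 0" "nm a \<le> B * N (ipow I n)" using B[OF In] by blast
    have aR: "a \<in> R" by (rule idl_R[OF In a(1)])
    obtain J where J: "idl J" "pid a = ipow I n \<odot> J"
      by (rule idl_dvd[OF idl_pid[OF aR a(2)] In pid_subset[OF In a(1)]])
    have "nm a = N (ipow I n) * N J" using N_pid[OF aR a(2)] N_mult[OF In J(1)] J(2) by simp
    then have "N (ipow I n) * N J \<le> N (ipow I n) * B" using a(3) by (simp add: mult.commute)
    then have "N J \<le> B" using N_pos[OF In] by simp
    then show ?thesis using aR a J by blast
  qed
  then obtain a J where aJ: "\<And>n. a n \<in> R" "\<And>n. a n \<noteq> 0" "\<And>n. idl (J n)" "\<And>n. N (J n) \<le> B"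
    "\<And>n. pid (a n) = ipow I n \<odot> J n" by metis
  have "\<not> inj J"
  proof
    assume "inj J"
    then have "infinite (range J)" by (rule range_inj_infinite)
    moreover have "range J \<subseteq> {I. idl I \<and> N I \<le> B}" using aJ by auto
    ultimately show False using finite_bounded_norm finite_subset by blast
  qed
  then obtain m' n' where "J m' = J n'" "m' \<noteq> n'" by (auto simp: inj_def)
  then obtain m n where mn: "J m = J n" "m < n" by (metis linorder_neqE_nat)
  define k where "k = n - m"
  have n: "n = k + m" "k > 0" using mn by (simp_all add: k_def)
  have "pid (a n) = ipow I k \<odot> (ipow I m \<odot> J m)"
    unfolding aJ(5)[of n] mn(1) unfolding n(1) ipow_add[OF I] imul_assoc by (rule refl)
  then have e: "pid (a n) = ipow I k \<odot> pid (a m)" unfolding aJ(5) .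
  have "a n \<in> ipow I k \<odot> pid (a m)" unfolding e[symmetric] by simp
  then have "a n \<in> pid (a m)"
    using imul_subset_right[OF idl_ipow[OF I] idl_pid[OF aJ(1,2)]] by blast
  then obtain \<alpha> where \<alpha>: "\<alpha> \<in> R" "a n = a m * \<alpha>" by (auto simp: pid_iff)
  have \<alpha>0: "\<alpha> \<noteq> 0" using \<alpha>(2) aJ(2)[of n] by auto
  have "pid (a m) \<odot> pid \<alpha> = pid (a m) \<odot> ipow I k"
    unfolding pid_mult \<alpha>(2)[symmetric] e by (rule imul_comm)
  then have "pid \<alpha> = ipow I k"
    by (rule imul_cancel[OF idl_pid[OF aJ(1,2)] idl_pid[OF \<alpha>(1) \<alpha>0] idl_ipow[OF I]])
  then show ?thesis using that n(2) \<alpha>(1) \<alpha>0 by simp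
qed

lemma coprime_element_inverse:
  assumes "coprime_ideals K (pid \<alpha>) \<mm>" "\<alpha> \<in> R" "\<alpha> \<noteq> 0" "idl \<mm>"
  obtains \<beta> where "\<beta> \<in> R" "\<alpha> * \<beta> - 1 \<in> \<mm>"
proof -
  obtain a b where ab: "a \<in> pid \<alpha>" "b \<in> \<mm>" "a + b = 1"
    by (rule coprime_idealsE[OF assms(1) idl_pid[OF assms(2,3)] assms(4)])
  obtain \<beta> where \<beta>: "\<beta> \<in> R" "a = \<alpha> * \<beta>" using ab(1) by (auto simp: pid_iff)
  have "\<alpha> * \<beta> - 1 = - b" using ab(3) \<beta>(2) by (metis diff_add_cancel diff_diff_add diff_self minus_diff_eq diff_0)
  then show ?thesis using that[OF \<beta>(1)] idl_uminus[OF assms(4) ab(2)] by simp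
qed

text \<open>Two powers of \<alpha> agree modulo M by the pigeonhole principle, and \<alpha> is
  invertible modulo M.\<close>

lemma power_cong_one:
  assumes cop: "coprime_ideals K (pid \<alpha>) (pid (of_nat M))"
    and \<alpha>: "\<alpha> \<in> R" "\<alpha> \<noteq> 0" and M: "M > 0"
  obtains k where "k > 0" "\<alpha> ^ k - 1 \<in> pid (of_nat M)"
proof -
  let ?m = "pid (of_nat M)"
  have m: "idl ?m" using M by (intro idl_pid) auto
  obtain S where S: "finite S" "S \<subseteq> R" "\<forall>r\<in>R. \<exists>u\<in>S. \<exists>t\<in>R. r = u + of_nat M * t"
    by (rule finite_residues[OF M])
  have "\<exists>u\<in>S. \<alpha> ^ n - u \<in> ?m" for n
  proof -
    obtain u t where ut: "u \<in> S" "t \<in> R" "\<alpha> ^ n = u + of_nat M * t"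
      using S(3) R_power[OF \<alpha>(1)] by blast
    have e: "\<alpha> ^ n - u = of_nat M * t" using ut(3) by simp
    have "\<alpha> ^ n - u \<in> ?m" unfolding e by (rule pid_memI[OF ut(2)])
    then show ?thesis using ut(1) by blast
  qed
  then obtain u where u: "\<And>n. u n \<in> S" "\<And>n. \<alpha> ^ n - u n \<in> ?m" by metis
  have "\<not> inj u"
  proof
    assume "inj u"
    then have "infinite (range u)" by (rule range_inj_infinite)
    moreover have "range u \<subseteq> S" using u(1) by auto
    ultimately show False using finite_subset[OF _ S(1)] by blast
  qed
  then obtain i' j' where "u i' = u j'" "i' \<noteq> j'" by (auto simp: inj_def)
  then obtain i j where ij: "u i = u j" "i < j" by (metis linorder_neqE_nat)
  define k where "k = j - i"
  have j: "j = i + k" "k > 0" using ij by (simp_all add: k_def)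
  have "(\<alpha> ^ j - u j) - (\<alpha> ^ i - u i) \<in> ?m" by (intro idl_diff[OF m] u)
  then have e: "\<alpha> ^ i * (\<alpha> ^ k - 1) \<in> ?m" using ij(1) unfolding j(1) by (simp add: power_add algebra_simps)
  obtain \<beta> where \<beta>: "\<beta> \<in> R" "\<alpha> * \<beta> - 1 \<in> ?m" by (rule coprime_element_inverse[OF cop \<alpha> m])
  have cancel: "x \<in> R \<Longrightarrow> \<alpha> ^ n * x \<in> ?m \<Longrightarrow> x \<in> ?m" for n x
  proof (induct n)
    case (Suc n)
    have n: "\<alpha> ^ n * x \<in> R" using Suc(2) \<alpha>(1) by (intro R_mult R_power)
    have "\<beta> * (\<alpha> ^ Suc n * x) - (\<alpha> * \<beta> - 1) * (\<alpha> ^ n * x) \<in> ?m"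
      by (rule idl_diff[OF m idl_mult[OF m \<beta>(1) Suc(3)] idl_mult_right[OF m n \<beta>(2)]])
    moreover have "\<beta> * (\<alpha> ^ Suc n * x) - (\<alpha> * \<beta> - 1) * (\<alpha> ^ n * x) = \<alpha> ^ n * x"
      by (simp add: algebra_simps)
    ultimately have "\<alpha> ^ n * x \<in> ?m" by (simp only:)
    then show ?case by (rule Suc(1)[OF Suc(2)])
  qed simp
  have "\<alpha> ^ k - 1 \<in> R" using \<alpha>(1) by (intro R_diff R_power) auto
  from cancel[OF this e] show ?thesis using that j(2) by blast
qed

text \<open>The order in the class group is multiplied by the order of the generator modulo M. On
  the resulting ideal a Hecke character has the known value \<alpha>^l.\<close>

lemma finite_ray_class_order:
  assumes I: "idl I" and M: "M > 0" and cop: "coprime (N I) M"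
  obtains k \<alpha> where "k > 0" "\<alpha> \<in> R" "\<alpha> \<noteq> 0" "ipow I k = pid \<alpha>"
    "\<alpha> - 1 \<in> pid (of_nat M)"
proof -
  obtain k \<alpha> where k: "k > 0" "\<alpha> \<in> R" "\<alpha> \<noteq> 0" "ipow I k = pid \<alpha>" by (rule finite_class_order[OF I])
  have "coprime (N (ipow I k)) M" using cop unfolding N_ipow[OF I] by simp
  then have "coprime_ideals K (pid \<alpha>) (pid (of_nat M))"
    unfolding k(4) by (subst coprime_nat_iff[OF idl_pid[OF k(2,3)] M])
  then obtain j where j: "j > 0" "\<alpha> ^ j - 1 \<in> pid (of_nat M)"
    by (rule power_cong_one[OF _ k(2,3) M])
  have "ipow I (k * j) = pid (\<alpha> ^ j)" unfolding ipow_mult[OF I] k(4) ipow_pid ..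
  then show ?thesis using that[of "k * j" "\<alpha> ^ j"] k j by auto
qed

end

section \<open>Fractional ideals and Hecke characters\<close>

lemma scale_scale: "(*) a ` (*) b ` A = (*) (a * b) ` (A :: complex set)"
  by (simp add: image_image mult.assoc)

lemma scale_1 [simp]: "(*) 1 ` A = (A :: complex set)"
  by simp

lemma imul_scale_right: "A \<odot> (*) c ` B = (*) c ` (A \<odot> B)"
  using imul_scale[of c B A] by (simp add: imul_comm)

context iqf
begin

lemma fractional_ideal_iff:
  "fractional_ideal K I \<longleftrightarrow> (\<exists>A c. idl A \<and> c \<in> R \<and> c \<noteq> 0 \<and> I = (*) (inverse c) ` A)"
proof -
  have "(\<lambda>x. x / c) ` A = (*) (inverse c) ` A" for c :: complex and A
    by (rule image_cong) (auto simp: divide_inverse mult.commute)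
  then show ?thesis unfolding fractional_ideal_def by (simp only:)
qed

lemma fractional_integral: "idl A \<Longrightarrow> fractional_ideal K A"
  unfolding fractional_ideal_iff by (intro exI[of _ A] exI[of _ 1]) auto

lemma fractional_imul:
  assumes "fractional_ideal K I" "fractional_ideal K J" shows "fractional_ideal K (I \<odot> J)"
proof -
  obtain A c where A: "idl A" "c \<in> R" "c \<noteq> 0" "I = (*) (inverse c) ` A"
    using assms(1) unfolding fractional_ideal_iff by blast
  obtain B d where B: "idl B" "d \<in> R" "d \<noteq> 0" "J = (*) (inverse d) ` B"
    using assms(2) unfolding fractional_ideal_iff by blast
  have "I \<odot> J = (*) (inverse (c * d)) ` (A \<odot> B)"
    unfolding A(4) B(4) imul_scale imul_scale_right scale_scale inverse_mult_distrib
    by (simp only: mult.commute)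
  moreover have "c * d \<in> R" "c * d \<noteq> 0" using A B by auto
  ultimately show ?thesis using idl_imul[OF A(1) B(1)] unfolding fractional_ideal_iff by blast
qed

lemma fractional_R: "fractional_ideal K I \<Longrightarrow> R \<odot> I = I"
  unfolding fractional_ideal_iff by (auto simp: imul_scale_right)

text \<open>The inverse of A / c is c times the conjugate of A, divided by N A.\<close>

lemma fractional_inverse:
  assumes "fractional_ideal K I" obtains J where "fractional_ideal K J" "J \<odot> I = R"
proof -
  obtain A c where A: "idl A" "c \<in> R" "c \<noteq> 0" "I = (*) (inverse c) ` A"
    using assms(1) unfolding fractional_ideal_iff by blast
  have n: "(of_nat (N A) :: complex) \<noteq> 0" "of_nat (N A) \<in> R" using N_pos[OF A(1)] by auto
  let ?B = "pid c \<odot> cnj ` A"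
  let ?J = "(*) (inverse (of_nat (N A))) ` ?B"
  have B: "?B = (*) c ` cnj ` A" by (rule imul_pid[OF idl_cnj[OF A(1)]])
  have "idl ?B" by (intro idl_imul idl_pid idl_cnj A)
  then have J: "fractional_ideal K ?J" using n unfolding fractional_ideal_iff by blast
  have 1: "inverse (of_nat (N A)) * c * inverse c = inverse (of_nat (N A))" using A(3) by simp
  have "?J \<odot> I = (*) (inverse (of_nat (N A)) * c * inverse c) ` (cnj ` A \<odot> A)"
    unfolding A(4) B imul_scale imul_scale_right scale_scale by (simp only: ac_simps)
  also have "\<dots> = (*) (inverse (of_nat (N A))) ` (*) (of_nat (N A)) ` R"
    unfolding 1 imul_comm[of _ A] imul_cnj_N[OF A(1)] principal_ideal_def by (rule refl)
  also have "\<dots> = R" unfolding scale_scale using n by simp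
  finally show ?thesis using that J by blast
qed

lemma fractional_pid: assumes "\<alpha> \<in> K" "\<alpha> \<noteq> 0" shows "fractional_ideal K (pid \<alpha>)"
proof -
  obtain a n where an: "a \<in> R" "n > 0" "\<alpha> = a / of_nat n" by (rule R_divide_of_nat[OF assms(1)])
  have "pid \<alpha> = (*) (inverse (of_nat n)) ` pid a"
    unfolding principal_ideal_def scale_scale an(3) by (simp add: divide_inverse mult.commute)
  moreover have "idl (pid a)" using an assms(2) by (intro idl_pid) auto
  ultimately show ?thesis unfolding fractional_ideal_iff using an(2)
    by (intro exI[of _ "pid a"] exI[of _ "of_nat n"]) auto
qed

lemma frac_ideal_group_simps [simp]:
  "carrier (frac_ideal_group K) = {I. fractional_ideal K I}"
  "monoid.mult (frac_ideal_group K) A B = A \<odot> B" "one (frac_ideal_group K) = R"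
  by (simp_all add: frac_ideal_group_def)

lemma comm_group_frac_ideals: "comm_group (frac_ideal_group K)"
proof (rule comm_groupI)
  show "\<exists>y\<in>carrier (frac_ideal_group K). y \<otimes>\<^bsub>frac_ideal_group K\<^esub> x = \<one>\<^bsub>frac_ideal_group K\<^esub>"
    if "x \<in> carrier (frac_ideal_group K)" for x
  proof -
    have "fractional_ideal K x" using that by simp
    then obtain J where "fractional_ideal K J" "J \<odot> x = R" by (rule fractional_inverse)
    then show ?thesis by (intro bexI[of _ J]) simp_all
  qed
qed (simp_all add: fractional_imul fractional_integral[OF idl_unit] imul_assoc fractional_R, rule imul_comm)

lemma subgroup_principal: "subgroup (pid ` (K - {0})) (frac_ideal_group K)"
proof -
  interpret G: comm_group "frac_ideal_group K" by (rule comm_group_frac_ideals)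
  show ?thesis
  proof (rule G.subgroupI)
    show "pid ` (K - {0}) \<subseteq> carrier (frac_ideal_group K)" using fractional_pid by auto
    show "pid ` (K - {0}) \<noteq> {}" using K_1 by (metis DiffI empty_iff imageI singletonD zero_neq_one)
    show "inv\<^bsub>frac_ideal_group K\<^esub> a \<in> pid ` (K - {0})" if a: "a \<in> pid ` (K - {0})" for a
    proof -
      obtain x where x: "x \<in> K" "x \<noteq> 0" "a = pid x" using a by auto
      have "pid (inverse x) \<odot> a = R" unfolding x(3) pid_mult using x(2) by simp
      then have "inv\<^bsub>frac_ideal_group K\<^esub> a = pid (inverse x)"
        using x fractional_pid K_inverse by (intro G.inv_equality) auto
      then show ?thesis using x K_inverse by auto
    qed
    show "a \<otimes>\<^bsub>frac_ideal_group K\<^esub> b \<in> pid ` (K - {0})"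
      if ab: "a \<in> pid ` (K - {0})" "b \<in> pid ` (K - {0})" for a b
    proof -
      obtain x y where "x \<in> K" "x \<noteq> 0" "a = pid x" "y \<in> K" "y \<noteq> 0" "b = pid y"
        using ab by auto
      then show ?thesis by (auto simp: pid_mult)
    qed
  qed
qed

lemma frac_pow_integral:
  assumes "idl A" shows "A [^]\<^bsub>frac_ideal_group K\<^esub> (n :: nat) = ipow A n"
proof -
  interpret G: comm_group "frac_ideal_group K" by (rule comm_group_frac_ideals)
  show ?thesis by (induct n) (simp_all add: G.nat_pow_Suc ipow_Suc imul_comm)
qed

text \<open>Every fractional ideal becomes integral after multiplication by a principal ideal, so
  the condition on all classes can be tested on integral ideals. The generator \<beta> is integral
  since it lies in the power.\<close>

theorem exponent_dvd_iff:
  assumes "l \<ge> 1"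
  shows "group_exponent (class_group K) dvd l \<longleftrightarrow>
    (\<forall>A. idl A \<longrightarrow> (\<exists>\<beta>\<in>R. \<beta> \<noteq> 0 \<and> ipow A l = pid \<beta>))"
proof -
  define G where "G = frac_ideal_group K"
  define H where "H = pid ` (K - {0})"
  interpret G: comm_group G unfolding G_def by (rule comm_group_frac_ideals)
  have sub: "subgroup H G" unfolding H_def G_def by (rule subgroup_principal)
  interpret H: normal H G by (rule G.subgroup_imp_normal[OF sub])
  have C: "class_group K = G Mod H" by (simp add: class_group_def G_def H_def)
  interpret C: group "G Mod H" by (rule H.factorgroup_is_group)
  have coset_pow: "(H #>\<^bsub>G\<^esub> x) [^]\<^bsub>G Mod H\<^esub> l = H #>\<^bsub>G\<^esub> (x [^]\<^bsub>G\<^esub> l)" if "x \<in> carrier G" for x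
    by (rule hom_nat_pow[symmetric, OF H.r_coset_hom_Mod that G.group_axioms C.group_axioms])
  have "group_exponent (class_group K) dvd l \<longleftrightarrow> (\<forall>c\<in>carrier (G Mod H). c [^]\<^bsub>G Mod H\<^esub> l = \<one>\<^bsub>G Mod H\<^esub>)"
    unfolding group_exponent_def C Lcm_dvd_iff using C.pow_eq_id by auto
  also have "\<dots> \<longleftrightarrow> (\<forall>x\<in>carrier G. H #>\<^bsub>G\<^esub> (x [^]\<^bsub>G\<^esub> l) = H)"
    unfolding carrier_FactGroup using coset_pow by auto
  also have "\<dots> \<longleftrightarrow> (\<forall>x\<in>carrier G. x [^]\<^bsub>G\<^esub> l \<in> H)"
    using G.coset_join1[OF _ _ sub] G.coset_join2[OF _ sub] G.nat_pow_closed by blast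
  also have "\<dots> \<longleftrightarrow> (\<forall>A. idl A \<longrightarrow> ipow A l \<in> H)"
  proof
    assume "\<forall>x\<in>carrier G. x [^]\<^bsub>G\<^esub> l \<in> H"
    then show "\<forall>A. idl A \<longrightarrow> ipow A l \<in> H"
      using frac_pow_integral fractional_integral unfolding G_def by fastforce
  next
    assume int: "\<forall>A. idl A \<longrightarrow> ipow A l \<in> H"
    show "\<forall>x\<in>carrier G. x [^]\<^bsub>G\<^esub> l \<in> H"
    proof
      fix x assume x: "x \<in> carrier G"
      then obtain A c where A: "idl A" "c \<in> R" "c \<noteq> 0" "x = (*) (inverse c) ` A"
        unfolding G_def by (auto simp: fractional_ideal_iff)
      have c: "idl (pid c)" by (rule idl_pid[OF A(2,3)])
      have "pid c \<odot> x = A"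
        unfolding A(4) imul_scale_right imul_pid[OF A(1)] scale_scale using A(3) by simp
      then have "pid c \<otimes>\<^bsub>G\<^esub> x = A" unfolding G_def by simp
      moreover have cG: "pid c \<in> carrier G" using fractional_integral[OF c] unfolding G_def by simp
      ultimately have "(pid c [^]\<^bsub>G\<^esub> l) \<otimes>\<^bsub>G\<^esub> (x [^]\<^bsub>G\<^esub> l) = A [^]\<^bsub>G\<^esub> l"
        using G.nat_pow_distrib x by metis
      moreover have "A [^]\<^bsub>G\<^esub> l = ipow A l" "pid c [^]\<^bsub>G\<^esub> l = ipow (pid c) l"
        using frac_pow_integral A(1) c unfolding G_def by auto
      ultimately have e: "ipow (pid c) l \<otimes>\<^bsub>G\<^esub> (x [^]\<^bsub>G\<^esub> l) \<in> H" using int A(1) by simp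
      have cH: "ipow (pid c) l \<in> H" using int c by blast
      have "inv\<^bsub>G\<^esub> (ipow (pid c) l) \<otimes>\<^bsub>G\<^esub> (ipow (pid c) l \<otimes>\<^bsub>G\<^esub> (x [^]\<^bsub>G\<^esub> l)) \<in> H"
        by (rule H.m_closed[OF H.m_inv_closed[OF cH] e])
      moreover have "inv\<^bsub>G\<^esub> a \<otimes>\<^bsub>G\<^esub> (a \<otimes>\<^bsub>G\<^esub> y) = y" if "a \<in> carrier G" "y \<in> carrier G" for a y
        using that by (simp add: G.m_assoc[symmetric])
      ultimately show "x [^]\<^bsub>G\<^esub> l \<in> H" using H.mem_carrier[OF cH] G.nat_pow_closed[OF x] by simp
    qed
  qed
  also have "\<dots> \<longleftrightarrow> (\<forall>A. idl A \<longrightarrow> (\<exists>\<beta>\<in>R. \<beta> \<noteq> 0 \<and> ipow A l = pid \<beta>))"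
  proof -
    have "(\<exists>\<beta>\<in>R. \<beta> \<noteq> 0 \<and> ipow A l = pid \<beta>)" if A: "idl A" and h: "ipow A l \<in> H" for A
    proof -
      obtain \<beta> where b: "\<beta> \<noteq> 0" "ipow A l = pid \<beta>" using h unfolding H_def by auto
      have "\<beta> \<in> ipow A l" unfolding b(2) by simp
      then show ?thesis using idl_R[OF idl_ipow[OF A]] b by blast
    qed
    then show ?thesis unfolding H_def using R_K by blast
  qed
  finally show ?thesis .
qed

lemma prime_to_simps [simp]:
  "monoid.mult (ideals_prime_to K \<mm>) A B = A \<odot> B" "one (ideals_prime_to K \<mm>) = R"
  by (simp_all add: ideals_prime_to_def)

abbreviation prime_to :: "complex set \<Rightarrow> complex set \<Rightarrow> bool" where
  "prime_to \<mm> I \<equiv> I \<in> carrier (ideals_prime_to K \<mm>)"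

lemma prime_to_iff: "prime_to \<mm> I \<longleftrightarrow> fractional_ideal K I \<and> (\<exists>A B. idl A \<and> idl B \<and>
    coprime_ideals K A \<mm> \<and> coprime_ideals K B \<mm> \<and> I \<odot> B = A)"
  by (simp add: ideals_prime_to_def)

lemma prime_to_integral:
  assumes "idl A" "idl \<mm>" shows "prime_to \<mm> A \<longleftrightarrow> coprime_ideals K A \<mm>"
proof
  assume "prime_to \<mm> A"
  then obtain B C where B: "idl B" "coprime_ideals K B \<mm>" "idl C" "A \<odot> C = B"
    unfolding prime_to_iff by blast
  then have "B \<subseteq> A" using imul_subset_left assms(1) by blast
  then show "coprime_ideals K A \<mm>" using coprime_mono_left B assms by blast
next
  assume "coprime_ideals K A \<mm>"
  then show "prime_to \<mm> A" unfolding prime_to_iff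
    using assms fractional_integral coprime_R idl_unit imul_R' by blast
qed

lemma units_of_complex: "monoid.mult (units_of complex_ring) x y = x * y" "carrier (units_of complex_ring) = UNIV - {0}"
proof -
  show "monoid.mult (units_of complex_ring) x y = x * y" by (simp add: units_of_def)
  have "Units complex_ring = UNIV - {0}"
  proof -
    have "x \<in> Units complex_ring" if "x \<noteq> 0" for x
      using that unfolding Units_def by (auto intro!: exI[of _ "inverse x"])
    moreover have "0 \<notin> Units complex_ring" unfolding Units_def by auto
    ultimately show ?thesis by auto
  qed
  then show "carrier (units_of complex_ring) = UNIV - {0}" by (simp add: units_of_def)
qed

lemma hecke_character_iff:
  "hecke_character K l \<mm> \<psi> \<longleftrightarrow> idl \<mm> \<and> (\<forall>I. prime_to \<mm> I \<longleftrightarrow> \<psi> I \<noteq> 0) \<and>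
    (\<forall>I J. prime_to \<mm> I \<longrightarrow> prime_to \<mm> J \<longrightarrow> \<psi> (I \<odot> J) = \<psi> I * \<psi> J) \<and>
    (\<forall>\<alpha>\<in>K - {0}. cong_one K \<mm> \<alpha> \<longrightarrow> \<psi> (pid \<alpha>) = \<alpha> ^ l)"
  unfolding hecke_character_def hom_def units_of_complex prime_to_simps by auto

lemma hecke_R: assumes "hecke_character K l \<mm> \<psi>" shows "\<psi> R = 1"
proof -
  have m: "idl \<mm>" using assms unfolding hecke_character_iff by blast
  then have R: "prime_to \<mm> R" using prime_to_integral idl_unit coprime_R by blast
  then have "\<psi> (R \<odot> R) = \<psi> R * \<psi> R" "\<psi> R \<noteq> 0" using assms unfolding hecke_character_iff by blast+
  then show ?thesis using idl_unit by simp
qed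

lemma hecke_coprime_nonzero:
  "hecke_character K l \<mm> \<psi> \<Longrightarrow> idl A \<Longrightarrow> \<psi> A \<noteq> 0 \<longleftrightarrow> coprime_ideals K A \<mm>"
  unfolding hecke_character_iff using prime_to_integral by blast

lemma hecke_mult:
  "hecke_character K l \<mm> \<psi> \<Longrightarrow> \<psi> I \<noteq> 0 \<Longrightarrow> \<psi> J \<noteq> 0 \<Longrightarrow> \<psi> (I \<odot> J) = \<psi> I * \<psi> J"
  unfolding hecke_character_iff by blast

lemma hecke_ipow:
  assumes h: "hecke_character K l \<mm> \<psi>" and A: "idl A" "\<psi> A \<noteq> 0"
  shows "\<psi> (ipow A n) = \<psi> A ^ n"
  by (induct n) (simp_all add: hecke_R[OF h] ipow_Suc hecke_mult[OF h] A)

text \<open>The defining condition on principal ideals, applied to a / b and cleared of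
  denominators.\<close>

lemma hecke_cong:
  assumes h: "hecke_character K l \<mm> \<psi>" and ab: "a \<in> R" "b \<in> R" "a \<noteq> 0" "b \<noteq> 0" "a - b \<in> \<mm>"
    and cop: "coprime_ideals K (pid a) \<mm>" "coprime_ideals K (pid b) \<mm>"
  shows "\<psi> (pid a) * b ^ l = \<psi> (pid b) * a ^ l"
proof -
  let ?\<alpha> = "a / b"
  have \<alpha>: "?\<alpha> \<in> K" "?\<alpha> \<noteq> 0" using ab R_K by auto
  have "cong_one K \<mm> ?\<alpha>" unfolding cong_one_def using ab cop by blast
  then have v: "\<psi> (pid ?\<alpha>) = ?\<alpha> ^ l" using h \<alpha> unfolding hecke_character_iff by blast
  then have "\<psi> (pid ?\<alpha>) \<noteq> 0" using \<alpha> by simp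
  moreover have "\<psi> (pid b) \<noteq> 0" using hecke_coprime_nonzero[OF h] idl_pid ab cop by blast
  ultimately have "\<psi> (pid ?\<alpha> \<odot> pid b) = ?\<alpha> ^ l * \<psi> (pid b)"
    using hecke_mult[OF h] v by metis
  then have "\<psi> (pid a) = ?\<alpha> ^ l * \<psi> (pid b)" unfolding pid_mult using ab by simp
  then show ?thesis using ab by (simp add: power_divide)
qed

text \<open>A fractional ideal prime to \<mm> is a quotient of integral ideals A, B prime to \<mm>,
  and receives the value g A / g B. Multiplicativity makes this independent of the quotient, so only
  integral ideals have to be treated when a character is constructed.\<close>

lemma hecke_character_extend:
  assumes m: "idl \<mm>"
    and g0: "\<And>A. idl A \<Longrightarrow> coprime_ideals K A \<mm> \<Longrightarrow> g A \<noteq> 0"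
    and g: "\<And>A B. idl A \<Longrightarrow> idl B \<Longrightarrow> coprime_ideals K A \<mm> \<Longrightarrow>
      coprime_ideals K B \<mm> \<Longrightarrow> g (A \<odot> B) = g A * g B"
    and cong: "\<And>a b. a \<in> R \<Longrightarrow> b \<in> R \<Longrightarrow> a \<noteq> 0 \<Longrightarrow> b \<noteq> 0 \<Longrightarrow> coprime_ideals K (pid a) \<mm> \<Longrightarrow>
      coprime_ideals K (pid b) \<mm> \<Longrightarrow> a - b \<in> \<mm> \<Longrightarrow>
      g (pid a) * b ^ l = g (pid b) * a ^ l"
  obtains \<psi> where "hecke_character K l \<mm> \<psi>"
    "\<And>A. idl A \<Longrightarrow> coprime_ideals K A \<mm> \<Longrightarrow> \<psi> A = g A"
proof -
  define rep where "rep = (\<lambda>I A B. idl A \<and> idl B \<and>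
    coprime_ideals K A \<mm> \<and> coprime_ideals K B \<mm> \<and> I \<odot> B = A)"
  have pt: "prime_to \<mm> I \<longleftrightarrow> fractional_ideal K I \<and> (\<exists>A B. rep I A B)" for I
    unfolding prime_to_iff rep_def ..
  have "\<exists>z. \<forall>A B. rep I A B \<longrightarrow> z = g A / g B" for I
  proof (cases "\<exists>A B. rep I A B")
    case True
    then obtain A B where r: "rep I A B" by blast
    have "g A / g B = g A' / g B'" if r': "rep I A' B'" for A' B'
    proof -
      have "A \<odot> B' = A' \<odot> B" using r r' unfolding rep_def by (metis imul_assoc imul_comm)
      then have "g A * g B' = g A' * g B" using g r r' unfolding rep_def by metis
      moreover have "g B \<noteq> 0" "g B' \<noteq> 0" using g0 r r' unfolding rep_def by blast+
      ultimately show ?thesis by (simp add: frac_eq_eq)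
    qed
    then show ?thesis by blast
  qed blast
  then obtain z where z: "\<And>I A B. rep I A B \<Longrightarrow> z I = g A / g B" by metis
  define \<psi> where "\<psi> = (\<lambda>I. if prime_to \<mm> I then z I else 0)"
  have val: "\<psi> I = g A / g B" if "fractional_ideal K I" "rep I A B" for I A B
    using that z pt unfolding \<psi>_def by auto
  have gR: "g R = 1"
  proof -
    have "g (R \<odot> R) = g R * g R" "g R \<noteq> 0" using g g0 idl_unit coprime_R[OF m] by blast+
    then show ?thesis using idl_unit by simp
  qed
  have vali: "\<psi> A = g A" if "idl A" "coprime_ideals K A \<mm>" for A
  proof -
    have "rep A A R" unfolding rep_def using that idl_unit coprime_R[OF m] by simp
    from val[OF fractional_integral[OF that(1)] this] show ?thesis by (simp add: gR)
  qed
  have "hecke_character K l \<mm> \<psi>" unfolding hecke_character_iff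
  proof (intro conjI allI impI ballI)
    show "prime_to \<mm> I \<longleftrightarrow> \<psi> I \<noteq> 0" for I
    proof
      assume "prime_to \<mm> I"
      then obtain A B where AB: "fractional_ideal K I" "rep I A B" unfolding pt by blast
      then have "g A \<noteq> 0" "g B \<noteq> 0" using g0 unfolding rep_def by blast+
      then show "\<psi> I \<noteq> 0" unfolding val[OF AB] by simp
    qed (auto simp: \<psi>_def split: if_splits)
    show "\<psi> (I \<odot> J) = \<psi> I * \<psi> J" if IJ: "prime_to \<mm> I" "prime_to \<mm> J" for I J
    proof -
      obtain A B where A: "fractional_ideal K I" "rep I A B" using IJ(1) unfolding pt by blast
      obtain C E where C: "fractional_ideal K J" "rep J C E" using IJ(2) unfolding pt by blast
      have "(I \<odot> J) \<odot> (B \<odot> E) = (I \<odot> B) \<odot> (J \<odot> E)" by (simp only: imul_ac)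
      then have "rep (I \<odot> J) (A \<odot> C) (B \<odot> E)"
        using A(2) C(2) coprime_imul m idl_imul unfolding rep_def by simp
      from val[OF fractional_imul[OF A(1) C(1)] this] have "\<psi> (I \<odot> J) = g (A \<odot> C) / g (B \<odot> E)" .
      also have "\<dots> = (g A / g B) * (g C / g E)" using g A(2) C(2) unfolding rep_def by simp
      finally show ?thesis using val[OF A] val[OF C] by simp
    qed
    show "\<psi> (pid \<alpha>) = \<alpha> ^ l" if \<alpha>: "\<alpha> \<in> K - {0}" "cong_one K \<mm> \<alpha>" for \<alpha>
    proof -
      obtain a b where ab: "a \<in> R" "b \<in> R" "b \<noteq> 0" "coprime_ideals K (pid a) \<mm>"
        "coprime_ideals K (pid b) \<mm>" "a - b \<in> \<mm>" "\<alpha> = a / b"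
        using \<alpha>(2) unfolding cong_one_def by blast
      have a0: "a \<noteq> 0" using \<alpha>(1) ab(7) by auto
      have "rep (pid \<alpha>) (pid a) (pid b)"
        unfolding rep_def pid_mult using ab a0 idl_pid by simp
      then have "\<psi> (pid \<alpha>) = g (pid a) / g (pid b)"
        using val fractional_pid \<alpha>(1) by simp
      moreover have "g (pid b) \<noteq> 0" using g0 idl_pid ab by blast
      then have "g (pid a) / g (pid b) = a ^ l / b ^ l"
        using cong[OF ab(1,2) a0 ab(3,4,5,6)] ab(3) by (simp add: frac_eq_eq mult.commute)
      ultimately show ?thesis unfolding ab(7) by (simp add: power_divide)
    qed
  qed (rule m)
  then show ?thesis using that vali by blast
qed

end

section \<open>Prime ideals\<close>

context iqf
begin

text \<open>The greatest common divisor of two ideals.\<close>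

definition iadd :: "complex set \<Rightarrow> complex set \<Rightarrow> complex set" where
  "iadd A B = {a + b | a b. a \<in> A \<and> b \<in> B}"

lemma iaddI: "a \<in> A \<Longrightarrow> b \<in> B \<Longrightarrow> a + b \<in> iadd A B"
  unfolding iadd_def by blast

lemma idl_iadd:
  assumes A: "idl A" and B: "idl B"
  shows "idl (iadd A B)" "A \<subseteq> iadd A B" "B \<subseteq> iadd A B"
proof -
  show 1: "A \<subseteq> iadd A B" using iaddI[OF _ idl_0[OF B]] by fastforce
  show "B \<subseteq> iadd A B" using iaddI[OF idl_0[OF A]] by fastforce
  obtain x where x: "x \<in> A" "x \<noteq> 0" using idl_nonzero[OF A] by metis
  show "idl (iadd A B)"
  proof (rule idlI[of _ x])
    show "iadd A B \<subseteq> R" unfolding iadd_def using idl_R[OF A] idl_R[OF B] by blast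
    show "x \<in> iadd A B" using 1 x by blast
    show "u + v \<in> iadd A B" if uv: "u \<in> iadd A B" "v \<in> iadd A B" for u v
    proof -
      obtain a b where u: "u = a + b" "a \<in> A" "b \<in> B" using uv(1) unfolding iadd_def by blast
      obtain c d where v: "v = c + d" "c \<in> A" "d \<in> B" using uv(2) unfolding iadd_def by blast
      have e: "u + v = (a + c) + (b + d)" unfolding u(1) v(1) by simp
      show ?thesis unfolding e by (intro iaddI idl_add[OF A] idl_add[OF B] u v)
    qed
    show "r * u \<in> iadd A B" if r: "r \<in> R" and u: "u \<in> iadd A B" for r u
    proof -
      obtain a b where u: "u = a + b" "a \<in> A" "b \<in> B" using u unfolding iadd_def by blast
      show ?thesis unfolding u(1) distrib_left by (intro iaddI idl_mult[OF A] idl_mult[OF B] u r)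
    qed
  qed (rule x(2))
qed

lemma coprime_iff_iadd:
  assumes A: "idl A" and B: "idl B"
  shows "coprime_ideals K A B \<longleftrightarrow> iadd A B = R"
proof
  assume "coprime_ideals K A B"
  then obtain a b where ab: "a \<in> A" "b \<in> B" "a + b = 1" by (rule coprime_idealsE[OF _ A B])
  then have "1 \<in> iadd A B" using iaddI by metis
  then show "iadd A B = R" by (rule idl_one[OF idl_iadd(1)[OF A B]])
next
  assume "iadd A B = R"
  then have "1 \<in> iadd A B" by simp
  then obtain a b where "a \<in> A" "b \<in> B" "a + b = 1" unfolding iadd_def by auto
  then show "coprime_ideals K A B" by (rule coprime_idealsI[OF A B])
qed

lemma idl_eq_of_N:
  assumes A: "idl A" and B: "idl B" and "A \<subseteq> B" "N A = N B" shows "A = B"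
proof -
  obtain C where C: "idl C" "A = B \<odot> C" by (rule idl_dvd[OF A B assms(3)])
  have "N A = N B * N C" unfolding C(2) by (rule N_mult[OF B C(1)])
  then have "N C = 1" using assms(4) N_pos[OF A] by simp
  then have "C = R" using N_1 C by blast
  then show ?thesis using C B by simp
qed

text \<open>After division by the greatest common divisor G the ideals A' and B' are coprime with
  equal k-th powers. A power of A' is still coprime to B' but is contained in it, so both are the
  unit ideal.\<close>

lemma ipow_inj:
  assumes A: "idl A" and B: "idl B" and k: "k > 0" and e: "ipow A k = ipow B k"
  shows "A = B"
proof -
  define G where "G = iadd A B"
  have G: "idl G" "A \<subseteq> G" "B \<subseteq> G" unfolding G_def by (rule idl_iadd[OF A B])+
  obtain A' where A': "idl A'" "A = G \<odot> A'" by (rule idl_dvd[OF A G(1,2)])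
  obtain B' where B': "idl B'" "B = G \<odot> B'" by (rule idl_dvd[OF B G(1,3)])
  have AB: "idl (iadd A' B')" by (rule idl_iadd[OF A'(1) B'(1)])
  have "A \<subseteq> G \<odot> iadd A' B'" unfolding A'(2) by (rule imul_mono[OF subset_refl idl_iadd(2)[OF A'(1) B'(1)]])
  moreover have "B \<subseteq> G \<odot> iadd A' B'" unfolding B'(2) by (rule imul_mono[OF subset_refl idl_iadd(3)[OF A'(1) B'(1)]])
  ultimately have "G \<subseteq> G \<odot> iadd A' B'"
    unfolding G_def iadd_def[of A B] using imul_sum by blast
  then have "G = G \<odot> iadd A' B'" using imul_subset_left[OF G(1) AB] by blast
  then have "G \<odot> iadd A' B' = G \<odot> R" using G(1) by simp
  then have 1: "iadd A' B' = R" by (rule imul_cancel[OF G(1) AB idl_unit])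
  have "ipow G k \<odot> ipow A' k = ipow G k \<odot> ipow B' k"
    using e unfolding A'(2) B'(2) ipow_imul[OF G(1) A'(1)] ipow_imul[OF G(1) B'(1)] .
  then have e': "ipow A' k = ipow B' k" by (rule imul_cancel[OF idl_ipow[OF G(1)] idl_ipow[OF A'(1)] idl_ipow[OF B'(1)]])
  have triv: "B' = R" if A': "idl A'" and B': "idl B'" and 1: "coprime_ideals K A' B'"
    and e: "ipow A' k = ipow B' k" for A' B'
  proof -
    obtain k' where k': "k = Suc k'" using k by (cases k) auto
    have "ipow B' k \<subseteq> B'" unfolding k' ipow_Suc by (rule imul_subset_left[OF B' idl_ipow[OF B']])
    moreover have "coprime_ideals K (ipow A' k) B'" by (rule coprime_ipow[OF 1 A' B'])
    then obtain a b where "a \<in> ipow A' k" "b \<in> B'" "a + b = 1" by (rule coprime_idealsE[OF _ idl_ipow[OF A'] B'])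
    ultimately have "1 \<in> B'" using e idl_add[OF B'] by (metis subsetD)
    then show ?thesis by (rule idl_one[OF B'])
  qed
  have c1: "coprime_ideals K A' B'" using 1 coprime_iff_iadd A' B' by blast
  have "iadd B' A' = iadd A' B'" unfolding iadd_def by (metis add.commute)
  then have c2: "coprime_ideals K B' A'" using 1 coprime_iff_iadd A' B' by metis
  have "B' = R" by (rule triv[OF A'(1) B'(1) c1 e'])
  moreover have "A' = R" by (rule triv[OF B'(1) A'(1) c2 e'[symmetric]])
  ultimately show ?thesis using A' B' by simp
qed

text \<open>The greatest common divisor of I and (p) has norm dividing p^2, and the norm is not 1
  because p divides N I. Norm p gives the first alternative, norm p^2 means that (p) divides
  I.\<close>

lemma prime_divides_norm:
  assumes I: "idl I" and p: "prime p" "p dvd N I"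
  obtains (degree_one) P C where "idl P" "N P = p" "idl C" "I = P \<odot> C"
    | (rational) C where "idl C" "I = pid (of_nat p) \<odot> C"
proof -
  have p0: "p > 0" using p(1) prime_gt_0_nat by blast
  let ?p = "pid (of_nat p)"
  have P: "idl ?p" using p0 by (intro idl_pid) auto
  have NP: "N ?p = p ^ 2" using N_pid[of "of_nat p"] p0 by (simp add: nm_of_nat)
  define J where "J = iadd I ?p"
  have J: "idl J" "I \<subseteq> J" "?p \<subseteq> J" unfolding J_def by (rule idl_iadd[OF I P])+
  have "N J dvd p ^ 2" using N_dvd[OF P J(1,3)] NP by simp
  then obtain i where i: "i \<le> 2" "N J = p ^ i" using divides_primepow_nat[OF p(1)] by auto
  have "\<not> coprime_ideals K I ?p" using coprime_nat_iff[OF I p0] p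
    by (metis coprime_absorb_right not_prime_unit)
  then have "i \<noteq> 0" using i N_1[OF J(1)] coprime_iff_iadd[OF I P] unfolding J_def by auto
  then consider "i = 1" | "i = 2" using i(1) by linarith
  then show ?thesis
  proof cases
    case 1
    obtain C where C: "idl C" "I = J \<odot> C" by (rule idl_dvd[OF I J(1,2)])
    have "N J = p" using i 1 by simp
    then show ?thesis by (rule degree_one[OF J(1) _ C])
  next
    case 2
    have "?p = J" by (rule idl_eq_of_N[OF P J(1,3)]) (use i 2 NP in simp)
    then have "I \<subseteq> ?p" using J(2) by simp
    then obtain C where C: "idl C" "I = ?p \<odot> C" by (rule idl_dvd[OF I P])
    then show ?thesis by (rule rational)
  qed
qed

lemma pid_prime: assumes "idl P" "N P = p" shows "P \<odot> cnj ` P = pid (of_nat p)"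
  using imul_cnj_N[OF assms(1)] assms(2) by simp

text \<open>The greatest common divisor of Q and P has norm p or 1. If it is 1, write 1 = q + a with
  q in Q and a in P: for x in the conjugate of P, the product a x lies in (p) and hence in Q, so x =
  q x + a x is in Q, and the norms agree.\<close>

lemma norm_prime_unique:
  assumes P: "idl P" "N P = p" and Q: "idl Q" "N Q = p" and p: "prime p"
  shows "Q = P \<or> Q = cnj ` P"
proof -
  define J where "J = iadd Q P"
  have J: "idl J" "Q \<subseteq> J" "P \<subseteq> J" unfolding J_def by (rule idl_iadd[OF Q(1) P(1)])+
  have cP: "idl (cnj ` P)" by (rule idl_cnj[OF P(1)])
  have "N J dvd p" using N_dvd[OF Q(1) J(1,2)] Q(2) by simp
  then consider "N J = p" | "N J = 1" using p prime_nat_iff by metis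
  then show ?thesis
  proof cases
    case 1
    have "Q = J" by (rule idl_eq_of_N[OF Q(1) J(1,2)]) (simp add: Q 1)
    moreover have "P = J" by (rule idl_eq_of_N[OF P(1) J(1,3)]) (simp add: P 1)
    ultimately show ?thesis by simp
  next
    case 2
    then have "1 \<in> J" using N_1[OF J(1)] by simp
    then obtain q a where qa: "1 = q + a" "q \<in> Q" "a \<in> P" unfolding J_def iadd_def by blast
    have "cnj ` P \<subseteq> Q"
    proof
      fix x assume x: "x \<in> cnj ` P"
      have "a * x \<in> P \<odot> cnj ` P" using qa(3) x by (rule imul_prod)
      then have "a * x \<in> pid (of_nat p)" unfolding pid_prime[OF P] .
      then have 1: "a * x \<in> Q" using pid_subset[OF Q(1) N_mem[OF Q(1)]] Q(2) by auto
      have 2: "q * x \<in> Q" by (rule idl_mult_right[OF Q(1) idl_R[OF cP x] qa(2)])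
      have "q * x + a * x = x" using qa(1) by (metis distrib_right mult_1)
      then show "x \<in> Q" using idl_add[OF Q(1) 2 1] by simp
    qed
    then have "cnj ` P = Q" by (rule idl_eq_of_N[OF cP Q(1)]) (simp add: N_cnj[OF P(1)] P Q)
    then show ?thesis by simp
  qed
qed

text \<open>A prime norm a y^2 forces y = 1, so x + w lies in P. If P were its own conjugate, it
  would contain w - cnj w, which is s or 2 s, and p would divide the norm 4 D of 2 s.\<close>

lemma conj_distinct:
  assumes P: "idl P" "N P = p" and p: "prime p" "\<not> p dvd 2 * D"
  shows "cnj ` P \<noteq> P"
proof
  assume e: "cnj ` P = P"
  obtain y a x c where b: "lattice_basis P y a x c" using idl_basis[OF P(1)] by blast
  have y: "y > 0" "a > 0" using b by (auto simp: lattice_basis_def)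
  have ya: "a * y\<^sup>2 = int p" using idl_basis_norm(1)[OF P(1) b] P(2) by simp
  have "y = 1"
  proof -
    have "(nat y)\<^sup>2 dvd p"
    proof -
      have "y\<^sup>2 dvd int p" using ya by (metis dvd_triv_right)
      then have "int ((nat y)\<^sup>2) dvd int p" using y by simp
      then show ?thesis by (simp only: int_dvd_int_iff)
    qed
    moreover have "squarefree p" using p(1) by (intro squarefree_prime_elem) auto
    ultimately have "is_unit (nat y)" by (metis squarefreeD)
    then show ?thesis using y by simp
  qed
  then have mem: "of_int x + w \<in> P" using b unfolding lattice_basis_def by (force intro: exI[of _ 0] exI[of _ 1])
  then have "cnj (of_int x + w) \<in> P" using e by (metis imageI)
  then have "(of_int x + w) - cnj (of_int x + w) \<in> P" using idl_diff[OF P(1) mem] by blast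
  then have d: "w - cnj w \<in> P" by simp
  have "(1 + s) / 2 - (1 - s) / 2 = s" by (simp flip: diff_divide_distrib)
  then have "w - cnj w = s \<or> w - cnj w = 2 * s" by (auto simp: w_def)
  then have "2 * s \<in> P" using d idl_mult[OF P(1), of 2 s] by auto
  then have "p dvd nm (2 * s)" using N_dvd_nm[OF P(1)] P(2) by blast
  moreover have "nm (2 * s) = 4 * D" using nm_s[of 0 2] by (simp add: nat_mult_distrib)
  ultimately have "p dvd 4 * D" by simp
  then have "p dvd 2 * (2 * D)" by simp
  then have "p dvd 2 \<or> p dvd 2 * D" using prime_dvd_mult_iff[OF p(1)] by blast
  then show False using p(2) by auto
qed

lemma conj_coprime:
  assumes P: "idl P" "N P = p" and p: "prime p" "\<not> p dvd 2 * D"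
  shows "coprime_ideals K P (cnj ` P)"
proof -
  have cP: "idl (cnj ` P)" by (rule idl_cnj[OF P(1)])
  let ?J = "iadd P (cnj ` P)"
  have J: "idl ?J" "P \<subseteq> ?J" "cnj ` P \<subseteq> ?J" by (rule idl_iadd[OF P(1) cP])+
  have "N ?J dvd p" using N_dvd[OF P(1) J(1,2)] P(2) by simp
  then consider "N ?J = p" | "N ?J = 1" using p prime_nat_iff by metis
  then show ?thesis
  proof cases
    case 1
    have "P = ?J" by (rule idl_eq_of_N[OF P(1) J(1,2)]) (simp add: P 1)
    moreover have "cnj ` P = ?J" by (rule idl_eq_of_N[OF cP J(1,3)]) (simp add: P 1 N_cnj)
    ultimately show ?thesis using conj_distinct[OF P p] by simp
  next
    case 2
    then show ?thesis using coprime_iff_iadd[OF P(1) cP] N_1[OF J(1)] by simp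
  qed
qed

text \<open>Induction on the norm stands in for factorisation into prime ideals. A rational prime
  that is the norm of some P is split off as P times its conjugate, so the last case only meets
  primes that are not norms of ideals.\<close>

lemma coprime_ideal_induct [consumes 2, case_names unit degree_one inert]:
  assumes "idl I" "coprime (N I) M"
    and unit: "Q R"
    and deg1: "\<And>P C. idl P \<Longrightarrow> prime (N P) \<Longrightarrow> coprime (N P) M \<Longrightarrow> idl C \<Longrightarrow>
      coprime (N C) M \<Longrightarrow> Q C \<Longrightarrow> Q (P \<odot> C)"
    and inert: "\<And>p C. prime p \<Longrightarrow> coprime p M \<Longrightarrow> (\<And>P. idl P \<Longrightarrow> N P \<noteq> p) \<Longrightarrow> idl C \<Longrightarrow>
      coprime (N C) M \<Longrightarrow> Q C \<Longrightarrow> Q (pid (of_nat p) \<odot> C)"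
  shows "Q I"
  using assms(1,2)
proof (induct "N I" arbitrary: I rule: less_induct)
  case less
  note I = less(2) and cop = less(3)
  have small: "N C < N I \<and> coprime (N C) M \<and> coprime (N B) M"
    if B: "idl B" "N B > 1" and C: "idl C" and e: "I = B \<odot> C" for B C
  proof -
    have NI: "N I = N B * N C" unfolding e by (rule N_mult[OF B(1) C])
    then show ?thesis using cop B(2) N_pos[OF C] by simp
  qed
  show ?case
  proof (cases "N I = 1")
    case True
    then show ?thesis using N_1[OF I] unit by simp
  next
    case False
    then obtain p where p: "prime p" "p dvd N I" using prime_factor_nat by blast
    have p1: "p > 1" using p(1) prime_gt_1_nat by blast
    have P1: "Q (P \<odot> C)" if P: "idl P" "N P = p" and C: "idl C" and e: "I = P \<odot> C" for P C
    proof -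
      have sm: "N C < N I" "coprime (N C) M" "coprime (N P) M" using small[OF P(1) _ C e] P(2) p1 by simp_all
      show ?thesis by (rule deg1[OF P(1) _ sm(3) C sm(2) less(1)[OF sm(1) C sm(2)]]) (simp add: P(2) p(1))
    qed
    show ?thesis using I p
    proof (cases rule: prime_divides_norm)
      case (degree_one P C)
      then show ?thesis using P1 by simp
    next
      case (rational C)
      show ?thesis
      proof (cases "\<exists>P. idl P \<and> N P = p")
        case True
        then obtain P where P: "idl P" "N P = p" by blast
        have e: "I = P \<odot> (cnj ` P \<odot> C)" unfolding rational(2) imul_assoc[symmetric] pid_prime[OF P] ..
        show ?thesis using P1[OF P idl_imul[OF idl_cnj[OF P(1)] rational(1)] e] e by simp
      next
        case False
        have pp: "idl (pid (of_nat p))" using p1 by (intro idl_pid) auto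
        have "N (pid (of_nat p)) = p ^ 2" using N_pid[of "of_nat p"] p1 by (simp add: nm_of_nat)
        then have sm: "N C < N I" "coprime (N C) M" "coprime (p ^ 2) M"
          using small[OF pp _ rational] one_less_power[OF p1, of 2] by simp_all
        then have "coprime p M" by simp
        then show ?thesis unfolding rational(2) using inert[OF p(1) _ _ rational(1) sm(2)] False less(1)[OF sm(1) rational(1) sm(2)]
          by blast
      qed
    qed
  qed
qed

end

section \<open>Values of rational characters\<close>

text \<open>The roots of a real quadratic polynomial are u and v, and the conjugate of u is a root
  different from u.\<close>

lemma nonreal_quadratic_conj:
  fixes u v :: complex
  assumes "u + v \<in> \<real>" "u * v \<in> \<real>" "u \<notin> \<real>" shows "v = cnj u"
proof -
  have c: "u + v = cnj u + cnj v" "u * v = cnj u * cnj v" using assms(1,2) by (simp_all add: Reals_cnj_iff)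
  have "(cnj u - u) * (cnj u - v) = cnj u * cnj u - (u + v) * cnj u + u * v" by (simp add: algebra_simps)
  also have "\<dots> = 0" unfolding c by (simp add: algebra_simps)
  finally have "cnj u = u \<or> cnj u = v" by simp
  then show ?thesis using assms(3) by (auto simp: Reals_cnj_iff)
qed

lemma quadratic_power_rational:
  fixes u :: complex
  assumes "u * u = a * u - b" "a \<in> \<rat>" "b \<in> \<rat>"
  obtains x y where "x \<in> \<rat>" "y \<in> \<rat>" "u ^ n = x * u + y"
proof -
  have "\<exists>x y. x \<in> \<rat> \<and> y \<in> \<rat> \<and> u ^ n = x * u + y"
  proof (induct n)
    case 0
    show ?case by (intro exI[of _ 0] exI[of _ 1]) simp
  next
    case (Suc n)
    then obtain x y where xy: "x \<in> \<rat>" "y \<in> \<rat>" "u ^ n = x * u + y" by blast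
    have "u ^ Suc n = x * (u * u) + y * u" unfolding power_Suc xy(3) by (simp add: algebra_simps)
    also have "\<dots> = (x * a + y) * u + (- x * b)" unfolding assms(1) by (simp add: algebra_simps)
    finally show ?case using xy(1,2) assms(2,3)
      by (intro exI[of _ "x * a + y"] exI[of _ "- x * b"]) simp
  qed
  then show ?thesis using that by blast
qed

context iqf
begin

lemma hecke_series_nth:
  "fps_nth (hecke_series K \<psi>) n = (\<Sum>\<aa> | idl \<aa> \<and> N \<aa> = n. \<psi> \<aa>)"
  by (simp add: hecke_series_def)

lemma ideals_norm_prime:
  assumes P: "idl P" "N P = p" and p: "prime p"
  shows "{I. idl I \<and> N I = p} = {P, cnj ` P}"
proof
  show "{I. idl I \<and> N I = p} \<subseteq> {P, cnj ` P}" using norm_prime_unique[OF P _ _ p] by blast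
  show "{P, cnj ` P} \<subseteq> {I. idl I \<and> N I = p}" using P idl_cnj[OF P(1)] N_cnj[OF P(1)] by auto
qed

lemma ideals_norm_prime_sq:
  assumes P: "idl P" "N P = p" and p: "prime p"
  shows "{I. idl I \<and> N I = p ^ 2} = {P \<odot> P, P \<odot> cnj ` P, cnj ` P \<odot> cnj ` P}"
proof
  note cP = idl_cnj[OF P(1)]
  have p0: "p > 0" using p prime_gt_0_nat by blast
  show "{P \<odot> P, P \<odot> cnj ` P, cnj ` P \<odot> cnj ` P} \<subseteq> {I. idl I \<and> N I = p ^ 2}"
    using P cP N_cnj[OF P(1)] idl_imul N_mult by (auto simp: power2_eq_square)
  show "{I. idl I \<and> N I = p ^ 2} \<subseteq> {P \<odot> P, P \<odot> cnj ` P, cnj ` P \<odot> cnj ` P}"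
  proof
    fix I assume "I \<in> {I. idl I \<and> N I = p ^ 2}"
    then have I: "idl I" "N I = p ^ 2" by auto
    have "p dvd N I" using I(2) by simp
    with I(1) p show "I \<in> {P \<odot> P, P \<odot> cnj ` P, cnj ` P \<odot> cnj ` P}"
    proof (cases rule: prime_divides_norm)
      case (degree_one Q C)
      have "N I = N Q * N C" unfolding degree_one(4) by (rule N_mult[OF degree_one(1,3)])
      then have "N C = p" using I(2) degree_one(2) p0 by (simp add: power2_eq_square)
      then have "C = P \<or> C = cnj ` P" by (rule norm_prime_unique[OF P degree_one(3) _ p])
      moreover have "Q = P \<or> Q = cnj ` P" by (rule norm_prime_unique[OF P degree_one(1,2) p])
      ultimately show ?thesis unfolding degree_one(4) using imul_comm by blast
    next
      case (rational C)
      have pp: "idl (pid (of_nat p))" using p0 by (intro idl_pid) auto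
      have "N (pid (of_nat p)) = p ^ 2" using N_pid[of "of_nat p"] p0 by (simp add: nm_of_nat)
      moreover have "N I = N (pid (of_nat p)) * N C" unfolding rational(2) by (rule N_mult[OF pp rational(1)])
      ultimately have "N C = 1" using I(2) p0 by simp
      then have "C = R" by (rule N_1[OF rational(1)])
      then show ?thesis unfolding rational(2) pid_prime[OF P, symmetric] using idl_imul[OF P(1) cP] by simp
    qed
  qed
qed

lemma ideals_norm_inert:
  assumes no: "\<And>P. idl P \<Longrightarrow> N P \<noteq> p" and p: "prime p"
  shows "{I. idl I \<and> N I = p ^ 2} = {pid (of_nat p)}"
proof
  have p0: "p > 0" using p prime_gt_0_nat by blast
  have pp: "idl (pid (of_nat p))" using p0 by (intro idl_pid) auto
  have Np: "N (pid (of_nat p)) = p ^ 2" using N_pid[of "of_nat p"] p0 by (simp add: nm_of_nat)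
  show "{pid (of_nat p)} \<subseteq> {I. idl I \<and> N I = p ^ 2}" using pp Np by simp
  show "{I. idl I \<and> N I = p ^ 2} \<subseteq> {pid (of_nat p)}"
  proof
    fix I assume "I \<in> {I. idl I \<and> N I = p ^ 2}"
    then have I: "idl I" "N I = p ^ 2" by auto
    have "p dvd N I" using I(2) by simp
    with I(1) p show "I \<in> {pid (of_nat p)}"
    proof (cases rule: prime_divides_norm)
      case (degree_one Q C)
      then show ?thesis using no by blast
    next
      case (rational C)
      have "N I = N (pid (of_nat p)) * N C" unfolding rational(2) by (rule N_mult[OF pp rational(1)])
      then have "N C = 1" using I(2) p0 Np by simp
      then have "C = R" by (rule N_1[OF rational(1)])
      then show ?thesis unfolding rational(2) using pp by simp
    qed
  qed
qed

section \<open>Rational coefficients force the values to generate l-th powers of ideals\<close>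

context
  fixes \<psi> l \<mm> M
  assumes hecke: "hecke_character K l \<mm> \<psi>" and rat: "rational_coeffs K \<psi>" and l: "l \<ge> 1"
    and M: "M > 0" "of_nat M \<in> \<mm>" "2 * D dvd M"
begin

lemma modulus: "idl \<mm>"
  using hecke unfolding hecke_character_iff by blast

lemma idl_pid_M: "idl (pid (of_nat M))"
  using M(1) by (intro idl_pid) auto

lemma coprime_norm_modulus:
  assumes A: "idl A" "coprime (N A) M" shows "coprime_ideals K A \<mm>" "\<psi> A \<noteq> 0"
proof -
  have "coprime_ideals K A (pid (of_nat M))" using coprime_nat_iff[OF A(1) M(1)] A(2) by simp
  then show "coprime_ideals K A \<mm>"
    by (rule coprime_mono[OF _ A(1) idl_pid_M modulus pid_subset[OF modulus M(2)]])
  then show "\<psi> A \<noteq> 0" using hecke_coprime_nonzero[OF hecke A(1)] by simp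
qed

lemma psi_principal_cong_one:
  assumes a: "a \<in> R" "a \<noteq> 0" "a - 1 \<in> pid (of_nat M)"
  shows "\<psi> (pid a) = a ^ l"
proof -
  have am: "a - 1 \<in> \<mm>" using a(3) pid_subset[OF modulus M(2)] by blast
  have A: "idl (pid a)" by (rule idl_pid[OF a(1,2)])
  have "a + - (a - 1) = 1" by simp
  then have "coprime_ideals K (pid a) \<mm>"
    by (rule coprime_idealsI[OF A modulus pid_mem idl_uminus[OF modulus am]])
  then have "\<psi> (pid a) * 1 ^ l = \<psi> (pid 1) * a ^ l"
    using hecke_cong[OF hecke a(1) R_1 a(2) _ am] coprime_R[OF modulus] by simp
  then show ?thesis using hecke_R[OF hecke] by simp
qed

text \<open>Some power p^k is 1 modulo M, so the value z satisfies z^k = (p^l)^k. A real z with this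
  property has absolute value p^l.\<close>

lemma psi_rational_prime:
  assumes p: "prime p" "coprime p M" and r: "\<psi> (pid (of_nat p)) \<in> \<real>"
  shows "\<psi> (pid (of_nat p)) = of_nat (p ^ l) \<or> \<psi> (pid (of_nat p)) = - of_nat (p ^ l)"
proof -
  let ?p = "of_nat p :: complex" let ?z = "\<psi> (pid ?p)"
  have p0: "?p \<noteq> 0" "?p \<in> R" using prime_gt_0_nat[OF p(1)] by auto
  have P: "idl (pid ?p)" by (rule idl_pid[OF p0(2,1)])
  have "coprime (N (pid ?p)) M" using N_pid[OF p0(2,1)] p(2) by (simp add: nm_of_nat)
  then have "\<psi> (pid ?p) \<noteq> 0" "coprime_ideals K (pid ?p) (pid (of_nat M))"
    using coprime_norm_modulus[OF P] coprime_nat_iff[OF P M(1)] by auto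
  then obtain k where k: "k > 0" "?p ^ k - 1 \<in> pid (of_nat M)"
    using power_cong_one[OF _ p0(2,1) M(1)] by blast
  have "?z ^ k = \<psi> (pid (?p ^ k))"
    using hecke_ipow[OF hecke P \<open>\<psi> (pid ?p) \<noteq> 0\<close>, of k] unfolding ipow_pid by simp
  also have "\<dots> = (?p ^ k) ^ l" using psi_principal_cong_one[OF R_power[OF p0(2)] _ k(2)] p0 by simp
  finally have e: "?z ^ k = of_nat ((p ^ l) ^ k)" by (simp flip: power_mult add: mult.commute)
  obtain x where x: "?z = of_real x" using r by (auto elim: Reals_cases)
  have "of_real (x ^ k) = (of_real (real (p ^ l) ^ k) :: complex)" using e unfolding x by simp
  then have "x ^ k = real (p ^ l) ^ k" by (simp only: of_real_eq_iff)
  then have "\<bar>x\<bar> ^ k = real (p ^ l) ^ k" by (metis abs_of_nat power_abs of_nat_power)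
  then have "\<bar>x\<bar> = real (p ^ l)" by (rule power_eq_imp_eq_base[OF _ _ _ k(1)]) simp_all
  then have "x = real (p ^ l) \<or> x = - real (p ^ l)" by linarith
  then show ?thesis unfolding x by auto
qed

text \<open>The values u at P and v at its conjugate have rational sum and product. Once they are
  known to be conjugate, u is identified through a power u^k = \<alpha>^l, where \<alpha> generates
  P^k and is 1 modulo M.\<close>

lemma psi_degree_one:
  assumes P: "idl P" "N P = p" and p: "prime p" "coprime p M"
  shows "\<psi> P \<in> R \<and> pid (\<psi> P) = ipow P l \<and> \<psi> (cnj ` P) = cnj (\<psi> P)"
proof -
  define u where "u = \<psi> P"
  define v where "v = \<psi> (cnj ` P)"
  have cP: "idl (cnj ` P)" "N (cnj ` P) = p" using idl_cnj[OF P(1)] N_cnj[OF P(1)] P(2) by auto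
  have pD: "\<not> p dvd 2 * D" using M(3) p by (meson coprime_common_divisor dvd_refl dvd_trans not_prime_unit)
  have copP: "coprime_ideals K P (cnj ` P)" by (rule conj_coprime[OF P p(1) pD])
  have ne: "cnj ` P \<noteq> P" by (rule conj_distinct[OF P p(1) pD])
  have nz: "\<psi> P \<noteq> 0" "\<psi> (cnj ` P) \<noteq> 0"
    using coprime_norm_modulus(2)[OF P(1)] coprime_norm_modulus(2)[OF cP(1)] P(2) cP(2) p(2) by auto
  have 1: "u + v \<in> \<rat>"
  proof -
    have "fps_nth (hecke_series K \<psi>) p = u + v"
      unfolding hecke_series_nth ideals_norm_prime[OF P p(1)] u_def v_def using ne by simp
    then show ?thesis using rat unfolding rational_coeffs_def by metis
  qed
  \<comment> \<open>The coefficient at p^2. The three ideals of this norm are distinct because P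
    differs from its conjugate and square roots of ideals are unique.\<close>
  have 2: "u * u + u * v + v * v \<in> \<rat>"
  proof -
    have n1: "P \<odot> P \<noteq> P \<odot> cnj ` P" using imul_cancel[OF P(1) P(1) cP(1)] ne by blast
    have n2: "P \<odot> cnj ` P \<noteq> cnj ` P \<odot> cnj ` P" using imul_cancel[OF cP(1) P(1) cP(1)] ne by (metis imul_comm)
    have n3: "P \<odot> P \<noteq> cnj ` P \<odot> cnj ` P"
    proof
      assume "P \<odot> P = cnj ` P \<odot> cnj ` P"
      then have "ipow P 2 = ipow (cnj ` P) 2" using P cP by (simp add: numeral_2_eq_2 ipow_Suc)
      then show False using ipow_inj[OF P(1) cP(1), of 2] ne by simp
    qed
    have "fps_nth (hecke_series K \<psi>) (p ^ 2) = \<psi> (P \<odot> P) + (\<psi> (P \<odot> cnj ` P) + \<psi> (cnj ` P \<odot> cnj ` P))"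
      unfolding hecke_series_nth ideals_norm_prime_sq[OF P p(1)] using n1 n2 n3 by simp
    also have "\<dots> = u * u + u * v + v * v"
      unfolding u_def v_def using hecke_mult[OF hecke] nz by simp
    finally show ?thesis using rat unfolding rational_coeffs_def by metis
  qed
  have uv: "u * v \<in> \<rat>"
  proof -
    have e: "u * v = (u + v) * (u + v) - (u * u + u * v + v * v)" by (simp add: algebra_simps)
    show ?thesis by (subst e) (intro Rats_diff Rats_mult 1 2)
  qed
  have uvp: "u * v = \<psi> (pid (of_nat p))"
    unfolding u_def v_def pid_prime[OF P, symmetric] using hecke_mult[OF hecke nz] by simp
  obtain k \<alpha> where k: "k > 0" "\<alpha> \<in> R" "\<alpha> \<noteq> 0" "ipow P k = pid \<alpha>"
    "\<alpha> - 1 \<in> pid (of_nat M)"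
    using finite_ray_class_order[OF P(1) M(1)] P(2) p(2) by metis
  have uk: "u ^ k = \<alpha> ^ l"
    using hecke_ipow[OF hecke P(1) nz(1), of k] psi_principal_cong_one[OF k(2,3,5)] unfolding k(4) u_def by simp
  \<comment> \<open>A real \<alpha>^l would make P^(k l) its own conjugate, and hence P as
    well.\<close>
  have nonreal: "\<alpha> ^ l \<notin> \<real>"
  proof
    assume "\<alpha> ^ l \<in> \<real>"
    then have "cnj (\<alpha> ^ l) = \<alpha> ^ l" by (simp add: Reals_cnj_iff)
    have "ipow P (k * l) = pid (\<alpha> ^ l)" unfolding ipow_mult[OF P(1)] k(4) ipow_pid ..
    moreover have "cnj ` pid (\<alpha> ^ l) = pid (\<alpha> ^ l)"
      unfolding pid_cnj \<open>cnj (\<alpha> ^ l) = \<alpha> ^ l\<close> ..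
    ultimately have "ipow (cnj ` P) (k * l) = ipow P (k * l)" unfolding ipow_cnj[symmetric] by simp
    then have "cnj ` P = P" using k(1) l by (intro ipow_inj[OF cP(1) P(1)]) auto
    then show False using ne by simp
  qed
  have u_nonreal: "u \<notin> \<real>" using nonreal Reals_power[of u k] unfolding uk by blast
  have v: "v = cnj u"
    by (rule nonreal_quadratic_conj[OF Rats_imp_Reals[OF 1] Rats_imp_Reals[OF uv] u_nonreal])
  \<comment> \<open>Since v is the conjugate of u, the product is a squared absolute value, which
    rules out the negative sign.\<close>
  have uvpos: "u * v = of_nat (p ^ l)"
  proof -
    have "u * v = of_nat (p ^ l) \<or> u * v = - of_nat (p ^ l)"
      using psi_rational_prime[OF p] Rats_imp_Reals[OF uv] unfolding uvp by blast
    moreover have "Re (u * v) \<ge> 0" unfolding v by (simp add: complex_mult_cnj)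
    moreover have "p ^ l > 0" using prime_gt_0_nat[OF p(1)] by simp
    then have "Re (- of_nat (p ^ l)) < 0" by (simp del: of_nat_power)
    ultimately show ?thesis by (metis not_le)
  qed
  have "u * u = (u + v) * u - u * v" by (simp add: algebra_simps)
  \<comment> \<open>As \<alpha>^l = x u + y is non-real, x is nonzero, and solving for u shows that
    u lies in the field.\<close>
  then obtain x y where xy: "x \<in> \<rat>" "y \<in> \<rat>" "u ^ k = x * u + y"
    using quadratic_power_rational[OF _ 1 uv] by metis
  have x0: "x \<noteq> 0" using nonreal xy(3) Rats_imp_Reals[OF xy(2)] unfolding uk by auto
  have "u = (\<alpha> ^ l - y) / x" using xy(3) x0 unfolding uk by (simp add: field_simps)
  then have uK: "u \<in> K" using R_K[OF R_power[OF k(2)]] K_Rats xy(1,2) by auto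
  have "algebraic_int u"
  proof (rule algebraic_int_root)
    show "algebraic_int (\<alpha> ^ l)" using R_power[OF k(2)] by (simp add: R_eq)
    show "poly (monom 1 k) u = \<alpha> ^ l" by (simp add: poly_monom uk)
    show "\<forall>i. poly.coeff (monom 1 k) i \<in> \<int>" by simp
    show "lead_coeff (monom 1 k) = (1 :: complex)" by (simp add: degree_monom_eq)
    show "degree (monom (1 :: complex) k) > 0" using k(1) by (simp add: degree_monom_eq)
  qed
  then have uR: "u \<in> R" using uK by (simp add: R_eq)
  have u0: "u \<noteq> 0" using nz unfolding u_def by simp
  \<comment> \<open>Both sides are the ideal generated by \<alpha>^l, and k-th roots of ideals are
    unique.\<close>
  have "ipow (pid u) k = ipow (ipow P l) k"
    unfolding ipow_pid uk unfolding ipow_pid[symmetric] k(4)[symmetric] ipow_mult[OF P(1), symmetric]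
    by (simp only: mult.commute)
  then have "pid u = ipow P l" by (rule ipow_inj[OF idl_pid[OF uR u0] idl_ipow[OF P(1)] k(1)])
  then show ?thesis using uR v unfolding u_def v_def by simp
qed

text \<open>Multiplicative induction from \<open>psi_degree_one\<close>. For a prime p that is not
  the norm of an ideal, (p) is the only ideal of norm p^2, so its value is a rational coefficient
  and equals p^l up to sign.\<close>

theorem rational_generates:
  assumes "idl A" "coprime (N A) M"
  shows "\<psi> A \<in> R \<and> \<psi> A \<noteq> 0 \<and> pid (\<psi> A) = ipow A l \<and> \<psi> (cnj ` A) = cnj (\<psi> A)"
  using assms
proof (induct rule: coprime_ideal_induct)
  case unit
  then show ?case using hecke_R[OF hecke] ipow_pid[of 1 l] by simp
next
  case (degree_one P C)
  note D1 = psi_degree_one[OF degree_one(1) refl degree_one(2,3)]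
  have nz: "\<psi> P \<noteq> 0" "\<psi> C \<noteq> 0" "\<psi> (cnj ` P) \<noteq> 0" "\<psi> (cnj ` C) \<noteq> 0"
    using coprime_norm_modulus(2)[OF degree_one(1,3)] degree_one(6) D1 by auto
  show ?case
    using D1 degree_one(6) nz unfolding imul_cnj hecke_mult[OF hecke nz(1,2)] hecke_mult[OF hecke nz(3,4)]
      pid_mult[symmetric] ipow_imul[OF degree_one(1,4)] by auto
next
  case (inert p C)
  let ?P = "pid (of_nat p)"
  have p0: "(of_nat p :: complex) \<noteq> 0" "(of_nat p :: complex) \<in> R" using prime_gt_0_nat[OF inert(1)] by auto
  have P: "idl ?P" by (rule idl_pid[OF p0(2,1)])
  have "coprime (N ?P) M" using N_pid[OF p0(2,1)] inert(2) by (simp add: nm_of_nat)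
  then have nzP: "\<psi> ?P \<noteq> 0" using coprime_norm_modulus(2)[OF P] by blast
  have "fps_nth (hecke_series K \<psi>) (p ^ 2) = \<psi> ?P"
  proof -
    have "{I. idl I \<and> N I = p ^ 2} = {?P}" by (rule ideals_norm_inert) (use inert(1,3) in blast)+
    then show ?thesis unfolding hecke_series_nth by simp
  qed
  then have "\<psi> ?P \<in> \<rat>" using rat unfolding rational_coeffs_def by metis
  then have v: "\<psi> ?P = of_nat (p ^ l) \<or> \<psi> ?P = - of_nat (p ^ l)"
    by (intro psi_rational_prime[OF inert(1,2)] Rats_imp_Reals)
  have cP: "cnj ` ?P = ?P" unfolding pid_cnj by simp
  have neg: "pid (- a) = pid a" for a
  proof -
    have "pid (-1) = R" by (rule pid_unit) (use R_of_int[of "-1"] nm_of_int[of "-1"] in simp_all)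
    then have "R \<odot> pid a = pid (- a)" using pid_mult[of "-1" a] by simp
    moreover have "R \<odot> pid a = pid a" using pid_mult[of 1 a] by simp
    ultimately show ?thesis by simp
  qed
  have D1: "\<psi> ?P \<in> R \<and> pid (\<psi> ?P) = ipow ?P l \<and> \<psi> (cnj ` ?P) = cnj (\<psi> ?P)"
    unfolding cP ipow_pid using v neg R_uminus[OF R_of_nat[of "p ^ l"]]
    by (auto simp del: of_nat_power simp flip: of_nat_power)
  have nz: "\<psi> ?P \<noteq> 0" "\<psi> C \<noteq> 0" "\<psi> (cnj ` ?P) \<noteq> 0" "\<psi> (cnj ` C) \<noteq> 0"
    using nzP inert(6) D1 by auto
  show ?case
    using D1 inert(6) nz unfolding imul_cnj hecke_mult[OF hecke nz(1,2)] hecke_mult[OF hecke nz(3,4)]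
      pid_mult[symmetric] ipow_imul[OF P inert(4)] by auto
qed

text \<open>Choose C of norm prime to M with I C generated by \<xi>. Then \<xi>^l / \<psi>(C)
  generates I^l.\<close>

theorem rational_imp_exponent_dvd: "group_exponent (class_group K) dvd l"
  unfolding exponent_dvd_iff[OF l]
proof (intro allI impI)
  fix I assume I: "idl I"
  obtain \<xi> C where C: "\<xi> \<in> R" "\<xi> \<noteq> 0" "idl C" "pid \<xi> = I \<odot> C" "coprime (N C) M"
    by (rule coprime_N_representative[OF I M(1)])
  define b where "b = \<psi> C"
  have b: "b \<in> R" "b \<noteq> 0" "pid b = ipow C l" using rational_generates[OF C(3,5)] by (auto simp: b_def)
  have e: "pid (\<xi> ^ l) = ipow I l \<odot> pid b"
    unfolding b(3) ipow_pid[symmetric] C(4) by (rule ipow_imul[OF I C(3)])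
  have "\<xi> ^ l \<in> ipow I l \<odot> pid b" unfolding e[symmetric] by simp
  then have "\<xi> ^ l \<in> pid b" using imul_subset_right[OF idl_ipow[OF I] idl_pid[OF b(1,2)]] by blast
  then obtain \<beta> where \<beta>: "\<beta> \<in> R" "\<xi> ^ l = b * \<beta>" by (auto simp: pid_iff)
  have \<beta>0: "\<beta> \<noteq> 0" using \<beta>(2) C(2) by auto
  have "pid b \<odot> ipow I l = pid b \<odot> pid \<beta>"
    unfolding pid_mult \<beta>(2)[symmetric] e by (rule imul_comm)
  then have "ipow I l = pid \<beta>"
    by (rule imul_cancel[OF idl_pid[OF b(1,2)] idl_ipow[OF I] idl_pid[OF \<beta>(1) \<beta>0]])
  then show "\<exists>\<beta>\<in>R. \<beta> \<noteq> 0 \<and> ipow I l = pid \<beta>" using \<beta>(1) \<beta>0 by blast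
qed

end

end

section \<open>Even quadratic Dirichlet characters\<close>

lemma Legendre_values: "Legendre a p \<in> {-1, 0, 1}"
  by (simp add: Legendre_def)

lemma Legendre_cong_eq:
  assumes "p > 2" "[Legendre a p = x] (mod p)" "x \<in> {-1, 0, 1}" shows "Legendre a p = x"
proof -
  have "p dvd Legendre a p - x" using assms(2) by (simp add: cong_iff_dvd_diff)
  moreover have "\<bar>Legendre a p - x\<bar> < p" using assms(1,3) Legendre_values[of a p] by auto
  ultimately have "Legendre a p - x = 0" using zdvd_imp_le[of p "\<bar>Legendre a p - x\<bar>"] by auto
  then show ?thesis by simp
qed

lemma Legendre_mult:
  assumes "prime p" "p > 2" shows "Legendre (a * b) (int p) = Legendre a (int p) * Legendre b (int p)"
proof (rule Legendre_cong_eq)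
  note e = euler_criterion[OF assms]
  have "[Legendre (a * b) (int p) = a ^ ((p - 1) div 2) * b ^ ((p - 1) div 2)] (mod int p)"
    using e[of "a * b"] by (simp add: power_mult_distrib)
  then show "[Legendre (a * b) (int p) = Legendre a (int p) * Legendre b (int p)] (mod int p)"
    by (rule cong_trans[OF _ cong_mult[OF cong_sym[OF e] cong_sym[OF e]]])
  show "Legendre a (int p) * Legendre b (int p) \<in> {-1, 0, 1}"
    using Legendre_values[of a "int p"] Legendre_values[of b "int p"] by auto
qed (use assms in simp)

lemma Legendre_cong: "[a = b] (mod p) \<Longrightarrow> Legendre a p = Legendre b p"
  unfolding Legendre_def QuadRes_def cong_def by simp

lemma Legendre_minus_one:
  assumes "prime p" "p > 2" shows "Legendre (-1) (int p) = (if p mod 4 = 1 then 1 else -1)"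
proof (rule Legendre_cong_eq)
  have odd: "odd p" using assms prime_odd_nat by simp
  have "(-1 :: int) ^ ((p - 1) div 2) = (if p mod 4 = 1 then 1 else -1)"
  proof (cases "p mod 4 = 1")
    case True
    then have "even ((p - 1) div 2)" by presburger
    then show ?thesis using True by simp
  next
    case False
    then have "odd ((p - 1) div 2)" using odd by presburger
    then show ?thesis using False by simp
  qed
  then show "[Legendre (-1) (int p) = (if p mod 4 = 1 then 1 else -1)] (mod int p)"
    using euler_criterion[OF assms, of "-1"] by simp
qed (use assms in auto)

text \<open>Gauss's lemma with h = (p - 1) / 2: the doubles of 1, ..., h are their own residues, and
  those exceeding h come from the numbers above h div 2. The parity of their number h - h div 2
  depends on p modulo 8.\<close>

lemma Legendre_two:
  assumes "prime p" "p > 2" shows "Legendre 2 (int p) = (if p mod 8 = 1 \<or> p mod 8 = 7 then 1 else -1)"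
proof -
  have odd: "odd p" using assms prime_odd_nat by simp
  have "[2 \<noteq> 0] (mod int p)" using assms by (simp add: cong_def)
  then interpret G: GAUSS p 2 using assms by unfold_locales auto
  define h where "h = (int p - 1) div 2"
  have h: "2 * h = int p - 1" "h \<ge> 0" using odd assms(2) unfolding h_def by presburger+
  have "G.C = (\<lambda>x. 2 * x) ` {0<..h}"
  proof -
    have "(x * 2) mod int p = 2 * x" if "x \<in> {0<..h}" for x using that h by (simp add: mod_pos_pos_trivial)
    then show ?thesis unfolding G.C_def G.B_def G.A_def h_def[symmetric] image_image by (intro image_cong) auto
  qed
  then have "G.E = (\<lambda>x. 2 * x) ` {h div 2<..h}"
    unfolding G.E_def h_def[symmetric] using h by auto
  then have "card G.E = card {h div 2<..h}" by (simp add: card_image inj_on_def)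
  then have c: "card G.E = nat (h - h div 2)" by simp
  have "even (nat (h - h div 2)) \<longleftrightarrow> even (h - h div 2)" using h(2) by (simp add: even_nat_iff)
  also have "\<dots> \<longleftrightarrow> int p mod 8 = 1 \<or> int p mod 8 = 7" using h by presburger
  also have "\<dots> \<longleftrightarrow> p mod 8 = 1 \<or> p mod 8 = 7" by presburger
  finally show ?thesis using G.gauss_lemma c by simp
qed

text \<open>The symbol is set to 0 at every prime dividing 2 d, and 8 d is taken as a period, exact
  or not. In this form symbols of d1 and d2 multiply to one of d1 d2, so existence reduces to -1 and
  primes. The value at -1 records that the symbol of a negative d is odd.\<close>

definition kronecker_symbol :: "int \<Rightarrow> (int \<Rightarrow> int) \<Rightarrow> bool" where
  "kronecker_symbol d e \<longleftrightarrow> (\<forall>a b. e (a * b) = e a * e b) \<and> (\<forall>a b. [a = b] (mod 8 * d) \<longrightarrow> e a = e b) \<and>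
    (\<forall>a. coprime a (2 * d) \<longrightarrow> e a = 1 \<or> e a = -1) \<and> (\<forall>a. \<not> coprime a (2 * d) \<longrightarrow> e a = 0) \<and>
    e (-1) = sgn d \<and> (\<forall>p. prime p \<longrightarrow> coprime (int p) (2 * d) \<longrightarrow> e (int p) = Legendre d (int p))"

lemma odd_prime_gt_2: "prime p \<Longrightarrow> coprime (int p) (2 * d) \<Longrightarrow> p > 2"
proof -
  assume p: "prime p" "coprime (int p) (2 * d)"
  have "p \<noteq> 2" using p(2) by auto
  then show "p > 2" using prime_ge_2_nat[OF p(1)] by simp
qed

lemma kronecker_mult:
  assumes d: "kronecker_symbol d1 e1" "kronecker_symbol d2 e2"
  shows "kronecker_symbol (d1 * d2) (\<lambda>a. e1 a * e2 a)"
  unfolding kronecker_symbol_def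
proof (intro conjI allI impI)
  have cop: "coprime a (2 * (d1 * d2)) \<longleftrightarrow> coprime a (2 * d1) \<and> coprime a (2 * d2)" for a
    by (auto simp: coprime_mult_right_iff)
  show "e1 (a * b) * e2 (a * b) = e1 a * e2 a * (e1 b * e2 b)" for a b
    using d unfolding kronecker_symbol_def by simp
  show "e1 a * e2 a = e1 b * e2 b" if ab: "[a = b] (mod 8 * (d1 * d2))" for a b
  proof -
    have "[a = b] (mod 8 * d1)" by (rule cong_dvd_modulus[OF ab]) simp
    moreover have "[a = b] (mod 8 * d2)" by (rule cong_dvd_modulus[OF ab]) simp
    ultimately have "e1 a = e1 b" "e2 a = e2 b" using d unfolding kronecker_symbol_def by blast+
    then show ?thesis by simp
  qed
  show "e1 a * e2 a = 1 \<or> e1 a * e2 a = -1" if "coprime a (2 * (d1 * d2))" for a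
  proof -
    have "e1 a = 1 \<or> e1 a = -1" "e2 a = 1 \<or> e2 a = -1" using d that unfolding kronecker_symbol_def cop by blast+
    then show ?thesis by auto
  qed
  show "e1 a * e2 a = 0" if "\<not> coprime a (2 * (d1 * d2))" for a
  proof -
    have "e1 a = 0 \<or> e2 a = 0" using d that unfolding kronecker_symbol_def cop by blast
    then show ?thesis by auto
  qed
  show "e1 (-1) * e2 (-1) = sgn (d1 * d2)" using d unfolding kronecker_symbol_def by (simp add: sgn_mult)
  show "e1 (int p) * e2 (int p) = Legendre (d1 * d2) (int p)" if p: "prime p" "coprime (int p) (2 * (d1 * d2))" for p
  proof -
    have "e1 (int p) = Legendre d1 (int p)" "e2 (int p) = Legendre d2 (int p)"
      using d p unfolding kronecker_symbol_def cop by blast+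
    then show ?thesis using Legendre_mult[OF p(1) odd_prime_gt_2[OF p]] by simp
  qed
qed

text \<open>\<open>chi4\<close> and \<open>chi8\<close> are the Dirichlet characters modulo 4 and 8
  that belong to -1 and 2, by the two supplements to quadratic reciprocity.\<close>

definition chi4 :: "int \<Rightarrow> int" where
  "chi4 a = (if a mod 4 = 1 then 1 else if a mod 4 = 3 then -1 else 0)"

definition chi8 :: "int \<Rightarrow> int" where
  "chi8 a = (if a mod 8 = 1 \<or> a mod 8 = 7 then 1 else if a mod 8 = 3 \<or> a mod 8 = 5 then -1 else 0)"

lemma chi4_mult: "chi4 (a * b) = chi4 a * chi4 b"
proof -
  define x where "x = a mod 4"
  define y where "y = b mod 4"
  have e: "(a * b) mod 4 = (x * y) mod 4" by (simp add: x_def y_def mod_mult_eq)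
  have "x = 0 \<or> x = 1 \<or> x = 2 \<or> x = 3" "y = 0 \<or> y = 1 \<or> y = 2 \<or> y = 3"
    unfolding x_def y_def by presburger+
  then show ?thesis unfolding chi4_def e x_def[symmetric] y_def[symmetric] by (elim disjE) simp_all
qed

lemma chi8_mult: "chi8 (a * b) = chi8 a * chi8 b"
proof -
  define x where "x = a mod 8"
  define y where "y = b mod 8"
  have e: "(a * b) mod 8 = (x * y) mod 8" by (simp add: x_def y_def mod_mult_eq)
  have "x = 0 \<or> x = 1 \<or> x = 2 \<or> x = 3 \<or> x = 4 \<or> x = 5 \<or> x = 6 \<or> x = 7"
    "y = 0 \<or> y = 1 \<or> y = 2 \<or> y = 3 \<or> y = 4 \<or> y = 5 \<or> y = 6 \<or> y = 7"
    unfolding x_def y_def by presburger+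
  then show ?thesis unfolding chi8_def e x_def[symmetric] y_def[symmetric] by (elim disjE) simp_all
qed

lemma chi4_cong: assumes "[a = b] (mod 8 * d)" shows "chi4 a = chi4 b"
proof -
  have "[a = b] (mod 4)" by (rule cong_dvd_modulus[OF assms]) simp
  then show ?thesis by (simp add: chi4_def cong_def)
qed

lemma chi8_cong: assumes "[a = b] (mod 8 * d)" shows "chi8 a = chi8 b"
proof -
  have "[a = b] (mod 8)" by (rule cong_dvd_modulus[OF assms]) simp
  then show ?thesis by (simp add: chi8_def cong_def)
qed

lemma chi4_values: "odd a \<Longrightarrow> chi4 a = 1 \<or> chi4 a = -1" "even a \<Longrightarrow> chi4 a = 0"
proof -
  show "chi4 a = 1 \<or> chi4 a = -1" if "odd a"
  proof -
    have "a mod 4 = 1 \<or> a mod 4 = 3" using that by presburger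
    then show ?thesis by (auto simp: chi4_def)
  qed
  show "chi4 a = 0" if "even a"
  proof -
    have "a mod 4 \<noteq> 1 \<and> a mod 4 \<noteq> 3" using that by presburger
    then show ?thesis by (simp add: chi4_def)
  qed
qed

lemma chi8_values: "odd a \<Longrightarrow> chi8 a = 1 \<or> chi8 a = -1" "even a \<Longrightarrow> chi8 a = 0"
proof -
  show "chi8 a = 1 \<or> chi8 a = -1" if "odd a"
  proof -
    have "a mod 8 = 1 \<or> a mod 8 = 3 \<or> a mod 8 = 5 \<or> a mod 8 = 7" using that by presburger
    then show ?thesis by (auto simp: chi8_def)
  qed
  show "chi8 a = 0" if "even a"
  proof -
    have "a mod 8 \<noteq> 1 \<and> a mod 8 \<noteq> 3 \<and> a mod 8 \<noteq> 5 \<and> a mod 8 \<noteq> 7" using that by presburger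
    then show ?thesis by (simp add: chi8_def)
  qed
qed

lemma odd_prime_coprime_2: "prime (p :: nat) \<Longrightarrow> p > 2 \<Longrightarrow> odd (int p)"
  using prime_odd_nat by simp

lemma chi4_prime: "prime p \<Longrightarrow> p > 2 \<Longrightarrow> chi4 (int p) = (if p mod 4 = 1 then 1 else -1)"
proof -
  assume p: "prime p" "p > 2"
  have "odd p" using odd_prime_coprime_2[OF p] by simp
  then have "int p mod 4 = 1 \<longleftrightarrow> p mod 4 = 1" "int p mod 4 = 1 \<or> int p mod 4 = 3" by presburger+
  then show ?thesis by (auto simp: chi4_def)
qed

lemma chi8_prime: "prime p \<Longrightarrow> p > 2 \<Longrightarrow> chi8 (int p) = (if p mod 8 = 1 \<or> p mod 8 = 7 then 1 else -1)"
proof -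
  assume p: "prime p" "p > 2"
  have "odd p" using odd_prime_coprime_2[OF p] by simp
  then have "int p mod 8 = 1 \<or> int p mod 8 = 7 \<longleftrightarrow> p mod 8 = 1 \<or> p mod 8 = 7"
    "int p mod 8 = 1 \<or> int p mod 8 = 7 \<or> int p mod 8 = 3 \<or> int p mod 8 = 5" by presburger+
  then show ?thesis by (auto simp: chi8_def)
qed

lemma kronecker_minus_one: "kronecker_symbol (-1) chi4"
  unfolding kronecker_symbol_def
proof (intro conjI allI impI)
  show "chi4 (a * b) = chi4 a * chi4 b" for a b by (rule chi4_mult)
  show "chi4 a = chi4 b" if "[a = b] (mod 8 * - 1)" for a b by (rule chi4_cong[OF that])
  show "chi4 (int p) = Legendre (- 1) (int p)" if p: "prime p" "coprime (int p) (2 * - 1)" for p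
    using Legendre_minus_one[OF p(1) odd_prime_gt_2[OF p]] chi4_prime[OF p(1) odd_prime_gt_2[OF p]] by simp
  show "chi4 a = 1 \<or> chi4 a = -1" if "coprime a (2 * - 1)" for a using that by (intro chi4_values) simp
  show "chi4 a = 0" if "\<not> coprime a (2 * - 1)" for a using that by (intro chi4_values) simp
qed (simp add: chi4_def)

lemma kronecker_two: "kronecker_symbol 2 chi8"
  unfolding kronecker_symbol_def
proof (intro conjI allI impI)
  have cop: "coprime a (2 * 2) \<longleftrightarrow> odd a" for a :: int
    unfolding coprime_mult_right_iff by simp
  show "chi8 (a * b) = chi8 a * chi8 b" for a b by (rule chi8_mult)
  show "chi8 a = chi8 b" if "[a = b] (mod 8 * 2)" for a b by (rule chi8_cong[OF that])
  show "chi8 a = 1 \<or> chi8 a = -1" if "coprime a (2 * 2)" for a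
    using that unfolding cop by (rule chi8_values)
  show "chi8 a = 0" if "\<not> coprime a (2 * 2)" for a
    using that unfolding cop by (intro chi8_values) simp
  show "chi8 (int p) = Legendre 2 (int p)" if p: "prime p" "coprime (int p) (2 * 2)" for p
    using Legendre_two[OF p(1) odd_prime_gt_2[OF p]] chi8_prime[OF p(1) odd_prime_gt_2[OF p]] by simp
qed (simp add: chi8_def)

text \<open>Reciprocity: the symbol of q at p is that of p at q, times \<open>chi4\<close> of p if q
  is 3 modulo 4. For q congruent to 1 the factor \<open>chi4 a * chi4 a\<close> is 1 at odd a and
  makes the symbol vanish at even a.\<close>

lemma kronecker_odd_prime:
  assumes q: "prime q" "q > 2"
  defines "e \<equiv> (\<lambda>a. Legendre a (int q) * (if q mod 4 = 1 then chi4 a * chi4 a else chi4 a))"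
  shows "kronecker_symbol (int q) e"
  unfolding kronecker_symbol_def
proof (intro conjI allI impI)
  have odd: "odd q" using q prime_odd_nat by simp
  have L0: "Legendre a (int q) = 0 \<longleftrightarrow> \<not> coprime a (int q)" for a
  proof -
    have "Legendre a (int q) = 0 \<longleftrightarrow> int q dvd a" by (auto simp: Legendre_def cong_0_iff)
    also have "\<dots> \<longleftrightarrow> \<not> coprime a (int q)" using q(1)
      by (metis coprime_commute prime_imp_coprime prime_nat_int_transfer coprime_absorb_left not_prime_unit)
    finally show ?thesis .
  qed
  have c4: "chi4 a = 0 \<longleftrightarrow> even a" for a using chi4_values by (metis zero_neq_one zero_neq_neg_one)
  show "e (a * b) = e a * e b" for a b unfolding e_def Legendre_mult[OF q] chi4_mult by simp
  show "e a = e b" if ab: "[a = b] (mod 8 * int q)" for a b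
  proof -
    have "[a = b] (mod int q)" by (rule cong_dvd_modulus[OF ab]) simp
    then show ?thesis unfolding e_def using Legendre_cong chi4_cong[OF ab] by metis
  qed
  show "e a = 1 \<or> e a = -1" if "coprime a (2 * int q)" for a
  proof -
    have "coprime a (int q)" "odd a" using that by (auto simp: coprime_mult_right_iff)
    then have "Legendre a (int q) \<noteq> 0" "chi4 a = 1 \<or> chi4 a = -1" using L0 chi4_values(1) by blast+
    then have "Legendre a (int q) = 1 \<or> Legendre a (int q) = -1" "chi4 a = 1 \<or> chi4 a = -1"
      using Legendre_values[of a "int q"] by auto
    then show ?thesis unfolding e_def by auto
  qed
  show "e a = 0" if "\<not> coprime a (2 * int q)" for a
  proof -
    have "\<not> coprime a (int q) \<or> even a" using that by (auto simp: coprime_mult_right_iff)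
    then show ?thesis unfolding e_def using L0[of a] c4[of a] by auto
  qed
  show "e (-1) = sgn (int q)" unfolding e_def Legendre_minus_one[OF q] using q(2) by (simp add: chi4_def)
  show "e (int p) = Legendre (int q) (int p)" if p: "prime p" "coprime (int p) (2 * int q)" for p
  proof -
    have g: "p > 2" by (rule odd_prime_gt_2[OF p])
    have oddp: "odd p" using odd_prime_coprime_2[OF p(1) g] by simp
    have ne: "p \<noteq> q" using p q by auto
    have rec: "Legendre (int p) (int q) * Legendre (int q) (int p) = (-1) ^ ((p - 1) div 2 * ((q - 1) div 2))"
      by (rule Quadratic_Reciprocity[OF p(1) g q ne])
    have c: "chi4 (int p) = (if p mod 4 = 1 then 1 else -1)"
      by (rule chi4_prime[OF p(1) g])
    have ev: "even ((p - 1) div 2) \<longleftrightarrow> p mod 4 = 1" "even ((q - 1) div 2) \<longleftrightarrow> q mod 4 = 1"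
      using oddp odd by presburger+
    have s: "(-1 :: int) ^ ((p - 1) div 2 * ((q - 1) div 2)) = (if q mod 4 = 1 then chi4 (int p) * chi4 (int p) else chi4 (int p))"
      unfolding c using ev by auto
    have "Legendre (int q) (int p) \<in> {-1, 0, 1}" "Legendre (int p) (int q) \<in> {-1, 0, 1}" by (rule Legendre_values)+
    then show ?thesis using rec unfolding e_def s[symmetric]
      by (auto simp: minus_one_power_iff split: if_splits)
  qed
qed

lemma kronecker_exists: assumes "d \<noteq> 0" shows "\<exists>e. kronecker_symbol d e"
  using assms
proof (induct d rule: prime_divisors_induct)
  case (unit x)
  \<comment> \<open>Writing 1 as a product of two factors -1 yields the symbol of 1 that vanishes at
    even numbers.\<close>
  then have "x = -1 \<or> x = (-1) * (-1)" by (auto simp: zdvd1_eq abs_if split: if_splits)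
  then show ?case using kronecker_minus_one kronecker_mult[OF kronecker_minus_one kronecker_minus_one] by auto
next
  case (factor p x)
  have "x \<noteq> 0" using factor(3) by auto
  then obtain e where e: "kronecker_symbol x e" using factor(2) by blast
  have "\<exists>e'. kronecker_symbol p e'"
  proof (cases "p = 2")
    case True
    then show ?thesis using kronecker_two by blast
  next
    case False
    define q where "q = nat p"
    have pq: "p = int q" using prime_ge_0_int[OF factor(1)] by (simp add: q_def)
    have q: "prime q" using factor(1) unfolding pq by simp
    have "q > 2" using prime_ge_2_nat[OF q] False pq by simp
    then show ?thesis unfolding pq using kronecker_odd_prime[OF q] by blast
  qed
  then show ?case using kronecker_mult[OF _ e] by blast
qed simp

section \<open>Lambert series of periodic functions with mean value zero\<close>

lemma power_sum_lipschitz: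
  fixes c :: "'a \<Rightarrow> real"
  assumes "finite I"
  obtains L where "L \<ge> 0" "\<And>u v. 0 \<le> u \<Longrightarrow> u \<le> 1 \<Longrightarrow> 0 \<le> v \<Longrightarrow> v \<le> 1 \<Longrightarrow>
    \<bar>(\<Sum>i\<in>I. c i * u ^ k i) - (\<Sum>i\<in>I. c i * v ^ k i)\<bar> \<le> L * \<bar>u - v\<bar>"
proof -
  define L where "L = (\<Sum>i\<in>I. \<bar>c i\<bar> * real (k i))"
  show ?thesis
  proof (rule that[of L])
    show "L \<ge> 0" unfolding L_def by (intro sum_nonneg) auto
    fix u v :: real assume uv: "0 \<le> u" "u \<le> 1" "0 \<le> v" "v \<le> 1"
    have "\<bar>(\<Sum>i\<in>I. c i * u ^ k i) - (\<Sum>i\<in>I. c i * v ^ k i)\<bar> = \<bar>\<Sum>i\<in>I. c i * (u ^ k i - v ^ k i)\<bar>"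
      by (simp add: sum_subtractf right_diff_distrib)
    also have "\<dots> \<le> (\<Sum>i\<in>I. \<bar>c i * (u ^ k i - v ^ k i)\<bar>)" by (rule sum_abs)
    also have "\<dots> \<le> (\<Sum>i\<in>I. \<bar>c i\<bar> * real (k i) * \<bar>u - v\<bar>)"
    proof (rule sum_mono)
      fix i
      have "\<bar>u ^ k i - v ^ k i\<bar> \<le> real (k i) * \<bar>u - v\<bar>"
        using norm_power_diff[of u v "k i"] uv by simp
      then show "\<bar>c i * (u ^ k i - v ^ k i)\<bar> \<le> \<bar>c i\<bar> * real (k i) * \<bar>u - v\<bar>"
        unfolding abs_mult mult.assoc by (rule mult_left_mono) simp
    qed
    also have "\<dots> = L * \<bar>u - v\<bar>" unfolding L_def by (simp add: sum_distrib_right)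
    finally show "\<bar>(\<Sum>i\<in>I. c i * u ^ k i) - (\<Sum>i\<in>I. c i * v ^ k i)\<bar> \<le> L * \<bar>u - v\<bar>" .
  qed
qed

lemma bounded_power_series_summable:
  fixes g :: "nat \<Rightarrow> real"
  assumes "\<And>n. \<bar>g n\<bar> \<le> 1" "0 \<le> u" "u < 1" shows "summable (\<lambda>n. norm (g n * u ^ n))"
proof (rule summable_comparison_test'[where N = 0])
  show "summable (\<lambda>n. u ^ n)" using assms by (intro summable_geometric) simp
  show "norm (norm (g n * u ^ n)) \<le> u ^ n" for n
    using mult_right_mono[OF assms(1), of "u ^ n" n] assms(2) by (simp add: abs_mult)
qed

text \<open>By periodicity (1 - u^q) G(u) is a polynomial, and it vanishes at u = 1 because the
  values over a period sum to 0. Cancelling 1 - u leaves G E = - Q with polynomials E, Q and E at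
  least 1 on nonnegative arguments, and such a quotient is Lipschitz on the unit interval.\<close>

lemma periodic_series_lipschitz:
  fixes g :: "nat \<Rightarrow> real"
  assumes q: "q > 0" and per: "\<And>n. g (n + q) = g n" and b: "\<And>n. \<bar>g n\<bar> \<le> 1" and s0: "(\<Sum>n<q. g n) = 0"
  obtains L where "L \<ge> 0" "\<And>u v. 0 \<le> u \<Longrightarrow> u < 1 \<Longrightarrow> 0 \<le> v \<Longrightarrow> v < 1 \<Longrightarrow>
    abs ((suminf (\<lambda>n. g n * u ^ n)) - (suminf (\<lambda>n. g n * v ^ n))) \<le> L * \<bar>u - v\<bar>"
proof -
  define G where "G = (\<lambda>u. suminf (\<lambda>n. g n * u ^ n))"
  define E where "E = (\<lambda>u :: real. \<Sum>i<q. 1 * u ^ i)"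
  define I where "I = Sigma {..<q} (\<lambda>b. {..<b})"
  define Q where "Q = (\<lambda>u. \<Sum>x\<in>I. g (fst x) * u ^ snd x)"
  have finI: "finite I" by (simp add: I_def)
  have GE: "G u * E u = - Q u" if u: "0 \<le> u" "u < 1" for u
  proof -
    have sm: "summable (\<lambda>n. g n * u ^ n)"
      by (rule summable_norm_cancel[OF bounded_power_series_summable[OF b u]])
    have "G u = (suminf (\<lambda>n. g (n + q) * u ^ (n + q))) + (\<Sum>n<q. g n * u ^ n)"
      unfolding G_def by (rule suminf_split_initial_segment[OF sm])
    also have "(suminf (\<lambda>n. g (n + q) * u ^ (n + q))) = (suminf (\<lambda>n. u ^ q * (g n * u ^ n)))"
      unfolding per by (intro suminf_cong) (simp add: power_add)
    also have "\<dots> = u ^ q * G u" unfolding G_def by (rule suminf_mult[OF sm])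
    finally have 1: "G u * (1 - u ^ q) = (\<Sum>n<q. g n * u ^ n)" by (simp add: algebra_simps)
    have "(\<Sum>n<q. g n * u ^ n) = (\<Sum>n<q. g n * u ^ n) - (\<Sum>n<q. g n)" using s0 by simp
    also have "\<dots> = (\<Sum>n<q. g n * (u ^ n - 1))" by (simp add: sum_subtractf right_diff_distrib)
    also have "\<dots> = (\<Sum>n<q. - ((1 - u) * (\<Sum>i<n. g n * u ^ i)))"
    proof (rule sum.cong[OF refl])
      fix n
      have "u ^ n - 1 = - ((1 - u) * (\<Sum>i<n. u ^ i))" using one_diff_power_eq[of u n] by simp
      then show "g n * (u ^ n - 1) = - ((1 - u) * (\<Sum>i<n. g n * u ^ i))"
        by (simp add: sum_distrib_left mult.left_commute)
    qed
    also have "\<dots> = - ((1 - u) * (\<Sum>n<q. \<Sum>i<n. g n * u ^ i))"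
      by (simp add: sum_negf sum_distrib_left)
    also have "(\<Sum>n<q. \<Sum>i<n. g n * u ^ i) = Q u"
      unfolding Q_def I_def by (subst sum.Sigma) (auto simp: case_prod_unfold)
    finally have 2: "(\<Sum>n<q. g n * u ^ n) = - ((1 - u) * Q u)" .
    have "1 - u ^ q = (1 - u) * E u" unfolding E_def using one_diff_power_eq[of u q] by simp
    then have "(1 - u) * (G u * E u) = (1 - u) * (- Q u)" using 1 2 by (simp add: mult.left_commute)
    then show ?thesis by (rule mult_left_cancel[THEN iffD1, rotated]) (use u in simp)
  qed
  have E1: "E u \<ge> 1" if "0 \<le> u" for u
  proof -
    have "(\<Sum>i\<in>{0}. 1 * u ^ i) \<le> E u" unfolding E_def by (rule sum_mono2) (use q that in auto)
    then show ?thesis by simp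
  qed
  define B where "B = real (card I)"
  have GB: "\<bar>G u\<bar> \<le> B" if u: "0 \<le> u" "u < 1" for u
  proof -
    have "\<bar>G u\<bar> * 1 \<le> \<bar>G u\<bar> * E u" by (rule mult_left_mono[OF E1[OF u(1)]]) simp
    also have "\<dots> = \<bar>G u * E u\<bar>" using E1[OF u(1)] by (simp add: abs_mult)
    also have "\<dots> = \<bar>Q u\<bar>" unfolding GE[OF u] by simp
    also have "\<dots> \<le> (\<Sum>x\<in>I. \<bar>g (fst x) * u ^ snd x\<bar>)" unfolding Q_def by (rule sum_abs)
    also have "\<dots> \<le> (\<Sum>x\<in>I. 1)"
    proof (rule sum_mono)
      fix x :: "nat \<times> nat"
      have "u ^ snd x \<le> 1" using u by (intro power_le_one) auto
      then have "\<bar>g (fst x)\<bar> * u ^ snd x \<le> 1 * 1" using b u by (intro mult_mono) auto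
      then show "\<bar>g (fst x) * u ^ snd x\<bar> \<le> 1" using u by (simp add: abs_mult)
    qed
    finally show ?thesis by (simp add: B_def)
  qed
  obtain L1 where L1: "L1 \<ge> 0" "\<And>u v. 0 \<le> u \<Longrightarrow> u \<le> 1 \<Longrightarrow> 0 \<le> v \<Longrightarrow> v \<le> 1 \<Longrightarrow> \<bar>Q u - Q v\<bar> \<le> L1 * \<bar>u - v\<bar>"
    unfolding Q_def using power_sum_lipschitz[OF finI, of "\<lambda>x. g (fst x)" snd] by blast
  obtain L2 where L2: "L2 \<ge> 0" "\<And>u v. 0 \<le> u \<Longrightarrow> u \<le> 1 \<Longrightarrow> 0 \<le> v \<Longrightarrow> v \<le> 1 \<Longrightarrow> \<bar>E u - E v\<bar> \<le> L2 * \<bar>u - v\<bar>"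
    unfolding E_def using power_sum_lipschitz[OF finite_lessThan[of q], of "\<lambda>_. 1" "\<lambda>i. i"] by blast
  have "\<bar>G u - G v\<bar> \<le> (L1 + B * L2) * \<bar>u - v\<bar>" if uv: "0 \<le> u" "u < 1" "0 \<le> v" "v < 1" for u v
  proof -
    have "(G u - G v) * E u = (G u * E u - G v * E v) + G v * (E v - E u)" by (simp add: algebra_simps)
    also have "\<dots> = (Q v - Q u) + G v * (E v - E u)" unfolding GE[OF uv(1,2)] GE[OF uv(3,4)] by simp
    finally have e: "(G u - G v) * E u = (Q v - Q u) + G v * (E v - E u)" .
    have "\<bar>G u - G v\<bar> * 1 \<le> \<bar>G u - G v\<bar> * E u" by (rule mult_left_mono[OF E1[OF uv(1)]]) simp
    also have "\<dots> = \<bar>(G u - G v) * E u\<bar>" using E1[OF uv(1)] by (simp add: abs_mult)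
    also have "\<dots> \<le> \<bar>Q v - Q u\<bar> + \<bar>G v\<bar> * \<bar>E v - E u\<bar>" unfolding e
      using abs_triangle_ineq[of "Q v - Q u" "G v * (E v - E u)"] by (simp add: abs_mult)
    also have "\<dots> \<le> L1 * \<bar>v - u\<bar> + B * (L2 * \<bar>v - u\<bar>)"
      using L1(2)[of v u] L2(2)[of v u] GB[OF uv(3,4)] uv by (intro add_mono mult_mono) auto
    also have "\<dots> = (L1 + B * L2) * \<bar>u - v\<bar>" by (simp add: algebra_simps abs_minus_commute)
    finally show ?thesis by simp
  qed
  moreover have "L1 + B * L2 \<ge> 0" using L1(1) L2(1) by (simp add: B_def)
  ultimately show ?thesis using that unfolding G_def by blast
qed

lemma periodic_partial_sum_bound:
  fixes f :: "nat \<Rightarrow> real"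
  assumes q: "q > 0" and per: "\<And>n. f (n + q) = f n" and b: "\<And>n. \<bar>f n\<bar> \<le> 1" and s0: "(\<Sum>n<q. f n) = 0"
  shows "\<bar>\<Sum>a<n. f a\<bar> \<le> real q"
proof (induct n rule: less_induct)
  case (less n)
  show ?case
  proof (cases "n < q")
    case True
    have "\<bar>\<Sum>a<n. f a\<bar> \<le> (\<Sum>a<n. 1)" by (rule order_trans[OF sum_abs sum_mono]) (rule b)
    then show ?thesis using True by simp
  next
    case False
    then obtain m where m: "n = m + q" by (metis add.commute le_Suc_ex not_less)
    have "(\<Sum>a<m + q. f a) = (\<Sum>a<q. f a) + (\<Sum>a<m. f (a + q))"
      using sum.nat_group[of f] sum.atLeastLessThan_concat[of 0 q "m + q" f] sum.shift_bounds_nat_ivl[of f 0 q m]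
      by (simp add: lessThan_atLeast0)
    then have "(\<Sum>a<n. f a) = (\<Sum>a<m. f a)" unfolding m per s0 by simp
    then show ?thesis using less[of m] m q by simp
  qed
qed

text \<open>Abel summation: the boundary term and the sum of partial sums against the increments of
  H contribute B V each.\<close>

lemma summation_by_parts_bound:
  fixes f H :: "nat \<Rightarrow> real"
  assumes S: "\<And>n. \<bar>\<Sum>a<n. f a\<bar> \<le> B" and H: "\<And>n. \<bar>H n\<bar> \<le> V" and V: "\<And>n. (\<Sum>a<n. \<bar>H a - H (Suc a)\<bar>) \<le> V"
  shows "\<bar>\<Sum>a<n. f a * H a\<bar> \<le> B * (V + V)"
proof -
  have B0: "B \<ge> 0" using S[of 0] by simp
  have e: "(\<Sum>a<n. f a * H a) = (\<Sum>a<n. f a) * H n + (\<Sum>a<n. (\<Sum>i<Suc a. f i) * (H a - H (Suc a)))"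
    by (induct n) (simp_all add: algebra_simps)
  have "\<bar>(\<Sum>a<n. f a) * H n\<bar> \<le> B * V" unfolding abs_mult using S H B0 by (intro mult_mono) auto
  moreover have "\<bar>\<Sum>a<n. (\<Sum>i<Suc a. f i) * (H a - H (Suc a))\<bar> \<le> (\<Sum>a<n. B * \<bar>H a - H (Suc a)\<bar>)"
    by (rule order_trans[OF sum_abs sum_mono]) (unfold abs_mult, rule mult_right_mono[OF S], simp)
  moreover have "(\<Sum>a<n. B * \<bar>H a - H (Suc a)\<bar>) \<le> B * V"
    unfolding sum_distrib_left[symmetric] by (rule mult_left_mono[OF V B0])
  ultimately show ?thesis unfolding e by (simp add: distrib_left)
qed

text \<open>Lambert series: \<open>\<Sum> (f * g)(n) t\<^sup>n = \<Sum> f(a) G(t\<^sup>a)\<close> with \<open>G(u) = \<Sum> g(b) u\<^sup>b\<close> stays bounded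
  as \<open>t\<close> tends to 1, because \<open>G\<close> is Lipschitz and \<open>f\<close> has bounded partial sums.\<close>

lemma lambert_series_bounded:
  fixes f g :: "nat \<Rightarrow> real"
  assumes q: "q > 0" and f: "\<And>n. f (n + q) = f n" "\<And>n. \<bar>f n\<bar> \<le> 1" "(\<Sum>n<q. f n) = 0" "f 0 = 0"
    and g: "\<And>n. g (n + q) = g n" "\<And>n. \<bar>g n\<bar> \<le> 1" "(\<Sum>n<q. g n) = 0" "g 0 = 0"
  obtains C where "\<And>t. 0 < t \<Longrightarrow> t < 1 \<Longrightarrow>
    \<exists>S \<le> C. ((\<lambda>n. (\<Sum>d | d dvd n. f d * g (n div d)) * t ^ n) has_sum S) {1..}"
proof -
  obtain L where L: "L \<ge> 0" "\<And>u v. 0 \<le> u \<Longrightarrow> u < 1 \<Longrightarrow> 0 \<le> v \<Longrightarrow> v < 1 \<Longrightarrow>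
    abs ((suminf (\<lambda>n. g n * u ^ n)) - (suminf (\<lambda>n. g n * v ^ n))) \<le> L * \<bar>u - v\<bar>"
    using periodic_series_lipschitz[OF q g(1-3)] by blast
  define G where "G = (\<lambda>u. suminf (\<lambda>n. g n * u ^ n))"
  have G0: "G 0 = 0" unfolding G_def using g(4) by (simp add: powser_zero)
  have "\<exists>S \<le> real q * (L + L). ((\<lambda>n. (\<Sum>d | d dvd n. f d * g (n div d)) * t ^ n) has_sum S) {1..}"
    if t: "0 < t" "t < 1" for t
  proof -
    define F where "F = (\<lambda>(a, b). f a * g b * t ^ (a * b))"
    define A where "A = {1 :: nat..} \<times> {1 :: nat..}"
    \<comment> \<open>For a, b at least 1 one has a + b \<le> 2 a b, so t^(a b) is at most r^a r^b.
      This product of geometric series majorises the double series.\<close>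
    define r where "r = sqrt t"
    have r: "0 < r" "r < 1" "r ^ 2 = t" unfolding r_def using t by auto
    have "(\<lambda>x. norm (F x)) summable_on A"
    proof (rule summable_on_comparison_test)
      show "(\<lambda>(a, b). r ^ a * r ^ b) summable_on A"
      proof (rule nonneg_bdd_above_summable_on)
        show "0 \<le> (case x of (a, b) \<Rightarrow> r ^ a * r ^ b)" for x using r by (auto split: prod.splits)
        show "bdd_above (sum (\<lambda>(a, b). r ^ a * r ^ b) ` {F. F \<subseteq> A \<and> finite F})"
        proof (rule bdd_aboveI2)
          fix S assume "S \<in> {F. F \<subseteq> A \<and> finite F}"
          then have fin: "finite S" by simp
          have "sum (\<lambda>(a, b). r ^ a * r ^ b) S \<le> sum (\<lambda>(a, b). r ^ a * r ^ b) (fst ` S \<times> snd ` S)"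
            by (rule sum_mono2) (use fin r in \<open>auto simp: rev_image_eqI\<close>)
          also have "\<dots> = (\<Sum>a\<in>fst ` S. r ^ a) * (\<Sum>b\<in>snd ` S. r ^ b)"
            by (simp add: sum_product sum.cartesian_product)
          also have "\<dots> \<le> (1 / (1 - r)) * (1 / (1 - r))"
          proof (rule mult_mono)
            show "(\<Sum>a\<in>fst ` S. r ^ a) \<le> 1 / (1 - r)" "(\<Sum>a\<in>snd ` S. r ^ a) \<le> 1 / (1 - r)"
              by (rule less_imp_le[OF geometric_sum_less[OF r(1,2)]], simp add: fin)+
          qed (use r in \<open>auto intro!: sum_nonneg\<close>)
          finally show "sum (\<lambda>(a, b). r ^ a * r ^ b) S \<le> (1 / (1 - r)) * (1 / (1 - r))" .
        qed
      qed
      fix x assume x: "x \<in> A"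
      obtain a b where ab: "x = (a, b)" "a \<ge> 1" "b \<ge> 1" using x unfolding A_def by auto
      have "a + b \<le> 2 * (a * b)"
      proof -
        have "a * 1 \<le> a * b" "1 * b \<le> a * b" by (rule mult_le_mono2[OF ab(3)], rule mult_le_mono1[OF ab(2)])
        then show ?thesis by linarith
      qed
      then have "r ^ (2 * (a * b)) \<le> r ^ (a + b)" using r by (intro power_decreasing) auto
      then have "t ^ (a * b) \<le> r ^ a * r ^ b" unfolding power_mult r(3) by (simp add: power_add)
      moreover have "\<bar>f a\<bar> * \<bar>g b\<bar> \<le> 1 * 1" using f(2) g(2) by (intro mult_mono) auto
      ultimately have "(\<bar>f a\<bar> * \<bar>g b\<bar>) * t ^ (a * b) \<le> 1 * (r ^ a * r ^ b)" using t by (intro mult_mono) auto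
      then show "norm (F x) \<le> (case x of (a, b) \<Rightarrow> r ^ a * r ^ b)" using t unfolding F_def ab(1) by (simp add: abs_mult)
      show "0 \<le> norm (F x)" by simp
    qed
    then have "F summable_on A" by (rule abs_summable_summable)
    then obtain S where S: "(F has_sum S) A" unfolding summable_on_def by blast
    have tn: "0 \<le> t ^ n" "n \<ge> 1 \<Longrightarrow> t ^ n < 1" for n using t by (auto simp: power_less_one_iff)
    have "((\<lambda>a. f a * G (t ^ a)) has_sum S) {1..}"
    proof (rule has_sum_SigmaD)
      show "(F has_sum S) (Sigma {1..} (\<lambda>_. {1..}))" using S unfolding A_def .
      fix a :: nat assume a: "a \<in> {1..}"
      have u: "0 \<le> t ^ a" "t ^ a < 1" using tn a by auto
      have "((\<lambda>b. g b * (t ^ a) ^ b) has_sum G (t ^ a)) UNIV"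
        unfolding G_def by (rule norm_summable_imp_has_sum[OF bounded_power_series_summable[OF g(2) u]])
          (rule summable_sums[OF summable_norm_cancel[OF bounded_power_series_summable[OF g(2) u]]])
      then have "((\<lambda>b. g b * (t ^ a) ^ b) has_sum G (t ^ a)) {1..}"
        using g(4) by (subst has_sum_cong_neutral[of UNIV _ _ "\<lambda>b. g b * (t ^ a) ^ b"]) (auto simp: Suc_le_eq)
      from has_sum_cmult_right[OF this, of "f a"]
      show "((\<lambda>b. F (a, b)) has_sum f a * G (t ^ a)) {1..}"
        unfolding F_def by (simp add: power_mult mult.assoc)
    qed
    \<comment> \<open>The maximum keeps the argument of G below 1, where the Lipschitz bound holds;
      the added term at a = 0 is zero because f 0 = 0.\<close>
    moreover have "((\<lambda>a. f a * G (t ^ max a 1)) has_sum S) UNIV \<longleftrightarrow> ((\<lambda>a. f a * G (t ^ a)) has_sum S) {1..}"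
      by (rule has_sum_cong_neutral) (use f(4) in \<open>auto simp: max_def not_le less_Suc_eq\<close>)
    ultimately have "((\<lambda>a. f a * G (t ^ max a 1)) has_sum S) UNIV" by blast
    then have lim: "(\<lambda>n. \<Sum>a<n. f a * G (t ^ max a 1)) \<longlonglongrightarrow> S" using has_sum_imp_sums unfolding sums_def by blast
    have "\<bar>\<Sum>a<n. f a * G (t ^ max a 1)\<bar> \<le> real q * (L + L)" for n
    proof (rule summation_by_parts_bound)
      show "\<bar>\<Sum>a<n. f a\<bar> \<le> real q" for n by (rule periodic_partial_sum_bound[OF q f(1-3)])
      show "\<bar>G (t ^ max n 1)\<bar> \<le> L" for n
      proof -
        have u: "0 \<le> t ^ max n 1" "t ^ max n 1 < 1" using tn(1) tn(2)[of "max n 1"] by auto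
        have "\<bar>G (t ^ max n 1) - G 0\<bar> \<le> L * \<bar>t ^ max n 1 - 0\<bar>" unfolding G_def by (rule L(2)) (use u in auto)
        also have "\<dots> \<le> L * 1" using u L(1) by (intro mult_left_mono) auto
        finally show ?thesis using G0 by simp
      qed
      \<comment> \<open>The variation along the decreasing sequence t^a is at most L times a
        telescoping sum, uniformly in t.\<close>
      show "(\<Sum>a<n. \<bar>G (t ^ max a 1) - G (t ^ max (Suc a) 1)\<bar>) \<le> L" for n
      proof -
        have "(\<Sum>a<n. \<bar>G (t ^ max a 1) - G (t ^ max (Suc a) 1)\<bar>) \<le> (\<Sum>a<n. L * (t ^ a - t ^ Suc a))"
        proof (rule sum_mono)
          fix a
          have d: "t ^ Suc a \<le> t ^ a" using t by (intro power_decreasing) auto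
          show "\<bar>G (t ^ max a 1) - G (t ^ max (Suc a) 1)\<bar> \<le> L * (t ^ a - t ^ Suc a)"
          proof (cases "a = 0")
            case True
            then show ?thesis using L(1) t by simp
          next
            case False
            have "\<bar>G (t ^ a) - G (t ^ Suc a)\<bar> \<le> L * \<bar>t ^ a - t ^ Suc a\<bar>" unfolding G_def
              by (rule L(2)) (use False tn[of a] tn[of "Suc a"] in auto)
            moreover have "max a 1 = a" "max (Suc a) 1 = Suc a" using False by auto
            ultimately show ?thesis using d by (simp only: abs_of_nonneg[of "t ^ a - t ^ Suc a"] diff_ge_0_iff_ge)
          qed
        qed
        also have "\<dots> = L * (\<Sum>a<n. t ^ a - t ^ Suc a)" by (simp only: sum_distrib_left)
        also have "(\<Sum>a<n. t ^ a - t ^ Suc a) = 1 - t ^ n" by (induct n) simp_all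
        also have "L * (1 - t ^ n) \<le> L * 1" using L(1) tn(1) by (intro mult_left_mono) auto
        finally show ?thesis by simp
      qed
    qed
    then have "S \<le> real q * (L + L)" by (intro LIMSEQ_le_const2[OF lim]) (auto intro: abs_le_D1)
    \<comment> \<open>The same double sum grouped by the product n = a b, with d = a.\<close>
    moreover have "((\<lambda>n. (\<Sum>d | d dvd n. f d * g (n div d)) * t ^ n) has_sum S) {1..}"
    proof (rule has_sum_SigmaD)
      let ?B = "Sigma {1 :: nat..} (\<lambda>n. {d. d dvd n})"
      define \<phi> where "\<phi> = (\<lambda>(n :: nat, d :: nat). (d, n div d))"
      have bij: "bij_betw \<phi> ?B A"
      proof (rule bij_betw_byWitness[where f' = "\<lambda>(a, b). (a * b, a)"])
        show "\<phi> ` ?B \<subseteq> A" unfolding \<phi>_def A_def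
          by (auto simp: Suc_le_eq intro: dvd_pos_nat dest: dvd_div_eq_0_iff)
        show "(\<lambda>(a, b). (a * b, a)) ` A \<subseteq> ?B" unfolding A_def by (auto simp: Suc_le_eq)
      qed (auto simp: \<phi>_def A_def)
      have "((\<lambda>x. F (\<phi> x)) has_sum S) ?B" using S has_sum_reindex_bij_betw[OF bij] by blast
      moreover have "((\<lambda>x. F (\<phi> x)) has_sum S) ?B \<longleftrightarrow>
          ((\<lambda>(n, d). f d * g (n div d) * t ^ n) has_sum S) ?B"
        by (rule has_sum_cong) (auto simp: F_def \<phi>_def)
      ultimately show "((\<lambda>(n, d). f d * g (n div d) * t ^ n) has_sum S) ?B" by blast
      fix n :: nat assume n: "n \<in> {1..}"
      have "finite {d. d dvd n}" using n by (intro finite_divisors_nat) auto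
      from has_sum_finite[OF this, of "\<lambda>d. f d * g (n div d) * t ^ n"]
      show "((\<lambda>d. case (n, d) of (n, d) \<Rightarrow> f d * g (n div d) * t ^ n) has_sum
        (\<Sum>d | d dvd n. f d * g (n div d)) * t ^ n) {d. d dvd n}"
        by (simp add: sum_distrib_right)
    qed
    ultimately show ?thesis by blast
  qed
  then show ?thesis using that by blast
qed

text \<open>The Lambert series has a bound C that is uniform in t. Its coefficients are nonnegative
  and at least 1 at the squares of numbers prime to q. With t^J = 1/2, each of M such squares not
  exceeding J contributes at least 1/2, which is too much once M > 2 C.\<close>

lemma no_nonneg_periodic_convolution:
  fixes f g :: "nat \<Rightarrow> real"
  assumes q: "q > 0" and f: "\<And>n. f (n + q) = f n" "\<And>n. \<bar>f n\<bar> \<le> 1" "(\<Sum>n<q. f n) = 0" "f 0 = 0"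
    and g: "\<And>n. g (n + q) = g n" "\<And>n. \<bar>g n\<bar> \<le> 1" "(\<Sum>n<q. g n) = 0" "g 0 = 0"
    and nonneg: "\<And>n. n > 0 \<Longrightarrow> 0 \<le> (\<Sum>d | d dvd n. f d * g (n div d))"
    and sq: "\<And>m. coprime m q \<Longrightarrow> m > 0 \<Longrightarrow> 1 \<le> (\<Sum>d | d dvd m\<^sup>2. f d * g (m\<^sup>2 div d))"
  shows False
proof -
  obtain C where C: "\<And>t. 0 < t \<Longrightarrow> t < 1 \<Longrightarrow>
    \<exists>S \<le> C. ((\<lambda>n. (\<Sum>d | d dvd n. f d * g (n div d)) * t ^ n) has_sum S) {1..}"
    using lambert_series_bounded[OF q f g] by blast
  obtain M :: nat where M: "real M > 2 * C" using reals_Archimedean2 by blast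
  \<comment> \<open>An explicit supply of numbers prime to q.\<close>
  define m where "m = (\<lambda>k. 1 + k * q)"
  define J where "J = (m M)\<^sup>2"
  define t where "t = root J (1 / 2)"
  have J: "J > 0" by (simp add: J_def m_def)
  have t: "0 < t" "t < 1" "t ^ J = 1 / 2" unfolding t_def using J by auto
  obtain S where S: "S \<le> C" "((\<lambda>n. (\<Sum>d | d dvd n. f d * g (n div d)) * t ^ n) has_sum S) {1..}"
    using C[OF t(1,2)] by blast
  have inj: "inj_on (\<lambda>k. (m k)\<^sup>2) {..<M}" using q by (auto intro!: inj_onI simp: m_def)
  have "real M * (1 / 2) = (\<Sum>k<M. 1 / 2)" by simp
  also have "\<dots> \<le> (\<Sum>k<M. (\<Sum>d | d dvd (m k)\<^sup>2. f d * g ((m k)\<^sup>2 div d)) * t ^ ((m k)\<^sup>2))"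
  proof (rule sum_mono)
    fix k assume k: "k \<in> {..<M}"
    have "coprime (m k) q"
    proof (rule coprimeI)
      fix c assume "c dvd m k" "c dvd q"
      then show "is_unit c" unfolding m_def by (metis dvd_add_left_iff dvd_mult)
    qed
    then have 1: "1 \<le> (\<Sum>d | d dvd (m k)\<^sup>2. f d * g ((m k)\<^sup>2 div d))" by (rule sq) (simp add: m_def)
    have "(m k)\<^sup>2 \<le> J" unfolding J_def m_def using k by (intro power_mono) auto
    then have "t ^ J \<le> t ^ ((m k)\<^sup>2)" using t by (intro power_decreasing) auto
    then have "1 * (1 / 2) \<le> (\<Sum>d | d dvd (m k)\<^sup>2. f d * g ((m k)\<^sup>2 div d)) * t ^ ((m k)\<^sup>2)"
      using 1 t(3) by (intro mult_mono) auto
    then show "1 / 2 \<le> (\<Sum>d | d dvd (m k)\<^sup>2. f d * g ((m k)\<^sup>2 div d)) * t ^ ((m k)\<^sup>2)" by simp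
  qed
  also have "\<dots> = (\<Sum>n\<in>(\<lambda>k. (m k)\<^sup>2) ` {..<M}. (\<Sum>d | d dvd n. f d * g (n div d)) * t ^ n)"
    by (simp add: sum.reindex[OF inj])
  also have "\<dots> \<le> S"
  proof (rule finite_sum_le_has_sum[OF S(2)])
    show "(\<lambda>k. (m k)\<^sup>2) ` {..<M} \<subseteq> {1..}" by (auto simp: m_def Suc_le_eq)
    show "0 \<le> (\<Sum>d | d dvd n. f d * g (n div d)) * t ^ n" if "n \<in> {1..} - (\<lambda>k. (m k)\<^sup>2) ` {..<M}" for n
      using that nonneg[of n] t by auto
  qed auto
  finally show False using M S(1) by simp
qed

section \<open>Positivity of Dirichlet convolutions\<close>

definition dconv :: "(nat \<Rightarrow> real) \<Rightarrow> (nat \<Rightarrow> real) \<Rightarrow> nat \<Rightarrow> real" where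
  "dconv f g n = (\<Sum>d | d dvd n. f d * g (n div d))"

lemma divisors_prime_power_mult:
  fixes p n k :: nat
  assumes p: "prime p" and n: "\<not> p dvd n"
  shows "{d. d dvd p ^ k * n} = (\<lambda>(i, e). p ^ i * e) ` ({..k} \<times> {e. e dvd n})"
    "inj_on (\<lambda>(i, e). p ^ i * e) ({..k} \<times> {e. e dvd n})"
proof -
  show "{d. d dvd p ^ k * n} = (\<lambda>(i, e). p ^ i * e) ` ({..k} \<times> {e. e dvd n})"
  proof (intro equalityI subsetI)
    fix d assume "d \<in> {d. d dvd p ^ k * n}"
    then have "d dvd p ^ k * n" by simp
    then obtain x y where xy: "d = x * y" "x dvd p ^ k" "y dvd n" by (rule dvd_productE)
    obtain i where "i \<le> k" "x = p ^ i" using divides_primepow_nat[OF p] xy(2) by blast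
    then show "d \<in> (\<lambda>(i, e). p ^ i * e) ` ({..k} \<times> {e. e dvd n})" using xy by auto
  next
    fix d assume "d \<in> (\<lambda>(i, e). p ^ i * e) ` ({..k} \<times> {e. e dvd n})"
    then obtain i e where "i \<le> k" "e dvd n" "d = p ^ i * e" by auto
    then show "d \<in> {d. d dvd p ^ k * n}" by (auto intro!: mult_dvd_mono le_imp_power_dvd)
  qed
  have le: "i \<le> j" if "p ^ i * e = p ^ j * e'" "e' dvd n" for i j e e'
  proof -
    have "coprime (p ^ i) e'" using p n that(2) by (metis coprime_power_left_iff dvd_trans prime_imp_coprime)
    moreover have "p ^ i dvd p ^ j * e'" using that(1) by (metis dvd_triv_left)
    ultimately have "p ^ i dvd p ^ j" by (simp add: coprime_dvd_mult_left_iff)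
    then show ?thesis using prime_gt_1_nat[OF p] power_dvd_imp_le by blast
  qed
  show "inj_on (\<lambda>(i, e). p ^ i * e) ({..k} \<times> {e. e dvd n})"
  proof (rule inj_onI, clarify)
    fix i e j e' assume h: "e dvd n" "e' dvd n" "p ^ i * e = p ^ j * e'"
    have "i = j" using le[OF h(3,2)] le[OF h(3)[symmetric] h(1)] by simp
    then show "i = j \<and> e = e'" using h(3) prime_gt_0_nat[OF p] by simp
  qed
qed

lemma dconv_prime_power_mult:
  assumes p: "prime p" and n: "\<not> p dvd n"
    and f: "\<And>a b. f (a * b) = f a * f b" "f 1 = 1" and g: "\<And>a b. g (a * b) = g a * g b" "g 1 = 1"
  shows "dconv f g (p ^ k * n) = (\<Sum>i\<le>k. f p ^ i * g p ^ (k - i)) * dconv f g n"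
proof -
  have fp: "f (p ^ i) = f p ^ i" "g (p ^ i) = g p ^ i" for i by (induct i) (use f g in simp_all)
  have "dconv f g (p ^ k * n) = (\<Sum>(i, e)\<in>{..k} \<times> {e. e dvd n}. f (p ^ i * e) * g (p ^ k * n div (p ^ i * e)))"
    unfolding dconv_def divisors_prime_power_mult(1)[OF p n]
    by (subst sum.reindex[OF divisors_prime_power_mult(2)[OF p n]]) (simp add: case_prod_unfold)
  also have "\<dots> = (\<Sum>(i, e)\<in>{..k} \<times> {e. e dvd n}. (f p ^ i * g p ^ (k - i)) * (f e * g (n div e)))"
  proof (rule sum.cong[OF refl])
    fix x assume "x \<in> {..k} \<times> {e. e dvd n}"
    then obtain i e where ie: "i \<in> {..k}" "e dvd n" and x: "x = (i, e)" by auto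
    have "p ^ k * n = (p ^ i * e) * (p ^ (k - i) * (n div e))"
    proof -
      have "p ^ k = p ^ i * p ^ (k - i)" "n = e * (n div e)" using ie by (simp_all flip: power_add)
      then have "p ^ k * n = (p ^ i * p ^ (k - i)) * (e * (n div e))" by metis
      then show ?thesis by (simp only: ac_simps)
    qed
    moreover have "e > 0" using ie(2) n by (intro Nat.gr0I) auto
    ultimately have "p ^ k * n div (p ^ i * e) = p ^ (k - i) * (n div e)"
      using prime_gt_0_nat[OF p] by (metis nonzero_mult_div_cancel_left mult_is_0 not_gr_zero power_not_zero)
    then show "(case x of (i, e) \<Rightarrow> f (p ^ i * e) * g (p ^ k * n div (p ^ i * e))) =
        (case x of (i, e) \<Rightarrow> f p ^ i * g p ^ (k - i) * (f e * g (n div e)))"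
      using f(1) g(1) fp x by simp
  qed
  also have "\<dots> = (\<Sum>i\<le>k. f p ^ i * g p ^ (k - i)) * dconv f g n"
    unfolding dconv_def sum_product sum.cartesian_product by simp
  finally show ?thesis .
qed

lemma alternating_sum: "(\<Sum>i\<le>k. (-1 :: real) ^ i) = (if even k then 1 else 0)"
  by (induct k) auto

lemma dconv_nonneg:
  assumes f: "\<And>a b. f (a * b) = f a * f b" "f 1 = 1" and g: "\<And>a b. g (a * b) = g a * g b" "g 1 = 1"
    and pr: "\<And>p. prime p \<Longrightarrow> (f p, g p) \<in> {(1, 1), (1, -1), (-1, 1), (0, 0)}" and n: "n > 0"
  shows "0 \<le> dconv f g n" "(\<And>p. prime p \<Longrightarrow> p dvd n \<Longrightarrow> f p \<noteq> 0) \<Longrightarrow> 1 \<le> dconv f g (n\<^sup>2)"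
proof -
  have A: "0 \<le> (\<Sum>i\<le>k. f p ^ i * g p ^ (k - i))" "f p \<noteq> 0 \<Longrightarrow> even k \<Longrightarrow> 1 \<le> (\<Sum>i\<le>k. f p ^ i * g p ^ (k - i))"
    if p: "prime p" for p k
  proof -
    have rev: "(\<Sum>i\<le>k. (-1 :: real) ^ (k - i)) = (\<Sum>i\<le>k. (-1) ^ i)"
      using sum.atLeastAtMost_rev[of "\<lambda>i. (-1 :: real) ^ i" 0 k] by (simp add: atMost_atLeast0)
    have 0: "0 \<le> (\<Sum>i\<le>k. (0 :: real) ^ i * 0 ^ (k - i))" by (intro sum_nonneg) simp
    show "0 \<le> (\<Sum>i\<le>k. f p ^ i * g p ^ (k - i))" using pr[OF p] rev alternating_sum[of k] 0 by auto
    show "1 \<le> (\<Sum>i\<le>k. f p ^ i * g p ^ (k - i))" if "f p \<noteq> 0" "even k"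
      using pr[OF p] rev alternating_sum[of k] that by auto
  qed
  have dec: "\<exists>p k m. prime p \<and> k > 0 \<and> n = p ^ k * m \<and> \<not> p dvd m \<and> m > 0 \<and> m < n" if n1: "n > 1" for n :: nat
  proof -
    obtain p where p: "prime p" "p dvd n" using n1 prime_factor_nat by (metis less_numeral_extra(4))
    define k where "k = multiplicity p n"
    obtain m where m: "n = p ^ k * m" "\<not> p dvd m"
      using multiplicity_decompose'[of n p] n1 p(1) unfolding k_def by (metis gr_implies_not0 not_prime_unit)
    have k: "k > 0" using p m by (metis gr0I mult_1 power_0)
    have m0: "m > 0" using m n1 by (intro Nat.gr0I) auto
    have "1 < p ^ k" using prime_gt_1_nat[OF p(1)] k by (rule one_less_power)
    then have "1 * m < p ^ k * m" using m0 by (intro mult_strict_right_mono) auto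
    then have "m < n" unfolding m(1) by simp
    then show ?thesis using p(1) k m m0 by blast
  qed
  have 1: "dconv f g 1 = 1" using f(2) g(2) by (simp add: dconv_def)
  show "0 \<le> dconv f g n" using n
  proof (induct n rule: less_induct)
    case (less n)
    show ?case
    proof (cases "n = 1")
      case False
      then have "n > 1" using less(2) by simp
      then obtain p k m where d: "prime p" "k > 0" "n = p ^ k * m" "\<not> p dvd m" "m > 0" "m < n" using dec by blast
      show ?thesis unfolding d(3) dconv_prime_power_mult[OF d(1,4) f g]
        by (intro mult_nonneg_nonneg A(1) less d)
    qed (use 1 in simp)
  qed
  show "1 \<le> dconv f g (n\<^sup>2)" if "\<And>p. prime p \<Longrightarrow> p dvd n \<Longrightarrow> f p \<noteq> 0" using n that
  proof (induct n rule: less_induct)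
    case (less n)
    show ?case
    proof (cases "n = 1")
      case False
      then have "n > 1" using less(2) by simp
      then obtain p k m where d: "prime p" "k > 0" "n = p ^ k * m" "\<not> p dvd m" "m > 0" "m < n" using dec by blast
      have e: "n\<^sup>2 = p ^ (k * 2) * m\<^sup>2" unfolding d(3) by (simp add: power_mult_distrib power_mult)
      have m2: "\<not> p dvd m\<^sup>2" using d(1,4) prime_dvd_power by blast
      have "p dvd n" using d(2,3) by (simp add: dvd_power)
      then have fp: "f p \<noteq> 0" using less(3) d(1) by blast
      have IH: "1 \<le> dconv f g (m\<^sup>2)" using less(1)[OF d(6,5)] less(3) unfolding d(3) by auto
      have "1 * 1 \<le> (\<Sum>i\<le>k * 2. f p ^ i * g p ^ (k * 2 - i)) * dconv f g (m\<^sup>2)"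
        by (intro mult_mono A(2)[OF d(1) fp] IH) (use A(1)[OF d(1)] in auto)
      then show ?thesis unfolding e dconv_prime_power_mult[OF d(1) m2 f g] by simp
    qed (use 1 in simp)
  qed
qed

lemma periodic_mod: fixes f :: "nat \<Rightarrow> 'a" assumes "\<And>n. f (n + q) = f n" shows "f (n mod q) = f n"
proof -
  have "f (m + k * q) = f m" for m k
  proof (induct k)
    case (Suc k)
    have "f (m + Suc k * q) = f ((m + k * q) + q)" by (simp add: algebra_simps)
    then show ?case using Suc assms by simp
  qed simp
  from this[of "n mod q" "n div q"] show ?thesis by simp
qed

text \<open>Multiplication by a permutes the residues modulo q, so the sum equals f(a) times
  itself.\<close>

lemma multiplicative_periodic_sum_zero:
  fixes f :: "nat \<Rightarrow> real"
  assumes q: "q > 0" and per: "\<And>n. f (n + q) = f n" and mult: "\<And>a b. f (a * b) = f a * f b"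
    and a: "coprime a q" "f a \<noteq> 1"
  shows "(\<Sum>n<q. f n) = 0"
proof -
  define h where "h = (\<lambda>n. (a * n) mod q)"
  have inj: "inj_on h {..<q}"
  proof (rule inj_onI)
    fix x y assume xy: "x \<in> {..<q}" "y \<in> {..<q}" "h x = h y"
    have "[a * x = a * y] (mod q)" using xy(3) by (simp add: h_def cong_def)
    then have "[x = y] (mod q)" using a(1) by (simp add: cong_mult_lcancel_nat)
    then show "x = y" using xy(1,2) by (simp add: cong_def)
  qed
  have "h ` {..<q} = {..<q}" by (rule endo_inj_surj[OF _ _ inj]) (use q in \<open>auto simp: h_def\<close>)
  then have "(\<Sum>n<q. f n) = (\<Sum>n\<in>h ` {..<q}. f n)" by simp
  also have "\<dots> = (\<Sum>n<q. f (h n))" by (simp add: sum.reindex[OF inj])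
  also have "\<dots> = (\<Sum>n<q. f a * f n)" unfolding h_def periodic_mod[of f, OF per] mult ..
  also have "\<dots> = f a * (\<Sum>n<q. f n)" by (simp add: sum_distrib_left)
  finally have "(1 - f a) * (\<Sum>n<q. f n) = 0" by (simp add: algebra_simps)
  then show ?thesis using a(2) by simp
qed

text \<open>If \<open>\<epsilon>\<close> is the Kronecker symbol of \<open>-D\<close>, then \<open>\<chi> * \<chi>\<epsilon>\<close> is nonnegative, because \<open>\<chi>\<close> is 1 on split primes.
  Evenness makes \<open>\<chi>\<epsilon>\<close> nontrivial: \<open>\<epsilon>(-1) = -1\<close>.\<close>

theorem even_character_trivial:
  fixes h :: "nat \<Rightarrow> real" and D M :: nat
  assumes D: "D > 0" and M: "M > 0" "8 * D dvd M"
    and mult: "\<And>a b. h (a * b) = h a * h b" and per: "\<And>n. h (n + M) = h n"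
    and vals: "\<And>n. coprime n M \<Longrightarrow> h n = 1 \<or> h n = -1" "\<And>n. \<not> coprime n M \<Longrightarrow> h n = 0"
    and even: "h (M - 1) = 1"
    and split: "\<And>p. prime p \<Longrightarrow> coprime p M \<Longrightarrow> Legendre (- int D) (int p) = 1 \<Longrightarrow> h p = 1"
    and n: "coprime n M"
  shows "h n = 1"
proof (rule ccontr)
  assume nontriv: "h n \<noteq> 1"
  have M8: "M \<ge> 8" using M D dvd_imp_le[OF M(2) M(1)] by linarith
  obtain e where "kronecker_symbol (- int D) e" using kronecker_exists[of "- int D"] D by auto
  then have e: "\<And>a b. e (a * b) = e a * e b" "\<And>a b. [a = b] (mod 8 * - int D) \<Longrightarrow> e a = e b"
    "\<And>a. coprime a (2 * - int D) \<Longrightarrow> e a = 1 \<or> e a = -1" "e (-1) = -1"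
    "\<And>p. prime p \<Longrightarrow> coprime (int p) (2 * - int D) \<Longrightarrow> e (int p) = Legendre (- int D) (int p)"
    using D unfolding kronecker_symbol_def by auto
  have cop: "coprime (int a) (2 * - int D)" if "coprime a M" for a
  proof -
    have "2 * D dvd M" using M(2) by (metis dvd_mult_left mult.assoc num_double numeral_times_numeral dvd_trans dvd_mult_right dvd_triv_right mult_dvd_mono dvd_refl)
    then have "coprime a (2 * D)" using that by (metis coprime_divisors dvd_refl)
    then have "coprime (int a) (int (2 * D))" by (simp only: coprime_int_iff)
    then show ?thesis by simp
  qed
  have eM: "e (int (a + M)) = e (int a)" for a
  proof (rule e(2))
    have "int (8 * D) dvd int M" using M(2) by (simp only: int_dvd_int_iff)
    then show "[int (a + M) = int a] (mod 8 * - int D)" by (simp add: cong_iff_dvd_diff)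
  qed
  define g where "g = (\<lambda>n. h n * real_of_int (e (int n)))"
  have chi1: "h 1 = 1" using vals(1)[of 1] mult[of 1 1] by auto
  have "e 1 * e 1 = e 1" using e(1)[of 1 1] by simp
  moreover have "e 1 = 1 \<or> e 1 = -1" using e(3)[of 1] by simp
  ultimately have e1: "e 1 = 1" by auto
  have f_abs: "\<bar>h n\<bar> \<le> 1" for n using vals[of n] by (cases "coprime n M") auto
  have g_abs: "\<bar>g n\<bar> \<le> 1" for n
  proof (cases "coprime n M")
    case True
    then show ?thesis using vals(1)[OF True] e(3)[OF cop[OF True]] by (auto simp: g_def)
  qed (simp add: g_def vals(2))
  have g_mult: "g (a * b) = g a * g b" for a b by (simp add: g_def mult e(1))
  have g_per: "g (n + M) = g n" for n unfolding g_def per eM ..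
  have zero: "h 0 = 0" using vals(2)[of 0] M8 by simp
  have copM: "coprime (M - 1) M" using M8 by (metis coprime_diff_one_left_nat less_le_trans zero_less_numeral)
  \<comment> \<open>On natural numbers M - 1 stands for -1. There h is 1 and the symbol of - D is
    -1, so g is not trivial even if h were.\<close>
  have gM: "g (M - 1) = -1"
  proof -
    have "int (8 * D) dvd int M" using M(2) by (simp only: int_dvd_int_iff)
    then have "[int (M - 1) = -1] (mod 8 * - int D)" using M8 by (simp add: cong_iff_dvd_diff of_nat_diff)
    then have "e (int (M - 1)) = -1" using e(2,4) by metis
    then show ?thesis unfolding g_def even by simp
  qed
  \<comment> \<open>Split primes give (1, 1), inert primes (1, -1) or (-1, 1), and primes dividing M
    give (0, 0). The pair (-1, -1), which could make the convolution negative, is excluded by the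
    hypothesis on split primes.\<close>
  have pr: "(h p, g p) \<in> {(1, 1), (1, -1), (-1, 1), (0, 0)}" if p: "prime p" for p
  proof (cases "coprime p M")
    case True
    have ep: "e (int p) = Legendre (- int D) (int p)" by (rule e(5)[OF p cop[OF True]])
    show ?thesis
    proof (cases "e (int p) = 1")
      case True': True
      then show ?thesis using split[OF p True] ep by (simp add: g_def)
    next
      case False
      then have "e (int p) = -1" using e(3)[OF cop[OF True]] by blast
      then show ?thesis using vals(1)[OF True] by (auto simp: g_def)
    qed
  next
    case False
    then show ?thesis using vals(2) by (simp add: g_def)
  qed
  show False
  proof (rule no_nonneg_periodic_convolution[of M h g])
    show "(\<Sum>n<M. h n) = 0" by (rule multiplicative_periodic_sum_zero[OF M(1) per mult n nontriv])
    show "(\<Sum>n<M. g n) = 0" by (rule multiplicative_periodic_sum_zero[OF M(1) g_per g_mult copM]) (unfold gM, simp)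
    show "0 \<le> (\<Sum>d | d dvd n. h d * g (n div d))" if "n > 0" for n
      using dconv_nonneg(1)[OF mult chi1 g_mult _ pr that] e1 chi1 unfolding dconv_def by (simp add: g_def)
    show "1 \<le> (\<Sum>d | d dvd m\<^sup>2. h d * g (m\<^sup>2 div d))" if m: "coprime m M" "m > 0" for m
    proof -
      have "h p \<noteq> 0" if "prime p" "p dvd m" for p
      proof -
        have "coprime p M" using m(1) that(2) by (metis coprime_divisors dvd_refl)
        then show ?thesis using vals(1) by fastforce
      qed
      then show ?thesis using dconv_nonneg(2)[OF mult chi1 g_mult _ pr m(2)] e1 chi1 unfolding dconv_def by (simp add: g_def)
    qed
  qed (use M(1) per f_abs g_per g_abs zero in \<open>auto simp: g_def\<close>)
qed

section \<open>Quadratic characters invariant under conjugation\<close>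

lemma squarefree_int_dvd:
  fixes D :: nat and x :: int
  assumes "squarefree D" "x\<^sup>2 dvd int D" shows "is_unit x"
proof -
  have "int (nat \<bar>x\<bar> ^ 2) = x\<^sup>2" by simp
  then have "nat \<bar>x\<bar> ^ 2 dvd D" using assms(2) int_dvd_int_iff by metis
  then have "is_unit (nat \<bar>x\<bar>)" using assms(1) squarefreeD by blast
  then show ?thesis by simp
qed

lemma square_eq_square_times_squarefree:
  fixes D :: nat and x y :: int
  assumes "squarefree D" "x\<^sup>2 = y\<^sup>2 * int D" "y \<noteq> 0" shows "D = 1"
proof -
  have "y\<^sup>2 dvd x\<^sup>2" unfolding assms(2) by simp
  then have "y dvd x" by simp
  then obtain k where k: "x = y * k" by blast
  have "y\<^sup>2 * k\<^sup>2 = y\<^sup>2 * int D" using assms(2) unfolding k power_mult_distrib by blast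
  then have kD: "k\<^sup>2 = int D" using assms(3) by simp
  then have "k\<^sup>2 dvd int D" by simp
  then have "is_unit k" by (rule squarefree_int_dvd[OF assms(1)])
  then have "\<bar>k\<bar> = 1" by simp
  then have "k\<^sup>2 = 1" by (metis power2_abs power_one)
  then show ?thesis using kD by simp
qed

lemma nat_sqrt_bounds: obtains a :: nat where "a\<^sup>2 \<le> m" "m < (a + 1)\<^sup>2"
proof -
  define M where "M = nat \<lfloor>sqrt (real m)\<rfloor>"
  have M1: "real M \<le> sqrt (real m)" and two_D_dvd_modulus: "sqrt (real m) < real M + 1"
    unfolding M_def by (simp_all add: of_nat_nat)
  have "real M ^ 2 \<le> real m" using power_mono[OF M1, of 2] by simp
  then have "M ^ 2 \<le> m" by (metis of_nat_le_iff of_nat_power)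
  moreover have "real m < (real M + 1) ^ 2" using power_strict_mono[OF two_D_dvd_modulus, of 2] by simp
  then have "m < (M + 1) ^ 2" by (metis of_nat_1 of_nat_add of_nat_less_iff of_nat_power)
  ultimately show ?thesis by (rule that)
qed

section \<open>Choosing the sign of a square root prime by prime\<close>

text \<open>Sorts the prime powers of m by the property Q. The two factors share no prime, which
  permits different choices on them by the Chinese remainder theorem.\<close>

lemma split_by_primes:
  fixes m :: int
  assumes "m \<noteq> 0"
  obtains G B where "m = G * B" "\<forall>p. prime p \<longrightarrow> p dvd G \<longrightarrow> \<not> Q p" "\<forall>p. prime p \<longrightarrow> p dvd B \<longrightarrow> Q p"
proof -
  have "m \<noteq> 0 \<longrightarrow> (\<exists>G B. m = G * B \<and> (\<forall>p. prime p \<longrightarrow> p dvd G \<longrightarrow> \<not> Q p) \<and> (\<forall>p. prime p \<longrightarrow> p dvd B \<longrightarrow> Q p))"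
  proof (induct m rule: prime_divisors_induct)
    case zero
    then show ?case by simp
  next
    case (unit x)
    have "x = x * 1" by simp
    moreover have "\<forall>p. prime p \<longrightarrow> p dvd x \<longrightarrow> \<not> Q p" using unit by (metis dvd_trans not_prime_unit)
    moreover have "\<forall>p::int. prime p \<longrightarrow> p dvd 1 \<longrightarrow> Q p" by (metis not_prime_unit)
    ultimately show ?case by blast
  next
    case (factor p x)
    show ?case
    proof
      assume "p * x \<noteq> 0"
      then obtain G B where GB: "x = G * B" "\<forall>p. prime p \<longrightarrow> p dvd G \<longrightarrow> \<not> Q p" "\<forall>p. prime p \<longrightarrow> p dvd B \<longrightarrow> Q p"
        using factor by auto
      have pr: "q = p \<or> q dvd y" if "prime q" "q dvd p * y" for q y
        using that factor(1) prime_dvd_mult_iff primes_dvd_imp_eq by blast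
      show "\<exists>G B. p * x = G * B \<and> (\<forall>p. prime p \<longrightarrow> p dvd G \<longrightarrow> \<not> Q p) \<and> (\<forall>p. prime p \<longrightarrow> p dvd B \<longrightarrow> Q p)"
      proof (cases "Q p")
        case True
        have "p * x = G * (p * B)" using GB(1) by simp
        moreover have "\<forall>q. prime q \<longrightarrow> q dvd p * B \<longrightarrow> Q q" using pr GB(3) True by blast
        ultimately show ?thesis using GB(2) by blast
      next
        case False
        have "p * x = (p * G) * B" using GB(1) by simp
        moreover have "\<forall>q. prime q \<longrightarrow> q dvd p * G \<longrightarrow> \<not> Q q" using pr GB(2) False by blast
        ultimately show ?thesis using GB(3) by blast
      qed
    qed
  qed
  then show ?thesis using assms that by blast
qed

lemma coprime_int_primesI:
  fixes a b :: int
  assumes "a \<noteq> 0" "\<And>p. prime p \<Longrightarrow> p dvd a \<Longrightarrow> p dvd b \<Longrightarrow> False"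
  shows "coprime a b"
proof (rule ccontr)
  assume "\<not> coprime a b"
  then have "\<not> is_unit (gcd a b)" using is_unit_gcd by blast
  moreover have "gcd a b \<noteq> 0" using assms(1) by simp
  ultimately obtain p where "p dvd gcd a b" "prime p" using prime_divisor_exists by blast
  then show False using assms(2)[of p] by simp
qed

text \<open>The primes of M where p^3 divides s0 W + u form the factor B of M^4, and there the sign
  of s0 is reversed. If both signs failed at p, then p^3 would divide 2 u and 2 W, so p^2 would
  divide u and W and p^4 would divide D v^2. As p does not divide v by primitivity, this contradicts
  squarefreeness of D.\<close>

lemma sign_choice:
  fixes u v W n s0 M :: int and D :: nat
  assumes prim: "\<forall>p. prime p \<longrightarrow> \<not> (p dvd u \<and> p dvd v \<and> p dvd W)"
    and e: "u\<^sup>2 + int D * v\<^sup>2 = n * W\<^sup>2" and D: "squarefree D" and M: "M > 0" and s0: "coprime s0 M"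
  obtains t where "M ^ 4 dvd t\<^sup>2 - s0\<^sup>2" "coprime t M" "\<forall>p. prime p \<longrightarrow> p dvd M \<longrightarrow> \<not> p ^ 3 dvd t * W + u"
proof -
  have "M ^ 4 \<noteq> 0" using M by simp
  then obtain G B where GB: "M ^ 4 = G * B"
    and G: "\<forall>p. prime p \<longrightarrow> p dvd G \<longrightarrow> \<not> p ^ 3 dvd s0 * W + u"
    and B: "\<forall>p. prime p \<longrightarrow> p dvd B \<longrightarrow> p ^ 3 dvd s0 * W + u"
    by (rule split_by_primes)
  have G0: "G \<noteq> 0" using GB M by auto
  have "coprime G B" using G B by (intro coprime_int_primesI[OF G0]) blast
  then obtain t where t: "[t = s0] (mod G)" "[t = - s0] (mod B)" using binary_chinese_remainder_int by blast
  have tG: "G dvd t - s0" and tB: "B dvd t + s0" using t unfolding cong_iff_dvd_diff by simp_all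
  have sq: "M ^ 4 dvd t\<^sup>2 - s0\<^sup>2"
    using mult_dvd_mono[OF tG tB] unfolding GB by (simp add: power2_eq_square algebra_simps)
  have ns0: "\<not> p dvd s0" if "prime p" "p dvd M" for p
    using that s0 by (metis coprime_common_divisor not_prime_unit)
  have "coprime M t"
  proof (rule coprime_int_primesI)
    show "M \<noteq> 0" using M by simp
    fix p assume p: "prime p" "p dvd M" "p dvd t"
    have "p dvd M ^ 4" using p(2) by (simp add: dvd_power_le dvd_trans)
    then have "p dvd t\<^sup>2 - s0\<^sup>2" using sq dvd_trans by blast
    moreover have "p dvd t\<^sup>2" using p(3) by (simp add: power2_eq_square)
    ultimately have "p dvd t\<^sup>2 - (t\<^sup>2 - s0\<^sup>2)" by (rule dvd_diff[rotated])
    then have "p dvd s0\<^sup>2" by simp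
    then have "p dvd s0" using p(1) prime_dvd_power by blast
    then show False using ns0[OF p(1,2)] by blast
  qed
  moreover have "\<not> p ^ 3 dvd t * W + u" if p: "prime p" "p dvd M" for p
  proof
    assume d: "p ^ 3 dvd t * W + u"
    have p4: "p ^ 4 dvd G * B" unfolding GB[symmetric] using p(2) by (rule dvd_power_same)
    have le: "p ^ 3 dvd p ^ 4" by (rule le_imp_power_dvd) simp
    show False
    proof (cases "p dvd B")
      case False
      have "coprime (p ^ 4) B" using prime_imp_coprime[OF p(1) False] by simp
      then have pG: "p ^ 4 dvd G" using p4 by (simp add: coprime_dvd_mult_left_iff)
      then have "p ^ 3 dvd t - s0" using le tG dvd_trans by metis
      then have "p ^ 3 dvd (t - s0) * W" by simp
      then have "p ^ 3 dvd (t * W + u) - (t - s0) * W" using d by (intro dvd_diff)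
      moreover have "(t * W + u) - (t - s0) * W = s0 * W + u" by (simp add: algebra_simps)
      ultimately have "p ^ 3 dvd s0 * W + u" by metis
      moreover have "p dvd G" using pG by (metis dvd_power dvd_trans zero_less_numeral)
      ultimately show False using G p(1) by blast
    next
      case True
      have b: "p ^ 3 dvd s0 * W + u" using B p(1) True by blast
      have "\<not> p dvd G" using G b p(1) by blast
      then have "coprime (p ^ 4) G" using prime_imp_coprime[OF p(1)] by simp
      then have pB: "p ^ 4 dvd B" using p4 by (simp add: coprime_dvd_mult_right_iff)
      then have "p ^ 3 dvd t + s0" using le tB dvd_trans by metis
      then have "p ^ 3 dvd (t + s0) * W" by simp
      then have "p ^ 3 dvd (t * W + u) - (t + s0) * W" using d by (intro dvd_diff)
      moreover have "(t * W + u) - (t + s0) * W = u - s0 * W" by (simp add: algebra_simps)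
      ultimately have b': "p ^ 3 dvd u - s0 * W" by metis
      have "p ^ 3 dvd (s0 * W + u) + (u - s0 * W)" using b b' by (rule dvd_add)
      moreover have "(s0 * W + u) + (u - s0 * W) = 2 * u" by simp
      ultimately have u: "p ^ 3 dvd 2 * u" by metis
      have "p ^ 3 dvd (s0 * W + u) - (u - s0 * W)" using b b' by (rule dvd_diff)
      moreover have "(s0 * W + u) - (u - s0 * W) = s0 * (2 * W)" by simp
      ultimately have "p ^ 3 dvd s0 * (2 * W)" by metis
      moreover have "coprime (p ^ 3) s0" using prime_imp_coprime[OF p(1) ns0[OF p]] by simp
      ultimately have W: "p ^ 3 dvd 2 * W" by (simp add: coprime_dvd_mult_right_iff)
      \<comment> \<open>The reason for cubes: at p = 2 one factor is lost, and the square that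
        remains is what the contradiction requires.\<close>
      have half: "p\<^sup>2 dvd x" if x: "p ^ 3 dvd 2 * x" for x
      proof (cases "p = 2")
        case True
        have "2 * 4 dvd 2 * x" using x unfolding True by simp
        then have "8 dvd 2 * x" by simp
        then have "4 dvd x" by presburger
        then show ?thesis unfolding True by simp
      next
        case False
        have "\<not> p dvd 2" using False p(1) primes_dvd_imp_eq two_is_prime by (metis zero_less_numeral)
        then have "coprime p 2" by (rule prime_imp_coprime[OF p(1)])
        then have "coprime (p ^ 3) 2" by (simp only: coprime_power_left_iff simp_thms)
        then have "p ^ 3 dvd x" using x by (simp add: coprime_dvd_mult_right_iff)
        moreover have "p\<^sup>2 dvd p ^ 3" by (rule le_imp_power_dvd) simp
        ultimately show ?thesis using dvd_trans by blast
      qed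
      have pu: "p dvd u" "p dvd W" using half[OF u] half[OF W] by (metis dvd_power dvd_trans zero_less_numeral)+
      then have pv: "\<not> p dvd v" using prim p(1) by blast
      have sq4: "p ^ 4 dvd x\<^sup>2" if "p\<^sup>2 dvd x" for x
        using dvd_power_same[OF that, of 2] by (simp flip: power_mult)
      have "p ^ 4 dvd n * W\<^sup>2 - u\<^sup>2" using sq4[OF half[OF u]] sq4[OF half[OF W]] by (intro dvd_diff) auto
      moreover have "n * W\<^sup>2 - u\<^sup>2 = int D * v\<^sup>2" using e by simp
      ultimately have "p ^ 4 dvd int D * v\<^sup>2" by metis
      moreover have "coprime (p ^ 4) (v\<^sup>2)" using prime_imp_coprime[OF p(1) pv] by simp
      ultimately have "p ^ 4 dvd int D" by (simp add: coprime_dvd_mult_left_iff)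
      moreover have "p\<^sup>2 dvd p ^ 4" by (rule le_imp_power_dvd) simp
      ultimately have "p\<^sup>2 dvd int D" using dvd_trans by blast
      then have "is_unit p" by (rule squarefree_int_dvd[OF D])
      then show False using p(1) not_prime_unit by blast
    qed
  qed
  ultimately show ?thesis using that[OF sq] by (simp add: coprime_commute)
qed

section \<open>Legendre's equation and square norms\<close>

context iqf
begin

text \<open>The ideal J generated by p and x + s, where x^2 is - D modulo p, has norm dividing p^2.
  If it were R or (p), then p would divide x + s or its conjugate in R; subtracting conjugates, p
  would divide 2 s and hence 4 D.\<close>

lemma split_prime_ideal:
  assumes p: "prime p" "\<not> p dvd 2 * D" and L: "Legendre (- int D) (int p) = 1"
  obtains P where "idl P" "N P = p"
proof -
  have p0: "p > 0" using p(1) prime_gt_0_nat by blast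
  have "QuadRes (int p) (- int D)" using L by (auto simp: Legendre_def split: if_splits)
  then obtain x where x: "[x\<^sup>2 = - int D] (mod int p)" unfolding QuadRes_def by blast
  then have "int p dvd x\<^sup>2 + int D" by (simp add: cong_iff_dvd_diff)
  then obtain k where k: "x\<^sup>2 + int D = int p * k" by blast
  let ?p = "pid (of_nat p)" and ?a = "of_int x + s"
  have aR: "?a \<in> R" by (intro R_add) auto
  have a0: "?a \<noteq> 0" by (metis add.right_neutral complex_is_Real_iff Im_s Re_s add_eq_0_iff Reals_of_int Reals_minus s_nonreal)
  have idp: "idl ?p" using p0 by (intro idl_pid) auto
  define J where "J = iadd ?p (pid ?a)"
  note J = idl_iadd[OF idp idl_pid[OF aR a0], folded J_def]
  have aa: "?a * cnj ?a = of_nat p * of_int k"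
  proof -
    have "?a * cnj ?a = of_int (x\<^sup>2 + int D)" by (simp add: algebra_simps s_sq power2_eq_square)
    then show ?thesis unfolding k by simp
  qed
  have no: False if r: "r \<in> R" "b = of_nat p * r" "b = ?a \<or> b = cnj ?a" for r b
  proof -
    have "2 * s = of_nat p * (r - cnj r) \<or> 2 * s = of_nat p * (cnj r - r)"
      using r(3)
    proof
      assume b: "b = ?a"
      have "2 * s = ?a - cnj ?a" by simp
      also have "\<dots> = of_nat p * r - cnj (of_nat p * r)" using r(2) unfolding b by presburger
      finally show ?thesis by (simp add: algebra_simps)
    next
      assume b: "b = cnj ?a"
      have "2 * s = cnj (cnj ?a) - cnj ?a" by simp
      also have "\<dots> = cnj (of_nat p * r) - of_nat p * r" using r(2) unfolding b by presburger
      finally show ?thesis by (simp add: algebra_simps)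
    qed
    then obtain c where c: "c \<in> R" "2 * s = of_nat p * c" using R_cnj r(1) R_diff by blast
    have "nm (2 * s) = nm (of_nat p * c)" using c(2) by simp
    moreover have "nm (2 * s) = 4 * D" using nm_s[of 0 2] by simp
    moreover have "nm (of_nat p * c) = p\<^sup>2 * nm c" using c(1) by (simp add: nm_mult nm_of_nat)
    ultimately have "p dvd 4 * D" by (metis dvd_mult2 dvd_triv_left power2_eq_square)
    moreover have "4 * D = 2 * (2 * D)" by simp
    ultimately have "p dvd 2 \<or> p dvd 2 * D" using p(1) prime_dvd_mult_iff by metis
    then show False using p(2) by auto
  qed
  have "of_nat p \<in> J" using J(2) pid_mem by blast
  then have "N J dvd p\<^sup>2" using N_dvd_nm[OF J(1)] nm_of_nat by metis
  then obtain i where i: "i \<le> 2" "N J = p ^ i" using divides_primepow_nat[OF p(1)] by blast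
  have "i = 1"
  proof (rule ccontr)
    assume "i \<noteq> 1"
    then consider "i = 0" | "i = 2" using i(1) by linarith
    then show False
    proof cases
      case 1
      then have "J = R" using N_1[OF J(1)] i(2) by simp
      then have "1 \<in> J" by simp
      then obtain f g where fg: "f \<in> R" "g \<in> R" "1 = of_nat p * f + ?a * g"
        unfolding J_def iadd_def pid_iff by blast
      have "cnj ?a = cnj ?a * (of_nat p * f + ?a * g)" using fg(3) by simp
      also have "\<dots> = of_nat p * (cnj ?a * f) + (?a * cnj ?a) * g" by (simp only: algebra_simps)
      also have "\<dots> = of_nat p * (cnj ?a * f + of_int k * g)" unfolding aa by (simp only: algebra_simps)
      finally show False using no[of "cnj ?a * f + of_int k * g" "cnj ?a"] fg aR R_cnj[OF aR] by blast
    next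
      case 2
      then have "N ?p = N J" using i(2) p0 by (simp add: N_pid nm_of_nat)
      then have "?p = J" by (rule idl_eq_of_N[OF idp J(1,2)])
      then have "?a \<in> ?p" using J(3) pid_mem by blast
      then obtain r where "r \<in> R" "?a = of_nat p * r" unfolding pid_iff by blast
      then show False using no[of r ?a] by blast
    qed
  qed
  then show ?thesis using that[OF J(1)] i(2) by simp
qed

text \<open>A Thue-type pigeonhole argument solves Legendre's equation.\<close>

lemma norm_times_square_represented:
  assumes I: "idl I" and n: "n = N I" and nD: "coprime n D"
    and s0: "int D dvd int n - s0\<^sup>2" and D1: "D \<noteq> 1"
  obtains u v W :: int where "W \<noteq> 0" "u\<^sup>2 + int D * v\<^sup>2 = int n * W\<^sup>2"
proof -
  have n0: "n > 0" using N_pos[OF I] n by simp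
  obtain a where a: "a\<^sup>2 \<le> n * D" "n * D < (a + 1)\<^sup>2" by (rule nat_sqrt_bounds)
  obtain b where b: "b\<^sup>2 \<le> n" "n < (b + 1)\<^sup>2" by (rule nat_sqrt_bounds)
  obtain c where c: "c\<^sup>2 \<le> D" "D < (c + 1)\<^sup>2" by (rule nat_sqrt_bounds)
  \<comment> \<open>The sides are about sqrt(n D), sqrt(n) and sqrt(D), so the box has more than n D
    points. The map f takes values in a set of size n D: cosets of I and residues modulo D.\<close>
  let ?S = "{0..int a} \<times> {0..int b} \<times> {0..int c}"
  define f where "f = (\<lambda>(x :: int, y :: int, z :: int). (rclass I (of_int x + of_int y * s), (x - s0 * z) mod int D))"
  have "\<not> inj_on f ?S"
  proof
    assume inj: "inj_on f ?S"
    have fin: "finite (rclass I ` R)" using N_pos[OF I] unfolding N_rclass by (rule card_ge_0_finite)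
    have "card ?S \<le> card ((rclass I ` R) \<times> {0..<int D})"
    proof (rule card_inj_on_le[OF inj])
      show "f ` ?S \<subseteq> (rclass I ` R) \<times> {0..<int D}"
        using D_pos by (auto simp: f_def intro!: imageI R_add R_mult)
      show "finite ((rclass I ` R) \<times> {0..<int D})" using fin by blast
    qed
    then have le: "(a + 1) * ((b + 1) * (c + 1)) \<le> n * D"
      by (simp add: card_cartesian_product N_rclass[symmetric] n nat_add_distrib)
    have "(n * D) * n < (a + 1)\<^sup>2 * (b + 1)\<^sup>2" using a(2) b(2) n0 by (intro mult_strict_mono) auto
    then have "(n * D) * n * D < (a + 1)\<^sup>2 * (b + 1)\<^sup>2 * (c + 1)\<^sup>2" using c(2) D_pos by (intro mult_strict_mono[OF \<open>(n * D) * n < (a + 1)\<^sup>2 * (b + 1)\<^sup>2\<close>]) auto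
    moreover have "(n * D) * n * D = (n * D)\<^sup>2" by (simp only: power2_eq_square mult_ac)
    moreover have "(a + 1)\<^sup>2 * (b + 1)\<^sup>2 * (c + 1)\<^sup>2 = ((a + 1) * ((b + 1) * (c + 1)))\<^sup>2"
      by (simp only: power_mult_distrib mult_ac)
    ultimately have "(n * D)\<^sup>2 < ((a + 1) * ((b + 1) * (c + 1)))\<^sup>2" by metis
    then have "n * D < (a + 1) * ((b + 1) * (c + 1))" by (rule power_less_imp_less_base) simp
    then show False using le by linarith
  qed
  then obtain x1 y1 z1 x2 y2 z2 where in1: "(x1, y1, z1) \<in> ?S" and in2: "(x2, y2, z2) \<in> ?S"
    and ne: "(x1, y1, z1) \<noteq> (x2, y2, z2)" and fe: "f (x1, y1, z1) = f (x2, y2, z2)"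
    unfolding inj_on_def by (metis prod_cases3)
  define x y z where "x = x1 - x2" and "y = y1 - y2" and "z = z1 - z2"
  have abs: "\<bar>x\<bar> \<le> int a" "\<bar>y\<bar> \<le> int b" "\<bar>z\<bar> \<le> int c" using in1 in2 by (auto simp: x_def y_def z_def)
  have nz: "\<not> (x = 0 \<and> y = 0 \<and> z = 0)" using ne by (auto simp: x_def y_def z_def)
  have "(of_int x1 + of_int y1 * s) - (of_int x2 + of_int y2 * s) \<in> I"
    using fe rclass_eq_iff[OF I] by (simp add: f_def)
  then have al: "of_int x + of_int y * s \<in> I" by (simp add: x_def y_def algebra_simps)
  have nn: "x\<^sup>2 + int D * y\<^sup>2 \<ge> 0" by simp
  have dn: "int n dvd x\<^sup>2 + int D * y\<^sup>2"
  proof -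
    have "n dvd nat (x\<^sup>2 + int D * y\<^sup>2)" using N_dvd_nm[OF I al] unfolding nm_s n .
    then have "int n dvd int (nat (x\<^sup>2 + int D * y\<^sup>2))" by (simp only: int_dvd_int_iff)
    then show ?thesis using nn by simp
  qed
  then have d1: "int n dvd x\<^sup>2 + int D * y\<^sup>2 - int n * z\<^sup>2" by simp
  have "int D dvd (x1 - s0 * z1) - (x2 - s0 * z2)" using fe by (simp add: f_def mod_eq_dvd_iff)
  moreover have "(x1 - s0 * z1) - (x2 - s0 * z2) = x - s0 * z" by (simp add: x_def z_def algebra_simps)
  ultimately have "int D dvd (x - s0 * z)" by metis
  then have "int D dvd (x - s0 * z) * (x + s0 * z) + int D * y\<^sup>2 - (int n - s0\<^sup>2) * z\<^sup>2"
    using s0 by (intro dvd_diff dvd_add) auto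
  moreover have "(x - s0 * z) * (x + s0 * z) + int D * y\<^sup>2 - (int n - s0\<^sup>2) * z\<^sup>2 = x\<^sup>2 + int D * y\<^sup>2 - int n * z\<^sup>2"
    by (simp add: power2_eq_square algebra_simps)
  ultimately have d2: "int D dvd x\<^sup>2 + int D * y\<^sup>2 - int n * z\<^sup>2" by metis
  \<comment> \<open>Divisibility by n comes from the coset of I, divisibility by D from x = s0 z
    modulo D and n = s0^2 modulo D. The box confines the quotient k to -1, 0, 1, 2.\<close>
  have "int n * int D dvd x\<^sup>2 + int D * y\<^sup>2 - int n * z\<^sup>2"
    using nD by (intro divides_mult d1 d2) simp
  then obtain k where k: "x\<^sup>2 + int D * y\<^sup>2 - int n * z\<^sup>2 = int n * int D * k" by blast
  have sqle: "t\<^sup>2 \<le> int q" if "\<bar>t\<bar> \<le> int r" "r\<^sup>2 \<le> q" for t q r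
  proof -
    have "t\<^sup>2 \<le> (int r)\<^sup>2" using that(1) by (metis abs_le_square_iff abs_of_nat)
    moreover have "(int r)\<^sup>2 \<le> int q" using that(2) by (metis of_nat_le_iff of_nat_power)
    ultimately show ?thesis by linarith
  qed
  have x2: "x\<^sup>2 \<le> int n * int D" using sqle[OF abs(1) a(1)] by simp
  have y2: "int D * y\<^sup>2 \<le> int n * int D" using sqle[OF abs(2) b(1)] D_pos by simp
  have z2: "int n * z\<^sup>2 \<le> int n * int D" using sqle[OF abs(3) c(1)] by (intro mult_left_mono) auto
  have p0: "int n * int D > 0" using n0 D_pos by simp
  have nz0: "int n * z\<^sup>2 \<ge> 0" "x\<^sup>2 \<ge> 0" "int D * y\<^sup>2 \<ge> 0" by simp_all
  have "int n * int D * k \<le> int n * int D * 2" using k x2 y2 nz0 by linarith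
  then have k2: "k \<le> 2" using p0 by (metis mult_le_cancel_left_pos)
  have "int n * int D * (-1) \<le> int n * int D * k" using k z2 nz0 by linarith
  then have k1: "-1 \<le> k" using p0 by (metis mult_le_cancel_left_pos)
  \<comment> \<open>The extreme values need equality in the box bounds: k = -1 gives z^2 = D and k =
    2 gives x^2 = y^2 D. A squarefree D other than 1 is not a square.\<close>
  have kn1: "k \<noteq> -1"
  proof
    assume "k = -1"
    then have "int n * int D * k = - (int n * int D)" by simp
    then have "int n * z\<^sup>2 = int n * int D" using k z2 nz0 by linarith
    then have "z\<^sup>2 = 1\<^sup>2 * int D" using n0 by simp
    then show False using square_eq_square_times_squarefree[OF D_sqf, of z 1] D1 by simp
  qed
  have kn2: "k \<noteq> 2"
  proof
    assume k2: "k = 2"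
    have "int n * int D * k = 2 * (int n * int D)" using k2 by simp
    then have e1: "x\<^sup>2 = int n * int D" "int D * y\<^sup>2 = int n * int D" using k x2 y2 nz0 by linarith+
    then have yn: "y\<^sup>2 = int n" using D_pos by simp
    then have "y \<noteq> 0" using n0 by auto
    moreover have "x\<^sup>2 = y\<^sup>2 * int D" using e1(1) yn by simp
    ultimately show False using square_eq_square_times_squarefree[OF D_sqf] D1 by blast
  qed
  consider "k = 0" | "k = 1" using k1 k2 kn1 kn2 by linarith
  then show ?thesis
  proof cases
    case 1
    then have e: "x\<^sup>2 + int D * y\<^sup>2 = int n * z\<^sup>2" using k by simp
    have "z \<noteq> 0"
    proof
      assume z: "z = 0"
      then have "x\<^sup>2 = 0" "int D * y\<^sup>2 = 0" using e nz0 by (simp_all add: add_nonneg_eq_0_iff)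
      then show False using nz z D_pos by simp
    qed
    then show ?thesis using that e by blast
  next
    case 2
    then have e: "x\<^sup>2 + int D * y\<^sup>2 = int n * (z\<^sup>2 + int D)" using k by (simp add: algebra_simps)
    \<comment> \<open>For k = 1 the right-hand side is n times the norm z^2 + D. Multiplying by this
      norm makes it n times a square, by the composition identity for norms.\<close>
    have "(x * z + int D * y)\<^sup>2 + int D * (y * z - x)\<^sup>2 = (x\<^sup>2 + int D * y\<^sup>2) * (z\<^sup>2 + int D)"
      by (simp add: power2_eq_square algebra_simps)
    also have "\<dots> = int n * (z\<^sup>2 + int D)\<^sup>2" unfolding e by (simp add: power2_eq_square)
    finally have "(x * z + int D * y)\<^sup>2 + int D * (y * z - x)\<^sup>2 = int n * (z\<^sup>2 + int D)\<^sup>2" .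
    moreover have "z\<^sup>2 + int D \<noteq> 0" using D_pos by (metis add_nonneg_eq_0_iff of_nat_0_le_iff of_nat_eq_0_iff zero_le_power2 less_numeral_extra(3))
    ultimately show ?thesis using that by blast
  qed
qed

lemma norm_times_square_primitive:
  assumes "idl I" "n = N I" "coprime n D" "int D dvd int n - s0\<^sup>2" "D \<noteq> 1"
  obtains u v W :: int where "u\<^sup>2 + int D * v\<^sup>2 = int n * W\<^sup>2"
    "\<forall>p. prime p \<longrightarrow> \<not> (p dvd u \<and> p dvd v \<and> p dvd W)"
proof -
  obtain u v W :: int where W: "W \<noteq> 0" and e: "u\<^sup>2 + int D * v\<^sup>2 = int n * W\<^sup>2"
    by (rule norm_times_square_represented[OF assms])
  define g where "g = gcd u (gcd v W)"
  have g0: "g \<noteq> 0" using W by (simp add: g_def)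
  obtain u' where u: "u = g * u'" using gcd_dvd1 unfolding g_def by blast
  have "g dvd v" "g dvd W" unfolding g_def by (meson dvd_trans gcd_dvd1 gcd_dvd2)+
  then obtain v' W' where vW: "v = g * v'" "W = g * W'" by blast
  have "g\<^sup>2 * (u'\<^sup>2 + int D * v'\<^sup>2) = g\<^sup>2 * (int n * W'\<^sup>2)"
    using e unfolding u vW by (simp add: power_mult_distrib algebra_simps)
  then have "u'\<^sup>2 + int D * v'\<^sup>2 = int n * W'\<^sup>2" using g0 by simp
  moreover have "\<not> (p dvd u' \<and> p dvd v' \<and> p dvd W')" if p: "prime p" for p
  proof
    assume "p dvd u' \<and> p dvd v' \<and> p dvd W'"
    then have "g * p dvd u" "g * p dvd v" "g * p dvd W" unfolding u vW by simp_all
    then have "g * p dvd g * 1" by (simp add: g_def)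
    then have "p dvd 1" using g0 by (metis dvd_mult_cancel_left)
    then show False using p not_prime_unit by blast
  qed
  ultimately show ?thesis using that by blast
qed

text \<open>Let \<open>al\<close> = u + v s have norm n W^2, and let \<open>ga\<close> be its
  conjugate plus t W. The norm of \<open>ga\<close> is W q, so \<open>al\<close> times
  \<open>ga\<close>^2, divided by W^2, has norm n q^2. Expanding, it equals t q + (n - t^2)
  \<open>ga\<close>, which is close to the rational integer t q because M^4 divides n - t^2.
  Dividing out the part of q shared with M gives c.\<close>

lemma norm_cong_square_representative:
  assumes I: "idl I" and n: "n = N I" and M: "M > 0" "2 * D dvd M" and nM: "coprime n M"
    and s0: "[int n = s0\<^sup>2] (mod int M ^ 4)" and D1: "D \<noteq> 1"
  obtains c :: complex and t q :: int where "c \<in> R" "nm c = n * nat (q\<^sup>2)" "coprime q (int M)" "coprime t (int M)"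
    "c - of_int (t * q) \<in> pid (of_nat M)"
proof -
  have DM: "D dvd M" using M(2) dvd_trans dvd_triv_right by blast
  have nD: "coprime n D" using nM DM by (metis coprime_divisors dvd_refl)
  have s0d: "int M ^ 4 dvd int n - s0\<^sup>2" using s0 by (simp add: cong_iff_dvd_diff)
  have "int D dvd int M ^ 4" using DM by (metis dvd_power dvd_trans int_dvd_int_iff zero_less_numeral)
  then have "int D dvd int n - s0\<^sup>2" using s0d dvd_trans by blast
  then obtain u v W :: int where e: "u\<^sup>2 + int D * v\<^sup>2 = int n * W\<^sup>2"
    and prim: "\<forall>p. prime p \<longrightarrow> \<not> (p dvd u \<and> p dvd v \<and> p dvd W)"
    using norm_times_square_primitive[OF I n nD _ D1] by blast
  have M0: "int M > 0" using M by simp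
  have pM4: "p dvd int M ^ 4" if "p dvd int M" for p using that by (metis dvd_power dvd_trans zero_less_numeral)
  have npn: "\<not> p dvd int n" if "prime p" "p dvd int M" for p
    using that nM by (metis coprime_common_divisor coprime_int_iff not_prime_unit)
  have "coprime (int M) s0"
  proof (rule coprime_int_primesI)
    fix p assume p: "prime p" "p dvd int M" "p dvd s0"
    have "p dvd int n - s0\<^sup>2" using pM4[OF p(2)] s0d dvd_trans by blast
    moreover have "p dvd s0\<^sup>2" using p(3) by (simp add: power2_eq_square)
    ultimately have "p dvd (int n - s0\<^sup>2) + s0\<^sup>2" by (rule dvd_add)
    then show False using npn[OF p(1,2)] by simp
  qed (use M0 in simp)
  then have s0M: "coprime s0 (int M)" by (simp add: coprime_commute)
  obtain t where t: "int M ^ 4 dvd t\<^sup>2 - s0\<^sup>2" "coprime t (int M)"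
    and tp: "\<forall>p. prime p \<longrightarrow> p dvd int M \<longrightarrow> \<not> p ^ 3 dvd t * W + u"
    by (rule sign_choice[OF prim e D_sqf M0 s0M])
  have "int M ^ 4 dvd (int n - s0\<^sup>2) - (t\<^sup>2 - s0\<^sup>2)" using s0d t(1) by (rule dvd_diff)
  then have ntd: "int M ^ 4 dvd int n - t\<^sup>2" by simp
  \<comment> \<open>W q is the norm of \<open>al\<close> + t W.\<close>
  define q where "q = (int n + t\<^sup>2) * W + 2 * t * u"
  have q': "q = (int n - t\<^sup>2) * W + 2 * t * (t * W + u)" by (simp add: q_def power2_eq_square algebra_simps)
  \<comment> \<open>Modulo p^4 the number q is 2 t (t W + u). The sign of t was chosen so that p^3
    does not divide t W + u, and the factor 2 can add at most one power.\<close>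
  have q4: "\<not> p ^ 4 dvd q" if p: "prime p" "p dvd int M" for p
  proof
    assume d: "p ^ 4 dvd q"
    have "p ^ 4 dvd int n - t\<^sup>2" using dvd_power_same[OF p(2), of 4] ntd dvd_trans by blast
    then have "p ^ 4 dvd q - (int n - t\<^sup>2) * W" using d by (intro dvd_diff) auto
    then have "p ^ 4 dvd t * (2 * (t * W + u))" unfolding q' by (simp add: mult_ac)
    moreover have "\<not> p dvd t" using p t(2) by (metis coprime_common_divisor not_prime_unit)
    then have "coprime (p ^ 4) t" using prime_imp_coprime[OF p(1)] by simp
    ultimately have d2: "p ^ 4 dvd 2 * (t * W + u)" by (simp add: coprime_dvd_mult_right_iff)
    have "p ^ 3 dvd t * W + u"
    proof (cases "p = 2")
      case True
      have "2 * 8 dvd 2 * (t * W + u)" using d2 unfolding True by simp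
      then have "8 dvd t * W + u" by (subst (asm) dvd_mult_cancel_left) simp
      then show ?thesis unfolding True by simp
    next
      case False
      have "\<not> p dvd 2" using False p(1) primes_dvd_imp_eq two_is_prime by (metis zero_less_numeral)
      then have "coprime p 2" by (rule prime_imp_coprime[OF p(1)])
        then have "coprime (p ^ 4) 2" by (simp only: coprime_power_left_iff simp_thms)
      then have "p ^ 4 dvd t * W + u" using d2 coprime_dvd_mult_right_iff by blast
      moreover have "p ^ 3 dvd p ^ 4" by (rule le_imp_power_dvd) simp
      ultimately show ?thesis using dvd_trans by blast
    qed
    then show False using tp p by blast
  qed
  have "2 dvd int M" using M(2) by (metis dvd_mult_left int_dvd_int_iff of_nat_numeral)
  then have q0: "q \<noteq> 0" using q4[of 2] by auto
  \<comment> \<open>By \<open>q4\<close>, division by g removes all primes of M from q. Since g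
    divides M^3, the quotient (n - t^2) / g is still divisible by M.\<close>
  define g where "g = gcd q (int M ^ 3)"
  have g0: "g \<noteq> 0" using q0 by (simp add: g_def)
  have "g dvd q" "g dvd int M ^ 3" by (simp_all add: g_def)
  then obtain q2 h where q2: "q = g * q2" and h: "int M ^ 3 = g * h" by blast
  have "coprime (int M) q2"
  proof (rule coprime_int_primesI)
    fix p assume p: "prime p" "p dvd int M" "p dvd q2"
    define k where "k = multiplicity p q"
    have pu: "\<not> is_unit p" using p(1) not_prime_unit by blast
    have "\<not> 4 \<le> k" using q4[OF p(1,2)] power_dvd_iff_le_multiplicity[OF q0 pu] unfolding k_def by blast
    then have k3: "k \<le> 3" by linarith
    have "p ^ k dvd q" unfolding k_def by (rule multiplicity_dvd)
    moreover have "p ^ k dvd int M ^ 3" by (rule dvd_power_le[OF p(2) k3])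
    ultimately have "p ^ k dvd g" by (simp add: g_def)
    then have "p ^ k * p dvd q" unfolding q2 using p(3) by (intro mult_dvd_mono)
    then have "p ^ Suc k dvd q" by (simp add: mult.commute)
    then have "Suc k \<le> k" using power_dvd_iff_le_multiplicity[OF q0 pu] unfolding k_def by blast
    then show False by simp
  qed (use M0 in simp)
  then have q2M: "coprime q2 (int M)" by (simp add: coprime_commute)
  obtain f where f: "int n - t\<^sup>2 = int M ^ 4 * f" using ntd by blast
  have f': "int n - t\<^sup>2 = g * (int M * h * f)"
  proof -
    have "int M ^ 4 = int M * int M ^ 3" by (simp add: eval_nat_numeral)
    then show ?thesis unfolding f h by simp
  qed
  define al where "al = of_int u + of_int v * s"
  have alR: "al \<in> R" unfolding al_def by (intro R_add R_mult) auto
  define ga where "ga = cnj al + of_int (t * W)"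
  have gaR: "ga \<in> R" unfolding ga_def using alR by (intro R_add) auto
  define c where "c = of_int (t * q2) + of_int (int M * h * f) * ga"
  have cR: "c \<in> R" unfolding c_def using gaR by (intro R_add R_mult) auto
  have alc: "cnj al = of_int u - of_int v * s" by (simp add: al_def)
  \<comment> \<open>The norm of g c, checked as a polynomial identity in \<open>al\<close> and its
    conjugate.\<close>
  have key: "(of_int t * of_int q + (of_int (int n) - of_int t ^ 2) * (cnj al + of_int t * of_int W)) *
      (of_int t * of_int q + (of_int (int n) - of_int t ^ 2) * (al + of_int t * of_int W)) = of_int (int n) * of_int q ^ 2"
  proof -
    have n1: "al * cnj al = of_int (int n) * of_int W ^ 2"
    proof -
      have "al * cnj al = of_int (u\<^sup>2 + int D * v\<^sup>2)" 
        unfolding alc by (simp add: al_def algebra_simps s_sq power2_eq_square)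
      then show ?thesis unfolding e by simp
    qed
    have t1: "al + cnj al = 2 * of_int u" unfolding alc by (simp add: al_def)
    have t2: "of_int q = (of_int (int n) + of_int t ^ 2) * of_int W + 2 * of_int t * (of_int u :: complex)"
      by (simp add: q_def)
    have gen: "(t' * q' + (n' - t' ^ 2) * (b + t' * W')) * (t' * q' + (n' - t' ^ 2) * (a + t' * W')) = n' * q' ^ 2"
      if "a * b = n' * W' ^ 2" "a + b = 2 * u'" "q' = (n' + t' ^ 2) * W' + 2 * t' * u'" for a b n' W' u' q' t' :: complex
    proof -
      have "(t' * q' + (n' - t' ^ 2) * (b + t' * W')) * (t' * q' + (n' - t' ^ 2) * (a + t' * W')) =
          (t' * q') ^ 2 + t' * q' * (n' - t' ^ 2) * ((a + b) + 2 * t' * W') +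
          (n' - t' ^ 2) ^ 2 * (a * b + t' * W' * (a + b) + t' ^ 2 * W' ^ 2)"
        by (simp add: power2_eq_square algebra_simps)
      also have "\<dots> = n' * q' ^ 2" unfolding that by (simp add: power2_eq_square algebra_simps)
      finally show ?thesis .
    qed
    show ?thesis by (rule gen[OF n1 t1 t2])
  qed
  have gc: "of_int g * c = of_int t * of_int q + (of_int (int n) - of_int t ^ 2) * (cnj al + of_int t * of_int W)"
  proof -
    have "of_int (int n) - of_int t ^ 2 = (of_int (int n - t\<^sup>2) :: complex)" by simp
    also have "\<dots> = of_int g * of_int (int M * h * f)" unfolding f' by simp
    finally have e1: "of_int (int n) - of_int t ^ 2 = (of_int g * of_int (int M * h * f) :: complex)" .
    show ?thesis unfolding e1 c_def ga_def q2 by (simp add: algebra_simps)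
  qed
  have gcc: "of_int g * cnj c = of_int t * of_int q + (of_int (int n) - of_int t ^ 2) * (al + of_int t * of_int W)"
  proof -
    have "of_int g * cnj c = cnj (of_int g * c)" by simp
    also have "\<dots> = of_int t * of_int q + (of_int (int n) - of_int t ^ 2) * (al + of_int t * of_int W)" unfolding gc by simp
    finally show ?thesis .
  qed
  have "of_int g ^ 2 * (c * cnj c) = (of_int g * c) * (of_int g * cnj c)" by (simp add: power2_eq_square)
  also have "\<dots> = of_int (int n) * of_int q ^ 2" unfolding gc gcc by (rule key)
  also have "\<dots> = of_int g ^ 2 * (of_int (int n * q2\<^sup>2))" unfolding q2 by (simp add: power2_eq_square)
  finally have "c * cnj c = of_int (int n * q2\<^sup>2)" using g0 by simp
  then have "c * cnj c = of_nat (n * nat (q2\<^sup>2))" by simp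
  then have "nm c = n * nat (q2\<^sup>2)" by (rule nm_eqI[OF cR])
  moreover have "c - of_int (t * q2) = of_nat M * (of_int (h * f) * ga)" by (simp add: c_def)
  then have "c - of_int (t * q2) \<in> pid (of_nat M)"
    using gaR unfolding pid_iff by (intro bexI[of _ "of_int (h * f) * ga"]) auto
  ultimately show ?thesis using that cR q2M t(2) by blast
qed

section \<open>A conjugation-invariant sign character depends only on the norm\<close>

context
  fixes X' :: "complex set \<Rightarrow> int" and M :: nat
  assumes M: "M > 0" "8 * D dvd M" and D1: "D \<noteq> 1"
    and vals: "\<And>I. idl I \<Longrightarrow> coprime (N I) M \<Longrightarrow> X' I = 1 \<or> X' I = -1"
    and mult: "\<And>I J. idl I \<Longrightarrow> coprime (N I) M \<Longrightarrow> idl J \<Longrightarrow> coprime (N J) M \<Longrightarrow>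
      X' (I \<odot> J) = X' I * X' J"
    and conj: "\<And>I. idl I \<Longrightarrow> coprime (N I) M \<Longrightarrow> X' (cnj ` I) = X' I"
    and cong: "\<And>a b. a \<in> R \<Longrightarrow> b \<in> R \<Longrightarrow> coprime (nm a) M \<Longrightarrow> coprime (nm b) M \<Longrightarrow>
      a - b \<in> pid (of_nat M) \<Longrightarrow> X' (pid a) = X' (pid b)"
begin

lemma two_D_dvd_modulus: "2 * D dvd M"
proof -
  have "2 * D dvd 8 * D" by simp
  then show ?thesis using M(2) dvd_trans by blast
qed

lemma sign_unit_ideal: "X' R = 1"
  using vals[OF idl_unit] mult[OF idl_unit _ idl_unit] idl_unit by auto

lemma coprime_imp_pos: "coprime n M \<Longrightarrow> n > 0"
proof (rule Nat.gr0I)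
  assume "coprime n M" "n = 0"
  then have "M = 1" by simp
  then have "8 dvd (1 :: nat)" using M(2) dvd_mult_left by blast
  then show False by simp
qed

text \<open>The function sending n to the sign of (n) satisfies the hypotheses of
  \<open>even_character_trivial\<close>: it is periodic by the congruence condition and even because
  -1 generates the unit ideal.\<close>

lemma sign_pid_nat: assumes n: "coprime n M" shows "X' (pid (of_nat n)) = 1"
proof -
  have idn: "idl (pid (of_nat n))" "coprime (N (pid (of_nat n))) M"
    if "coprime n M" for n
    using coprime_imp_pos[OF that] that by (auto intro!: idl_pid simp: N_pid nm_of_nat)
  define h :: "nat \<Rightarrow> real" where "h n = (if coprime n M then of_int (X' (pid (of_nat n))) else 0)" for n
  have "h n = 1"
  proof (rule even_character_trivial[OF D_pos M])
    show "coprime n M" by (rule n)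
    show "h (a * b) = h a * h b" for a b
    proof (cases "coprime a M \<and> coprime b M")
      case True
      then have a: "coprime a M" and b: "coprime b M" by blast+
      have "X' (pid (of_nat (a * b))) = X' (pid (of_nat a)) * X' (pid (of_nat b))"
        using mult[OF idn[OF a] idn[OF b]] unfolding pid_mult of_nat_mult .
      then show ?thesis using a b by (simp add: h_def)
    next
      case False
      then show ?thesis by (auto simp: h_def)
    qed
    show "h (n + M) = h n" for n
    proof (cases "coprime n M")
      case True
      then have T': "coprime (n + M) M" by (metis coprime_iff_gcd_eq_1 gcd_add1)
      have "X' (pid (of_nat (n + M))) = X' (pid (of_nat n))"
      proof (rule cong)
        show "coprime (nm (of_nat (n + M))) M" using T' unfolding nm_of_nat by (simp only: coprime_power_left_iff simp_thms)
        show "coprime (nm (of_nat n)) M" using True by (simp add: nm_of_nat)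
        have "of_nat (n + M) - of_nat n = (of_nat M :: complex)" by simp
        then show "of_nat (n + M) - of_nat n \<in> pid (of_nat M)" by (metis pid_mem)
      qed (rule R_of_nat)+
      then show ?thesis using True T' by (simp add: h_def)
    next
      case False
      then have "\<not> coprime (n + M) M" by (metis coprime_iff_gcd_eq_1 gcd_add1)
      then show ?thesis using False by (simp add: h_def)
    qed
    show "h n = 1 \<or> h n = -1" if "coprime n M" for n using vals[OF idn[OF that]] that by (auto simp: h_def)
    show "h n = 0" if "\<not> coprime n M" for n using that by (simp add: h_def)
    have M1: "M \<ge> 1" using M(1) by simp
    have cM: "coprime (M - 1) M" using M(1) by (rule coprime_diff_one_left_nat)
    have "X' (pid (of_nat (M - 1))) = X' (pid (of_int (-1)))"
    proof (rule cong)
      show "coprime (nm (of_nat (M - 1))) M" using cM by (simp add: nm_of_nat)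
      show "coprime (nm (of_int (-1))) M" by (simp add: nm_of_int del: of_int_minus)
      have "of_nat (M - 1) - of_int (-1) = (of_nat M :: complex)" using M1 by (simp add: of_nat_diff)
      then show "of_nat (M - 1) - of_int (-1) \<in> pid (of_nat M)" by simp
    qed auto
    also have "pid (of_int (-1)) = R" by (rule pid_unit) (simp_all add: nm_of_int del: of_int_minus)
    finally show "h (M - 1) = 1" using cM sign_unit_ideal by (simp add: h_def)
    \<comment> \<open>Here (p) is P times its conjugate, and the two factors have equal
      signs.\<close>
    show "h p = 1" if p: "prime p" "coprime p M" and L: "Legendre (- int D) (int p) = 1" for p
    proof -
      have "\<not> p dvd 2 * D" using p two_D_dvd_modulus by (metis coprime_common_divisor dvd_refl dvd_trans not_prime_unit)
      then obtain P where P: "idl P" "N P = p" using split_prime_ideal[OF p(1) _ L] by blast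
      have cP: "coprime (N P) M" using P(2) p(2) by simp
      have "X' (P \<odot> cnj ` P) = X' P * X' (cnj ` P)"
        using P(1) cP by (intro mult idl_cnj) (simp_all add: N_cnj)
      also have "\<dots> = 1" unfolding conj[OF P(1) cP] using vals[OF P(1) cP] by auto
      finally have "X' (pid (of_nat p)) = 1" unfolding pid_prime[OF P] .
      then show ?thesis using p(2) by (simp add: h_def)
    qed
  qed
  then show ?thesis using n by (simp add: h_def)
qed

lemma sign_pid_int: assumes n: "coprime n (int M)" shows "X' (pid (of_int n)) = 1"
proof -
  have c: "coprime (nat \<bar>n\<bar>) M" using n by (metis abs_ge_zero coprime_abs_left_iff coprime_int_iff nat_0_le)
  have "pid (of_int n) = pid (of_nat (nat \<bar>n\<bar>))"
  proof (cases "n \<ge> 0")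
    case True
    then show ?thesis by simp
  next
    case False
    have "pid (of_int (-1)) = R" by (rule pid_unit) (simp_all add: nm_of_int del: of_int_minus)
    moreover have "idl (pid (of_int n))" using False by (intro idl_pid) auto
    ultimately have "pid (of_int n) = pid (of_int (-1)) \<odot> pid (of_int n)" by simp
    then show ?thesis using False unfolding pid_mult by simp
  qed
  then show ?thesis using sign_pid_nat[OF c] by simp
qed

text \<open>The prime ideals of a given prime norm are P and its conjugate, which have equal signs.
  So a common factor can be removed from both ideals up to conjugation, and the norm
  decreases.\<close>

lemma sign_depends_on_norm:
  assumes "idl I" "coprime (N I) M"
  shows "idl J \<Longrightarrow> N J = N I \<Longrightarrow> X' J = X' I"
  using assms
proof (induct I arbitrary: J rule: coprime_ideal_induct)
  case unit
  then show ?case using N_1[of J] by simp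
next
  case deg1: (degree_one P C)
  have p0: "N P > 0" by (rule N_pos[OF deg1(1)])
  have NJ: "N J = N P * N C" using deg1(8) N_mult[OF deg1(1,4)] by simp
  have "\<exists>P' C'. idl P' \<and> N P' = N P \<and> idl C' \<and> J = P' \<odot> C'"
  proof (rule prime_divides_norm[OF deg1(7,2)])
    show "N P dvd N J" using NJ by simp
    show ?thesis if "idl P'" "N P' = N P" "idl C'" "J = P' \<odot> C'" for P' C'
      using that by blast
    \<comment> \<open>If the whole (p) divides J, it splits as P times its conjugate, and P itself
      serves as the factor of norm p.\<close>
    show ?thesis if "idl C'" "J = pid (of_nat (N P)) \<odot> C'" for C'
    proof -
      have "J = P \<odot> (cnj ` P \<odot> C')" using that(2) unfolding imul_cnj_N[OF deg1(1), symmetric] by (simp only: imul_assoc)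
      then show ?thesis using deg1(1) idl_imul[OF idl_cnj[OF deg1(1)] that(1)] by blast
    qed
  qed
  then obtain P' C' where P': "idl P'" "N P' = N P" "idl C'" and J: "J = P' \<odot> C'" by blast
  have NC: "N C' = N C" using NJ p0 P'(2) N_mult[OF P'(1,3)] J by simp
  have XC: "X' C' = X' C" by (rule deg1(6)[OF P'(3) NC])
  have "P' = P \<or> P' = cnj ` P" by (rule norm_prime_unique[OF deg1(1) refl P'(1,2) deg1(2)])
  then have XP: "X' P' = X' P" using conj[OF deg1(1,3)] by auto
  have "X' J = X' P' * X' C'" unfolding J using P' NC deg1(3,5) by (intro mult) simp_all
  also have "\<dots> = X' (P \<odot> C)" unfolding XP XC using mult[OF deg1(1,3,4,5)] by simp
  finally show ?case .
next
  case (inert p C)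
  have p0: "p > 0" using inert(1) prime_gt_0_nat by blast
  have pp: "idl (pid (of_nat p))" using p0 by (intro idl_pid) auto
  have Np: "N (pid (of_nat p)) = p\<^sup>2" using p0 by (simp add: N_pid nm_of_nat)
  have cp: "coprime (N (pid (of_nat p))) M" unfolding Np using inert(2) by simp
  have NJ: "N J = p\<^sup>2 * N C" using inert(8) N_mult[OF pp inert(4)] Np by simp
  have "\<exists>C'. idl C' \<and> J = pid (of_nat p) \<odot> C'"
  proof (rule prime_divides_norm[OF inert(7,1)])
    show "p dvd N J" using NJ by (simp add: power2_eq_square)
    show ?thesis if "idl P'" "N P' = p" for P' using that inert(3) by blast
  qed blast
  then obtain C' where C': "idl C'" "J = pid (of_nat p) \<odot> C'" by blast
  have NC: "N C' = N C" using NJ p0 Np N_mult[OF pp C'(1)] C'(2) by simp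
  have XC: "X' C' = X' C" by (rule inert(6)[OF C'(1) NC])
  have "X' J = X' (pid (of_nat p)) * X' C'" unfolding C'(2) using C'(1) NC pp cp inert(5) by (intro mult) simp_all
  also have "\<dots> = X' (pid (of_nat p) \<odot> C)" unfolding XC using mult[OF pp cp inert(4,5)] by simp
  finally show ?case .
qed

text \<open>The representative b has the norm of I times (q), so the two ideals have equal signs. It
  is congruent modulo M to the rational integer t q, and rational integers have sign 1.\<close>

lemma sign_norm_square:
  assumes I: "idl I" and c: "coprime (N I) M" and s0: "[N I = a\<^sup>2] (mod M ^ 4)"
  shows "X' I = 1"
proof -
  have "[int (N I) = (int a)\<^sup>2] (mod int M ^ 4)" using s0 by (metis cong_int_iff of_nat_power)
  then obtain b t q where b: "b \<in> R" "nm b = N I * nat (q\<^sup>2)" "coprime q (int M)" "coprime t (int M)"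
    "b - of_int (t * q) \<in> pid (of_nat M)"
    by (rule norm_cong_square_representative[OF I refl M(1) two_D_dvd_modulus c _ D1])
  have cq: "coprime (nat (k\<^sup>2)) M" if "coprime k (int M)" for k
  proof -
    have "coprime (k\<^sup>2) (int M)" using that by simp
    then show ?thesis by (metis coprime_int_iff int_nat_eq zero_le_power2)
  qed
  have cb: "coprime (nm b) M" unfolding b(2) using c cq[OF b(3)] by simp
  have b0: "b \<noteq> 0" using coprime_imp_pos[OF cb] nm_eq_0[OF b(1)] by auto
  have q0: "q \<noteq> 0" using coprime_imp_pos[OF cq[OF b(3)]] by auto
  have iq: "idl (pid (of_int q))" using q0 by (intro idl_pid) auto
  have Nq: "N (pid (of_int q)) = nat (q\<^sup>2)" using q0 by (simp add: N_pid nm_of_int)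
  have ctq: "coprime (t * q) (int M)" using b(3,4) by simp
  have "X' (I \<odot> pid (of_int q)) = X' I * X' (pid (of_int q))"
    by (rule mult[OF I c iq]) (unfold Nq, rule cq[OF b(3)])
  then have "X' I = X' (I \<odot> pid (of_int q))" using sign_pid_int[OF b(3)] by simp
  also have "\<dots> = X' (pid b)"
  proof (rule sign_depends_on_norm)
    show "idl (pid b)" by (rule idl_pid[OF b(1) b0])
    show "coprime (N (pid b)) M" using cb N_pid[OF b(1) b0] by simp
    show "idl (I \<odot> pid (of_int q))" by (rule idl_imul[OF I iq])
    show "N (I \<odot> pid (of_int q)) = N (pid b)"
      unfolding N_mult[OF I iq] Nq N_pid[OF b(1) b0] b(2) ..
  qed
  also have "\<dots> = X' (pid (of_int (t * q)))"
    by (rule cong[OF b(1) R_of_int cb _ b(5)]) (unfold nm_of_int, rule cq[OF ctq])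
  also have "\<dots> = 1" by (rule sign_pid_int[OF ctq])
  finally show ?thesis .
qed

end

end

section \<open>Comparison of rational characters\<close>

definition square_mod :: "nat \<Rightarrow> nat \<Rightarrow> bool" where
  "square_mod m n \<longleftrightarrow> (\<exists>a. [n = a\<^sup>2] (mod m))"

lemma square_mod_mult: assumes "square_mod m a" "square_mod m b" shows "square_mod m (a * b)"
proof -
  obtain x y where "[a = x\<^sup>2] (mod m)" "[b = y\<^sup>2] (mod m)" using assms unfolding square_mod_def by blast
  then have "[a * b = x\<^sup>2 * y\<^sup>2] (mod m)" by (rule cong_mult)
  then show ?thesis unfolding square_mod_def power_mult_distrib[symmetric] by blast
qed

lemma square_mod_square: "square_mod m (a * a)"
  unfolding square_mod_def by (rule exI[of _ a]) (simp add: power2_eq_square)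

text \<open>If x inverts k modulo m, then n is congruent to (n k) k x^2.\<close>

lemma square_mod_cancel:
  assumes "square_mod m (n * k)" "square_mod m k" "coprime k m" shows "square_mod m n"
proof -
  obtain b c where b: "[n * k = b\<^sup>2] (mod m)" and c: "[k = c\<^sup>2] (mod m)"
    using assms(1,2) unfolding square_mod_def by blast
  obtain x where x: "[k * x = 1] (mod m)" using cong_solve_coprime_nat[OF assms(3)] by auto
  have "[n * ((k * x) * (k * x)) = n * (1 * 1)] (mod m)" by (intro cong_mult cong_refl x)
  moreover have "n * ((k * x) * (k * x)) = (n * k) * k * x\<^sup>2" by (simp add: power2_eq_square)
  moreover have "[(n * k) * k * x\<^sup>2 = b\<^sup>2 * c\<^sup>2 * x\<^sup>2] (mod m)" by (intro cong_mult cong_refl b c)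
  moreover have "b\<^sup>2 * c\<^sup>2 * x\<^sup>2 = (b * c * x)\<^sup>2" by (simp add: power_mult_distrib)
  ultimately have "[n = (b * c * x)\<^sup>2] (mod m)" by (metis cong_sym cong_trans mult_1 mult.commute)
  then show ?thesis unfolding square_mod_def by blast
qed

text \<open>The graph of a partial character with values in \<open>{1, -1}\<close> that is trivial on squares
  modulo \<open>m\<close>; such graphs are extended one generator at a time.\<close>

definition sign_graph :: "nat \<Rightarrow> (nat \<times> int) set \<Rightarrow> bool" where
  "sign_graph m G \<longleftrightarrow> (1, 1) \<in> G \<and>
    (\<forall>n e. (n, e) \<in> G \<longrightarrow> coprime n m \<and> (e = 1 \<or> e = -1) \<and> (square_mod m n \<longrightarrow> e = 1)) \<and>
    (\<forall>n e n' e'. (n, e) \<in> G \<longrightarrow> (n', e') \<in> G \<longrightarrow> (n * n', e * e') \<in> G)"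

lemma sign_graphD:
  assumes "sign_graph m G"
  shows "(1, 1) \<in> G" "(n, e) \<in> G \<Longrightarrow> coprime n m" "(n, e) \<in> G \<Longrightarrow> e = 1 \<or> e = -1"
    "(n, e) \<in> G \<Longrightarrow> square_mod m n \<Longrightarrow> e = 1" "(n, e) \<in> G \<Longrightarrow> (n', e') \<in> G \<Longrightarrow> (n * n', e * e') \<in> G"
  using assms unfolding sign_graph_def by blast+

text \<open>The value at g is forced to be -1 exactly if n g is a square for some n of value -1.
  Modulo squares n g^i is n or n g, so consistency has to be checked for these two only.\<close>

lemma sign_graph_adjoin:
  assumes G: "sign_graph m G" and g: "coprime g m"
  obtains G' e where "sign_graph m G'" "G \<subseteq> G'" "(g, e) \<in> G'"
proof -
  note GD = sign_graphD[OF G]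
  define \<epsilon> :: int where "\<epsilon> = (if \<exists>n. (n, -1) \<in> G \<and> square_mod m (n * g) then -1 else 1)"
  have eps: "\<epsilon> = 1 \<or> \<epsilon> = -1" by (simp add: \<epsilon>_def)
  define G' where "G' = {(n * g ^ i, e * \<epsilon> ^ i) | n e i. (n, e) \<in> G}"
  have sq: "e * \<epsilon> ^ i = 1" if ne: "(n, e) \<in> G" and s: "square_mod m (n * g ^ i)" for n e i
  proof (cases "even i")
    case True
    then obtain j where j: "i = j + j" by (metis evenE mult_2)
    have "square_mod m (g ^ i)" unfolding j power_add by (rule square_mod_square)
    then have "square_mod m n" using square_mod_cancel[OF s] g by simp
    moreover have "\<epsilon> ^ i = 1" using True eps by auto
    ultimately show ?thesis using GD(4)[OF ne] by simp
  next
    case False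
    then obtain j where j: "i = Suc (j + j)" by (metis oddE mult_2 Suc_eq_plus1)
    have "n * g ^ i = (n * g) * (g ^ j * g ^ j)" unfolding j by (simp add: power_add mult_ac)
    then have s': "square_mod m (n * g)" using square_mod_cancel[OF s[unfolded \<open>n * g ^ i = (n * g) * (g ^ j * g ^ j)\<close>] square_mod_square] g by simp
    have ei: "\<epsilon> ^ i = \<epsilon>" using False eps by auto
    show ?thesis
    proof (cases "\<epsilon> = 1")
      case True
      then have "\<not> (n, -1) \<in> G" using s' unfolding \<epsilon>_def by (auto split: if_splits)
      then show ?thesis using GD(3)[OF ne] ne True by auto
    next
      case False
      then obtain n2 where n2: "(n2, -1) \<in> G" "square_mod m (n2 * g)" unfolding \<epsilon>_def by (auto split: if_splits)
      have "square_mod m ((n * g) * (n2 * g))" by (rule square_mod_mult[OF s' n2(2)])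
      moreover have "(n * g) * (n2 * g) = (n * n2) * (g * g)" by (simp add: mult_ac)
      ultimately have "square_mod m (n * n2)" using square_mod_cancel[OF _ square_mod_square] g by (metis coprime_mult_left_iff)
      then have "e * -1 = 1" using GD(4)[OF GD(5)[OF ne n2(1)]] by simp
      then show ?thesis using ei eps False by simp
    qed
  qed
  have "sign_graph m G'"
    unfolding sign_graph_def
  proof (intro conjI allI impI)
    have "(1 * g ^ 0, 1 * \<epsilon> ^ 0) \<in> G'" unfolding G'_def using GD(1) by blast
    then show "(1, 1) \<in> G'" by simp
    fix n e assume ne: "(n, e) \<in> G'"
    then obtain n0 e0 i where 0: "n = n0 * g ^ i" "e = e0 * \<epsilon> ^ i" "(n0, e0) \<in> G" unfolding G'_def by blast
    show "coprime n m" using GD(2)[OF 0(3)] g unfolding 0(1) by simp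
    have "\<epsilon> ^ i = 1 \<or> \<epsilon> ^ i = -1" using eps by (metis power_one neg_one_even_power neg_one_odd_power)
    then show "e = 1 \<or> e = -1" using GD(3)[OF 0(3)] unfolding 0(2) by auto
    show "e = 1" if "square_mod m n" using sq[OF 0(3)] that unfolding 0(1,2) by blast
    fix n' e' assume ne': "(n', e') \<in> G'"
    then obtain n1 e1 j where 1: "n' = n1 * g ^ j" "e' = e1 * \<epsilon> ^ j" "(n1, e1) \<in> G" unfolding G'_def by blast
    have "n * n' = (n0 * n1) * g ^ (i + j)" "e * e' = (e0 * e1) * \<epsilon> ^ (i + j)"
      unfolding 0(1,2) 1(1,2) by (simp_all add: power_add mult_ac)
    then show "(n * n', e * e') \<in> G'" unfolding G'_def using GD(5)[OF 0(3) 1(3)] by blast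
  qed
  moreover have "G \<subseteq> G'"
  proof
    fix x assume x: "x \<in> G"
    obtain n e where ne: "x = (n, e)" by (cases x)
    have "(n * g ^ 0, e * \<epsilon> ^ 0) \<in> G'" unfolding G'_def using x ne by blast
    then show "x \<in> G'" unfolding ne by simp
  qed
  moreover have "(1 * g ^ 1, 1 * \<epsilon> ^ 1) \<in> G'" unfolding G'_def using GD(1) by blast
  then have "(g, \<epsilon>) \<in> G'" by simp
  ultimately show ?thesis by (rule that)
qed

lemma sign_graph_cover:
  assumes "sign_graph m G" "finite S" "\<And>g. g \<in> S \<Longrightarrow> coprime g m"
  shows "\<exists>G'. sign_graph m G' \<and> G \<subseteq> G' \<and> (\<forall>g\<in>S. \<exists>e. (g, e) \<in> G')"
  using assms(2,3)
proof (induct S)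
  case empty
  then show ?case using assms(1) by blast
next
  case (insert g S)
  obtain G1 where G1: "sign_graph m G1" "G \<subseteq> G1" "\<forall>g\<in>S. \<exists>e. (g, e) \<in> G1" using insert by blast
  have "coprime g m" using insert(4) by blast
  then obtain G' e where "sign_graph m G'" "G1 \<subseteq> G'" "(g, e) \<in> G'" by (rule sign_graph_adjoin[OF G1(1)])
  then show ?case using G1 by blast
qed

text \<open>Adjoin all residues below m that are prime to m. The resulting graph is single-valued
  modulo m: if n and n' are congruent, n n' is a square, so the product of their signs is 1.\<close>

lemma quadratic_character_extend:
  assumes G: "sign_graph m G" and m: "m > 0"
  obtains \<phi> where "quadratic_dirichlet_character m \<phi>" "\<And>n e. (n, e) \<in> G \<Longrightarrow> \<phi> n = of_int e"
proof -
  have "finite {g. g < m \<and> coprime g m}" by simp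
  then obtain H where H: "sign_graph m H" "G \<subseteq> H" "\<forall>g\<in>{g. g < m \<and> coprime g m}. \<exists>e. (g, e) \<in> H"
    using sign_graph_cover[OF G, of "{g. g < m \<and> coprime g m}"] by blast
  note HD = sign_graphD[OF H(1)]
  have uniq: "e = e'" if "(n, e) \<in> H" "(n', e') \<in> H" "[n = n'] (mod m)" for n n' e e'
  proof -
    have "[n * n' = n' * n'] (mod m)" using that(3) by (intro cong_mult cong_refl)
    then have "square_mod m (n * n')" unfolding square_mod_def power2_eq_square by blast
    then have "e * e' = 1" using HD(4)[OF HD(5)[OF that(1,2)]] by blast
    then show ?thesis using HD(3)[OF that(1)] HD(3)[OF that(2)] by auto
  qed
  define f where "f n = (SOME e. (n mod m, e) \<in> H)" for n
  have f: "(n mod m, f n) \<in> H" if "coprime n m" for n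
  proof -
    have "coprime (n mod m) m" using that m by simp
    then have "\<exists>e. (n mod m, e) \<in> H" using H(3) m by auto
    then show ?thesis unfolding f_def by (rule someI_ex)
  qed
  define \<phi> :: "nat \<Rightarrow> complex" where "\<phi> n = (if coprime n m then of_int (f n) else 0)" for n
  have val: "f n = 1 \<or> f n = -1" if "coprime n m" for n using HD(3)[OF f[OF that]] .
  have fmult: "f (a * b) = f a * f b" if ab: "coprime a m" "coprime b m" for a b
  proof (rule uniq)
    show "(a * b mod m, f (a * b)) \<in> H" using ab by (intro f) simp
    show "((a mod m) * (b mod m), f a * f b) \<in> H" by (intro HD(5) f ab)
    show "[a * b mod m = (a mod m) * (b mod m)] (mod m)" by (simp add: cong_def mod_mult_eq)
  qed
  have ext: "\<phi> n = of_int e" if ne: "(n, e) \<in> G" for n e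
  proof -
    have neH: "(n, e) \<in> H" using ne H(2) by blast
    have c: "coprime n m" by (rule HD(2)[OF neH])
    have "e = f n" by (rule uniq[OF neH f[OF c]]) (simp add: cong_def)
    then show ?thesis using c by (simp add: \<phi>_def)
  qed
  have "dirichlet_character m \<phi>"
    unfolding dirichlet_character_def
  proof (intro conjI allI)
    show "m > 0" by (rule m)
    show "\<phi> 1 = 1" using ext[OF sign_graphD(1)[OF G]] by simp
    show "\<phi> (a * b) = \<phi> a * \<phi> b" for a b using fmult[of a b] by (auto simp: \<phi>_def)
    show "\<phi> (a + m) = \<phi> a" for a
    proof -
      have "coprime (a + m) m = coprime a m" by (metis coprime_iff_gcd_eq_1 gcd_add1)
      then show ?thesis by (simp add: \<phi>_def f_def)
    qed
    show "\<phi> a = 0 \<longleftrightarrow> \<not> coprime a m" for a using val[of a] by (auto simp: \<phi>_def)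
  qed
  then have "quadratic_dirichlet_character m \<phi>"
    unfolding quadratic_dirichlet_character_def
  proof (intro conjI allI impI)
    fix a assume "coprime a m"
    then show "\<phi> a ^ 2 = 1" using val[of a] by (auto simp: \<phi>_def)
  qed
  then show ?thesis using that ext by blast
qed

section \<open>Units and the quotient of two rational characters\<close>

context iqf
begin

text \<open>The pairs (N I, X' I) form a sign graph modulo M^4; triviality on squares is
  \<open>sign_norm_square\<close>. It contains in particular that ideals of equal norm have equal
  signs.\<close>

lemma quadratic_character_of_norm:
  assumes M: "M > 0" "8 * D dvd M" and D1: "D \<noteq> 1"
    and vals: "\<And>I. idl I \<Longrightarrow> coprime (N I) M \<Longrightarrow> X' I = 1 \<or> X' I = -1"
    and mult: "\<And>I J. idl I \<Longrightarrow> coprime (N I) M \<Longrightarrow> idl J \<Longrightarrow> coprime (N J) M \<Longrightarrow>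
      X' (I \<odot> J) = X' I * X' J"
    and conj: "\<And>I. idl I \<Longrightarrow> coprime (N I) M \<Longrightarrow> X' (cnj ` I) = X' I"
    and cong: "\<And>a b. a \<in> R \<Longrightarrow> b \<in> R \<Longrightarrow> coprime (nm a) M \<Longrightarrow> coprime (nm b) M \<Longrightarrow>
      a - b \<in> pid (of_nat M) \<Longrightarrow> X' (pid a) = X' (pid b)"
  obtains \<phi> where "quadratic_dirichlet_character (M ^ 4) \<phi>"
    "\<And>I. idl I \<Longrightarrow> coprime (N I) M \<Longrightarrow> \<phi> (N I) = of_int (X' I)"
proof -
  define G where "G = {(N I, X' I) | I. idl I \<and> coprime (N I) M}"
  have "sign_graph (M ^ 4) G"
    unfolding sign_graph_def
  proof (intro conjI allI impI)
    have "X' R = 1" using vals[OF idl_unit] mult[OF idl_unit _ idl_unit] idl_unit by auto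
    then show "(1, 1) \<in> G" unfolding G_def using idl_unit N_R by (metis (mono_tags, lifting) coprime_1_left mem_Collect_eq)
    fix n e assume "(n, e) \<in> G"
    then obtain I where I: "idl I" "coprime (N I) M" "n = N I" "e = X' I" unfolding G_def by blast
    show "coprime n (M ^ 4)" using I(2,3) by simp
    show "e = 1 \<or> e = -1" using vals[OF I(1,2)] I(4) by simp
    show "e = 1" if "square_mod (M ^ 4) n"
      using that sign_norm_square[OF M D1 vals mult conj cong I(1,2)] unfolding square_mod_def I(3,4) by blast
    fix n' e' assume "(n', e') \<in> G"
    then obtain J where J: "idl J" "coprime (N J) M" "n' = N J" "e' = X' J" unfolding G_def by blast
    have IJ: "idl (I \<odot> J)" by (rule idl_imul[OF I(1) J(1)])
    have "N (I \<odot> J) = n * n'" unfolding I(3) J(3) by (rule N_mult[OF I(1) J(1)])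
    moreover have "X' (I \<odot> J) = e * e'" unfolding I(4) J(4) by (rule mult[OF I(1,2) J(1,2)])
    moreover have "coprime (N (I \<odot> J)) M" using N_mult[OF I(1) J(1)] I(2) J(2) by simp
    ultimately show "(n * n', e * e') \<in> G" unfolding G_def using IJ by (metis (mono_tags, lifting) mem_Collect_eq)
  qed
  moreover have "M ^ 4 > 0" using M(1) by simp
  ultimately obtain \<phi> where \<phi>: "quadratic_dirichlet_character (M ^ 4) \<phi>" "\<And>n e. (n, e) \<in> G \<Longrightarrow> \<phi> n = of_int e"
    by (rule quadratic_character_extend) blast
  have "\<phi> (N I) = of_int (X' I)" if "idl I" "coprime (N I) M" for I
    using that by (intro \<phi>(2)) (auto simp: G_def)
  then show ?thesis using that \<phi>(1) by blast
qed

text \<open>A unit with a nonzero coordinate j at w satisfies i^2 + D j^2 = 1, or (2 i + j)^2 + D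
  j^2 = 4 if D is 3 modulo 4. This leaves D = 1 and D = 3.\<close>

lemma unit_order:
  assumes u: "u \<in> R" "nm u = 1"
  shows "u ^ 2 = 1 \<or> D = 1 \<and> u ^ 4 = 1 \<or> D = 3 \<and> u ^ 6 = 1"
proof -
  obtain i j where ij: "u = of_int i + of_int j * w" using u(1) R_basis by blast
  have n1: "i ^ 2 + i * j * tw + j ^ 2 * nw = 1" using u(2) nm_basis[of i j] unfolding ij by simp
  show ?thesis
  proof (cases "j = 0")
    case True
    then have "i\<^sup>2 = 1" using n1 by simp
    then have "(of_int i :: complex) ^ 2 = 1" by (metis of_int_1 of_int_power)
    then show ?thesis using True by (simp add: ij)
  next
    case False
    then have j1: "j\<^sup>2 \<ge> 1" by (simp add: int_one_le_iff_zero_less)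
    show ?thesis
    proof (cases "D mod 4 = 3")
      case True
      have t: "tw = 1" and nw: "4 * nw = int D + 1"
      proof -
        have "int D mod 4 = 3" using True by (metis of_nat_mod of_nat_numeral)
        then show "tw = 1" "4 * nw = int D + 1" using True unfolding tw_def nw_def by presburger+
      qed
      have "4 = 4 * (i ^ 2 + i * j * tw + j ^ 2 * nw)" using n1 by simp
      also have "\<dots> = 4 * i\<^sup>2 + 4 * i * j + j\<^sup>2 * (4 * nw)" unfolding t by (simp add: algebra_simps)
      also have "\<dots> = (2 * i + j)\<^sup>2 + j\<^sup>2 * int D" unfolding nw by (simp add: power2_eq_square algebra_simps)
      finally have e: "(2 * i + j)\<^sup>2 + j\<^sup>2 * int D = 4" by simp
      have D3: "int D \<ge> 3" using True by presburger
      have "1 * int D \<le> j\<^sup>2 * int D" using j1 by (intro mult_right_mono) auto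
      moreover have "(2 * i + j)\<^sup>2 \<ge> 0" by simp
      ultimately have "int D \<le> 4" using e by linarith
      then have D: "D = 3" using True D3 by presburger
      have "0 \<le> (2 * i + j)\<^sup>2" by simp
      then have j2: "j\<^sup>2 = 1" using e[unfolded D] j1 by linarith
      then have "(2 * i + j)\<^sup>2 = 1" using e unfolding D by simp
      then have "(of_int (2 * i + j) :: complex) ^ 2 = 1" by (metis of_int_1 of_int_power)
      moreover define c where "c = (of_int (2 * i + j) :: complex)"
      ultimately have c2: "c ^ 2 = 1" by simp
      \<comment> \<open>The trace c squares to 1, and u^2 = c u - 1 then yields u^3 = - c.\<close>
      have "u + cnj u = c" unfolding ij c_def using w_trace t by (simp add: algebra_simps cnj_w)
      moreover have "u * cnj u = 1" using unit_cnj[OF u] .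
      ultimately have uu: "u * u = c * u - 1" by (metis add_diff_cancel_left' distrib_left mult.commute diff_add_cancel)
      have "u ^ 3 = u * (u * u)" by (simp add: power3_eq_cube)
      also have "\<dots> = u * (c * u - 1)" by (simp only: uu)
      also have "\<dots> = c * (u * u) - u" by (simp add: algebra_simps)
      also have "\<dots> = c * (c * u - 1) - u" by (simp only: uu)
      also have "\<dots> = c ^ 2 * u - c - u" by (simp add: power2_eq_square algebra_simps)
      also have "\<dots> = - c" unfolding c2 by simp
      finally have "u ^ 3 = - c" .
      then have "(u ^ 3) ^ 2 = 1" using c2 by simp
      then have "u ^ 6 = 1" by (simp flip: power_mult)
      then show ?thesis using D by simp
    next
      case False
      then have t: "tw = 0" and nw: "nw = int D" and ws: "w = s" by (simp_all add: tw_def nw_def w_def)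
      have e: "i\<^sup>2 + j\<^sup>2 * int D = 1" using n1 unfolding t nw by simp
      have "1 * int D \<le> j\<^sup>2 * int D" using j1 by (intro mult_right_mono) auto
      moreover have "i\<^sup>2 \<ge> 0" by simp
      ultimately have "int D \<le> 1" using e by linarith
      then have D: "D = 1" using D_pos by simp
      have "0 \<le> i\<^sup>2" by simp
      then have i0: "i\<^sup>2 = 0" and j2: "j\<^sup>2 = 1" using e[unfolded D] j1 by linarith+
      have "(of_int j :: complex) ^ 2 = 1" using j2 by (metis of_int_1 of_int_power)
      moreover have "u ^ 2 = of_int j ^ 2 * (s * s)" using i0 by (simp add: ij ws power_mult_distrib power2_eq_square)
      moreover have "of_nat D = (1 :: complex)" using D by simp
      ultimately have "u ^ 2 = -1" unfolding s_sq by simp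
      then have "(u ^ 2) ^ 2 = 1" by simp
      then have "u ^ 4 = 1" by (simp flip: power_mult)
      then show ?thesis using D by simp
    qed
  qed
qed

lemma K_generate_field: "K = generate_field complex_ring {csqrt (- of_nat D)}"
proof -
  let ?G = "generate_field complex_ring {s}"
  have cs: "csqrt (- of_nat D) = s" by (subst csqrt_of_real_nonpos) (auto simp: s_def)
  have add: "x + y \<in> ?G" if "x \<in> ?G" "y \<in> ?G" for x y using generate_field.eng_add[OF that] by simp
  have mult: "x * y \<in> ?G" if "x \<in> ?G" "y \<in> ?G" for x y using generate_field.eng_mult[OF that] by simp
  have one: "1 \<in> ?G" using generate_field.one[of complex_ring "{s}"] by simp
  have neg: "- x \<in> ?G" if "x \<in> ?G" for x using generate_field.a_inv[OF that] by simp
  have inv: "inverse x \<in> ?G" if "x \<in> ?G" "x \<noteq> 0" for x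
    using generate_field.m_inv[OF that(1)] that(2) by (simp add: complex_ring_m_inv)
  have zero: "0 \<in> ?G" using add[OF one neg[OF one]] by simp
  have nat: "of_nat n \<in> ?G" for n by (induct n) (auto intro: add one zero)
  have int: "of_int n \<in> ?G" for n by (cases n rule: int_cases2) (auto intro: nat neg)
  have rat: "r \<in> ?G" if r: "r \<in> \<rat>" for r
  proof -
    obtain a b where ab: "b > 0" "r = of_int a / of_int b" using r by (rule Rats_cases')
    have "of_int a * inverse (of_int b) \<in> ?G" using ab(1) by (intro mult inv int) auto
    then show ?thesis unfolding ab(2) divide_inverse .
  qed
  have sG: "s \<in> ?G" by (rule generate_field.incl) simp
  have "x \<in> K" if "x \<in> ?G" for x
    using that by (induct rule: generate_field.induct) (auto simp: complex_ring_m_inv)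
  moreover have "x \<in> ?G" if xK: "x \<in> K" for x
  proof -
    obtain p q where pq: "p \<in> \<rat>" "q \<in> \<rat>" and x: "x = p + q * s" using xK unfolding K_iff by blast
    show ?thesis unfolding x by (rule add[OF rat[OF pq(1)] mult[OF rat[OF pq(2)] sG]])
  qed
  ultimately show ?thesis unfolding cs by blast
qed

text \<open>Both values generate A^l, so their quotient g is a unit, compatible with conjugation.
  The l-th powers in the two congruence conditions cancel, so g extends to a character of infinity
  type 0.\<close>

theorem rational_characters_twist:
  assumes h: "hecke_character K l \<mm> \<psi>" "rational_coeffs K \<psi>"
    and h': "hecke_character K l \<mm>' \<psi>'" "rational_coeffs K \<psi>'" and l: "l \<ge> 1"
  shows "is_twist K \<psi> \<psi>'"
proof -
  have m: "idl \<mm>" and m': "idl \<mm>'" using h(1) h'(1) unfolding hecke_character_iff by blast+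
  \<comment> \<open>The norms put M into both moduli; 8 D is the period of the Kronecker symbol of -
    D.\<close>
  define M where "M = 8 * D * N \<mm> * N \<mm>'"
  have M0: "M > 0" using D_pos N_pos[OF m] N_pos[OF m'] by (simp add: M_def)
  have M8: "8 * D dvd M" and M2: "2 * D dvd M" unfolding M_def by (simp_all add: mult.assoc)
  have "of_nat M = of_nat (8 * D * N \<mm>') * (of_nat (N \<mm>) :: complex)" by (simp add: M_def)
  then have Mm: "of_nat M \<in> \<mm>" using idl_mult[OF m R_of_nat N_mem[OF m]] by metis
  have "of_nat M = of_nat (8 * D * N \<mm>) * (of_nat (N \<mm>') :: complex)" by (simp add: M_def)
  then have Mm': "of_nat M \<in> \<mm>'" using idl_mult[OF m' R_of_nat N_mem[OF m']] by metis
  let ?J = "pid (of_nat M)"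
  have J: "idl ?J" using M0 by (intro idl_pid) auto
  have Jm: "?J \<subseteq> \<mm>" "?J \<subseteq> \<mm>'" by (rule pid_subset[OF m Mm], rule pid_subset[OF m' Mm'])
  note gen = rational_generates[OF h l M0 Mm M2] and gen' = rational_generates[OF h' l M0 Mm' M2]
  define g where "g A = \<psi>' A / \<psi> A" for A
  have cJ: "coprime_ideals K A ?J \<longleftrightarrow> coprime (N A) M" if "idl A" for A
    by (rule coprime_nat_iff[OF that M0])
  have g: "g A \<in> R \<and> nm (g A) = 1 \<and> \<psi>' A = \<psi> A * g A \<and> g (cnj ` A) = cnj (g A) \<and> g A \<noteq> 0"
    if A: "idl A" "coprime (N A) M" for A
  proof -
    have p: "\<psi> A \<in> R" "\<psi> A \<noteq> 0" "pid (\<psi> A) = ipow A l" "\<psi> (cnj ` A) = cnj (\<psi> A)" using gen[OF A] by blast+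
    have p': "\<psi>' A \<noteq> 0" "pid (\<psi>' A) = ipow A l" "\<psi>' (cnj ` A) = cnj (\<psi>' A)" using gen'[OF A] by blast+
    have "pid (\<psi>' A) = pid (\<psi> A)" unfolding p(3) p'(2) ..
    then obtain u where u: "u \<in> R" "nm u = 1" "\<psi>' A = \<psi> A * u" by (rule pid_eqD[OF _ p(2,1)])
    have "g A = u" unfolding g_def u(3) using p(2) by simp
    moreover have "u \<noteq> 0" using u(3) p'(1) by auto
    moreover have "g (cnj ` A) = cnj (g A)" unfolding g_def p(4) p'(3) by simp
    ultimately show ?thesis using u by simp
  qed
  have gmult: "g (A \<odot> B) = g A * g B"
    if AB: "idl A" "coprime (N A) M" "idl B" "coprime (N B) M" for A B
  proof -
    have "\<psi> A \<noteq> 0" "\<psi> B \<noteq> 0" "\<psi>' A \<noteq> 0" "\<psi>' B \<noteq> 0" using gen[OF AB(1,2)] gen[OF AB(3,4)] gen'[OF AB(1,2)] gen'[OF AB(3,4)] by blast+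
    then have "\<psi> (A \<odot> B) = \<psi> A * \<psi> B" "\<psi>' (A \<odot> B) = \<psi>' A * \<psi>' B" using hecke_mult[OF h(1)] hecke_mult[OF h'(1)] by blast+
    then show ?thesis by (simp add: g_def)
  qed
  have gcong: "g (pid a) = g (pid b)"
    if ab: "a \<in> R" "b \<in> R" "a \<noteq> 0" "b \<noteq> 0" "coprime (nm a) M" "coprime (nm b) M" "a - b \<in> ?J" for a b
  proof -
    have ia: "idl (pid a)" and ib: "idl (pid b)" using ab by (auto intro: idl_pid)
    have ca: "coprime (N (pid a)) M" and cb: "coprime (N (pid b)) M" using ab by (auto simp: N_pid)
    have cm: "coprime_ideals K (pid a) ?J" "coprime_ideals K (pid b) ?J" using ca cb cJ ia ib by blast+
    have 1: "\<psi> (pid a) * b ^ l = \<psi> (pid b) * a ^ l"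
      using Jm ab(7) coprime_mono[OF cm(1) ia J m Jm(1)] coprime_mono[OF cm(2) ib J m Jm(1)]
      by (intro hecke_cong[OF h(1) ab(1-4)]) auto
    have 2: "\<psi>' (pid a) * b ^ l = \<psi>' (pid b) * a ^ l"
      using Jm ab(7) coprime_mono[OF cm(1) ia J m' Jm(2)] coprime_mono[OF cm(2) ib J m' Jm(2)]
      by (intro hecke_cong[OF h'(1) ab(1-4)]) auto
    have nz: "\<psi> (pid a) \<noteq> 0" "\<psi> (pid b) \<noteq> 0" using gen[OF ia ca] gen[OF ib cb] by blast+
    have "g (pid a) = (\<psi>' (pid a) * b ^ l) / (\<psi> (pid a) * b ^ l)"
      using ab(4) by (simp add: g_def)
    also have "\<dots> = g (pid b)" unfolding 1 2 using ab(3) by (simp add: g_def)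
    finally show ?thesis .
  qed
  obtain \<Xi> where \<Xi>: "hecke_character K 0 ?J \<Xi>" "\<And>A. idl A \<Longrightarrow> coprime_ideals K A ?J \<Longrightarrow> \<Xi> A = g A"
  proof (rule hecke_character_extend[OF J, of g 0])
    show "g A \<noteq> 0" if "idl A" "coprime_ideals K A ?J" for A using g[OF that(1)] cJ that by blast
    show "g (A \<odot> B) = g A * g B" if "idl A" "idl B" "coprime_ideals K A ?J" "coprime_ideals K B ?J" for A B
      using gmult[of A B] cJ that by blast
    show "g (pid a) * b ^ 0 = g (pid b) * a ^ 0"
      if "a \<in> R" "b \<in> R" "a \<noteq> 0" "b \<noteq> 0" "coprime_ideals K (pid a) ?J"
        "coprime_ideals K (pid b) ?J" "a - b \<in> ?J" for a b
      using gcong[of a b] that cJ[OF idl_pid] by (simp add: N_pid)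
  qed blast
  \<comment> \<open>Fractional ideals are reduced to quotients of integral ones, where the values of
    all three characters are known.\<close>
  have quot: "\<exists>A B. idl A \<and> idl B \<and> coprime (N A) M \<and> coprime (N B) M \<and> I \<odot> B = A \<and>
      \<Xi> A = g A \<and> \<Xi> B = g B \<and> g A = \<Xi> I * g B \<and> prime_to \<mm>' I" if I: "\<Xi> I \<noteq> 0" for I
  proof -
    have "prime_to ?J I" using \<Xi>(1) I unfolding hecke_character_iff by blast
    then obtain A B where AB: "fractional_ideal K I" "idl A" "idl B"
      "coprime_ideals K A ?J" "coprime_ideals K B ?J" "I \<odot> B = A" unfolding prime_to_iff by blast
    have B0: "\<Xi> B \<noteq> 0" using hecke_coprime_nonzero[OF \<Xi>(1) AB(3)] AB(5) by blast
    have "\<Xi> A = \<Xi> I * \<Xi> B" using hecke_mult[OF \<Xi>(1) I B0] unfolding AB(6) .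
    then have "g A = \<Xi> I * g B" using \<Xi>(2) AB by simp
    moreover have "prime_to \<mm>' I" unfolding prime_to_iff
      using AB coprime_mono[OF AB(4,2) J m' Jm(2)] coprime_mono[OF AB(5,3) J m' Jm(2)] by blast
    ultimately show ?thesis using AB cJ \<Xi>(2) by blast
  qed
  have ext: "extends_character \<psi>' (\<lambda>I. \<psi> I * \<Xi> I)"
    unfolding extends_character_def
  proof (intro allI impI)
    fix I assume nz: "\<psi> I * \<Xi> I \<noteq> 0"
    then have "\<Xi> I \<noteq> 0" "\<psi> I \<noteq> 0" by auto
    then obtain A B where AB: "idl A" "idl B" "coprime (N A) M" "coprime (N B) M" "I \<odot> B = A"
      "g A = \<Xi> I * g B" "prime_to \<mm>' I" using quot by blast
    have I': "\<psi>' I \<noteq> 0" using AB(7) h'(1) unfolding hecke_character_iff by blast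
    have B0: "\<psi> B \<noteq> 0" "\<psi>' B \<noteq> 0" using gen[OF AB(2,4)] gen'[OF AB(2,4)] by blast+
    have "\<psi>' I * \<psi>' B = \<psi>' A" using hecke_mult[OF h'(1) I' B0(2)] AB(5) by simp
    also have "\<dots> = \<psi> A * g A" using g[OF AB(1,3)] by blast
    also have "\<dots> = (\<psi> I * \<Xi> I) * (\<psi> B * g B)"
      using hecke_mult[OF h(1) \<open>\<psi> I \<noteq> 0\<close> B0(1)] unfolding AB(5) AB(6) by simp
    also have "\<psi> B * g B = \<psi>' B" using g[OF AB(2,4)] by metis
    finally show "\<psi>' I = \<psi> I * \<Xi> I" using B0(2) by simp
  qed
  have order: "order_divides \<Xi> k" if k: "\<And>A. idl A \<Longrightarrow> coprime (N A) M \<Longrightarrow> g A ^ k = 1" for k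
    unfolding order_divides_def
  proof (intro allI impI)
    fix I assume "\<Xi> I \<noteq> 0"
    then obtain A B where AB: "idl A" "idl B" "coprime (N A) M" "coprime (N B) M" "g A = \<Xi> I * g B"
      using quot by blast
    have "g A ^ k = \<Xi> I ^ k * g B ^ k" unfolding AB(5) by (rule power_mult_distrib)
    then show "\<Xi> I ^ k = 1" using k[OF AB(1,3)] k[OF AB(2,4)] by simp
  qed
  have "twisting_character K \<Xi>"
  proof -
    consider "D = 1" | "D = 3" | "D \<noteq> 1" "D \<noteq> 3" by blast
    then show ?thesis
    proof cases
      case 1
      have "g A ^ 4 = 1" if "idl A" "coprime (N A) M" for A
      proof -
        have "g A ^ 2 = 1 \<or> g A ^ 4 = 1" using unit_order[of "g A"] g[OF that] 1 by auto
        then show ?thesis 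
        proof
          assume "g A ^ 2 = 1"
          then have "(g A ^ 2) ^ 2 = 1" by simp
          then show ?thesis by (simp flip: power_mult)
        qed
      qed
      then have "order_divides \<Xi> 4" by (rule order)
      moreover have "K = generate_field complex_ring {csqrt (-1)}" using K_generate_field 1 by simp
      ultimately show ?thesis unfolding twisting_character_def using \<Xi>(1) by blast
    next
      case 2
      have "g A ^ 6 = 1" if "idl A" "coprime (N A) M" for A
      proof -
        have "g A ^ 2 = 1 \<or> g A ^ 6 = 1" using unit_order[of "g A"] g[OF that] 2 by auto
        then show ?thesis
        proof
          assume "g A ^ 2 = 1"
          then have "(g A ^ 2) ^ 3 = 1" by simp
          then show ?thesis by (simp flip: power_mult)
        qed
      qed
      then have "order_divides \<Xi> 6" by (rule order)
      moreover have "K = generate_field complex_ring {csqrt (-3)}" using K_generate_field 2 by simp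
      ultimately show ?thesis unfolding twisting_character_def using \<Xi>(1) by blast
    next
      case 3
      have pm: "g A = 1 \<or> g A = -1" if "idl A" "coprime (N A) M" for A
        using unit_order[of "g A"] g[OF that] 3 by (auto simp: power2_eq_1_iff)
      define X' :: "complex set \<Rightarrow> int" where "X' A = (if g A = 1 then 1 else -1)" for A
      have X': "g A = of_int (X' A)" if "idl A" "coprime (N A) M" for A
        using pm[OF that] by (auto simp: X'_def)
      have nz: "a \<noteq> 0" if "coprime (nm a) M" for a
      proof
        assume "a = 0"
        then have "nm a = 0" using nm_eq_0[of a] by simp
        then have "M = 1" using that by simp
        then have "8 dvd (1 :: nat)" using M8 dvd_mult_left by blast
        then show False by simp
      qed
      obtain \<phi> where \<phi>: "quadratic_dirichlet_character (M ^ 4) \<phi>"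
        "\<And>I. idl I \<Longrightarrow> coprime (N I) M \<Longrightarrow> \<phi> (N I) = of_int (X' I)"
      proof (rule quadratic_character_of_norm[OF M0 M8 3(1), of X'])
        show "X' I = 1 \<or> X' I = -1" for I by (simp add: X'_def)
        show "X' (I \<odot> J) = X' I * X' J"
          if "idl I" "coprime (N I) M" "idl J" "coprime (N J) M" for I J
          using gmult[OF that] pm[OF that(1,2)] pm[OF that(3,4)] by (auto simp: X'_def)
        show "X' (cnj ` I) = X' I" if "idl I" "coprime (N I) M" for I
          using pm[OF that] g[OF that] by (auto simp: X'_def)
        show "X' (pid a) = X' (pid b)"
          if "a \<in> R" "b \<in> R" "coprime (nm a) M" "coprime (nm b) M" "a - b \<in> ?J" for a b
          using gcong[of a b] that nz by (simp add: X'_def)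
      qed blast
      \<comment> \<open>The identity is required at all integral ideals. M and M^4 have the same
        primes, so both sides vanish at the same ideals.\<close>
      have "\<Xi> I = \<phi> (N I)" if I: "idl I" for I
      proof (cases "coprime (N I) M")
        case True
        then show ?thesis using \<Xi>(2)[OF I] X'[OF I True] \<phi>(2)[OF I True] cJ[OF I] by simp
      next
        case False
        then have "\<Xi> I = 0" using hecke_coprime_nonzero[OF \<Xi>(1) I] cJ[OF I] by blast
        moreover have "\<not> coprime (N I) (M ^ 4)" using False by simp
        then have "\<phi> (N I) = 0"
          using \<phi>(1) unfolding quadratic_dirichlet_character_def dirichlet_character_def by blast
        ultimately show ?thesis by simp
      qed
      then show ?thesis unfolding twisting_character_def using \<Xi>(1) \<phi>(1) by blast
    qed
  qed
  then show ?thesis unfolding is_twist_def using ext by blast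
qed

end

section \<open>Existence of rational characters\<close>

context iqf
begin

text \<open>Since \<open>\<psi>(A)\<close> must generate \<open>A\<^sup>l\<close>, a rational character is a multiplicative
  choice of generators; \<open>W\<close> is the set of chosen ones.\<close>

lemma character_from_generators:
  assumes m: "idl \<mm>" and mc: "cnj ` \<mm> = \<mm>" and W0: "0 \<notin> W"
    and W_mult: "\<And>a b. a \<in> W \<Longrightarrow> b \<in> W \<Longrightarrow> a * b \<in> W" and W_cnj: "\<And>a. a \<in> W \<Longrightarrow> cnj a \<in> W"
    and uniq: "\<And>\<beta> u. \<beta> \<in> W \<Longrightarrow> u \<in> R \<Longrightarrow> nm u = 1 \<Longrightarrow> \<beta> * u \<in> W \<Longrightarrow> u = 1"
    and exist: "\<And>A. idl A \<Longrightarrow> coprime_ideals K A \<mm> \<Longrightarrow> \<exists>\<beta>\<in>R. \<beta> \<in> W \<and> pid \<beta> = ipow A l"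
    and cong: "\<And>a b u. a \<in> R \<Longrightarrow> b \<in> R \<Longrightarrow> a \<noteq> 0 \<Longrightarrow> b \<noteq> 0 \<Longrightarrow> coprime_ideals K (pid a) \<mm> \<Longrightarrow>
      coprime_ideals K (pid b) \<mm> \<Longrightarrow> a - b \<in> \<mm> \<Longrightarrow> u \<in> R \<Longrightarrow> nm u = 1 \<Longrightarrow> a ^ l * u \<in> W \<Longrightarrow> b ^ l * u \<in> W"
    and prim: "\<And>\<nn>. idl \<nn> \<Longrightarrow> \<mm> \<subset> \<nn> \<Longrightarrow> \<exists>a\<in>R. a \<noteq> 0 \<and>
      coprime_ideals K (pid a) \<mm> \<and> a - 1 \<in> \<nn> \<and> a ^ l \<notin> W"
  shows "\<exists>\<psi>. primitive_hecke_character K l \<psi> \<and> rational_coeffs K \<psi>"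
proof -
  define g where "g A = (SOME \<beta>. \<beta> \<in> R \<and> \<beta> \<in> W \<and> pid \<beta> = ipow A l)" for A
  have g: "g A \<in> R \<and> g A \<in> W \<and> pid (g A) = ipow A l"
    if "idl A" "coprime_ideals K A \<mm>" for A
  proof -
    have "\<exists>\<beta>. \<beta> \<in> R \<and> \<beta> \<in> W \<and> pid \<beta> = ipow A l" using exist[OF that] by blast
    then show ?thesis unfolding g_def by (rule someI_ex)
  qed
  have g_eq: "g A = \<beta>" if A: "idl A" "coprime_ideals K A \<mm>"
    and b: "\<beta> \<in> R" "\<beta> \<in> W" "pid \<beta> = ipow A l" for A \<beta>
  proof -
    have b0: "\<beta> \<noteq> 0" using b(2) W0 by auto
    have "pid (g A) = pid \<beta>" using g[OF A] b(3) by simp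
    then obtain u where u: "u \<in> R" "nm u = 1" "g A = \<beta> * u" by (rule pid_eqD[OF _ b0 b(1)])
    have "u = 1" using uniq[OF b(2) u(1,2)] g[OF A] unfolding u(3) by blast
    then show ?thesis using u(3) by simp
  qed
  have g0: "g A \<noteq> 0" if "idl A" "coprime_ideals K A \<mm>" for A using g[OF that] W0 by metis
  obtain \<psi> where \<psi>: "hecke_character K l \<mm> \<psi>" "\<And>A. idl A \<Longrightarrow> coprime_ideals K A \<mm> \<Longrightarrow> \<psi> A = g A"
  proof (rule hecke_character_extend[OF m g0, where l = l])
    show "g (A \<odot> B) = g A * g B"
      if AB: "idl A" "idl B" "coprime_ideals K A \<mm>" "coprime_ideals K B \<mm>" for A B
    proof (rule g_eq)
      show "pid (g A * g B) = ipow (A \<odot> B) l"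
        unfolding pid_mult[symmetric] ipow_imul[OF AB(1,2)] using g[OF AB(1,3)] g[OF AB(2,4)] by simp
    qed (use AB g W_mult in \<open>auto intro: idl_imul coprime_imul[OF _ _ _ _ m]\<close>)
    show "g (pid a) * b ^ l = g (pid b) * a ^ l"
      if ab: "a \<in> R" "b \<in> R" "a \<noteq> 0" "b \<noteq> 0" "coprime_ideals K (pid a) \<mm>"
        "coprime_ideals K (pid b) \<mm>" "a - b \<in> \<mm>" for a b
    proof -
      note ga = g[OF idl_pid[OF ab(1,3)] ab(5)]
      have "pid (g (pid a)) = pid (a ^ l)" using ga unfolding ipow_pid by blast
      moreover have "a ^ l \<noteq> 0" "a ^ l \<in> R" using ab by auto
      ultimately obtain u where u: "u \<in> R" "nm u = 1" "g (pid a) = a ^ l * u" by (rule pid_eqD)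
      have "a ^ l * u \<in> W" using ga unfolding u(3) by blast
      then have bW: "b ^ l * u \<in> W" by (rule cong[OF ab u(1,2)])
      have "g (pid b) = b ^ l * u"
      proof (rule g_eq[OF idl_pid[OF ab(2,4)] ab(6) _ bW])
        show "b ^ l * u \<in> R" using ab(2) u(1) by auto
        have "pid (b ^ l * u) = pid (b ^ l) \<odot> R"
          unfolding pid_mult[symmetric] pid_unit[OF u(1,2)] ..
        also have "\<dots> = pid (b ^ l)" using ab(2,4) by (intro imul_R' idl_pid) auto
        finally show "pid (b ^ l * u) = ipow (pid b) l" unfolding ipow_pid .
      qed
      then show ?thesis unfolding u(3) by simp
    qed
  qed auto
  have psi0: "\<psi> A = 0" if "idl A" "\<not> coprime_ideals K A \<mm>" for A
    using hecke_coprime_nonzero[OF \<psi>(1) that(1)] that(2) by blast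
  have cc: "coprime_ideals K (cnj ` A) \<mm>" if "idl A" "coprime_ideals K A \<mm>" for A
    using coprime_cnj[OF that(2,1) m] unfolding mc .
  have psi_cnj: "\<psi> (cnj ` A) = cnj (\<psi> A)" if A: "idl A" for A
  proof (cases "coprime_ideals K A \<mm>")
    case True
    have "g (cnj ` A) = cnj (g A)"
    proof (rule g_eq[OF idl_cnj[OF A] cc[OF A True]])
      show "pid (cnj (g A)) = ipow (cnj ` A) l"
        unfolding pid_cnj[symmetric] ipow_cnj[symmetric] using g[OF A True] by simp
    qed (use g[OF A True] W_cnj in auto)
    then show ?thesis using \<psi>(2)[OF A True] \<psi>(2)[OF idl_cnj[OF A] cc[OF A True]] by simp
  next
    case False
    have "\<not> coprime_ideals K (cnj ` A) \<mm>" using cc[OF idl_cnj[OF A]] False by auto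
    then show ?thesis using psi0[OF A False] psi0[OF idl_cnj[OF A]] by simp
  qed
  have psiK: "\<psi> A \<in> K" if "idl A" for A
    using psi0[OF that] \<psi>(2)[OF that] g[OF that] R_K K_0 by metis
  have "rational_coeffs K \<psi>"
    unfolding rational_coeffs_def hecke_series_nth
  proof
    fix n
    let ?S = "{\<aa>. idl \<aa> \<and> N \<aa> = n}"
    \<comment> \<open>The coefficient lies in the field, and it is real because conjugation permutes
      the ideals of norm n; hence it is rational.\<close>
    have sumK: "sum \<psi> S \<in> K" if "S \<subseteq> ?S" for S
      using that by (induct S rule: infinite_finite_induct) (auto intro: psiK)
    have "cnj (sum \<psi> ?S) = (\<Sum>\<aa>\<in>?S. \<psi> (cnj ` \<aa>))" by (simp add: psi_cnj)
    also have "\<dots> = sum \<psi> ?S"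
      by (rule sum.reindex_bij_witness[of _ "(`) cnj" "(`) cnj"]) (auto simp: idl_cnj N_cnj)
    finally have "sum \<psi> ?S \<in> \<real>" by (simp add: Reals_cnj_iff)
    then show "sum \<psi> ?S \<in> \<rat>" using sumK[of ?S] by (intro K_real) auto
  qed
  moreover have "is_conductor K l \<mm> \<psi>"
    unfolding is_conductor_def
  proof (intro conjI \<psi>(1) notI)
    \<comment> \<open>An extension to \<nn> would take the value a^l at (a), whereas the value of
      \<psi> there belongs to W and a^l does not.\<close>
    assume "\<exists>\<nn> \<psi>'. \<mm> \<subset> \<nn> \<and> hecke_character K l \<nn> \<psi>' \<and> extends_character \<psi>' \<psi>"
    then obtain \<nn> \<psi>' where n: "\<mm> \<subset> \<nn>" "hecke_character K l \<nn> \<psi>'" "extends_character \<psi>' \<psi>" by blast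
    have idn: "idl \<nn>" using n(2) unfolding hecke_character_iff by blast
    obtain a where a: "a \<in> R" "a \<noteq> 0" "coprime_ideals K (pid a) \<mm>" "a - 1 \<in> \<nn>" "a ^ l \<notin> W"
      using prim[OF idn n(1)] by blast
    have ia: "idl (pid a)" by (rule idl_pid[OF a(1,2)])
    have an: "coprime_ideals K (pid a) \<nn>" using coprime_mono[OF a(3) ia m idn] n(1) by blast
    have "\<psi>' (pid a) * 1 ^ l = \<psi>' (pid 1) * a ^ l"
      using a an coprime_R[OF idn] by (intro hecke_cong[OF n(2)]) auto
    then have "\<psi>' (pid a) = a ^ l" using hecke_R[OF n(2)] by simp
    moreover have "\<psi> (pid a) = g (pid a)" by (rule \<psi>(2)[OF ia a(3)])
    moreover have "\<psi>' (pid a) = \<psi> (pid a)"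
      using n(3) g0[OF ia a(3)] \<psi>(2)[OF ia a(3)] unfolding extends_character_def by metis
    ultimately show False using g[OF ia a(3)] a(5) by metis
  qed
  ultimately show ?thesis unfolding primitive_hecke_character_def by blast
qed

lemma unit_pm_one: assumes "u \<in> R" "nm u = 1" "D \<noteq> 1" "D \<noteq> 3" shows "u = 1 \<or> u = -1"
  using unit_order[OF assms(1,2)] assms(3,4) by (auto simp: power2_eq_1_iff)

lemma even_exponent_character:
  assumes D: "D \<noteq> 1" "D \<noteq> 3" and l: "even l"
    and e: "\<forall>A. idl A \<longrightarrow> (\<exists>\<beta>\<in>R. \<beta> \<noteq> 0 \<and> ipow A l = pid \<beta>)"
  shows "\<exists>\<psi>. primitive_hecke_character K l \<psi> \<and> rational_coeffs K \<psi>"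
proof -
  obtain k where k: "l = k * 2" using l by (metis dvd_mult_div_cancel mult.commute)
  obtain p where p: "prime p" "p dvd D" using D(1) prime_factor_nat by blast
  have mD: "multiplicity p D = 1"
  proof -
    have pu: "\<not> is_unit p" using p(1) not_prime_unit by blast
    have D0: "D \<noteq> 0" using D_pos by simp
    have "1 \<le> multiplicity p D" using p(2) power_dvd_iff_le_multiplicity[OF D0 pu, of 1] by simp
    moreover have "\<not> p ^ 2 dvd D" using D_sqf pu squarefreeD by blast
    then have "\<not> 2 \<le> multiplicity p D" using power_dvd_iff_le_multiplicity[OF D0 pu] by blast
    ultimately show ?thesis by linarith
  qed
  have mm: "multiplicity p (a * b) = multiplicity p a + multiplicity p b" if "a > 0" "b > 0" for a b
    using p(1) that by (intro prime_elem_multiplicity_mult_distrib) auto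
  define W where "W = {\<delta> ^ 2 * of_nat n | \<delta> n. \<delta> \<in> K \<and> \<delta> \<noteq> 0 \<and> n > 0 \<and> even (multiplicity p n)}"
  have sqW: "\<delta> ^ 2 \<in> W" if "\<delta> \<in> K" "\<delta> \<noteq> 0" for \<delta>
  proof -
    have "\<delta> ^ 2 * of_nat 1 \<in> W" unfolding W_def using that by fastforce
    then show ?thesis by simp
  qed
  \<comment> \<open>Dividing the two representations gives z in the field with z^2 = - n n'. Then z
    is a rational multiple of s, so n n' is D times a rational square, against the parities at
    p.\<close>
  have noneg: False if in1: "\<beta> \<in> W" and in2: "- \<beta> \<in> W" for \<beta>
  proof -
    obtain d n where dn: "\<beta> = d ^ 2 * of_nat n" "d \<in> K" "d \<noteq> 0" "n > 0" "even (multiplicity p n)"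
      using in1 unfolding W_def by blast
    obtain d' n' where dn': "- \<beta> = d' ^ 2 * of_nat n'" "d' \<in> K" "d' \<noteq> 0" "n' > 0" "even (multiplicity p n')"
      using in2 unfolding W_def by blast
    define z where "z = d * of_nat n / d'"
    have zK: "z \<in> K" unfolding z_def using dn dn' by (intro K_divide K_mult) auto
    have "d ^ 2 * of_nat n = - (d' ^ 2 * of_nat n')" using dn(1) dn'(1) by (metis minus_minus)
    then have "d ^ 2 * of_nat n * of_nat n = - (d' ^ 2 * of_nat n') * of_nat n" by simp
    then have zz: "z ^ 2 = - of_nat (n * n')" unfolding z_def using dn'(3) by (simp add: power_divide power2_eq_square field_simps)
    obtain x y where xy: "x \<in> \<rat>" "y \<in> \<rat>" and z: "z = x + y * s" using zK unfolding K_iff by blast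
    have zz': "z ^ 2 = (x ^ 2 - of_nat D * y ^ 2) + (2 * x * y) * s"
    proof -
      have "z ^ 2 = x ^ 2 + 2 * x * y * s + y ^ 2 * (s * s)" unfolding z by (simp add: power2_eq_square algebra_simps)
      then show ?thesis unfolding s_sq by (simp add: algebra_simps)
    qed
    have "2 * x * y * s = - of_nat (n * n') - (x ^ 2 - of_nat D * y ^ 2)"
      using trans[OF zz'[symmetric] zz] by (metis add_diff_cancel_left')
    moreover have "2 * x * y \<in> \<rat>" "- of_nat (n * n') - (x ^ 2 - of_nat D * y ^ 2) \<in> \<rat>"
      using xy by (auto intro!: Rats_mult Rats_diff Rats_power simp: Rats_minus_iff)
    ultimately have x_y: "2 * x * y = 0" "- of_nat (n * n') - (x ^ 2 - of_nat D * y ^ 2) = 0"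
      using nonreal_rational_independent[OF s_nonreal] by blast+
    have nn: "Re (of_nat (n * n')) > 0" using dn(4) dn'(4) by simp
    obtain xr yr :: rat where r: "x = of_rat xr" "y = of_rat yr" using xy by (auto elim!: Rats_cases)
    have "x = 0"
    proof (rule ccontr)
      assume "x \<noteq> 0"
      then have "y = 0" using x_y(1) by simp
      then have "of_nat (n * n') + x ^ 2 = 0" using x_y(2) by (simp add: algebra_simps add_eq_0_iff)
      then have "Re (of_nat (n * n') + x ^ 2) = 0" by simp
      moreover have "x ^ 2 = of_real (Re x ^ 2)" using Rats_imp_Reals[OF xy(1)] by (metis of_real_Re of_real_power)
      ultimately show False using nn by (simp add: add_pos_nonneg order_less_imp_not_eq2 pos_add_strict)
    qed
    then have e1: "of_nat (n * n') = of_nat D * y ^ 2" using x_y(2) by simp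
    obtain a b where ab: "b > 0" "y = of_int a / of_int b" using xy(2) by (rule Rats_cases')
    have "of_nat (n * n') * of_int b ^ 2 = of_nat D * (of_int a :: complex) ^ 2" unfolding e1 ab(2) using ab(1) by (simp add: power_divide)
    then have "of_int (int (n * n') * b ^ 2) = (of_int (int D * a ^ 2) :: complex)" by simp
    then have e2: "int (n * n') * b ^ 2 = int D * a ^ 2" unfolding of_int_eq_iff .
    then have "int (n * n' * nat \<bar>b\<bar> ^ 2) = int (D * nat \<bar>a\<bar> ^ 2)" by simp
    then have e3: "n * n' * nat \<bar>b\<bar> ^ 2 = D * nat \<bar>a\<bar> ^ 2" by (simp only: of_nat_eq_iff)
    have b0: "nat \<bar>b\<bar> > 0" using ab(1) by simp
    have a0: "nat \<bar>a\<bar> > 0"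
    proof (rule Nat.gr0I)
      assume "nat \<bar>a\<bar> = 0"
      then have "n * n' * nat \<bar>b\<bar> ^ 2 = 0" unfolding e3 by simp
      then show False using b0 dn(4) dn'(4) by simp
    qed
    have "multiplicity p (n * n' * nat \<bar>b\<bar> ^ 2) = multiplicity p n + multiplicity p n' + (multiplicity p (nat \<bar>b\<bar>) + multiplicity p (nat \<bar>b\<bar>))"
      using b0 dn(4) dn'(4) by (simp add: mm power2_eq_square)
    moreover have "multiplicity p (D * nat \<bar>a\<bar> ^ 2) = 1 + (multiplicity p (nat \<bar>a\<bar>) + multiplicity p (nat \<bar>a\<bar>))"
      using a0 D_pos by (simp add: mm power2_eq_square mD)
    ultimately show False using dn(5) dn'(5) unfolding e3 by presburger
  qed
  show ?thesis
  proof (rule character_from_generators[OF idl_unit R_cnj_image, of W])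
    show "0 \<notin> W" by (auto simp: W_def)
    show "a * b \<in> W" if in1: "a \<in> W" and in2: "b \<in> W" for a b
    proof -
      obtain d n where dn: "a = d ^ 2 * of_nat n" "d \<in> K" "d \<noteq> 0" "n > 0" "even (multiplicity p n)"
        using in1 unfolding W_def by blast
      obtain d' n' where dn': "b = d' ^ 2 * of_nat n'" "d' \<in> K" "d' \<noteq> 0" "n' > 0" "even (multiplicity p n')"
        using in2 unfolding W_def by blast
      have "a * b = (d * d') ^ 2 * of_nat (n * n')" unfolding dn(1) dn'(1) by (simp add: power_mult_distrib mult_ac)
      moreover have "even (multiplicity p (n * n'))" using mm[OF dn(4) dn'(4)] dn(5) dn'(5) by simp
      moreover have "d * d' \<in> K" "d * d' \<noteq> 0" "n * n' > 0" using dn dn' by auto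
      ultimately show ?thesis unfolding W_def by blast
    qed
    show "cnj a \<in> W" if in1: "a \<in> W" for a
    proof -
      obtain d n where dn: "a = d ^ 2 * of_nat n" "d \<in> K" "d \<noteq> 0" "n > 0" "even (multiplicity p n)"
        using in1 unfolding W_def by blast
      have "cnj a = cnj d ^ 2 * of_nat n" unfolding dn(1) by simp
      moreover have "cnj d \<in> K" "cnj d \<noteq> 0" using dn by auto
      ultimately show ?thesis unfolding W_def using dn(4,5) by blast
    qed
    show "u = 1" if "\<beta> \<in> W" "u \<in> R" "nm u = 1" "\<beta> * u \<in> W" for \<beta> u
      using unit_pm_one[OF that(2,3) D] noneg[OF that(1)] that(4) by auto
    show "b ^ l * u \<in> W" if "a \<noteq> 0" "b \<noteq> 0" "a \<in> R" "b \<in> R" "u \<in> R" "nm u = 1" "a ^ l * u \<in> W" for a b u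
    proof -
      have *: "c ^ l \<in> W" if "c \<in> R" "c \<noteq> 0" for c unfolding k power_mult using that R_K by (intro sqW) auto
      have "u \<noteq> -1" using *[OF that(3,1)] noneg that(7) by auto
      then have "u = 1" using unit_pm_one[OF that(5,6) D] by blast
      then show ?thesis using *[OF that(4,2)] by simp
    qed
    \<comment> \<open>The conductor is the unit ideal, and no ideal is strictly larger.\<close>
    show "\<exists>a\<in>R. a \<noteq> 0 \<and> coprime_ideals K (pid a) R \<and> a - 1 \<in> \<nn> \<and> a ^ l \<notin> W"
      if "idl \<nn>" "R \<subset> \<nn>" for \<nn> using that idl_sub by blast
    show "\<exists>\<beta>\<in>R. \<beta> \<in> W \<and> pid \<beta> = ipow A l" if A: "idl A" for A
    proof -
      obtain b where b: "b \<in> R" "b \<noteq> 0" "ipow A l = pid b" using e A by blast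
      define m where "m = N A ^ k"
      have m0: "m > 0" using N_pos[OF A] by (simp add: m_def)
      have "nm b = N (pid b)" using N_pid[OF b(1,2)] by simp
      also have "\<dots> = m ^ 2" unfolding b(3)[symmetric] N_ipow[OF A] k power_mult m_def ..
      finally have bb: "b * cnj b = of_nat m ^ 2" using nm[OF b(1)] by simp
      \<comment> \<open>From b times its conjugate = m^2 follows (b + m)^2 = b T, where T is the
        trace of b plus 2 m and m T is the norm of b + m. For b = - m both vanish, and s / D is used
        instead.\<close>
      have "\<exists>d n. b = d ^ 2 * of_nat n \<and> d \<in> K \<and> d \<noteq> 0 \<and> n > 0"
      proof (cases "b = - of_nat m")
        case True
        have "b = (s / of_nat D) ^ 2 * of_nat (D * m)" unfolding True using D_pos
          by (simp add: power_divide power2_eq_square s_sq)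
        moreover have "s / of_nat D \<in> K" "s / of_nat D \<noteq> 0" "D * m > 0" using D_pos m0 by auto
        ultimately show ?thesis by blast
      next
        case False
        then have c0: "b + of_nat m \<noteq> 0" by (simp add: eq_neg_iff_add_eq_0)
        have cR: "b + of_nat m \<in> R" using b(1) by auto
        have "nm (b + of_nat m) > 0" using nm_eq_0[OF cR] c0 by (intro Nat.gr0I) auto
        moreover have "of_int (int (nm (b + of_nat m))) = (of_int (int m * (tr b + 2 * int m)) :: complex)"
        proof -
          have "of_int (int (nm (b + of_nat m))) = (b + of_nat m) * cnj (b + of_nat m)" using nm[OF cR] by simp
          also have "\<dots> = b * cnj b + of_nat m * (b + cnj b) + of_nat m ^ 2" by (simp add: algebra_simps power2_eq_square)
          also have "\<dots> = of_int (int m * (tr b + 2 * int m))" unfolding bb tr[OF b(1), symmetric]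
            by (simp add: algebra_simps power2_eq_square)
          finally show ?thesis .
        qed
        then have "int (nm (b + of_nat m)) = int m * (tr b + 2 * int m)" unfolding of_int_eq_iff .
        ultimately have "int m * (tr b + 2 * int m) > 0" by linarith
        then have T0: "tr b + 2 * int m > 0" using m0 by (simp add: zero_less_mult_iff)
        define T where "T = nat (tr b + 2 * int m)"
        have T: "T > 0" "int T = tr b + 2 * int m" using T0 by (simp_all add: T_def)
        have TC: "(of_nat T :: complex) = b + cnj b + 2 * of_nat m"
          unfolding tr[OF b(1), symmetric] by (metis T(2) of_int_add of_int_mult of_int_numeral of_int_of_nat_eq)
        have "(b + of_nat m) ^ 2 = b ^ 2 + 2 * of_nat m * b + b * cnj b" unfolding bb by (simp add: power2_eq_square algebra_simps)
        also have "\<dots> = b * of_nat T" unfolding TC by (simp add: power2_eq_square algebra_simps)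
        finally have "b = ((b + of_nat m) / of_nat T) ^ 2 * of_nat T" using T(1) by (simp add: power_divide power2_eq_square)
        moreover have "(b + of_nat m) / of_nat T \<in> K" using cR R_K by auto
        moreover have "(b + of_nat m) / of_nat T \<noteq> 0" using c0 T(1) by auto
        ultimately show ?thesis using T(1) by blast
      qed
      then obtain d n where dn: "b = d ^ 2 * of_nat n" "d \<in> K" "d \<noteq> 0" "n > 0" by blast
      show ?thesis
      proof (cases "even (multiplicity p n)")
        case True
        then have "b \<in> W" unfolding W_def using dn by blast
        then show ?thesis using b by metis
      next
        case False
        \<comment> \<open>Passing to - b multiplies n by D and thus makes the exponent of p
          even.\<close>
        have "- b = (d * s / of_nat D) ^ 2 * of_nat (n * D)"
        proof -
          have "(d * s / of_nat D) ^ 2 * of_nat (n * D) = d ^ 2 * (s * s) * of_nat n / of_nat D"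
            using D_pos by (simp add: power_divide power_mult_distrib power2_eq_square)
          also have "\<dots> = - b" unfolding s_sq dn(1) using D_pos by simp
          finally show ?thesis by simp
        qed
        moreover have "even (multiplicity p (n * D))" using mm[OF dn(4) D_pos] mD False by simp
        moreover have "d * s / of_nat D \<in> K" by (intro K_divide K_mult dn K_s K_of_nat)
        moreover have "d * s / of_nat D \<noteq> 0" "n * D > 0" using dn D_pos by auto
        ultimately have "- b \<in> W" unfolding W_def by blast
        moreover have "pid (- b) = pid b"
        proof -
          have "pid (of_int (-1)) = R" by (rule pid_unit) (simp_all add: nm_of_int del: of_int_minus)
          then have "pid b = pid (of_int (-1)) \<odot> pid b"
            using idl_pid[OF b(1,2)] by simp
          then show ?thesis unfolding pid_mult by simp
        qed
        moreover have "- b \<in> R" using b(1) by auto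
        ultimately show ?thesis using b(3) by metis
      qed
    qed
  qed
qed

lemma pid_uminus: assumes "a \<in> R" "a \<noteq> 0" shows "pid (- a) = pid a"
proof -
  have "pid (of_int (-1)) = R" by (rule pid_unit) (simp_all add: nm_of_int del: of_int_minus)
  then have "pid a = pid (of_int (-1)) \<odot> pid a"
    using idl_pid[OF assms] by simp
  then show ?thesis unfolding pid_mult by simp
qed

section \<open>Odd exponents\<close>

text \<open>An odd sign character \<theta> of the residues modulo \<mm> picks one of the generators
  \<beta>, - \<beta>. As l is odd, \<theta>(a^l) = \<theta>(a), so the choice respects congruences,
  and \<mm> is the conductor as soon as \<theta> does not factor through a larger ideal.\<close>

lemma odd_exponent_character:
  fixes \<theta> :: "complex \<Rightarrow> int"
  assumes D: "D \<noteq> 1" "D \<noteq> 3" and l: "odd l"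
    and e: "\<forall>A. idl A \<longrightarrow> (\<exists>\<beta>\<in>R. \<beta> \<noteq> 0 \<and> ipow A l = pid \<beta>)"
    and m: "idl \<mm>" "cnj ` \<mm> = \<mm>"
    and val: "\<And>a. a \<in> R \<Longrightarrow> a \<noteq> 0 \<Longrightarrow> coprime_ideals K (pid a) \<mm> \<Longrightarrow> \<theta> a = 1 \<or> \<theta> a = -1"
    and mult: "\<And>a b. a \<in> R \<Longrightarrow> a \<noteq> 0 \<Longrightarrow> coprime_ideals K (pid a) \<mm> \<Longrightarrow>
      b \<in> R \<Longrightarrow> b \<noteq> 0 \<Longrightarrow> coprime_ideals K (pid b) \<mm> \<Longrightarrow> \<theta> (a * b) = \<theta> a * \<theta> b"
    and conj: "\<And>a. a \<in> R \<Longrightarrow> \<theta> (cnj a) = \<theta> a"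
    and cong: "\<And>a b. a \<in> R \<Longrightarrow> b \<in> R \<Longrightarrow> a - b \<in> \<mm> \<Longrightarrow> \<theta> a = \<theta> b"
    and neg: "\<theta> (-1) = -1"
    and prim: "\<And>\<nn>. idl \<nn> \<Longrightarrow> \<mm> \<subset> \<nn> \<Longrightarrow> \<exists>a\<in>R. a \<noteq> 0 \<and>
      coprime_ideals K (pid a) \<mm> \<and> a - 1 \<in> \<nn> \<and> \<theta> a = -1"
  shows "\<exists>\<psi>. primitive_hecke_character K l \<psi> \<and> rational_coeffs K \<psi>"
proof -
  define C where "C a \<longleftrightarrow> a \<in> R \<and> a \<noteq> 0 \<and> coprime_ideals K (pid a) \<mm>" for a
  have C_mult: "C (a * b)" if "C a" "C b" for a b
    using that coprime_imul[of "pid a" \<mm> "pid b"] m(1) unfolding C_def pid_mult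
    by (auto intro: idl_pid)
  have C1: "C 1" using coprime_R[OF m(1)] by (simp add: C_def)
  have Cm1: "C (-1)" using C1 pid_uminus[of 1] R_uminus[OF R_1] by (simp add: C_def)
  have C_pow: "C (a ^ n)" if "C a" for a n by (induct n) (auto intro: C1 C_mult that)
  have val': "\<theta> a = 1 \<or> \<theta> a = -1" if "C a" for a using val that by (auto simp: C_def)
  have mult': "\<theta> (a * b) = \<theta> a * \<theta> b" if "C a" "C b" for a b using mult that by (auto simp: C_def)
  have "\<theta> 1 = \<theta> 1 * \<theta> 1" using mult'[OF C1 C1] by simp
  then have th1: "\<theta> 1 = 1" using val'[OF C1] by auto
  have pow: "\<theta> (a ^ n) = \<theta> a ^ n" if "C a" for a n by (induct n) (simp_all add: th1 mult' that C_pow)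
  have Cneg: "C (- a)" "\<theta> (- a) = - \<theta> a" if "C a" for a
    using C_mult[OF Cm1 that] mult'[OF Cm1 that] neg by simp_all
  define W where "W = {a. C a \<and> \<theta> a = 1}"
  show ?thesis
  proof (rule character_from_generators[OF m, of W])
    show "0 \<notin> W" by (simp add: W_def C_def)
    show "a * b \<in> W" if "a \<in> W" "b \<in> W" for a b using that C_mult mult' by (simp add: W_def)
    show "cnj a \<in> W" if "a \<in> W" for a
    proof -
      have a: "C a" "\<theta> a = 1" using that by (auto simp: W_def)
      then have "coprime_ideals K (cnj ` pid a) (cnj ` \<mm>)"
        by (intro coprime_cnj m(1)) (auto simp: C_def intro: idl_pid)
      then have "C (cnj a)" using a unfolding m(2) pid_cnj C_def by auto
      then show ?thesis using a conj by (simp add: W_def C_def)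
    qed
    show "u = 1" if "\<beta> \<in> W" "u \<in> R" "nm u = 1" "\<beta> * u \<in> W" for \<beta> u
      using unit_pm_one[OF that(2,3) D] Cneg(2)[of \<beta>] that(1,4) by (auto simp: W_def)
    show "b ^ l * u \<in> W" if ab: "a \<in> R" "b \<in> R" "a \<noteq> 0" "b \<noteq> 0" "coprime_ideals K (pid a) \<mm>"
      "coprime_ideals K (pid b) \<mm>" "a - b \<in> \<mm>" "u \<in> R" "nm u = 1" "a ^ l * u \<in> W" for a b u
    proof -
      have Ca: "C a" and Cb: "C b" using ab by (auto simp: C_def)
      have Cu: "C u" using unit_pm_one[OF ab(8,9) D] C1 Cm1 by auto
      have "\<theta> (b ^ l * u) = \<theta> (a ^ l * u)"
        using mult'[OF C_pow[OF Ca] Cu] mult'[OF C_pow[OF Cb] Cu] pow[OF Ca] pow[OF Cb] cong[OF ab(1,2,7)] by simp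
      then show ?thesis using ab(10) C_mult[OF C_pow[OF Cb] Cu] by (simp add: W_def)
    qed
    show "\<exists>a\<in>R. a \<noteq> 0 \<and> coprime_ideals K (pid a) \<mm> \<and> a - 1 \<in> \<nn> \<and> a ^ l \<notin> W"
      if n: "idl \<nn>" "\<mm> \<subset> \<nn>" for \<nn>
    proof -
      obtain a where a: "a \<in> R" "a \<noteq> 0" "coprime_ideals K (pid a) \<mm>" "a - 1 \<in> \<nn>" "\<theta> a = -1"
        using prim[OF n] by blast
      then have "\<theta> (a ^ l) = -1" using pow[of a l] l by (simp add: C_def)
      then have "a ^ l \<notin> W" by (simp add: W_def)
      then show ?thesis using a by blast
    qed
    show "\<exists>\<beta>\<in>R. \<beta> \<in> W \<and> pid \<beta> = ipow A l"
      if A: "idl A" "coprime_ideals K A \<mm>" for A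
    proof -
      obtain b where b: "b \<in> R" "b \<noteq> 0" "ipow A l = pid b" using e A by blast
      have Cb: "C b" unfolding C_def b(3)[symmetric] using b(1,2) coprime_ipow[OF A(2,1) m(1)] by blast
      show ?thesis
      proof (cases "\<theta> b = 1")
        case True
        then show ?thesis using Cb b by (auto simp: W_def)
      next
        case False
        then have "- b \<in> W" using val'[OF Cb] Cneg[OF Cb] by (auto simp: W_def)
        then show ?thesis using pid_uminus[OF b(1,2)] b(1,3) by (metis R_uminus)
      qed
    qed
  qed
qed

text \<open>Twice the trace of a product is the product of the traces plus that of the differences a
  - cnj a and b - cnj b, which are integer multiples of s. So half the trace is multiplicative
  modulo odd divisors of D.\<close>

lemma trace_mult:
  assumes "a \<in> R" "b \<in> R"
  obtains k where "2 * tr (a * b) = tr a * tr b + int D * k"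
proof -
  have diff: "\<exists>j::int. x - cnj x = of_int j * s" if x: "x \<in> R" for x
  proof -
    obtain i j where "x = of_int i + of_int j * w" using x R_basis by blast
    then have "x - cnj x = of_int j * (w - cnj w)" by (simp add: algebra_simps)
    moreover have "w - cnj w = s \<or> w - cnj w = of_int 2 * s" by (simp add: w_def diff_divide_distrib[symmetric])
    ultimately have "x - cnj x = of_int j * s \<or> x - cnj x = of_int (j * 2) * s" by auto
    then show ?thesis by blast
  qed
  obtain i j :: int where ij: "a - cnj a = of_int i * s" "b - cnj b = of_int j * s" using diff assms by blast
  have "of_int (2 * tr (a * b)) = 2 * (a * b + cnj (a * b))" using tr[OF R_mult[OF assms]] by simp
  also have "\<dots> = (a + cnj a) * (b + cnj b) + (a - cnj a) * (b - cnj b)" by (simp add: algebra_simps)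
  also have "\<dots> = (a + cnj a) * (b + cnj b) + of_int i * of_int j * (s * s)" unfolding ij by (simp add: algebra_simps)
  also have "\<dots> = of_int (tr a * tr b + int D * (- i * j))" unfolding s_sq tr[OF assms(1), symmetric] tr[OF assms(2), symmetric] by simp
  finally have "2 * tr (a * b) = tr a * tr b + int D * (- i * j)" unfolding of_int_eq_iff .
  then show ?thesis by (rule that)
qed

lemma tr_add: "a \<in> R \<Longrightarrow> b \<in> R \<Longrightarrow> tr (a + b) = tr a + tr b"
  by (rule tr_eqI) (auto simp: tr)

lemma tr_diff: "a \<in> R \<Longrightarrow> b \<in> R \<Longrightarrow> tr (a - b) = tr a - tr b"
  by (rule tr_eqI) (auto simp: tr)

lemma tr_cnj: "a \<in> R \<Longrightarrow> tr (cnj a) = tr a"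
  by (rule tr_eqI) (auto simp: tr add.commute)

lemma tr_of_int: "tr (of_int n) = 2 * n"
  by (rule tr_eqI) auto

text \<open>P is the prime above the ramified p, and half the trace of a represents its class in the
  residue field with p elements. The quadratic residue symbol of that class is a sign character,
  invariant under conjugation, and odd because p is 3 modulo 4.\<close>

lemma ramified_prime_character:
  assumes D: "D \<noteq> 1" "D \<noteq> 3" and l: "odd l"
    and e: "\<forall>A. idl A \<longrightarrow> (\<exists>\<beta>\<in>R. \<beta> \<noteq> 0 \<and> ipow A l = pid \<beta>)"
    and p: "prime p" "p dvd D" "p mod 4 = 3"
  shows "\<exists>\<psi>. primitive_hecke_character K l \<psi> \<and> rational_coeffs K \<psi>"
proof -
  define P where "P = {a \<in> R. int p dvd tr a}"
  have pp: "prime (int p)" using p(1) by simp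
  have p2: "p > 2" using p(3) p(1) prime_ge_2_nat[of p] by (cases "p = 2") auto
  have np2: "\<not> int p dvd 2" using p2 zdvd_imp_le[of "int p" 2] by auto
  have pD: "int p dvd int D" using p(2) by simp
  have half: "int p dvd x" if "int p dvd 2 * x" for x using that np2 pp prime_dvd_mult_iff by blast
  have pm: "[2 * tr (a * b) = tr a * tr b] (mod int p)" if ab: "a \<in> R" "b \<in> R" for a b
  proof -
    obtain k where k: "2 * tr (a * b) = tr a * tr b + int D * k" by (rule trace_mult[OF ab])
    have "2 * tr (a * b) - tr a * tr b = int D * k" using k by simp
    then show ?thesis unfolding cong_iff_dvd_diff using pD by simp
  qed
  have P: "idl P"
  proof (rule idlI)
    show "of_int (int p) \<in> P" unfolding P_def mem_Collect_eq tr_of_int by simp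
    show "of_int (int p) \<noteq> (0 :: complex)" using p2 by simp
    show "x + y \<in> P" if "x \<in> P" "y \<in> P" for x y using that by (auto simp: P_def tr_add)
    show "r * x \<in> P" if "r \<in> R" "x \<in> P" for r x
    proof -
      have x: "x \<in> R" "int p dvd tr x" using that(2) by (auto simp: P_def)
      have "int p dvd tr r * tr x" using x(2) by simp
      then have "int p dvd 2 * tr (r * x)" using pm[OF that(1) x(1)] cong_dvd_iff by (metis cong_sym cong_dvd_modulus_nat cong_dvd_iff)
      then have "int p dvd tr (r * x)" by (rule half)
      then show ?thesis using R_mult[OF that(1) x(1)] by (simp add: P_def)
    qed
  qed (auto simp: P_def)
  have Pc: "cnj ` P = P"
  proof -
    have "cnj x \<in> P" if "x \<in> P" for x using that by (auto simp: P_def tr_cnj)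
    then show ?thesis by (metis cnj_cnj_image image_subset_iff subset_antisym image_mono)
  qed
  have one: "1 \<notin> P" using np2 tr_of_int[of 1] by (simp add: P_def)
  have nd: "\<not> int p dvd tr a" if ca: "a \<in> R" "a \<noteq> 0" "coprime_ideals K (pid a) P" for a
  proof
    assume "int p dvd tr a"
    then have aP: "a \<in> P" using ca(1) by (simp add: P_def)
    obtain x y where xy: "x \<in> pid a" "y \<in> P" "x + y = 1"
      by (rule coprime_idealsE[OF ca(3) idl_pid[OF ca(1,2)] P])
    then have "x \<in> P" using pid_subset[OF P aP] by blast
    then have "1 \<in> P" using idl_add[OF P _ xy(2)] xy(3) by metis
    then show False using one by blast
  qed
  \<comment> \<open>2 tr a is 4 times half the trace, so the symbol is unchanged and division by 2
    is avoided.\<close>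
  define \<theta> where "\<theta> a = Legendre (2 * tr a) (int p)" for a
  have L4: "Legendre 4 (int p) = 1"
  proof -
    have "\<not> int p dvd 2 * 2" using np2 pp prime_dvd_mult_iff by blast
    then have n0: "\<not> [4 = 0] (mod int p)" by (simp add: cong_0_iff)
    have "QuadRes (int p) 4" unfolding QuadRes_def by (rule exI[of _ 2]) simp
    then show ?thesis using n0 by (simp add: Legendre_def)
  qed
  have Lm: "Legendre (a * b) (int p) = Legendre a (int p) * Legendre b (int p)" for a b
    using Legendre_mult p(1) p2 by simp
  have Lv: "Legendre a (int p) = 1 \<or> Legendre a (int p) = -1" if "\<not> int p dvd a" for a
    using that by (auto simp: Legendre_def cong_0_iff)
  have Lc: "Legendre a (int p) = Legendre b (int p)" if "[a = b] (mod int p)" for a b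
    using Legendre_cong that by blast
  show ?thesis
  proof (rule odd_exponent_character[OF D l e P Pc, of \<theta>])
    show "\<theta> a = 1 \<or> \<theta> a = -1" if "a \<in> R" "a \<noteq> 0" "coprime_ideals K (pid a) P" for a
      unfolding \<theta>_def using nd[OF that] half by (intro Lv) blast
    show "\<theta> (a * b) = \<theta> a * \<theta> b" if "a \<in> R" "b \<in> R" for a b
    proof -
      have "\<theta> a * \<theta> b = Legendre (4 * (tr a * tr b)) (int p)" unfolding \<theta>_def Lm[symmetric] by (simp add: mult_ac)
      also have "\<dots> = Legendre (tr a * tr b) (int p)" unfolding Lm[of 4] L4 by simp
      also have "\<dots> = \<theta> (a * b)" unfolding \<theta>_def by (rule Lc, rule cong_sym, rule pm[OF that])
      finally show ?thesis by simp
    qed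
    show "\<theta> (cnj a) = \<theta> a" if "a \<in> R" for a using tr_cnj[OF that] by (simp add: \<theta>_def)
    show "\<theta> a = \<theta> b" if "a \<in> R" "b \<in> R" "a - b \<in> P" for a b
    proof -
      have "int p dvd tr a - tr b" using that tr_diff by (simp add: P_def)
      then have "[tr a = tr b] (mod int p)" by (simp add: cong_iff_dvd_diff)
      then show ?thesis unfolding \<theta>_def by (intro Lc cong_mult cong_refl)
    qed
    have "\<theta> (-1) = Legendre (4 * (-1)) (int p)" unfolding \<theta>_def using tr_of_int[of "-1"] by simp
    also have "\<dots> = Legendre (-1) (int p)" unfolding Lm[of 4] L4 by simp
    also have "\<dots> = -1" using Legendre_minus_one[of p] p(1,3) p2 by simp
    finally show th: "\<theta> (-1) = -1" .
    show "\<exists>a\<in>R. a \<noteq> 0 \<and> coprime_ideals K (pid a) P \<and> a - 1 \<in> \<nn> \<and> \<theta> a = -1"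
      if n: "idl \<nn>" "P \<subset> \<nn>" for \<nn>
    proof -
      obtain x where x: "x \<in> \<nn>" "x \<notin> P" using n(2) by blast
      have xR: "x \<in> R" using idl_R[OF n(1) x(1)] .
      then have nx: "\<not> int p dvd tr x" using x(2) by (simp add: P_def)
      \<comment> \<open>The ideal P is maximal: y has trace 0 and so lies in P, whence 2 x - y = tr
        x lies in \<nn>. It is prime to p, so 1 lies in \<nn>, and a = -1 detects that the character
        is not trivial.\<close>
      define y where "y = x - cnj x"
      have yR: "y \<in> R" using xR by (auto simp: y_def)
      have "tr y = 0" by (rule tr_eqI[OF yR]) (simp add: y_def)
      then have "y \<in> \<nn>" using yR n(2) by (auto simp: P_def)
      then have "2 * x - y \<in> \<nn>" using x(1) by (intro idl_diff[OF n(1)] idl_mult[OF n(1)]) auto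
      moreover have "2 * x - y = of_int (tr x)" using tr[OF xR] by (simp add: y_def)
      ultimately have t: "of_int (tr x) \<in> \<nn>" by metis
      have pn: "of_int (int p) \<in> \<nn>"
      proof -
        have "of_int (int p) \<in> P" unfolding P_def mem_Collect_eq tr_of_int by simp
        then show ?thesis using n(2) by blast
      qed
      have "coprime (int p) (tr x)" by (rule prime_imp_coprime[OF pp nx])
      then obtain c d where cd: "c * int p + d * tr x = 1" by (metis bezout_int coprime_imp_gcd_eq_1)
      have "of_int c * of_int (int p) + of_int d * of_int (tr x) \<in> \<nn>"
        by (intro idl_add[OF n(1)] idl_mult[OF n(1)] t pn R_of_int)
      moreover have "of_int c * of_int (int p) + of_int d * of_int (tr x) = (of_int (c * int p + d * tr x) :: complex)" by simp
      ultimately have "1 \<in> \<nn>" unfolding cd by (metis of_int_1)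
      then have "\<nn> = R" by (rule idl_one[OF n(1)])
      moreover have "-1 \<in> R" using R_uminus[OF R_1] .
      moreover have "pid (-1) = R" using pid_uminus[of 1] by simp
      then have "coprime_ideals K (pid (-1)) P" using coprime_R[OF P] by simp
      ultimately show ?thesis using th R_uminus[OF R_numeral[of "num.Bit0 num.One"]] by (intro bexI[of _ "-1"]) auto
    qed
  qed
qed

text \<open>The integers of even norm form the ideal P above 2, with P^2 = (2). For l = 2 k + 1 the
  principal ideal P^l is 2^k P, so dividing its generator by 2^k leaves an element of norm
  2.\<close>

lemma no_odd_exponent:
  assumes D: "D mod 4 \<noteq> 3" "D > 2" and l: "odd l"
    and e: "\<forall>A. idl A \<longrightarrow> (\<exists>\<beta>\<in>R. \<beta> \<noteq> 0 \<and> ipow A l = pid \<beta>)"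
  shows False
proof -
  have t: "tw = 0" and nw: "nw = int D" and ws: "w = s" using D(1) by (simp_all add: tw_def nw_def w_def)
  have form: "\<exists>i j. x = of_int i + of_int j * s \<and> int (nm x) = i ^ 2 + int D * j ^ 2" if x: "x \<in> R" for x
  proof -
    obtain i j where "x = of_int i + of_int j * w" using x R_basis by blast
    then show ?thesis using nm_basis[of i j] unfolding t nw ws by (auto simp: mult.commute)
  qed
  have D4: "D mod 4 = 1 \<or> D mod 4 = 2"
  proof -
    have "\<not> 2 ^ 2 dvd D"
    proof
      assume "2 ^ 2 dvd D"
      then have "is_unit (2 :: nat)" using D_sqf squarefreeD by blast
      then show False by simp
    qed
    then show ?thesis using D(1) by simp presburger
  qed
  define P where "P = {x \<in> R. even (nm x)}"
  \<comment> \<open>Modulo 2 the norm is linear in the coordinates, which makes P closed under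
    addition.\<close>
  have nm_ev: "even (nm (of_int i + of_int j * s)) \<longleftrightarrow> even (i + int D * j)" for i j :: int
  proof -
    have "int (nm (of_int i + of_int j * s)) = i ^ 2 + int D * j ^ 2" unfolding nm_s by simp
    moreover have "even (int (nm (of_int i + of_int j * s))) \<longleftrightarrow> even (nm (of_int i + of_int j * s))" by simp
    ultimately show ?thesis by (metis even_add even_mult_iff even_power pos2)
  qed
  have P: "idl P"
  proof (rule idlI)
    show "2 \<in> P" using nm_of_nat[of 2] by (simp add: P_def)
    show "x + y \<in> P" if "x \<in> P" "y \<in> P" for x y
    proof -
      have xy: "x \<in> R" "y \<in> R" "even (nm x)" "even (nm y)" using that by (auto simp: P_def)
      obtain i j where x: "x = of_int i + of_int j * s" using form[OF xy(1)] by blast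
      obtain i' j' where y: "y = of_int i' + of_int j' * s" using form[OF xy(2)] by blast
      have "x + y = of_int (i + i') + of_int (j + j') * s" unfolding x y by (simp add: algebra_simps)
      then have "even (nm (x + y)) \<longleftrightarrow> even ((i + i') + int D * (j + j'))" using nm_ev by presburger
      moreover have "even (i + int D * j)" "even (i' + int D * j')" using xy(3,4) unfolding x y nm_ev by blast+
      ultimately have "even (nm (x + y))" by (simp add: distrib_left)
      then show ?thesis using xy by (auto simp: P_def)
    qed
    show "r * x \<in> P" if "r \<in> R" "x \<in> P" for r x using that by (auto simp: P_def nm_mult)
  qed (auto simp: P_def)
  have cP: "cnj ` P = P"
  proof -
    have "cnj x \<in> P" if "x \<in> P" for x using that by (auto simp: P_def)
    then show ?thesis by (metis cnj_cnj_image image_subset_iff subset_antisym image_mono)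
  qed
  have i2: "idl (pid 2)" by (rule idl_pid) auto
  have N2: "N (pid 2) = 4" using N_pid[of 2] nm_of_nat[of 2] by simp
  have P2: "pid 2 \<subseteq> P"
    by (rule pid_subset[OF P]) (use nm_of_nat[of 2] in \<open>simp add: P_def\<close>)
  have "N P dvd 4" using N_dvd[OF i2 P P2] unfolding N2 .
  then have "N P dvd 2 ^ 2" by simp
  then obtain i where i: "i \<le> 2" "N P = 2 ^ i" using divides_primepow_nat[OF two_is_prime_nat] by blast
  have "i \<noteq> 0"
  proof
    assume "i = 0"
    then have "P = R" using N_1[OF P] i(2) by simp
    then have "1 \<in> P" by simp
    then show False using nm_of_nat[of 1] by (simp add: P_def)
  qed
  moreover have "i \<noteq> 2"
  proof
    assume "i = 2"
    then have e2: "pid 2 = P" using idl_eq_of_N[OF i2 P P2] N2 i(2) by simp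
    \<comment> \<open>With this x the norm x^2 + D of x + s is 2 modulo 4, so x + s is in P but not
      in (2).\<close>
    define x :: int where "x = (if even D then 0 else 1)"
    have "of_int x + of_int 1 * s \<in> P" unfolding P_def mem_Collect_eq nm_ev x_def by auto
    then have "of_int x + of_int 1 * s \<in> pid 2" using e2 by blast
    then obtain r where r: "r \<in> R" "of_int x + of_int 1 * s = 2 * r" unfolding pid_iff by blast
    have "nm (of_int x + of_int 1 * s) = 4 * nm r" unfolding r(2) using r(1) nm_of_nat[of 2] by (simp add: nm_mult)
    moreover have "int (nm (of_int x + of_int 1 * s)) = x ^ 2 + int D" unfolding nm_s by simp
    ultimately have "x ^ 2 + int D = 4 * int (nm r)" by simp
    then show False using D4 unfolding x_def by (simp split: if_splits) presburger+
  qed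
  ultimately have NP: "N P = 2" using i by (cases "i = 1") auto
  have PP: "P \<odot> P = pid 2" using pid_prime[OF P NP] unfolding cP by simp
  obtain k where k: "l = 2 * k + 1" using l by (metis oddE)
  obtain b where b: "b \<in> R" "b \<noteq> 0" "ipow P l = pid b" using e P by blast
  have "ipow P l = ipow (ipow P 2) k \<odot> P" unfolding k ipow_add[OF P] ipow_mult[OF P] ipow_1[OF P] ..
  also have "ipow P 2 = pid 2" unfolding PP[symmetric] by (simp add: numeral_2_eq_2 ipow_Suc imul_R'[OF P])
  finally have eb: "pid b = pid (2 ^ k) \<odot> P" unfolding b(3) ipow_pid .
  have "b \<in> pid (2 ^ k) \<odot> P" unfolding eb[symmetric] by simp
  moreover have "idl (pid (2 ^ k))" by (intro idl_pid R_power) auto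
  ultimately have "b \<in> pid (2 ^ k)" using imul_subset_left[OF _ P] by blast
  then obtain c where c: "c \<in> R" "b = 2 ^ k * c" unfolding pid_iff by blast
  have "nm b = N P ^ l" using N_pid[OF b(1,2)] N_ipow[OF P] b(3) by metis
  moreover have "nm b = nm (2 ^ k) * nm c" unfolding c(2) using c(1) by (intro nm_mult) auto
  moreover have "nm (2 ^ k) = 4 ^ k" using nm_power[of 2 k] nm_of_nat[of 2] by simp
  moreover have "(2 :: nat) ^ l = 4 ^ k * 2" unfolding k by (simp add: power_mult)
  ultimately have "nm c = 2" unfolding NP by simp
  then obtain i j where ij: "2 = i ^ 2 + int D * j ^ 2" using form[OF c(1)] by auto
  show False
  proof (cases "j = 0")
    case True
    then have i2: "i ^ 2 = 2" using ij by simp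
    have "\<bar>i\<bar> < 2"
    proof (rule ccontr)
      assume "\<not> \<bar>i\<bar> < 2"
      then have "2 * 2 \<le> \<bar>i\<bar> * \<bar>i\<bar>" by (intro mult_mono) auto
      then show False using i2 by (simp add: power2_eq_square)
    qed
    then have "i = 0 \<or> i = 1 \<or> i = -1" by linarith
    then show False using i2 by auto
  next
    case False
    then have "j ^ 2 \<ge> 1" by (simp add: int_one_le_iff_zero_less)
    then have "int D * 1 \<le> int D * j ^ 2" by (intro mult_left_mono) auto
    moreover have "i ^ 2 \<ge> 0" by simp
    ultimately show False using ij D(2) by linarith
  qed
qed

end

text \<open>At x + y sqrt(-2) with x odd this is a quadratic character modulo 4 sqrt(-2): the
  Kronecker symbol of -2 at x, with the sign reversed if y is 2 modulo 4. The periods 8 and 4 of x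
  and y reflect the multiples of 4 sqrt(-2).\<close>

definition sign8 :: "int \<Rightarrow> int \<Rightarrow> int" where
  "sign8 x y = (if (x mod 8 \<in> {1, 3}) = (y mod 4 \<noteq> 2) then 1 else -1)"

lemma sign8_periodic: "sign8 (x + 8 * k) (y + 4 * m) = sign8 x y"
  by (simp add: sign8_def)

lemma sign8_mult_residues:
  "\<forall>a\<in>set [1, 3, 5, 7]. \<forall>b\<in>set [0, 1, 2, 3]. \<forall>a'\<in>set [1, 3, 5, 7]. \<forall>b'\<in>set [0, 1, 2, 3].
    sign8 (a * a' - 2 * b * b') (a * b' + a' * b) = sign8 a b * sign8 a' b'"
  by code_simp

lemma sign8_mult:
  assumes "odd x" "odd x'"
  shows "sign8 (x * x' - 2 * y * y') (x * y' + x' * y) = sign8 x y * sign8 x' y'"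
proof -
  have mod8: "x mod 8 \<in> set [1, 3, 5, 7]" if "odd x" for x :: int using that by simp presburger
  have mod4: "y mod 4 \<in> set [0, 1, 2, 3]" for y :: int by simp presburger
  define a q where "a = x mod 8" and "q = x div 8"
  define a' q' where "a' = x' mod 8" and "q' = x' div 8"
  define b r where "b = y mod 4" and "r = y div 4"
  define b' r' where "b' = y' mod 4" and "r' = y' div 4"
  have x: "x = a + 8 * q" and x': "x' = a' + 8 * q'" and y: "y = b + 4 * r" and y': "y' = b' + 4 * r'"
    by (simp_all add: a_def q_def a'_def q'_def b_def r_def b'_def r'_def)
  have res: "sign8 (a * a' - 2 * b * b') (a * b' + a' * b) = sign8 a b * sign8 a' b'"
    unfolding a_def a'_def b_def b'_def
    by (rule sign8_mult_residues[rule_format, OF mod8[OF assms(1)] mod4 mod8[OF assms(2)] mod4])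
  have e1: "x * x' - 2 * y * y' = (a * a' - 2 * b * b') + 8 * (q * a' + a * q' + 8 * q * q' - r * b' - b * r' - 4 * r * r')"
    unfolding x x' y y' by (simp add: algebra_simps)
  have e2: "x * y' + x' * y = (a * b' + a' * b) + 4 * (2 * q * b' + a * r' + 8 * q * r' + 2 * q' * b + a' * r + 8 * q' * r)"
    unfolding x x' y y' by (simp add: algebra_simps)
  show ?thesis
    unfolding e1 e2 sign8_periodic res by (subst x, subst x', subst y, subst y') (simp only: sign8_periodic)
qed

lemma prime_3_mod_4_divisor:
  fixes n :: nat
  assumes "n mod 4 = 3" shows "\<exists>p. prime p \<and> p dvd n \<and> p mod 4 = 3"
  using assms
proof (induct n rule: less_induct)
  case (less n)
  have "n \<noteq> 1" using less(2) by auto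
  then obtain p where p: "prime p" "p dvd n" using prime_factor_nat by blast
  then obtain m where m: "n = p * m" by blast
  show ?case
  proof (cases "p mod 4 = 3")
    case True
    then show ?thesis using p by blast
  next
    case False
    have "odd n" using less(2) by presburger
    then have "odd p" using m by simp
    then have p1: "p mod 4 = 1" using False by presburger
    have "(p * m) mod 4 = ((p mod 4) * (m mod 4)) mod 4" by (simp only: mod_mult_eq)
    then have "m mod 4 = 3" using less(2) unfolding m p1 by simp
    moreover have "m < n"
    proof -
      have "m > 0" using \<open>m mod 4 = 3\<close> by (intro Nat.gr0I) auto
      then have "1 * m < p * m" using prime_gt_1_nat[OF p(1)] by (intro mult_strict_right_mono) auto
      then show ?thesis unfolding m by simp
    qed
    ultimately obtain r where "prime r" "r dvd m" "r mod 4 = 3" using less(1) by blast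
    then show ?thesis unfolding m by (metis dvd_mult)
  qed
qed

context iqf
begin

text \<open>No prime congruent to 3 modulo 4 divides D = 2, so the sign comes from a power of the
  prime (s) above 2: the modulus generated by 4 s is (s)^5, and \<open>sign8\<close> is odd and
  invariant under conjugation.\<close>

lemma sqrt_minus_two_character:
  assumes D: "D = 2" and l: "odd l"
    and e: "\<forall>A. idl A \<longrightarrow> (\<exists>\<beta>\<in>R. \<beta> \<noteq> 0 \<and> ipow A l = pid \<beta>)"
  shows "\<exists>\<psi>. primitive_hecke_character K l \<psi> \<and> rational_coeffs K \<psi>"
proof -
  have ws: "w = s" unfolding w_def using D by simp
  have "of_nat D = (2 :: complex)" using D by simp
  then have ss: "s * s = - 2" using s_sq by simp
  have coord: "\<exists>x y :: int. a = of_int x + of_int y * s" if aR: "a \<in> R" for a using aR unfolding R_basis ws by blast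
  have inR: "of_int x + of_int y * s \<in> R" for x y :: int using R_I unfolding ws by blast
  \<comment> \<open>The traces of a and a s are 2 x and - 4 y, so the coordinates are recovered
    exactly.\<close>
  define \<theta> where "\<theta> a = sign8 (tr a div 2) (tr (a * s) div (-4))" for a
  have th: "\<theta> (of_int x + of_int y * s) = sign8 x y" for x y :: int
  proof -
    have "tr (of_int x + of_int y * s) = 2 * x" by (rule tr_eqI[OF inR]) simp
    moreover have "tr ((of_int x + of_int y * s) * s) = - 4 * y"
    proof (rule tr_eqI)
      show "(of_int x + of_int y * s) * s \<in> R" by (intro R_mult inR R_s)
      have "(of_int x + of_int y * s) * s = of_int x * s - 2 * of_int y" by (simp add: algebra_simps ss)
      then show "(of_int x + of_int y * s) * s + cnj ((of_int x + of_int y * s) * s) = of_int (- 4 * y)" by simp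
    qed
    ultimately show ?thesis unfolding \<theta>_def by simp
  qed
  define \<mm> where "\<mm> = pid (4 * s)"
  have m: "idl \<mm>" unfolding \<mm>_def by (rule idl_pid) auto
  have sm: "pid (- s) = pid s" by (rule pid_uminus) auto
  have mc: "cnj ` \<mm> = \<mm>"
  proof -
    have "cnj ` \<mm> = pid (4 * (- s))" unfolding \<mm>_def pid_cnj by simp
    also have "\<dots> = \<mm>" unfolding \<mm>_def pid_mult[symmetric] sm ..
    finally show ?thesis .
  qed
  have ids: "idl (pid s)" by (rule idl_pid) auto
  have Ns: "N (pid s) = 2"
  proof -
    have "N (pid s) = nm s" by (rule N_pid) auto
    moreover have "nm s = D" using nm_s[of 0 1] by simp
    ultimately show ?thesis using D by metis
  qed
  have ms: "\<mm> \<subseteq> pid s"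
  proof -
    have "s * 4 \<in> pid s" by (rule pid_memI) auto
    then show ?thesis unfolding \<mm>_def by (intro pid_subset[OF ids]) (simp add: mult.commute)
  qed
  have odd: "odd x" if c: "of_int x + of_int y * s \<noteq> 0" "coprime_ideals K (pid (of_int x + of_int y * s)) \<mm>" for x y :: int
  proof
    assume "even x"
    then obtain z where z: "x = 2 * z" by blast
    have "s * (of_int y - of_int z * s) = of_int y * s - of_int z * (s * s)" by (simp add: algebra_simps)
    also have "\<dots> = of_int x + of_int y * s" unfolding ss z by simp
    finally have "of_int x + of_int y * s = s * (of_int y - of_int z * s)" by simp
    moreover have "of_int y - of_int z * s \<in> R" by (intro R_diff R_mult) auto
    ultimately have "of_int x + of_int y * s \<in> pid s" unfolding pid_iff by blast
    then have "pid (of_int x + of_int y * s) \<subseteq> pid s" by (rule pid_subset[OF ids])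
    moreover obtain u v where uv: "u \<in> pid (of_int x + of_int y * s)" "v \<in> \<mm>" "u + v = 1"
      by (rule coprime_idealsE[OF c(2) idl_pid[OF inR c(1)] m])
    ultimately have "1 \<in> pid s" using idl_add[OF ids] ms by (metis subsetD)
    then have "pid s = R" by (rule idl_one[OF ids])
    then show False using Ns by simp
  qed
  show ?thesis
  proof (rule odd_exponent_character[OF _ _ l e m mc, of \<theta>])
    show "D \<noteq> 1" "D \<noteq> 3" using D by simp_all
    show "\<theta> a = 1 \<or> \<theta> a = -1" for a by (simp add: \<theta>_def sign8_def)
    show "\<theta> (a * b) = \<theta> a * \<theta> b"
      if ca: "a \<in> R" "a \<noteq> 0" "coprime_ideals K (pid a) \<mm>"
        and cb: "b \<in> R" "b \<noteq> 0" "coprime_ideals K (pid b) \<mm>" for a b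
    proof -
      obtain x y where a: "a = of_int x + of_int y * s" using coord[OF ca(1)] by blast
      obtain x' y' where b: "b = of_int x' + of_int y' * s" using coord[OF cb(1)] by blast
      have ox: "odd x" "odd x'" using odd ca(2,3) cb(2,3) unfolding a b by blast+
      have "a * b = of_int x * of_int x' + of_int y * of_int y' * (s * s) + (of_int x * of_int y' + of_int x' * of_int y) * s"
        unfolding a b by (simp add: algebra_simps)
      also have "\<dots> = of_int (x * x' - 2 * y * y') + of_int (x * y' + x' * y) * s" unfolding ss by simp
      finally have ab: "a * b = of_int (x * x' - 2 * y * y') + of_int (x * y' + x' * y) * s" .
      show ?thesis unfolding ab th sign8_mult[OF ox] unfolding a b th ..
    qed
    show "\<theta> (cnj a) = \<theta> a" if aR: "a \<in> R" for a
    proof -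
      obtain x y where a: "a = of_int x + of_int y * s" using coord[OF aR] by blast
      have "cnj a = of_int x + of_int (- y) * s" unfolding a by simp
      then have "\<theta> (cnj a) = sign8 x (- y)" using th by metis
      moreover have "sign8 x (- y) = sign8 x y"
      proof -
        have "(- y) mod 4 = 2 \<longleftrightarrow> y mod 4 = 2" by presburger
        then show ?thesis by (simp add: sign8_def)
      qed
      ultimately show ?thesis unfolding a th by simp
    qed
    show "\<theta> a = \<theta> b" if ab: "a \<in> R" "b \<in> R" "a - b \<in> \<mm>" for a b
    proof -
      obtain x y where b: "b = of_int x + of_int y * s" using coord[OF ab(2)] by blast
      obtain r where r: "r \<in> R" "a - b = 4 * s * r" using ab(3) unfolding \<mm>_def pid_iff by blast
      obtain u v where uv: "r = of_int u + of_int v * s" using coord[OF r(1)] by blast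
      have "a = b + 4 * s * r" using r(2) by (metis add.commute diff_add_cancel)
      also have "\<dots> = of_int x + of_int y * s + 4 * of_int u * s + 4 * of_int v * (s * s)" unfolding b uv by (simp add: algebra_simps)
      also have "\<dots> = of_int (x + 8 * (- v)) + of_int (y + 4 * u) * s" unfolding ss by (simp add: algebra_simps)
      finally have a: "a = of_int (x + 8 * (- v)) + of_int (y + 4 * u) * s" .
      show ?thesis unfolding a th sign8_periodic unfolding b th ..
    qed
    show "\<theta> (-1) = -1" using th[of "-1" 0] by (simp add: sign8_def)
    show "\<exists>a\<in>R. a \<noteq> 0 \<and> coprime_ideals K (pid a) \<mm> \<and> a - 1 \<in> \<nn> \<and> \<theta> a = -1"
      if n: "idl \<nn>" "\<mm> \<subset> \<nn>" for \<nn>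
    proof -
      have i4: "idl (pid 4)" by (rule idl_pid) auto
      have "\<mm> \<subseteq> \<nn>" using n(2) by blast
      then obtain C where C: "idl C" "\<mm> = \<nn> \<odot> C" by (rule idl_dvd[OF m n(1)])
      have Nm: "N \<mm> = 32"
      proof -
        have "N \<mm> = nm (4 * s)" unfolding \<mm>_def by (rule N_pid) auto
        also have "\<dots> = 32" using nm_s[of 0 4] D by simp
        finally show ?thesis .
      qed
      have "N C dvd 32" using N_mult[OF n(1) C(1)] C(2) Nm by (metis dvd_triv_right)
      then have "N C dvd 2 ^ 5" by simp
      then obtain i where i: "N C = 2 ^ i" using divides_primepow_nat[OF two_is_prime_nat] by blast
      have "i \<noteq> 0"
      proof
        assume "i = 0"
        then have "C = R" using N_1[OF C(1)] i by simp
        then show False using C(2) n imul_R' by auto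
      qed
      then have C2: "2 dvd N C" using i by simp
      \<comment> \<open>The norm of C is a nontrivial power of 2, and (s) is the only ideal of norm
        2. Cancelling (s) shows that every modulus strictly larger than (4 s) contains 4.\<close>
      have "\<exists>C'. idl C' \<and> C = pid s \<odot> C'"
      proof (rule prime_divides_norm[OF C(1) two_is_prime_nat C2])
        show ?thesis if P: "idl P" "N P = 2" "idl C'" "C = P \<odot> C'" for P C'
        proof -
          have "P = pid s \<or> P = cnj ` pid s"
            by (rule norm_prime_unique[OF ids Ns P(1,2) two_is_prime_nat])
          then have "P = pid s" unfolding pid_cnj using sm by simp
          then show ?thesis using P(3,4) by blast
        qed
        show ?thesis if P: "idl C'" "C = pid (of_nat 2) \<odot> C'" for C'
        proof -
          have "s * (- s) = of_nat 2" using ss by simp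
          then have "pid (of_nat 2) = pid s \<odot> pid s"
            using pid_mult[of s "- s"] sm by metis
          then have "C = pid s \<odot> (pid s \<odot> C')" using P(2) imul_assoc by metis
          then show ?thesis using idl_imul[OF ids P(1)] by blast
        qed
      qed
      then obtain C' where C': "idl C'" "C = pid s \<odot> C'" by blast
      have "pid s \<odot> pid 4 = \<mm>" unfolding \<mm>_def pid_mult by (simp add: mult.commute)
      also have "\<dots> = pid s \<odot> (\<nn> \<odot> C')" unfolding C(2) C'(2) by (rule imul_left_comm)
      finally have "pid 4 = \<nn> \<odot> C'" by (rule imul_cancel[OF ids i4 idl_imul[OF n(1) C'(1)]])
      then have "pid 4 \<subseteq> \<nn>" using imul_subset_left[OF n(1) C'(1)] by blast
      then have n4: "4 \<in> \<nn>" using pid_mem by blast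
      \<comment> \<open>The witness 5 is 1 modulo 4 but has sign -1; 25 - 24 = 1 proves coprimality,
        as 4 s times 3 s is -24.\<close>
      have cop: "coprime_ideals K (pid 5) \<mm>"
      proof (rule coprime_idealsI[OF _ m])
        show "idl (pid 5)" by (rule idl_pid) auto
        show "5 * 5 \<in> pid 5" by (rule pid_memI) simp
        show "4 * s * (3 * s) \<in> \<mm>" unfolding \<mm>_def by (rule pid_memI) auto
        have "4 * s * (3 * s) = 12 * (s * s)" by simp
        then show "5 * 5 + 4 * s * (3 * s) = 1" unfolding ss by simp
      qed
      have "\<theta> 5 = -1" using th[of 5 0] by (simp add: sign8_def)
      then show ?thesis using cop n4 by (intro bexI[of _ 5]) auto
    qed
  qed
qed

section \<open>The two fields with extra units\<close>

text \<open>The condition \<open>nw = 1\<close> means D = 1 or D = 3. Rounding the coordinates of x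
  / d leaves e, f of absolute value at most 1/2, and the norm form at (e, f) is at most 3/4, so
  division with remainder works.\<close>

lemma norm_euclidean_principal:
  assumes nw: "nw = 1" and I: "idl I"
  shows "\<exists>a\<in>R. a \<noteq> 0 \<and> I = pid a"
proof -
  obtain d0 where "d0 \<in> I" "d0 \<noteq> 0" by (rule idl_nonzero[OF I])
  then obtain d where d: "d \<in> I" "d \<noteq> 0" and least: "\<And>y. y \<in> I \<Longrightarrow> y \<noteq> 0 \<Longrightarrow> nm d \<le> nm y"
    using ex_has_least_nat[of "\<lambda>x. x \<in> I \<and> x \<noteq> 0" d0 nm] by blast
  have dR: "d \<in> R" by (rule idl_R[OF I d(1)])
  have "x \<in> pid d" if x: "x \<in> I" for x
  proof -
    define z where "z = x / d"
    have Iw: "Im w \<noteq> 0" using w_nonreal by (simp add: complex_is_Real_iff)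
    define Q where "Q = Im z / Im w"
    define P where "P = Re z - Q * Re w"
    have z: "z = of_real P + of_real Q * w" using Iw by (simp add: complex_eq_iff P_def Q_def)
    define i where "i = round P"
    define j where "j = round Q"
    define e f where "e = P - of_int i" and "f = Q - of_int j"
    have ef: "\<bar>e\<bar> \<le> 1/2" "\<bar>f\<bar> \<le> 1/2" unfolding e_def f_def i_def j_def
      using of_int_round_abs_le[of P] of_int_round_abs_le[of Q] by (simp_all add: abs_minus_commute)
    define q where "q = of_int i + of_int j * w"
    have qR: "q \<in> R" unfolding q_def by (rule R_I)
    define y where "y = x - q * d"
    have yI: "y \<in> I" unfolding y_def by (intro idl_diff[OF I] idl_mult[OF I] x d(1) qR)
    have yR: "y \<in> R" by (rule idl_R[OF I yI])
    have "y = d * (z - q)" using d(2) by (simp add: y_def z_def algebra_simps)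
    also have "z - q = of_real e + of_real f * w" unfolding z q_def e_def f_def by (simp add: algebra_simps)
    finally have y: "y = d * (of_real e + of_real f * w)" .
    have "of_nat (nm y) = y * cnj y" by (rule nm[OF yR])
    also have "\<dots> = (d * cnj d) * ((of_real e) ^ 2 + of_real e * of_real f * (w + cnj w) + (of_real f) ^ 2 * (w * cnj w))"
      unfolding y by (simp add: algebra_simps power2_eq_square)
    also have "\<dots> = of_real (real (nm d) * (e ^ 2 + e * f * of_int tw + f ^ 2))"
      unfolding w_trace w_norm nw nm[OF dR, symmetric] by simp
    finally have "complex_of_real (real (nm y)) = of_real (real (nm d) * (e ^ 2 + e * f * of_int tw + f ^ 2))" by simp
    then have ny: "real (nm y) = real (nm d) * (e ^ 2 + e * f * of_int tw + f ^ 2)" unfolding of_real_eq_iff .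
    have small: "\<bar>g * h\<bar> \<le> 1/4" if "\<bar>g\<bar> \<le> 1/2" "\<bar>h\<bar> \<le> 1/2" for g h :: real
    proof -
      have "\<bar>g\<bar> * \<bar>h\<bar> \<le> 1/2 * (1/2)" using that by (intro mult_mono) auto
      then show ?thesis by (simp add: abs_mult)
    qed
    have "tw = 0 \<or> tw = 1" by (simp add: tw_def)
    then have "\<bar>e * f * of_int tw\<bar> \<le> 1/4" using small[OF ef] by auto
    then have lt: "e ^ 2 + e * f * of_int tw + f ^ 2 < 1"
      using small[OF ef(1) ef(1)] small[OF ef(2) ef(2)] unfolding power2_eq_square by linarith
    have "nm d > 0" using nm_eq_0[OF dR] d(2) by (intro Nat.gr0I) auto
    then have "real (nm d) * (e ^ 2 + e * f * of_int tw + f ^ 2) < real (nm d) * 1" using lt by (intro mult_strict_left_mono) auto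
    then have "nm y < nm d" using ny by simp
    then have "y = 0" using least[OF yI] by (metis not_less)
    then have "x = d * q" by (simp add: y_def)
    then show ?thesis unfolding pid_iff using qR by blast
  qed
  then have "I = pid d" using pid_subset[OF I d(1)] by blast
  then show ?thesis using dR d(2) by blast
qed

text \<open>Modulo \<open>\<mm>\<^sub>0\<close> each invertible residue is represented by exactly
  one unit, so each ideal prime to q has one generator congruent to 1, whose l-th power is the
  value. For the exact conductor the congruence is weakened as far as the l-th power stays well
  defined.\<close>

lemma class_number_one_character:
  assumes nw: "nw = 1" and l: "l \<ge> 1" and q: "q > 1" and m0: "idl \<mm>\<^sub>0"
    and star: "\<And>a. a \<in> R \<Longrightarrow> \<not> q dvd nm a \<Longrightarrow> \<exists>v\<in>R. nm v = 1 \<and> v * a - 1 \<in> \<mm>\<^sub>0"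
    and trq: "\<And>y. y \<in> R \<Longrightarrow> q dvd nm y \<Longrightarrow> int q dvd tr y"
    and cj: "\<And>\<mm> x. idl \<mm> \<Longrightarrow> \<mm>\<^sub>0 \<subseteq> \<mm> \<Longrightarrow> x \<in> \<mm> \<Longrightarrow> q dvd nm x \<Longrightarrow> cnj x \<in> \<mm>"
    and un: "\<And>v. v \<in> R \<Longrightarrow> nm v = 1 \<Longrightarrow> v - 1 \<in> \<mm>\<^sub>0 \<Longrightarrow> v = 1"
  shows "\<exists>\<psi>. primitive_hecke_character K l \<psi> \<and> rational_coeffs K \<psi>"
proof -
  \<comment> \<open>Such an x is a unit modulo \<open>\<mm>\<^sub>0\<close>, hence modulo
    \<mm>.\<close>
  have full: "\<mm> = R" if m: "idl \<mm>" "\<mm>\<^sub>0 \<subseteq> \<mm>" "x \<in> \<mm>" "\<not> q dvd nm x" for \<mm> x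
  proof -
    obtain v where v: "v \<in> R" "nm v = 1" "v * x - 1 \<in> \<mm>\<^sub>0" using star[OF idl_R[OF m(1,3)] m(4)] by blast
    have "v * x - (v * x - 1) \<in> \<mm>" by (rule idl_diff[OF m(1) idl_mult[OF m(1) v(1) m(3)]]) (use v(3) m(2) in blast)
    then have "1 \<in> \<mm>" by simp
    then show ?thesis by (rule idl_one[OF m(1)])
  qed
  have res: "\<exists>v\<in>R. nm v = 1 \<and> v * a - 1 \<in> \<mm>"
    if m: "idl \<mm>" "\<mm>\<^sub>0 \<subseteq> \<mm>" and a: "a \<in> R" "a \<noteq> 0" "coprime_ideals K (pid a) \<mm>" for \<mm> a
  proof (cases "q dvd nm a")
    case False
    then show ?thesis using star[OF a(1)] m(2) by blast
  next
    case True
    \<comment> \<open>If q divides nm a, it divides the norm and the trace of x. So y = 1 - x in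
      \<mm> has norm 1 modulo q, and \<mm> is the whole ring.\<close>
    obtain x y where xy: "x \<in> pid a" "y \<in> \<mm>" "x + y = 1"
      by (rule coprime_idealsE[OF a(3) idl_pid[OF a(1,2)] m(1)])
    obtain r where r: "r \<in> R" "x = a * r" using xy(1) unfolding pid_iff by blast
    have xR: "x \<in> R" using r a(1) by auto
    have qx: "q dvd nm x" using True unfolding r(2) nm_mult[OF a(1) r(1)] by simp
    have yR: "y \<in> R" by (rule idl_R[OF m(1) xy(2)])
    have y: "y = 1 - x" using xy(3) by (metis add_diff_cancel_left')
    have "of_int (int (nm y)) = y * cnj y" using nm[OF yR] by simp
    also have "\<dots> = 1 - (x + cnj x) + x * cnj x" unfolding y by (simp add: algebra_simps)
    also have "\<dots> = of_int (1 - tr x + int (nm x))" unfolding tr[OF xR, symmetric] nm[OF xR, symmetric] by simp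
    finally have ny: "int (nm y) = 1 - tr x + int (nm x)" unfolding of_int_eq_iff .
    have "\<not> q dvd nm y"
    proof
      assume "q dvd nm y"
      then have "int q dvd int (nm y)" by simp
      moreover have "int q dvd tr x - int (nm x)" using trq[OF xR qx] qx by (intro dvd_diff) auto
      ultimately have "int q dvd int (nm y) + (tr x - int (nm x))" by (rule dvd_add)
      then show False using q unfolding ny by simp
    qed
    then have "\<mm> = R" by (rule full[OF m xy(2)])
    then show ?thesis using a(1) nm_of_nat[of 1] by (intro bexI[of _ 1]) auto
  qed
  \<comment> \<open>Two generators congruent to 1 modulo \<nn> differ by a unit v congruent to 1,
    and only v^l matters for the value. A good modulus of least norm is the conductor.\<close>
  define good where "good \<nn> \<longleftrightarrow> idl \<nn> \<and> \<mm>\<^sub>0 \<subseteq> \<nn> \<and> (\<forall>v\<in>R. nm v = 1 \<longrightarrow> v - 1 \<in> \<nn> \<longrightarrow> v ^ l = 1)" for \<nn>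
  have "good \<mm>\<^sub>0" unfolding good_def
  proof (intro conjI ballI impI m0 subset_refl)
    fix v assume "v \<in> R" "nm v = 1" "v - 1 \<in> \<mm>\<^sub>0"
    then have "v = 1" by (rule un)
    then show "v ^ l = 1" by simp
  qed
  then obtain \<mm> where good: "good \<mm>" and least: "\<And>\<nn>. good \<nn> \<Longrightarrow> N \<mm> \<le> N \<nn>"
    using ex_has_least_nat[of good "\<mm>\<^sub>0" N] by blast
  have m: "idl \<mm>" "\<mm>\<^sub>0 \<subseteq> \<mm>" using good unfolding good_def by blast+
  have mu: "v ^ l = 1" if "v \<in> R" "nm v = 1" "v - 1 \<in> \<mm>" for v using good that unfolding good_def by blast
  have "cnj x \<in> \<mm>" if "x \<in> \<mm>" for x
  proof (cases "q dvd nm x")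
    case True
    then show ?thesis by (rule cj[OF m that])
  next
    case False
    then show ?thesis using full[OF m that] that by auto
  qed
  then have mc: "cnj ` \<mm> = \<mm>" by (metis cnj_cnj_image image_subset_iff subset_antisym image_mono)
  \<comment> \<open>A unit quotient of two l-th powers is the l-th power of a unit, since l-th roots
    of ideals are unique.\<close>
  have key: "\<exists>v\<in>R. nm v = 1 \<and> c = a * v \<and> u = v ^ l"
    if ca: "c \<in> R" "a \<in> R" "c \<noteq> 0" "a \<noteq> 0" and u: "u \<in> R" "nm u = 1" and eq: "c ^ l = a ^ l * u" for a c u
  proof -
    have ia: "idl (pid a)" and ic: "idl (pid c)" using ca by (auto intro: idl_pid)
    have "ipow (pid c) l = pid (a ^ l) \<odot> R"
      unfolding ipow_pid eq pid_unit[OF u, symmetric] pid_mult ..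
    also have "\<dots> = ipow (pid a) l" unfolding ipow_pid[symmetric] by (rule imul_R'[OF idl_ipow[OF ia]])
    finally have "pid c = pid a" using l by (intro ipow_inj[OF ic ia]) auto
    then obtain v where v: "v \<in> R" "nm v = 1" "c = a * v" by (rule pid_eqD[OF _ ca(4,2)])
    have "a ^ l * v ^ l = a ^ l * u" using eq unfolding v(3) power_mult_distrib .
    then have "u = v ^ l" using ca(4) by simp
    then show ?thesis using v by blast
  qed
  define W where "W = {a ^ l | a. a \<in> R \<and> a \<noteq> 0 \<and> a - 1 \<in> \<mm>}"
  have WI: "x \<in> W" if "x = a ^ l" "a \<in> R" "a \<noteq> 0" "a - 1 \<in> \<mm>" for x a using that unfolding W_def by blast
  have WE: "\<exists>a. x = a ^ l \<and> a \<in> R \<and> a \<noteq> 0 \<and> a - 1 \<in> \<mm>" if "x \<in> W" for x using that unfolding W_def by blast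
  show ?thesis
  proof (rule character_from_generators[OF m(1) mc, of W])
    show "0 \<notin> W" by (auto simp: W_def)
    show "x * y \<in> W" if xy: "x \<in> W" "y \<in> W" for x y
    proof -
      obtain a where a: "x = a ^ l" "a \<in> R" "a \<noteq> 0" "a - 1 \<in> \<mm>" using WE[OF xy(1)] by blast
      obtain b where b: "y = b ^ l" "b \<in> R" "b \<noteq> 0" "b - 1 \<in> \<mm>" using WE[OF xy(2)] by blast
      have "(a - 1) * b + (b - 1) \<in> \<mm>" using a b by (intro idl_add[OF m(1)] idl_mult_right[OF m(1)])
      moreover have "(a - 1) * b + (b - 1) = a * b - 1" by (simp add: algebra_simps)
      ultimately have "a * b - 1 \<in> \<mm>" by metis
      then show ?thesis using a b by (intro WI[of _ "a * b"]) (auto simp: power_mult_distrib)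
    qed
    show "cnj x \<in> W" if x: "x \<in> W" for x
    proof -
      obtain a where a: "x = a ^ l" "a \<in> R" "a \<noteq> 0" "a - 1 \<in> \<mm>" using WE[OF x] by blast
      have "cnj (a - 1) \<in> \<mm>" using a(4) mc by blast
      then have "cnj a - 1 \<in> \<mm>" by simp
      then show ?thesis using a by (intro WI[of _ "cnj a"]) auto
    qed
    show "u = 1" if b: "\<beta> \<in> W" "u \<in> R" "nm u = 1" "\<beta> * u \<in> W" for \<beta> u
    proof -
      obtain a where a: "\<beta> = a ^ l" "a \<in> R" "a \<noteq> 0" "a - 1 \<in> \<mm>" using WE[OF b(1)] by blast
      obtain c where c: "\<beta> * u = c ^ l" "c \<in> R" "c \<noteq> 0" "c - 1 \<in> \<mm>" using WE[OF b(4)] by blast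
      have "c ^ l = a ^ l * u" using c(1) a(1) by metis
      then obtain v where v: "v \<in> R" "nm v = 1" "c = a * v" "u = v ^ l" using key[OF c(2) a(2) c(3) a(3) b(2,3)] by blast
      have "(c - 1) - v * (a - 1) \<in> \<mm>" by (intro idl_diff[OF m(1)] idl_mult[OF m(1)] a c v)
      moreover have "(c - 1) - v * (a - 1) = v - 1" unfolding v(3) by (simp add: algebra_simps)
      ultimately have "v - 1 \<in> \<mm>" by metis
      then show ?thesis using mu[OF v(1,2)] v(4) by simp
    qed
    show "b ^ l * u \<in> W" if ab: "a \<in> R" "b \<in> R" "a \<noteq> 0" "b \<noteq> 0" "coprime_ideals K (pid a) \<mm>"
      "coprime_ideals K (pid b) \<mm>" "a - b \<in> \<mm>" "u \<in> R" "nm u = 1" "a ^ l * u \<in> W" for a b u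
    proof -
      obtain c where c: "a ^ l * u = c ^ l" "c \<in> R" "c \<noteq> 0" "c - 1 \<in> \<mm>" using WE[OF ab(10)] by blast
      obtain v where v: "v \<in> R" "nm v = 1" "c = a * v" "u = v ^ l" using key[OF c(2) ab(1) c(3) ab(3,8,9) c(1)[symmetric]] by blast
      have "(c - 1) - v * (a - b) \<in> \<mm>" by (intro idl_diff[OF m(1)] idl_mult[OF m(1)] ab c v)
      moreover have "(c - 1) - v * (a - b) = b * v - 1" unfolding v(3) by (simp add: algebra_simps)
      ultimately have "b * v - 1 \<in> \<mm>" by metis
      moreover have "v \<noteq> 0" using v(3) c(3) by auto
      ultimately show ?thesis using ab v by (intro WI[of _ "b * v"]) (auto simp: power_mult_distrib)
    qed
    show "\<exists>a\<in>R. a \<noteq> 0 \<and> coprime_ideals K (pid a) \<mm> \<and> a - 1 \<in> \<nn> \<and> a ^ l \<notin> W"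
      if n: "idl \<nn>" "\<mm> \<subset> \<nn>" for \<nn>
    proof -
      have mn: "\<mm> \<subseteq> \<nn>" "\<mm> \<noteq> \<nn>" using n(2) by blast+
      have "N \<nn> dvd N \<mm>" by (rule N_dvd[OF m(1) n(1) mn(1)])
      then have "N \<nn> \<le> N \<mm>" using N_pos[OF m(1)] by (rule dvd_imp_le)
      moreover have "N \<mm> \<noteq> N \<nn>" using idl_eq_of_N[OF m(1) n(1) mn(1)] mn(2) by blast
      ultimately have "\<not> good \<nn>" using least by fastforce
      then obtain v where v: "v \<in> R" "nm v = 1" "v - 1 \<in> \<nn>" "v ^ l \<noteq> 1"
        unfolding good_def using n(1) m(2) mn(1) by blast
      have v0: "v \<noteq> 0" using unit_cnj[OF v(1,2)] by auto
      have "v ^ l \<notin> W"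
      proof
        assume "v ^ l \<in> W"
        then obtain c where c: "v ^ l = c ^ l" "c \<in> R" "c \<noteq> 0" "c - 1 \<in> \<mm>" using WE by blast
        have "v ^ l \<in> R" "nm (v ^ l) = 1" using v by (auto simp: nm_power)
        moreover have "c ^ l = 1 ^ l * v ^ l" using c(1) by simp
        ultimately obtain v' where "v' \<in> R" "nm v' = 1" "c = 1 * v'" using key[OF c(2) R_1 c(3) one_neq_zero[symmetric, THEN not_sym]] by (metis one_neq_zero)
        then have "c ^ l = 1" using mu[of c] c(4) by simp
        then show False using c(1) v(4) by simp
      qed
      then show ?thesis using v v0 pid_unit[OF v(1,2)] coprime_R[OF m(1)] by (intro bexI[of _ v]) auto
    qed
    show "\<exists>\<beta>\<in>R. \<beta> \<in> W \<and> pid \<beta> = ipow A l"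
      if A: "idl A" "coprime_ideals K A \<mm>" for A
    proof -
      obtain a where a: "a \<in> R" "a \<noteq> 0" "A = pid a" using norm_euclidean_principal[OF nw A(1)] by blast
      have "coprime_ideals K (pid a) \<mm>" using A(2) unfolding a(3) .
      then obtain v where v: "v \<in> R" "nm v = 1" "v * a - 1 \<in> \<mm>" using res[OF m a(1,2)] by blast
      have v0: "v \<noteq> 0" using unit_cnj[OF v(1,2)] by auto
      have "pid (v * a) = R \<odot> pid a" unfolding pid_mult[symmetric] pid_unit[OF v(1,2)] ..
      also have "\<dots> = A" unfolding a(3) by (rule imul_R[OF idl_pid[OF a(1,2)]])
      finally have "pid ((v * a) ^ l) = ipow A l" unfolding ipow_pid[symmetric] by simp
      moreover have "(v * a) ^ l \<in> W" using v v0 a by (intro WI[of _ "v * a"]) auto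
      moreover have "(v * a) ^ l \<in> R" using v a by auto
      ultimately show ?thesis by blast
    qed
  qed
qed

text \<open>The four units represent the four invertible residues modulo 2 + 2 s, an ideal of norm
  8. Invertible means odd norm, so q = 2.\<close>

lemma gaussian_character:
  assumes D: "D = 1" and l: "l \<ge> 1"
  shows "\<exists>\<psi>. primitive_hecke_character K l \<psi> \<and> rational_coeffs K \<psi>"
proof -
  have ws: "w = s" and nw: "nw = 1" unfolding w_def nw_def using D by simp_all
  have "of_nat D = (1 :: complex)" using D by simp
  then have ss: "s * s = - 1" using s_sq by simp
  have coord: "\<exists>x y :: int. a = of_int x + of_int y * s" if aR: "a \<in> R" for a using aR unfolding R_basis ws by blast
  have inR: "of_int x + of_int y * s \<in> R" for x y :: int using R_I unfolding ws by blast
  have nmc: "int (nm (of_int x + of_int y * s)) = x ^ 2 + y ^ 2" for x y :: int unfolding nm_s using D by simp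
  have trc: "tr (of_int x + of_int y * s) = 2 * x" for x y :: int by (rule tr_eqI[OF inR]) simp
  have evn: "even (nm (of_int x + of_int y * s)) \<longleftrightarrow> even (x + y)" for x y :: int
  proof -
    have "even (nm (of_int x + of_int y * s)) \<longleftrightarrow> even (int (nm (of_int x + of_int y * s)))" by simp
    also have "\<dots> \<longleftrightarrow> even (x + y)" unfolding nmc by simp
    finally show ?thesis .
  qed
  have e1: "(2 + 2 * s) * (of_int c + of_int d * s) = of_int (2 * (c - d)) + of_int (2 * (c + d)) * s" for c d :: int
  proof -
    have "(2 + 2 * s) * (of_int c + of_int d * s) = 2 * of_int c + 2 * of_int d * (s * s) + (2 * of_int c + 2 * of_int d) * s"
      by (simp add: algebra_simps)
    then show ?thesis unfolding ss by (simp add: algebra_simps)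
  qed
  define \<mm>\<^sub>0 where "\<mm>\<^sub>0 = pid (2 + 2 * s)"
  have memI: "of_int x + of_int y * s \<in> \<mm>\<^sub>0" if ev: "even x" "even y" "4 dvd x + y" for x y :: int
  proof -
    obtain x' y' where xy: "x = 2 * x'" "y = 2 * y'" using ev(1,2) by (metis evenE)
    have "even (x' + y')" using ev(3) unfolding xy by presburger
    then obtain c where c: "x' + y' = 2 * c" by blast
    define d where "d = c - x'"
    have "x = 2 * (c - d)" "y = 2 * (c + d)" using c unfolding xy d_def by auto
    then have "of_int x + of_int y * s = (2 + 2 * s) * (of_int c + of_int d * s)" unfolding e1 by simp
    then show ?thesis unfolding \<mm>\<^sub>0_def pid_iff using inR by blast
  qed
  have memD: "even x \<and> even y \<and> 4 dvd x + y" if mem: "of_int x + of_int y * s \<in> \<mm>\<^sub>0" for x y :: int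
  proof -
    obtain r where r: "r \<in> R" "of_int x + of_int y * s = (2 + 2 * s) * r" using mem unfolding \<mm>\<^sub>0_def pid_iff by blast
    obtain c d where cd: "r = of_int c + of_int d * s" using coord[OF r(1)] by blast
    have "of_int x + of_int y * w = of_int (2 * (c - d)) + of_int (2 * (c + d)) * w" using r(2) unfolding cd e1 ws .
    then have "x = 2 * (c - d)" "y = 2 * (c + d)" using basis_unique by blast+
    then show ?thesis by simp
  qed
  \<comment> \<open>The signs suffice if the real coordinate is odd; the other elements of odd norm
    are first multiplied by s.\<close>
  have h: "\<exists>v\<in>R. nm v = 1 \<and> v * (of_int x + of_int y * s) - 1 \<in> \<mm>\<^sub>0" if xy: "odd x" "even y" for x y :: int
  proof (cases "4 dvd (x - 1) + y")
    case True
    then have "of_int (x - 1) + of_int y * s \<in> \<mm>\<^sub>0" using xy by (intro memI) auto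
    moreover have "of_int (x - 1) + of_int y * s = 1 * (of_int x + of_int y * s) - 1" by simp
    ultimately have "1 * (of_int x + of_int y * s) - 1 \<in> \<mm>\<^sub>0" by metis
    moreover have "nm 1 = 1" using nm_of_nat[of 1] by simp
    ultimately show ?thesis using R_1 by blast
  next
    case False
    then have "4 dvd (- x - 1) + (- y)" using xy by presburger
    then have "of_int (- x - 1) + of_int (- y) * s \<in> \<mm>\<^sub>0" using xy by (intro memI) auto
    moreover have "of_int (- x - 1) + of_int (- y) * s = (-1) * (of_int x + of_int y * s) - 1" by (simp add: algebra_simps)
    ultimately have "(-1) * (of_int x + of_int y * s) - 1 \<in> \<mm>\<^sub>0" by metis
    moreover have "nm (-1) = 1" using nm_of_int[of "-1"] by simp
    ultimately show ?thesis using R_uminus[OF R_1] by blast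
  qed
  have m0: "idl \<mm>\<^sub>0" unfolding \<mm>\<^sub>0_def
  proof (rule idl_pid)
    show "2 + 2 * s \<in> R" by (intro R_add R_mult) auto
    show "2 + 2 * s \<noteq> 0"
    proof
      assume "2 + 2 * s = 0"
      then have "Re (2 + 2 * s) = 0" by simp
      then show False by simp
    qed
  qed
  show ?thesis
  proof (rule class_number_one_character[OF nw l _ m0, of 2])
    show "(1 :: nat) < 2" by simp
    show "\<exists>v\<in>R. nm v = 1 \<and> v * a - 1 \<in> \<mm>\<^sub>0" if aR: "a \<in> R" and na: "\<not> 2 dvd nm a" for a
    proof -
      obtain x y where a: "a = of_int x + of_int y * s" using coord[OF aR] by blast
      have o: "odd (x + y)" using na unfolding a evn .
      show ?thesis
      proof (cases "odd x")
        case True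
        then show ?thesis unfolding a using o by (intro h) auto
      next
        case False
        have "s * a = of_int x * s + of_int y * (s * s)" unfolding a by (simp add: algebra_simps)
        then have sa: "s * a = of_int (- y) + of_int x * s" unfolding ss by simp
        obtain v where v: "v \<in> R" "nm v = 1" "v * (of_int (- y) + of_int x * s) - 1 \<in> \<mm>\<^sub>0"
          using h[of "- y" x] o False by auto
        have "nm s = D" using nm_s[of 0 1] by simp
        then have "nm s = 1" using D by metis
        then have "nm (v * s) = 1" using nm_mult[OF v(1) R_s] v(2) by simp
        moreover have "v * s * a - 1 \<in> \<mm>\<^sub>0" using v(3) by (simp only: mult.assoc sa)
        moreover have "v * s \<in> R" by (rule R_mult[OF v(1) R_s])
        ultimately show ?thesis by blast
      qed
    qed
    show "int 2 dvd tr y" if yR: "y \<in> R" for y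
      using coord[OF yR] trc by auto
    show "cnj x \<in> \<mm>" if m: "idl \<mm>" "\<mm>\<^sub>0 \<subseteq> \<mm>" "x \<in> \<mm>" and nx: "2 dvd nm x" for \<mm> x
    proof -
      obtain a b where x: "x = of_int a + of_int b * s" using coord[OF idl_R[OF m(1,3)]] by blast
      have ab: "even (a + b)" using nx unfolding x evn .
      \<comment> \<open>The conjugate of x is x - 2 b s. For even b the multiple 2 b s lies in
        \<open>\<mm>\<^sub>0\<close>; for odd b the element (1 + s) x is congruent to 2 s modulo
        \<open>\<mm>\<^sub>0\<close>, so \<mm> contains 2 s.\<close>
      have "of_int b * (2 * s) \<in> \<mm>"
      proof (cases "even b")
        case True
        then obtain c where c: "b = 2 * c" by blast
        have "of_int 0 + of_int (2 * b) * s \<in> \<mm>\<^sub>0" using c by (intro memI) auto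
        then have "of_int 0 + of_int (2 * b) * s \<in> \<mm>" using m(2) by blast
        then show ?thesis by (simp add: mult_ac)
      next
        case False
        have "of_int (a - b) + of_int (a + b - 2) * s \<in> \<mm>\<^sub>0"
        proof (rule memI)
          show "even (a - b)" "even (a + b - 2)" using ab by simp_all
          show "4 dvd a - b + (a + b - 2)" using ab False by presburger
        qed
        then have 1: "of_int (a - b) + of_int (a + b - 2) * s \<in> \<mm>" using m(2) by blast
        have 2: "(1 + s) * x \<in> \<mm>" using m(3) by (intro idl_mult[OF m(1)] R_add) auto
        have "(1 + s) * x = of_int a + of_int b * (s * s) + (of_int a + of_int b) * s" unfolding x by (simp add: algebra_simps)
        then have "(1 + s) * x - (of_int (a - b) + of_int (a + b - 2) * s) = 2 * s" unfolding ss by (simp add: algebra_simps)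
        then have "2 * s \<in> \<mm>" using idl_diff[OF m(1) 2 1] by metis
        then show ?thesis by (rule idl_mult[OF m(1) R_of_int])
      qed
      then have "x - of_int b * (2 * s) \<in> \<mm>" by (rule idl_diff[OF m(1,3)])
      moreover have "x - of_int b * (2 * s) = cnj x" unfolding x by simp
      ultimately show ?thesis by metis
    qed
    show "v = 1" if v: "v \<in> R" "nm v = 1" "v - 1 \<in> \<mm>\<^sub>0" for v
    proof -
      obtain x y where xy: "v = of_int x + of_int y * s" using coord[OF v(1)] by blast
      have "v - 1 = of_int (x - 1) + of_int y * s" unfolding xy by simp
      then have mem: "even (x - 1)" "even y" "4 dvd (x - 1) + y" using memD[of "x - 1" y] v(3) by metis+
      have n: "x ^ 2 + y ^ 2 = 1" using nmc[of x y] v(2) unfolding xy by simp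
      obtain z where z: "y = 2 * z" using mem(2) by blast
      have y0: "y = 0"
      proof (rule ccontr)
        assume "y \<noteq> 0"
        then have "z ^ 2 \<ge> 1" using z by (simp add: int_one_le_iff_zero_less)
        moreover have "x ^ 2 + 4 * z ^ 2 = 1" using n unfolding z by (simp add: power_mult_distrib)
        moreover have "x ^ 2 \<ge> 0" by simp
        ultimately show False by linarith
      qed
      then have "x = 1 \<or> x = -1" using n by (simp add: power2_eq_1_iff)
      then have "x = 1" using mem(3) y0 by auto
      then show ?thesis unfolding xy y0 by simp
    qed
  qed
qed

text \<open>The six units represent the six invertible residues modulo 3, an ideal of norm 9, and q
  = 3 is ramified.\<close>

lemma eisenstein_character:
  assumes D: "D = 3" and l: "l \<ge> 1"
  shows "\<exists>\<psi>. primitive_hecke_character K l \<psi> \<and> rational_coeffs K \<psi>"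
proof -
  have tw: "tw = 1" and nw: "nw = 1" unfolding tw_def nw_def using D by simp_all
  have coord: "\<exists>x y :: int. a = of_int x + of_int y * w" if aR: "a \<in> R" for a using aR unfolding R_basis .
  have nmc: "int (nm (of_int x + of_int y * w)) = x ^ 2 + x * y + y ^ 2" for x y :: int unfolding nm_basis tw nw by simp
  have trc: "tr (of_int x + of_int y * w) = 2 * x + y" for x y :: int
    by (rule tr_eqI[OF R_I]) (simp add: cnj_w tw algebra_simps)
  have q4: "4 * (x ^ 2 + x * y + y ^ 2) = (2 * x + y) ^ 2 + 3 * y ^ 2" for x y :: int
    by (simp add: power2_eq_square algebra_simps)
  define \<mm>\<^sub>0 where "\<mm>\<^sub>0 = pid 3"
  have m0: "idl \<mm>\<^sub>0" unfolding \<mm>\<^sub>0_def by (rule idl_pid) auto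
  have trq: "int 3 dvd tr y" if yR: "y \<in> R" and d: "3 dvd nm y" for y
  proof -
    obtain a b where y: "y = of_int a + of_int b * w" using coord[OF yR] by blast
    have "int 3 dvd int (nm y)" using d by (simp only: int_dvd_int_iff)
    then have d3: "3 dvd a ^ 2 + a * b + b ^ 2" unfolding y nmc by simp
    have "3 dvd 4 * (a ^ 2 + a * b + b ^ 2) - 3 * b ^ 2" using d3 by (intro dvd_diff dvd_mult dvd_triv_left)
    then have "3 dvd (2 * a + b) ^ 2" unfolding q4 by simp
    moreover have "prime (3 :: int)" by simp
    ultimately have "3 dvd 2 * a + b" using prime_dvd_power by blast
    then show ?thesis unfolding y trc by simp
  qed
  show ?thesis
  proof (rule class_number_one_character[OF nw l _ m0 _ trq])
    show "(1 :: nat) < 3" by simp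
    show "\<exists>v\<in>R. nm v = 1 \<and> v * a - 1 \<in> \<mm>\<^sub>0" if aR: "a \<in> R" and na: "\<not> 3 dvd nm a" for a
    proof -
      obtain x y where a: "a = of_int x + of_int y * w" using coord[OF aR] by blast
      have n3: "\<not> 3 dvd x ^ 2 + x * y + y ^ 2"
      proof
        assume "3 dvd x ^ 2 + x * y + y ^ 2"
        then have "int 3 dvd int (nm a)" unfolding a nmc by simp
        then show False using na by (simp only: int_dvd_int_iff simp_thms)
      qed
      \<comment> \<open>The norm is (x - y)^2 modulo 3, so x and y have different residues. Two
        distinct numbers among -1, 0, 1 always give a unit.\<close>
      have "\<exists>i j :: int. i ^ 2 + i * j + j ^ 2 = 1 \<and> 3 dvd x - i \<and> 3 dvd y - j"
      proof -
        have rx: "x mod 3 = 0 \<or> x mod 3 = 1 \<or> x mod 3 = 2" and ry: "y mod 3 = 0 \<or> y mod 3 = 1 \<or> y mod 3 = 2" by presburger+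
        have ne: "x mod 3 \<noteq> y mod 3"
        proof
          assume "x mod 3 = y mod 3"
          then have "3 dvd x - y" by (simp add: mod_eq_dvd_iff)
          then have "3 dvd (x - y) * (x - y) + 3 * (x * y)" by simp
          moreover have "(x - y) * (x - y) + 3 * (x * y) = x ^ 2 + x * y + y ^ 2" by (simp add: power2_eq_square algebra_simps)
          ultimately show False using n3 by metis
        qed
        define c :: "int \<Rightarrow> int" where "c r = (if r = 2 then -1 else r)" for r
        have c: "3 dvd z - c (z mod 3)" for z :: int
        proof (cases "z mod 3 = 2")
          case True
          then have "3 dvd z + 1" by presburger
          then show ?thesis using True by (simp add: c_def)
        next
          case False
          have "3 dvd z - z mod 3" by presburger
          then show ?thesis using False by (simp add: c_def)
        qed
        have "c (x mod 3) ^ 2 + c (x mod 3) * c (y mod 3) + c (y mod 3) ^ 2 = 1"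
          using rx ry ne by (elim disjE) (simp_all add: c_def)
        then show ?thesis using c by blast
      qed
      then obtain i j where ij: "i ^ 2 + i * j + j ^ 2 = 1" "3 dvd x - i" "3 dvd y - j" by blast
      define u where "u = of_int i + of_int j * w"
      have uR: "u \<in> R" unfolding u_def by (rule R_I)
      have u1: "nm u = 1" using nmc[of i j] ij(1) unfolding u_def by simp
      obtain x' y' where x': "x - i = 3 * x'" "y - j = 3 * y'" using ij(2,3) by blast
      have "a - u = of_int (x - i) + of_int (y - j) * w" unfolding a u_def by (simp add: algebra_simps)
      also have "\<dots> = 3 * (of_int x' + of_int y' * w)" unfolding x' by (simp add: algebra_simps)
      finally have "a - u \<in> \<mm>\<^sub>0" unfolding \<mm>\<^sub>0_def pid_iff using R_I by blast
      then have "cnj u * (a - u) \<in> \<mm>\<^sub>0" using uR by (intro idl_mult[OF m0]) auto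
      moreover have "cnj u * (a - u) = cnj u * a - 1" using unit_cnj[OF uR u1] by (simp add: right_diff_distrib mult.commute)
      ultimately have "cnj u * a - 1 \<in> \<mm>\<^sub>0" by metis
      then show ?thesis using uR u1 by (intro bexI[of _ "cnj u"]) auto
    qed
    show "cnj x \<in> \<mm>" if m: "idl \<mm>" "\<mm>\<^sub>0 \<subseteq> \<mm>" "x \<in> \<mm>" and nx: "3 dvd nm x" for \<mm> x
    proof -
      have xR: "x \<in> R" by (rule idl_R[OF m(1,3)])
      obtain k where k: "tr x = int 3 * k" using trq[OF xR nx] by blast
      have "3 \<in> \<mm>" using m(2) pid_mem unfolding \<mm>\<^sub>0_def by blast
      then have "3 * of_int k \<in> \<mm>" by (intro idl_mult_right[OF m(1)]) auto
      then have "3 * of_int k - x \<in> \<mm>" using m(3) by (rule idl_diff[OF m(1)])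
      moreover have "3 * of_int k - x = cnj x"
      proof -
        have "x + cnj x = of_int (int 3 * k)" using tr[OF xR] unfolding k by simp
        then show ?thesis by (simp add: algebra_simps)
      qed
      ultimately show ?thesis by metis
    qed
    show "v = 1" if v: "v \<in> R" "nm v = 1" "v - 1 \<in> \<mm>\<^sub>0" for v
    proof -
      obtain x y where xy: "v = of_int x + of_int y * w" using coord[OF v(1)] by blast
      obtain r where r: "r \<in> R" "v - 1 = 3 * r" using v(3) unfolding \<mm>\<^sub>0_def pid_iff by blast
      obtain i j where ij: "r = of_int i + of_int j * w" using coord[OF r(1)] by blast
      have "of_int (x - 1) + of_int y * w = v - 1" unfolding xy by simp
      also have "\<dots> = of_int (3 * i) + of_int (3 * j) * w" unfolding r(2) ij by (simp add: algebra_simps)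
      finally have e: "x - 1 = 3 * i" "y = 3 * j" using basis_unique by blast+
      have n: "x ^ 2 + x * y + y ^ 2 = 1" using nmc[of x y] v(2) unfolding xy by simp
      then have n4: "(2 * x + y) ^ 2 + 3 * y ^ 2 = 4" using q4[of x y] by simp
      have y0: "y = 0"
      proof (rule ccontr)
        assume "y \<noteq> 0"
        then have "j ^ 2 \<ge> 1" using e(2) by (simp add: int_one_le_iff_zero_less)
        moreover have "(2 * x + y) ^ 2 + 27 * j ^ 2 = 4" using n4 unfolding e(2) by (simp add: power_mult_distrib)
        moreover have "(2 * x + y) ^ 2 \<ge> 0" by simp
        ultimately show False by linarith
      qed
      then have "x = 1 \<or> x = -1" using n by (simp add: power2_eq_1_iff)
      then have "x = 1" using e(1) by presburger
      then show ?thesis unfolding xy y0 by simp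
    qed
  qed
qed

text \<open>For odd l the class of D modulo 4 decides: D congruent to 3 has a prime divisor
  congruent to 3, and the other D > 2 contradict the hypothesis on the exponent.\<close>

theorem rational_character_exists:
  assumes l: "l \<ge> 1" and e: "group_exponent (class_group K) dvd l"
  shows "\<exists>\<psi>. primitive_hecke_character K l \<psi> \<and> rational_coeffs K \<psi>"
proof -
  have ex: "\<forall>A. idl A \<longrightarrow> (\<exists>\<beta>\<in>R. \<beta> \<noteq> 0 \<and> ipow A l = pid \<beta>)"
    using exponent_dvd_iff[OF l] e by blast
  consider "D = 1" | "D = 3" | "D \<noteq> 1" "D \<noteq> 3" "even l" | "D \<noteq> 1" "D \<noteq> 3" "odd l" "D mod 4 = 3"
    | "odd l" "D = 2" | "odd l" "D mod 4 \<noteq> 3" "D > 2"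
    using D_pos by linarith
  then show ?thesis
  proof cases
    case 1
    then show ?thesis by (rule gaussian_character[OF _ l])
  next
    case 2
    then show ?thesis by (rule eisenstein_character[OF _ l])
  next
    case 3
    then show ?thesis by (rule even_exponent_character[OF _ _ _ ex])
  next
    case 4
    obtain p where "prime p" "p dvd D" "p mod 4 = 3" using prime_3_mod_4_divisor[OF 4(4)] by blast
    then show ?thesis by (rule ramified_prime_character[OF 4(1-3) ex])
  next
    case 5
    show ?thesis by (rule sqrt_minus_two_character[OF 5(2,1) ex])
  next
    case 6
    show ?thesis using no_odd_exponent[OF 6(2,3,1) ex] by blast
  qed
qed

lemma primitive_rational_imp_exponent_dvd:
  assumes p: "primitive_hecke_character K l \<psi>" and r: "rational_coeffs K \<psi>" and l: "l \<ge> 1"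
  shows "group_exponent (class_group K) dvd l"
proof -
  obtain \<mm> where h: "hecke_character K l \<mm> \<psi>" using p unfolding primitive_hecke_character_def is_conductor_def by blast
  have m: "idl \<mm>" using h unfolding hecke_character_iff by blast
  show ?thesis
  proof (rule rational_imp_exponent_dvd[OF h r l])
    show "2 * D * N \<mm> > 0" using D_pos N_pos[OF m] by simp
    show "of_nat (2 * D * N \<mm>) \<in> \<mm>" using idl_mult[OF m R_of_nat N_mem[OF m], of "2 * D"] by simp
    show "2 * D dvd 2 * D * N \<mm>" by simp
  qed
qed

end

theorem theorem2p4:
  fixes l :: nat
  assumes "l \<ge> 1"
  shows "equiv (rational_hecke_characters l) (twist_equivalence l) \<and>
    fst respects twist_equivalence l \<and>
    bij_betw (\<lambda>C. the_elem (fst ` C))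
      (rational_hecke_characters l // twist_equivalence l)
      {K. imag_quad_field K \<and> group_exponent (class_group K) dvd l}"
proof -
  define H where "H = rational_hecke_characters l"
  define E where "E = twist_equivalence l"
  have H: "(K, \<psi>) \<in> H \<longleftrightarrow> imag_quad_field K \<and> primitive_hecke_character K l \<psi> \<and> rational_coeffs K \<psi>" for K \<psi>
    by (simp add: H_def rational_hecke_characters_def)
  have tw: "is_twist K \<psi> \<psi>'" if KH: "(K, \<psi>) \<in> H" "(K, \<psi>') \<in> H" for K \<psi> \<psi>'
  proof -
    obtain D where "iqf K D" using KH(1) imag_quad_field_iqf unfolding H by blast
    then interpret iqf K D .
    obtain \<mm> \<mm>' where "hecke_character K l \<mm> \<psi>" "hecke_character K l \<mm>' \<psi>'"
      using KH unfolding H primitive_hecke_character_def is_conductor_def by blast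
    then show ?thesis using rational_characters_twist KH assms unfolding H by blast
  qed
  \<comment> \<open>As any two rational characters of one field are twists of each other,
    equivalence is equality of fields. This gives symmetry and transitivity at once, and later
    injectivity.\<close>
  have E: "(x, y) \<in> E \<longleftrightarrow> x \<in> H \<and> y \<in> H \<and> fst x = fst y" for x y
    using tw unfolding E_def twist_equivalence_def H_def by (cases x; cases y) auto
  have eq: "equiv H E"
    by (rule equivI) (auto simp: refl_on_def sym_on_def trans_on_def E)
  have resp: "fst respects E" by (auto simp: congruent_def E)
  \<comment> \<open>A class consists of all rational characters of a single field, so
    \<open>the_elem\<close> is applied to a singleton.\<close>
  have cls: "\<exists>K \<psi>. (K, \<psi>) \<in> H \<and> C = {y \<in> H. fst y = K} \<and> the_elem (fst ` C) = K" if C: "C \<in> H // E" for C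
  proof -
    obtain K \<psi> where x: "(K, \<psi>) \<in> H" "C = E `` {(K, \<psi>)}" using C by (metis quotientE surj_pair)
    have "C = {y \<in> H. fst y = K}" using x by (auto simp: E)
    moreover have "fst ` {y \<in> H. fst y = K} = {K}" using x(1) by force
    ultimately show ?thesis using x(1) by auto
  qed
  have "bij_betw (\<lambda>C. the_elem (fst ` C)) (H // E) {K. imag_quad_field K \<and> group_exponent (class_group K) dvd l}"
    unfolding bij_betw_def
  proof
    show "inj_on (\<lambda>C. the_elem (fst ` C)) (H // E)"
    proof (rule inj_onI)
      fix C C' assume C: "C \<in> H // E" "C' \<in> H // E" and e: "the_elem (fst ` C) = the_elem (fst ` C')"
      obtain K where K: "C = {y \<in> H. fst y = K}" "the_elem (fst ` C) = K" using cls[OF C(1)] by blast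
      obtain K' where K': "C' = {y \<in> H. fst y = K'}" "the_elem (fst ` C') = K'" using cls[OF C(2)] by blast
      have "K = K'" using e unfolding K(2) K'(2) .
      then show "C = C'" unfolding K(1) K'(1) by simp
    qed
    show "(\<lambda>C. the_elem (fst ` C)) ` (H // E) = {K. imag_quad_field K \<and> group_exponent (class_group K) dvd l}"
    proof (intro equalityI subsetI)
      fix K assume "K \<in> (\<lambda>C. the_elem (fst ` C)) ` (H // E)"
      then obtain \<psi> where K: "(K, \<psi>) \<in> H" using cls by (metis (no_types, lifting) imageE)
      obtain D where "iqf K D" using K imag_quad_field_iqf unfolding H by blast
      then interpret iqf K D .
      show "K \<in> {K. imag_quad_field K \<and> group_exponent (class_group K) dvd l}"
        using K primitive_rational_imp_exponent_dvd[OF _ _ assms] unfolding H by blast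
    next
      fix K assume "K \<in> {K. imag_quad_field K \<and> group_exponent (class_group K) dvd l}"
      then have K: "imag_quad_field K" "group_exponent (class_group K) dvd l" by blast+
      obtain D where "iqf K D" using K imag_quad_field_iqf by blast
      then interpret iqf K D .
      obtain \<psi> where x: "(K, \<psi>) \<in> H" using rational_character_exists[OF assms K(2)] K(1) unfolding H by blast
      have C: "E `` {(K, \<psi>)} \<in> H // E" by (rule quotientI[OF x])
      have "E `` {(K, \<psi>)} = {y \<in> H. fst y = K}" using x by (auto simp: E)
      moreover have "fst ` {y \<in> H. fst y = K} = {K}" using x by force
      ultimately have "the_elem (fst ` (E `` {(K, \<psi>)})) = K" by simp
      then show "K \<in> (\<lambda>C. the_elem (fst ` C)) ` (H // E)" using C by force
    qed
  qed
  then show ?thesis using eq resp unfolding H_def E_def by blast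
qed

end
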